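(* Let $1<q\le2$, $p>1$, and let $[X,\mathcal B,m^i,\nu_i]$ ($i=1,2$) be reversible random walk spaces on the same measurable space with $\nu_2\ll\nu_1$, $\mu=\frac{d\nu_2}{d\nu_1}\in L^\infty(X,\nu_1)$, $\mu\ge c>0$ $\nu_1$-a.e., and assume either $\nu_1(X)<\infty$, or $\nu_1(X)=+\infty$ and $q\le\frac p{p-1}\le2\le p$. Let $T>0$. For any $u_0\in L^2(X,\nu_1)$ and $f\in L^2(0,T;L^2(X,\nu_1))$ the problem $$u_t-\Delta_q^{m^1}u-\mu\Delta_p^{m^2}u\ni f\ \text{on }[0,T],\qquad u(0)=u_0,$$ has a unique strong solution $u=u_{u_0,f}$; moreover for $u=u_{u_0,f}$, $\tilde u=u_{\tilde u_0,\tilde f}$, all $0\le t\le T$ and $1\le r\le\infty$, $$\|(u(t)-\tilde u(t))^+\|_{L^r(X,\nu_1)}\le\|(u_0-\tilde u_0)^+\|_{L^r(X,\nu_1)}+\int_0^t\|(f(s)-\tilde f(s))^+\|_{L^r(X,\nu_1)}\,ds.$$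
   Context: Random walk space $[X,\mathcal B,m,\nu]$: measurable space with countably generated $\sigma$-algebra, probability measures $m_x$ depending measurably on $x$, $\sigma$-finite invariant measure $\nu$ ($\nu(A)=\int m_x(A)\,d\nu(x)$), reversible if $dm_x(y)d\nu(x)=dm_y(x)d\nu(y)$. $\nabla u(x,y)=u(y)-u(x)$. $H=L^2(X,\nu_1)$. For $s>1$: $(u,w)\in\Delta_s^m$ iff $u,w\in L^2(X,\nu)$, $\nabla u\in L^s(dm_x(y)d\nu(x))$ and $w(x)=\int_X|\nabla u(x,y)|^{s-2}\nabla u(x,y)\,dm_x(y)$. The operator $A=-\Delta_q^{m^1}-\mu\Delta_p^{m^2}$ on $H$: $(u,v)\in A$ iff $u,v\in H$, $v=-w_1-\mu w_2$ with $(u,w_1)\in\Delta_q^{m^1}$ (w.r.t. $\nu_1$), $(u,w_2)\in\Delta_p^{m^2}$ (w.r.t. $\nu_2$). The problem means $u_t+Au\ni f$. Strong solution: $u\in C([0,T];H)\cap W^{1,2}_{\rm loc}(0,T;H)$, $u(0)=u_0$, $u(t)$ in the domain of $A$ and $f(t)-u_t(t)\in A(u(t))$ for a.e. $t$. *)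

theory Defs
  imports "HOL-Probability.Probability"
begin

definition countably_generated :: "'a measure \<Rightarrow> bool" where
  "countably_generated M \<longleftrightarrow>
     (\<exists>C. countable C \<and> C \<subseteq> Pow (space M) \<and> sets M = sigma_sets (space M) C)"

definition random_walk_space :: "'a measure \<Rightarrow> ('a \<Rightarrow> 'a measure) \<Rightarrow> 'a measure \<Rightarrow> bool" where
  "random_walk_space M m \<nu> \<longleftrightarrow>
     countably_generated M \<and>
     m \<in> measurable M (subprob_algebra M) \<and>
     (\<forall>x\<in>space M. prob_space (m x)) \<and>
     sets \<nu> = sets M \<and> sigma_finite_measure \<nu> \<and>
     (\<forall>A\<in>sets M. emeasure \<nu> A = (\<integral>\<^sup>+ x. emeasure (m x) A \<partial>\<nu>))"

definition reversible :: "'a measure \<Rightarrow> ('a \<Rightarrow> 'a measure) \<Rightarrow> 'a measure \<Rightarrow> bool" where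
  "reversible M m \<nu> \<longleftrightarrow>
     (\<forall>C\<in>sets (M \<Otimes>\<^sub>M M).
        (\<integral>\<^sup>+ x. (\<integral>\<^sup>+ y. indicator C (x, y) \<partial>(m x)) \<partial>\<nu>)
      = (\<integral>\<^sup>+ x. (\<integral>\<^sup>+ y. indicator C (y, x) \<partial>(m x)) \<partial>\<nu>))"

definition memL2 :: "'a measure \<Rightarrow> ('a \<Rightarrow> real) \<Rightarrow> bool" where
  "memL2 \<nu> u \<longleftrightarrow> u \<in> borel_measurable \<nu> \<and> integrable \<nu> (\<lambda>x. (u x)\<^sup>2)"

definition L2dist :: "'a measure \<Rightarrow> ('a \<Rightarrow> real) \<Rightarrow> ('a \<Rightarrow> real) \<Rightarrow> real" where
  "L2dist \<nu> u w = sqrt (\<integral>x. (u x - w x)\<^sup>2 \<partial>\<nu>)"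

definition sLap_rel :: "('a \<Rightarrow> 'a measure) \<Rightarrow> 'a measure \<Rightarrow> real \<Rightarrow> ('a \<Rightarrow> real) \<Rightarrow> ('a \<Rightarrow> real) \<Rightarrow> bool" where
  "sLap_rel m \<nu> s u w \<longleftrightarrow>
     memL2 \<nu> u \<and> memL2 \<nu> w \<and>
     (\<integral>\<^sup>+ x. (\<integral>\<^sup>+ y. ennreal (\<bar>u y - u x\<bar> powr s) \<partial>(m x)) \<partial>\<nu>) < \<infinity> \<and>
     (AE x in \<nu>. w x = (\<integral>y. \<bar>u y - u x\<bar> powr (s - 2) * (u y - u x) \<partial>(m x)))"

definition A_rel :: "('a \<Rightarrow> 'a measure) \<Rightarrow> 'a measure \<Rightarrow> ('a \<Rightarrow> 'a measure) \<Rightarrow> 'a measure \<Rightarrow>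
    ('a \<Rightarrow> real) \<Rightarrow> real \<Rightarrow> real \<Rightarrow> ('a \<Rightarrow> real) \<Rightarrow> ('a \<Rightarrow> real) \<Rightarrow> bool" where
  "A_rel m1 \<nu>1 m2 \<nu>2 \<mu> p q u v \<longleftrightarrow>
     memL2 \<nu>1 u \<and> memL2 \<nu>1 v \<and>
     (\<exists>w1 w2. sLap_rel m1 \<nu>1 q u w1 \<and> sLap_rel m2 \<nu>2 p u w2 \<and>
        (AE x in \<nu>1. v x = - w1 x - \<mu> x * w2 x))"

text \<open>f in L^2(0,T; L^2(X,nu)), given by a jointly measurable representative.\<close>
definition memL2T :: "'a measure \<Rightarrow> real \<Rightarrow> (real \<Rightarrow> 'a \<Rightarrow> real) \<Rightarrow> bool" where
  "memL2T \<nu> T f \<longleftrightarrow>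
     (\<lambda>(t, x). f t x) \<in> borel_measurable (lborel \<Otimes>\<^sub>M \<nu>) \<and>
     (\<integral>\<^sup>+ t\<in>{0..T}. (\<integral>\<^sup>+ x. ennreal ((f t x)\<^sup>2) \<partial>\<nu>) \<partial>lborel) < \<infinity>"

text \<open>Strong solution of u_t + A u \<ni> f on [0,T], u(0) = u0.
  u in C([0,T];H); u in W^{1,2}_loc(0,T;H), expressed through a (jointly measurable)
  derivative v in L^2_loc(0,T;H) with u(t) - u(s) = integral from s to t of v;
  u(t) in D(A) and f(t) - u_t(t) in A(u(t)) for a.e. t.\<close>
definition strong_solution :: "('a \<Rightarrow> 'a measure) \<Rightarrow> 'a measure \<Rightarrow> ('a \<Rightarrow> 'a measure) \<Rightarrow> 'a measure \<Rightarrow>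
    ('a \<Rightarrow> real) \<Rightarrow> real \<Rightarrow> real \<Rightarrow> real \<Rightarrow> ('a \<Rightarrow> real) \<Rightarrow> (real \<Rightarrow> 'a \<Rightarrow> real) \<Rightarrow>
    (real \<Rightarrow> 'a \<Rightarrow> real) \<Rightarrow> bool" where
  "strong_solution m1 \<nu>1 m2 \<nu>2 \<mu> p q T u0 f u \<longleftrightarrow>
     (\<forall>t\<in>{0..T}. memL2 \<nu>1 (u t)) \<and>
     (\<forall>t\<in>{0..T}. ((\<lambda>s. L2dist \<nu>1 (u s) (u t)) \<longlongrightarrow> 0) (at t within {0..T})) \<and>
     (AE x in \<nu>1. u 0 x = u0 x) \<and>
     (\<exists>v. (\<lambda>(t, x). v t x) \<in> borel_measurable (lborel \<Otimes>\<^sub>M \<nu>1) \<and>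
        (\<forall>a b. 0 < a \<longrightarrow> a \<le> b \<longrightarrow> b < T \<longrightarrow>
           (\<integral>\<^sup>+ t\<in>{a..b}. (\<integral>\<^sup>+ x. ennreal ((v t x)\<^sup>2) \<partial>\<nu>1) \<partial>lborel) < \<infinity>) \<and>
        (\<forall>s t. 0 < s \<longrightarrow> s \<le> t \<longrightarrow> t < T \<longrightarrow>
           (AE x in \<nu>1. u t x - u s x = (\<integral>\<tau>\<in>{s..t}. v \<tau> x \<partial>lborel))) \<and>
        (AE t in lborel. t \<in> {0<..<T} \<longrightarrow>
           A_rel m1 \<nu>1 m2 \<nu>2 \<mu> p q (u t) (\<lambda>x. f t x - v t x)))"

definition Lr_norm :: "'a measure \<Rightarrow> ennreal \<Rightarrow> ('a \<Rightarrow> real) \<Rightarrow> ennreal" where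
  "Lr_norm \<nu> r g =
     (if r = \<top> then esssup \<nu> (\<lambda>x. ennreal \<bar>g x\<bar>)
      else (let I = (\<integral>\<^sup>+ x. ennreal (\<bar>g x\<bar> powr enn2real r) \<partial>\<nu>)
            in if I = \<top> then \<top> else ennreal (enn2real I powr (1 / enn2real r))))"

end

theory Submission
  imports Defs
begin

text \<open>The operator is the subdifferential in L^2 of a convex energy, and it is accretive against every
  bounded monotone function of the difference which vanishes near zero. The second fact uses reversibility:
  integration by parts turns the pairing into an integral over pairs of points whose integrand is
  nonnegative by monotonicity of r |r|^(s-2).

  Existence: the resolvent equation is solved by minimizing energy plus squared distance. Implicit Euler
  schemes for finite energy data and step function forcing form a Cauchy sequence in C([0,T]; L^2), and the
  time derivatives are bounded in L^2 with weight t, independently of the initial energy. Minty's argument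
  in space-time identifies the limit.

  Contraction: for a convex function j vanishing near the negative half line, the integral of
  k j((u - u')/k) is controlled along the flow when k(t) is the right-hand side of the claim. Letting j
  increase to the positive part of the r-th power (or penalize values above 1 for r = infinity) gives the
  estimate, and uniqueness follows.\<close>

section \<open>Square integrable functions\<close>

text \<open>Two obstacles shape the argument. The operator wants each Laplacian in L^2 separately,
  while a subgradient controls only the sum \<open>W1 u + \<mu> W2 u\<close>. Cutting each kernel
  integral at jumps of size 1 separates the two; this is where q \<le> 2 and the alternative between
  finite measure and large p are spent. Next, the initial datum may have infinite energy, so the
  time derivative is square integrable only after multiplication by sqrt t. It is produced as a
  strong limit of convex combinations of approximate derivatives (Mazur), and the equation is
  identified on [\<alpha>, T] for every \<alpha> > 0. Minty's argument needs the resolvent of a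
  function of time. Rather than selecting it measurably in t, the whole theory of the operator is
  instantiated once more on space-time, with walks that never change t. The contraction for all r at
  once rests on rewriting "the norm of the positive part of w is at most k" as countably many
  inequalities between the integral of j(w/k) and a constant \<beta>. The scale k moves with time,
  and its growth is the integral of the norms of the forcing.\<close>

definition L2n :: "'a measure \<Rightarrow> ('a \<Rightarrow> real) \<Rightarrow> real" where
  "L2n \<nu> u = sqrt (\<integral>x. (u x)\<^sup>2 \<partial>\<nu>)"

lemma L2dist_eq_L2n: "L2dist \<nu> u w = L2n \<nu> (\<lambda>x. u x - w x)"
  by (simp add: L2dist_def L2n_def)

lemma memL2_measurable[measurable_dest]: "memL2 \<nu> u \<Longrightarrow> u \<in> borel_measurable \<nu>"
  by (simp add: memL2_def)

lemma memL2_integrable: "memL2 \<nu> u \<Longrightarrow> integrable \<nu> (\<lambda>x. (u x)\<^sup>2)"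
  by (simp add: memL2_def)

lemma memL2_mult_integrable:
  assumes "memL2 \<nu> u" "memL2 \<nu> v"
  shows "integrable \<nu> (\<lambda>x. u x * v x)"
proof (rule Bochner_Integration.integrable_bound)
  show "integrable \<nu> (\<lambda>x. (u x)\<^sup>2 + (v x)\<^sup>2)"
    using assms by (auto simp: memL2_def)
  show "(\<lambda>x. u x * v x) \<in> borel_measurable \<nu>"
    using assms by (auto simp: memL2_def)
  have "\<bar>a * b\<bar> \<le> a\<^sup>2 + b\<^sup>2" for a b :: real
  proof -
    have "0 \<le> (\<bar>a\<bar> - \<bar>b\<bar>)\<^sup>2" "0 \<le> \<bar>a\<bar> * \<bar>b\<bar>" by auto
    then show ?thesis unfolding power2_diff abs_mult power2_abs by linarith
  qed
  then show "AE x in \<nu>. norm (u x * v x) \<le> norm ((u x)\<^sup>2 + (v x)\<^sup>2)"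
    by (auto intro!: AE_I2)
qed

lemma memL2_bound:
  assumes "memL2 \<nu> g" "u \<in> borel_measurable \<nu>" "AE x in \<nu>. \<bar>u x\<bar> \<le> K * \<bar>g x\<bar>"
  shows "memL2 \<nu> u"
  unfolding memL2_def
proof (intro conjI assms(2), rule Bochner_Integration.integrable_bound)
  show "integrable \<nu> (\<lambda>x. K\<^sup>2 * (g x)\<^sup>2)" using assms by (auto simp: memL2_def)
  show "(\<lambda>x. (u x)\<^sup>2) \<in> borel_measurable \<nu>" using assms by auto
  show "AE x in \<nu>. norm ((u x)\<^sup>2) \<le> norm (K\<^sup>2 * (g x)\<^sup>2)"
    using assms(3)
  proof eventually_elim
    case (elim x)
    then have "\<bar>u x\<bar>\<^sup>2 \<le> (K * \<bar>g x\<bar>)\<^sup>2" by (intro power_mono) auto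
    then show ?case by (simp add: power_mult_distrib)
  qed
qed

lemma memL2_cong_AE:
  assumes "memL2 \<nu> g" "u \<in> borel_measurable \<nu>" "AE x in \<nu>. u x = g x"
  shows "memL2 \<nu> u"
  using assms by (intro memL2_bound[where K=1, OF assms(1)]) auto

lemma memL2_cmult[intro]: "memL2 \<nu> u \<Longrightarrow> memL2 \<nu> (\<lambda>x. k * u x)"
  by (auto simp: memL2_def power_mult_distrib)

lemma memL2_divide[intro]: "memL2 \<nu> u \<Longrightarrow> memL2 \<nu> (\<lambda>x. u x / k)"
  using memL2_cmult[of \<nu> u "1/k"] by simp

lemma memL2_uminus[intro]: "memL2 \<nu> u \<Longrightarrow> memL2 \<nu> (\<lambda>x. - u x)"
  by (auto simp: memL2_def)

lemma memL2_abs[intro]: "memL2 \<nu> u \<Longrightarrow> memL2 \<nu> (\<lambda>x. \<bar>u x\<bar>)"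
  by (auto simp: memL2_def)

lemma memL2_0[simp, intro]: "memL2 \<nu> (\<lambda>x. 0)"
  by (auto simp: memL2_def)

lemma memL2_add[intro]:
  assumes "memL2 \<nu> u" "memL2 \<nu> v"
  shows "memL2 \<nu> (\<lambda>x. u x + v x)"
proof -
  have "integrable \<nu> (\<lambda>x. (u x)\<^sup>2 + (v x)\<^sup>2 + 2 * (u x * v x))"
    using assms memL2_mult_integrable[OF assms] by (auto simp: memL2_def)
  then show ?thesis
    using assms by (auto simp: memL2_def power2_sum mult.assoc)
qed

lemma memL2_diff[intro]:
  assumes "memL2 \<nu> u" "memL2 \<nu> v"
  shows "memL2 \<nu> (\<lambda>x. u x - v x)"
  using memL2_add[OF assms(1) memL2_uminus[OF assms(2)]] by simp

lemma memL2_sum[intro]: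
  assumes "\<And>i. i \<in> I \<Longrightarrow> memL2 \<nu> (u i)"
  shows "memL2 \<nu> (\<lambda>x. \<Sum>i\<in>I. u i x)"
  using assms by (induction I rule: infinite_finite_induct) auto

lemma L2n_nonneg[simp]: "0 \<le> L2n \<nu> u"
  by (simp add: L2n_def)

lemma L2n_power2: "(L2n \<nu> u)\<^sup>2 = (\<integral>x. (u x)\<^sup>2 \<partial>\<nu>)"
  by (simp add: L2n_def)

lemma L2n_cong_AE:
  assumes "u \<in> borel_measurable \<nu>" "v \<in> borel_measurable \<nu>" "AE x in \<nu>. u x = v x"
  shows "L2n \<nu> u = L2n \<nu> v"
  unfolding L2n_def
  by (rule arg_cong[where f=sqrt], rule integral_cong_AE) (use assms in auto)

lemma L2n_cmult: "L2n \<nu> (\<lambda>x. k * u x) = \<bar>k\<bar> * L2n \<nu> u"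
  by (simp add: L2n_def power_mult_distrib real_sqrt_mult)

lemma L2n_uminus: "L2n \<nu> (\<lambda>x. - u x) = L2n \<nu> u"
  by (simp add: L2n_def)

lemma L2n_commute: "L2n \<nu> (\<lambda>x. u x - v x) = L2n \<nu> (\<lambda>x. v x - u x)"
  by (simp add: L2n_def power2_commute)

lemma L2n_zero[simp]: "L2n \<nu> (\<lambda>x. 0) = 0"
  by (simp add: L2n_def)

text \<open>The binary quadratic form s^2 a + 2 s t b + t^2 c is nonnegative; evaluating it at (c,
  -b) gives b^2 \<le> a c after division by c.\<close>

lemma L2_Cauchy_Schwarz:
  assumes "memL2 \<nu> u" "memL2 \<nu> v"
  shows "\<bar>\<integral>x. u x * v x \<partial>\<nu>\<bar> \<le> L2n \<nu> u * L2n \<nu> v"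
proof -
  let ?a = "\<integral>x. (u x)\<^sup>2 \<partial>\<nu>" and ?b = "\<integral>x. u x * v x \<partial>\<nu>" and ?c = "\<integral>x. (v x)\<^sup>2 \<partial>\<nu>"
  note [simp] = memL2_integrable[OF assms(1)] memL2_integrable[OF assms(2)]
    memL2_mult_integrable[OF assms]
  have quad: "0 \<le> s\<^sup>2 * ?a + 2 * s * t * ?b + t\<^sup>2 * ?c" for s t
  proof -
    have "0 \<le> (\<integral>x. (s * u x + t * v x)\<^sup>2 \<partial>\<nu>)" by simp
    also have "\<dots> = (\<integral>x. s\<^sup>2 * (u x)\<^sup>2 + 2 * s * t * (u x * v x) + t\<^sup>2 * (v x)\<^sup>2 \<partial>\<nu>)"
      by (rule Bochner_Integration.integral_cong) (auto simp: algebra_simps power2_eq_square)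
    also have "\<dots> = s\<^sup>2 * ?a + 2 * s * t * ?b + t\<^sup>2 * ?c" by simp
    finally show ?thesis .
  qed
  have a: "0 \<le> ?a" and c: "0 \<le> ?c" by auto
  have "?b\<^sup>2 \<le> ?a * ?c"
  proof (cases "?c = 0")
    case True
    have "?b = 0"
    proof (rule ccontr)
      assume b: "?b \<noteq> 0"
      \<comment> \<open>For c = 0 the form is affine in t, and this t gives it the value a - (a + 1)
        = -1.\<close>
      show False using quad[of 1 "- (?a + 1) / (2 * ?b)"] True b by (simp add: field_simps)
    qed
    then show ?thesis using True by simp
  next
    case False
    have "0 \<le> ?c\<^sup>2 * ?a + 2 * ?c * (- ?b) * ?b + (- ?b)\<^sup>2 * ?c" by (rule quad)
    then have "0 \<le> ?c * (?c * ?a - ?b\<^sup>2)" by (simp add: power2_eq_square algebra_simps)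
    then show ?thesis using False c by (simp add: zero_le_mult_iff mult.commute)
  qed
  then have "sqrt (?b\<^sup>2) \<le> sqrt (?a * ?c)" by (rule real_sqrt_le_mono)
  then show ?thesis by (simp add: L2n_def real_sqrt_mult)
qed

lemma L2n_triangle:
  assumes "memL2 \<nu> u" "memL2 \<nu> v"
  shows "L2n \<nu> (\<lambda>x. u x + v x) \<le> L2n \<nu> u + L2n \<nu> v"
proof -
  note [simp] = memL2_integrable[OF assms(1)] memL2_integrable[OF assms(2)]
    memL2_mult_integrable[OF assms]
  have "(L2n \<nu> (\<lambda>x. u x + v x))\<^sup>2 = (\<integral>x. (u x)\<^sup>2 + 2 * (u x * v x) + (v x)\<^sup>2 \<partial>\<nu>)"
    unfolding L2n_power2
    by (rule Bochner_Integration.integral_cong) (auto simp: algebra_simps power2_eq_square)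
  also have "\<dots> = (L2n \<nu> u)\<^sup>2 + 2 * (\<integral>x. u x * v x \<partial>\<nu>) + (L2n \<nu> v)\<^sup>2"
    by (simp add: L2n_power2)
  also have "\<dots> \<le> (L2n \<nu> u + L2n \<nu> v)\<^sup>2"
    using L2_Cauchy_Schwarz[OF assms] by (simp add: power2_sum)
  finally show ?thesis by (rule power2_le_imp_le) simp
qed

lemma L2n_triangle_diff:
  assumes "memL2 \<nu> u" "memL2 \<nu> v" "memL2 \<nu> w"
  shows "L2n \<nu> (\<lambda>x. u x - w x) \<le> L2n \<nu> (\<lambda>x. u x - v x) + L2n \<nu> (\<lambda>x. v x - w x)"
  using L2n_triangle[OF memL2_diff[OF assms(1,2)] memL2_diff[OF assms(2,3)]] by simp

lemma L2n_mono:
  assumes "memL2 \<nu> v" "u \<in> borel_measurable \<nu>" "AE x in \<nu>. \<bar>u x\<bar> \<le> \<bar>v x\<bar>"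
  shows "L2n \<nu> u \<le> L2n \<nu> v"
  unfolding L2n_def
proof (rule real_sqrt_le_mono, rule integral_mono_AE)
  show "integrable \<nu> (\<lambda>x. (u x)\<^sup>2)" "integrable \<nu> (\<lambda>x. (v x)\<^sup>2)"
    using memL2_bound[OF assms(1,2), of 1] assms by (auto simp: memL2_def)
  show "AE x in \<nu>. (u x)\<^sup>2 \<le> (v x)\<^sup>2"
    using assms(3) by eventually_elim (rule abs_le_square_iff[THEN iffD1])
qed

lemma L2n_eq_0_AE:
  assumes "memL2 \<nu> u" "L2n \<nu> u \<le> 0"
  shows "AE x in \<nu>. u x = 0"
proof -
  have "(\<integral>x. (u x)\<^sup>2 \<partial>\<nu>) = 0" using assms(2) L2n_nonneg[of \<nu> u] L2n_power2[of \<nu> u] by simp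
  then show ?thesis using assms(1)
    by (subst (asm) integral_nonneg_eq_0_iff_AE) (auto simp: memL2_def)
qed

lemma nn_integral_L2n:
  assumes "memL2 \<nu> u"
  shows "(\<integral>\<^sup>+x. ennreal ((u x)\<^sup>2) \<partial>\<nu>) = ennreal ((L2n \<nu> u)\<^sup>2)"
  unfolding L2n_power2 using assms by (subst nn_integral_eq_integral) (auto simp: memL2_def)

lemma memL2_nn_integralI:
  assumes "u \<in> borel_measurable \<nu>" "(\<integral>\<^sup>+x. ennreal ((u x)\<^sup>2) \<partial>\<nu>) \<le> ennreal (B\<^sup>2)" "0 \<le> B"
  shows "memL2 \<nu> u" "L2n \<nu> u \<le> B"
proof -
  have "(\<integral>\<^sup>+x. ennreal ((u x)\<^sup>2) \<partial>\<nu>) < \<infinity>"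
    using assms(2) by (rule le_less_trans) simp
  then show m: "memL2 \<nu> u"
    using assms(1) by (auto simp: memL2_def integrable_iff_bounded)
  show "L2n \<nu> u \<le> B"
    by (rule power2_le_imp_le[OF _ \<open>0 \<le> B\<close>])
      (use assms(2) in \<open>simp add: nn_integral_L2n[OF m]\<close>)
qed

lemma memL2_iff_nn_integral:
  assumes "u \<in> borel_measurable \<nu>"
  shows "memL2 \<nu> u \<longleftrightarrow> (\<integral>\<^sup>+x. ennreal ((u x)\<^sup>2) \<partial>\<nu>) < \<infinity>"
  using assms by (auto simp: memL2_def integrable_iff_bounded)

text \<open>The bounds are required from \<open>K\<close> on only, since the lemma is applied to
  differences \<open>g j - g k\<close> of a fast Cauchy sequence, which are controlled for j \<ge>
  k.\<close>

lemma L2n_Fatou: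
  assumes [measurable]: "\<And>k. u k \<in> borel_measurable \<nu>" "G \<in> borel_measurable \<nu>"
    and lim: "AE x in \<nu>. (\<lambda>k. u k x) \<longlonglongrightarrow> G x"
    and mem: "\<And>k. k \<ge> K \<Longrightarrow> memL2 \<nu> (u k)" and le: "\<And>k. k \<ge> K \<Longrightarrow> L2n \<nu> (u k) \<le> B" and "0 \<le> B"
  shows "memL2 \<nu> G" "L2n \<nu> G \<le> B"
proof -
  have "(\<integral>\<^sup>+x. ennreal ((G x)\<^sup>2) \<partial>\<nu>) = (\<integral>\<^sup>+x. liminf (\<lambda>k. ennreal ((u k x)\<^sup>2)) \<partial>\<nu>)"
  proof (rule nn_integral_cong_AE)
    show "AE x in \<nu>. ennreal ((G x)\<^sup>2) = liminf (\<lambda>k. ennreal ((u k x)\<^sup>2))"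
      using lim
    proof eventually_elim
      case (elim x)
      then have "(\<lambda>k. ennreal ((u k x)\<^sup>2)) \<longlonglongrightarrow> ennreal ((G x)\<^sup>2)"
        by (intro tendsto_ennrealI tendsto_power)
      then show ?case by (intro lim_imp_Liminf[symmetric]) auto
    qed
  qed
  also have "\<dots> \<le> liminf (\<lambda>k. \<integral>\<^sup>+x. ennreal ((u k x)\<^sup>2) \<partial>\<nu>)"
    by (rule nn_integral_liminf) auto
  also have "\<dots> \<le> ennreal (B\<^sup>2)"
  proof (rule Liminf_le)
    show "\<forall>\<^sub>F k in sequentially. (\<integral>\<^sup>+x. ennreal ((u k x)\<^sup>2) \<partial>\<nu>) \<le> ennreal (B\<^sup>2)"
      using eventually_ge_at_top[of K]
    proof eventually_elim
      case (elim k)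
      then show ?case
        using nn_integral_L2n[OF mem[OF elim]] le[OF elim]
        by (simp add: power_mono)
    qed
  qed simp
  finally have *: "(\<integral>\<^sup>+x. ennreal ((G x)\<^sup>2) \<partial>\<nu>) \<le> ennreal (B\<^sup>2)" .
  show "memL2 \<nu> G" "L2n \<nu> G \<le> B"
    by (rule memL2_nn_integralI[OF _ * \<open>0 \<le> B\<close>]; simp)+
qed

text \<open>Riesz--Fischer for sequences with geometrically decaying increments. The limit is the pointwise
  one, so that joint measurability in a parameter is inherited.\<close>

lemma L2_complete_fast:
  assumes mem: "\<And>k. memL2 \<nu> (g k)"
    and fast: "\<And>k. L2n \<nu> (\<lambda>x. g (Suc k) x - g k x) \<le> (1/2) ^ k"
  shows "AE x in \<nu>. (\<lambda>k. g k x) \<longlonglongrightarrow> lim (\<lambda>k. g k x)"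
    and "memL2 \<nu> (\<lambda>x. lim (\<lambda>k. g k x))"
    and "L2n \<nu> (\<lambda>x. g k x - lim (\<lambda>j. g j x)) \<le> 2 * (1/2) ^ k"
proof -
  have [measurable]: "g k \<in> borel_measurable \<nu>" for k using mem by measurable
  let ?G = "\<lambda>x. lim (\<lambda>k. g k x)"
  have [measurable]: "?G \<in> borel_measurable \<nu>" by measurable
  \<comment> \<open>The increments are summed with weights 2^k: the integrals of 2^k d_k^2 are at
    most 2^(-k), so for a.e. x the values d_k(x) are O(2^(-k/2)) and form an absolutely summable
    series.\<close>
  let ?d = "\<lambda>k x. g (Suc k) x - g k x"
  have "(\<integral>\<^sup>+x. (\<Sum>k. ennreal (2 ^ k * (?d k x)\<^sup>2)) \<partial>\<nu>) = (\<Sum>k. \<integral>\<^sup>+x. ennreal (2 ^ k * (?d k x)\<^sup>2) \<partial>\<nu>)"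
    by (rule nn_integral_suminf) measurable
  also have "\<dots> \<le> (\<Sum>k. ennreal ((1/2) ^ k))"
  proof (rule suminf_le)
    fix k
    have "(\<integral>\<^sup>+x. ennreal (2 ^ k * (?d k x)\<^sup>2) \<partial>\<nu>) = ennreal (2 ^ k) * (\<integral>\<^sup>+x. ennreal ((?d k x)\<^sup>2) \<partial>\<nu>)"
      by (subst nn_integral_cmult[symmetric]) (auto simp: ennreal_mult)
    also have "\<dots> = ennreal (2 ^ k * (L2n \<nu> (?d k))\<^sup>2)"
      by (subst nn_integral_L2n) (auto intro!: mem simp: ennreal_mult)
    also have "\<dots> \<le> ennreal (2 ^ k * ((1/2) ^ k)\<^sup>2)"
      by (intro ennreal_leI mult_left_mono power_mono fast) auto
    also have "2 ^ k * ((1/2::real) ^ k)\<^sup>2 = (1/2) ^ k"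
      by (simp add: power2_eq_square power_divide)
    finally show "(\<integral>\<^sup>+x. ennreal (2 ^ k * (?d k x)\<^sup>2) \<partial>\<nu>) \<le> ennreal ((1/2) ^ k)" .
  qed auto
  also have "\<dots> < \<infinity>"
    by (subst suminf_ennreal_eq[OF _ geometric_sums]) (auto)
  finally have "(\<integral>\<^sup>+x. (\<Sum>k. ennreal (2 ^ k * (?d k x)\<^sup>2)) \<partial>\<nu>) \<noteq> \<infinity>" by simp
  then have "AE x in \<nu>. (\<Sum>k. ennreal (2 ^ k * (?d k x)\<^sup>2)) \<noteq> \<infinity>"
    by (intro nn_integral_PInf_AE) auto
  then show AE: "AE x in \<nu>. (\<lambda>k. g k x) \<longlonglongrightarrow> ?G x"
  proof eventually_elim
    case (elim x)
    then have "summable (\<lambda>k. 2 ^ k * (?d k x)\<^sup>2)"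
      by (intro summable_suminf_not_top) auto
    then have "Bseq (\<lambda>k. 2 ^ k * (?d k x)\<^sup>2)"
      by (intro convergent_imp_Bseq) (auto simp: convergent_def dest: summable_LIMSEQ_zero)
    then obtain K where K: "0 < K" "\<And>k. norm (2 ^ k * (?d k x)\<^sup>2) \<le> K" by (auto elim: BseqE)
    have bd: "norm (?d k x) \<le> sqrt K * (sqrt (1/2)) ^ k" for k
    proof -
      have "(?d k x)\<^sup>2 \<le> K * (1/2) ^ k"
        using K(2)[of k] by (simp add: field_simps power_divide)
      then have "sqrt ((?d k x)\<^sup>2) \<le> sqrt (K * (1/2) ^ k)" by (rule real_sqrt_le_mono)
      then show ?thesis by (simp only: real_sqrt_mult real_sqrt_power[of "1/2"] real_sqrt_abs real_norm_def)
    qed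
    have "summable (\<lambda>k. ?d k x)"
      by (rule summable_comparison_test'[where N=0, OF _ bd]) (auto intro!: summable_mult summable_geometric)
    then have "convergent (\<lambda>n. \<Sum>k<n. ?d k x)" by (simp add: summable_iff_convergent)
    then have "convergent (\<lambda>n. g n x - g 0 x)" by (simp only: sum_lessThan_telescope[of "\<lambda>k. g k x"])
    then have "convergent (\<lambda>n. g n x - g 0 x + g 0 x)" by (intro convergent_add convergent_const)
    then show ?case by (simp add: convergent_LIMSEQ_iff)
  qed
  have step: "L2n \<nu> (\<lambda>x. g (k + n) x - g k x) \<le> 2 * (1/2) ^ k - 2 * (1/2) ^ (k + n)" for k n
  proof (induction n)
    case (Suc n)
    have "L2n \<nu> (\<lambda>x. g (k + Suc n) x - g k x)
        \<le> L2n \<nu> (\<lambda>x. g (k + Suc n) x - g (k + n) x) + L2n \<nu> (\<lambda>x. g (k + n) x - g k x)"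
      by (rule L2n_triangle_diff) (rule mem)+
    then show ?case using Suc fast[of "k + n"] by simp
  qed simp
  have step': "L2n \<nu> (\<lambda>x. g j x - g k x) \<le> 2 * (1/2) ^ k" if "j \<ge> k" for j k
  proof -
    have "L2n \<nu> (\<lambda>x. g (k + (j - k)) x - g k x) \<le> 2 * (1/2) ^ k - 2 * (1/2) ^ (k + (j - k))" by (rule step)
    also have "\<dots> \<le> 2 * (1/2) ^ k" by simp
    finally show ?thesis using that by simp
  qed
  have lim': "AE x in \<nu>. (\<lambda>j. g j x - g k x) \<longlonglongrightarrow> ?G x - g k x" for k
    using AE by eventually_elim (intro tendsto_diff tendsto_const)
  have res: "memL2 \<nu> (\<lambda>x. ?G x - g k x)" "L2n \<nu> (\<lambda>x. ?G x - g k x) \<le> 2 * (1/2) ^ k" for k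
  proof -
    note F = L2n_Fatou[where u="\<lambda>j x. g j x - g k x" and G="\<lambda>x. ?G x - g k x" and K=k
        and \<nu>=\<nu> and B="2 * (1/2) ^ k", OF _ _ lim' _ step']
    show "memL2 \<nu> (\<lambda>x. ?G x - g k x)" by (rule F(1)) (auto intro!: mem)
    show "L2n \<nu> (\<lambda>x. ?G x - g k x) \<le> 2 * (1/2) ^ k" by (rule F(2)) (auto intro!: mem)
  qed
  show "memL2 \<nu> ?G" using memL2_add[OF res(1)[of 0] mem[of 0]] by simp
  show "L2n \<nu> (\<lambda>x. g k x - ?G x) \<le> 2 * (1/2) ^ k" using res(2)[of k] by (simp add: L2n_commute)
qed

section \<open>Completeness of L^2 and minimization of uniformly convex functionals\<close>

lemma fast_subsequence:
  fixes d :: "nat \<Rightarrow> nat \<Rightarrow> real"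
  assumes "\<And>e. e > 0 \<Longrightarrow> \<exists>N. \<forall>m\<ge>N. \<forall>n\<ge>N. d m n < e"
  obtains r where "strict_mono r" "\<And>k. d (r (Suc k)) (r k) \<le> (1/2) ^ k"
proof -
  have "\<forall>k. \<exists>N. \<forall>m\<ge>N. \<forall>n\<ge>N. d m n < (1/2) ^ k" using assms by simp
  then obtain N where N: "\<And>k m n. m \<ge> N k \<Longrightarrow> n \<ge> N k \<Longrightarrow> d m n < (1/2) ^ k" by metis
  \<comment> \<open>The sum dominates every threshold up to k, and the summand k makes the sequence
    strictly increasing.\<close>
  define r where "r k = (\<Sum>i\<le>k. N i) + k" for k
  have "strict_mono r" by (auto simp: strict_mono_Suc_iff r_def)
  have rN: "r k \<ge> N k" for k unfolding r_def
    by (rule trans_le_add1, rule member_le_sum) auto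
  have "r (Suc k) \<ge> N k" for k
    using rN[of k] strict_monoD[OF \<open>strict_mono r\<close>, of k "Suc k"] by simp
  then have "d (r (Suc k)) (r k) \<le> (1/2) ^ k" for k
    using N rN by (simp add: less_imp_le)
  with \<open>strict_mono r\<close> show ?thesis using that by blast
qed

text \<open>The subsequence and its a.e. limit are exported together with norm convergence, because
  lower semicontinuity of the energy is a Fatou argument and needs pointwise convergence.\<close>

lemma L2_complete:
  assumes mem: "\<And>k. memL2 \<nu> (g k)"
    and Cauchy: "\<And>e. e > 0 \<Longrightarrow> \<exists>N. \<forall>m\<ge>N. \<forall>n\<ge>N. L2n \<nu> (\<lambda>x. g m x - g n x) < e"
  obtains G r where "memL2 \<nu> G" "(\<lambda>k. L2n \<nu> (\<lambda>x. g k x - G x)) \<longlonglongrightarrow> 0" "strict_mono r"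
    "AE x in \<nu>. (\<lambda>k. g (r k) x) \<longlonglongrightarrow> G x"
proof -
  obtain r where r: "strict_mono r" "\<And>k. L2n \<nu> (\<lambda>x. g (r (Suc k)) x - g (r k) x) \<le> (1/2) ^ k"
    by (rule fast_subsequence[OF Cauchy]) blast+
  let ?G = "\<lambda>x. lim (\<lambda>k. g (r k) x)"
  note fast = L2_complete_fast[where g="\<lambda>k. g (r k)", OF mem r(2)]
  have "(\<lambda>k. L2n \<nu> (\<lambda>x. g k x - ?G x)) \<longlonglongrightarrow> 0"
  proof (rule LIMSEQ_I)
    fix e :: real assume "0 < e"
    then obtain N where N: "\<And>m n. m \<ge> N \<Longrightarrow> n \<ge> N \<Longrightarrow> L2n \<nu> (\<lambda>x. g m x - g n x) < e / 2"
      using Cauchy[of "e / 2"] by auto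
    obtain K where K: "(1/2::real) ^ K < e / 4" using real_arch_pow_inv[of "e/4" "1/2"] \<open>0 < e\<close> by auto
    show "\<exists>no. \<forall>k\<ge>no. norm (L2n \<nu> (\<lambda>x. g k x - ?G x) - 0) < e"
    proof (intro exI allI impI)
      fix k assume k: "k \<ge> N"
      let ?j = "max N K"
      have "r ?j \<ge> ?j" using r(1) by (rule seq_suble)
      then have "L2n \<nu> (\<lambda>x. g k x - g (r ?j) x) < e / 2" using k by (intro N) auto
      moreover have "L2n \<nu> (\<lambda>x. g (r ?j) x - ?G x) \<le> 2 * (1/2) ^ ?j" by (rule fast(3))
      moreover have "(1/2::real) ^ ?j \<le> (1/2) ^ K" by (rule power_decreasing) auto
      moreover have "L2n \<nu> (\<lambda>x. g k x - ?G x) \<le> L2n \<nu> (\<lambda>x. g k x - g (r ?j) x) + L2n \<nu> (\<lambda>x. g (r ?j) x - ?G x)"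
        by (rule L2n_triangle_diff) (rule mem fast(2))+
      ultimately show "norm (L2n \<nu> (\<lambda>x. g k x - ?G x) - 0) < e"
        using K unfolding real_norm_def diff_0_right abs_of_nonneg[OF L2n_nonneg] by linarith
    qed
  qed
  then show ?thesis using fast r(1) that by blast
qed

text \<open>A midpoint inequality with a quadratic gain makes near-minimizers Cauchy in norm, which
  replaces weak compactness. The sets may shrink with k: then the infima increase and stay below
  \<open>C\<close>. Constant sets serve for the resolvent and for the density of step functions,
  shrinking ones for Mazur's lemma.\<close>

lemma minimizing_sequence:
  fixes S :: "nat \<Rightarrow> ('a \<Rightarrow> real) set" and I :: "('a \<Rightarrow> real) \<Rightarrow> real"
  assumes dec: "\<And>k. S (Suc k) \<subseteq> S k" and mem: "\<And>u. u \<in> S 0 \<Longrightarrow> memL2 \<nu> u"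
    and pos: "\<And>u. u \<in> S 0 \<Longrightarrow> 0 \<le> I u" and bdd: "\<And>k. \<exists>u\<in>S k. I u \<le> C"
    and a: "0 < a"
    and mid: "\<And>k u v. u \<in> S k \<Longrightarrow> v \<in> S k \<Longrightarrow> (\<lambda>x. (u x + v x) / 2) \<in> S k"
    and I_mid: "\<And>u v. u \<in> S 0 \<Longrightarrow> v \<in> S 0 \<Longrightarrow>
       I (\<lambda>x. (u x + v x) / 2) \<le> (I u + I v) / 2 - a * (L2n \<nu> (\<lambda>x. u x - v x))\<^sup>2"
  obtains h G r where "\<And>k. h k \<in> S k" "\<And>k v. v \<in> S k \<Longrightarrow> I (h k) \<le> I v + 1 / (real k + 1)"
    "memL2 \<nu> G" "(\<lambda>k. L2n \<nu> (\<lambda>x. h k x - G x)) \<longlonglongrightarrow> 0" "strict_mono r"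
    "AE x in \<nu>. (\<lambda>k. h (r k) x) \<longlonglongrightarrow> G x"
proof -
  have dec': "S j \<subseteq> S k" if "k \<le> j" for j k
    using dec that by (rule lift_Suc_antimono_le)
  have S0: "u \<in> S 0" if "u \<in> S k" for u k using dec'[of 0 k] that by auto
  define d where "d k = Inf (I ` S k)" for k
  have bdd_below: "bdd_below (I ` S k)" for k
    using pos S0 by (intro bdd_belowI[where m=0]) auto
  have d_le: "d k \<le> I u" if "u \<in> S k" for k u
    unfolding d_def using that by (intro cInf_lower bdd_below) auto
  have ne: "S k \<noteq> {}" for k using bdd[of k] by auto
  have "\<exists>u\<in>S k. I u < d k + 1 / (real k + 1)" for k
  proof -
    have "\<exists>y\<in>I ` S k. y < d k + 1 / (real k + 1)"
      unfolding d_def using ne[of k] bdd_below[of k] by (intro cInf_lessD) auto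
    then show ?thesis by auto
  qed
  then obtain h where h: "\<And>k. h k \<in> S k" "\<And>k. I (h k) < d k + 1 / (real k + 1)" by metis
  have "incseq d"
    unfolding incseq_def d_def using dec' bdd_below ne
    by (auto intro!: cInf_superset_mono)
  moreover have "d k \<le> C" for k using bdd[of k] d_le[of _ k] by (auto intro: order_trans)
  ultimately obtain L where "d \<longlonglongrightarrow> L" by (rule incseq_convergent[of d C, OF _ allI]) auto
  then have Cd: "Cauchy d" by (intro convergent_Cauchy convergentI)
  \<comment> \<open>For k \<le> j both points lie in \<open>S k\<close>, hence so does their
    midpoint, whose value is at least \<open>d k\<close>; the quadratic gain is therefore at most
    the excess of the two values over \<open>d k\<close>.\<close>
  have est: "a * (L2n \<nu> (\<lambda>x. h j x - h k x))\<^sup>2 \<le> \<bar>d j - d k\<bar> + 1 / (real k + 1)" if "k \<le> j" for j k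
  proof -
    have hj: "h j \<in> S k" using h(1) dec'[OF that] by auto
    have "d k \<le> I (\<lambda>x. (h j x + h k x) / 2)" by (intro d_le mid hj h)
    also have "\<dots> \<le> (I (h j) + I (h k)) / 2 - a * (L2n \<nu> (\<lambda>x. h j x - h k x))\<^sup>2"
      by (intro I_mid S0[OF h(1)])
    finally have "a * (L2n \<nu> (\<lambda>x. h j x - h k x))\<^sup>2 \<le> (d j - d k) / 2 + (1 / (real j + 1) + 1 / (real k + 1)) / 2"
      using h(2)[of j] h(2)[of k] by argo
    moreover have "1 / (real j + 1) \<le> 1 / (real k + 1)" using that by (simp add: frac_le)
    moreover have "(d j - d k) / 2 \<le> \<bar>d j - d k\<bar>" by (auto simp: abs_if)
    ultimately show ?thesis by argo
  qed
  have memh: "memL2 \<nu> (h k)" for k using h(1) S0 mem by blast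
  have "\<exists>N. \<forall>m\<ge>N. \<forall>n\<ge>N. L2n \<nu> (\<lambda>x. h m x - h n x) < e" if e: "e > 0" for e
  proof -
    have ae: "a * e\<^sup>2 / 2 > 0" using a e by simp
    then obtain N1 where N1: "\<And>m n. m \<ge> N1 \<Longrightarrow> n \<ge> N1 \<Longrightarrow> \<bar>d m - d n\<bar> < a * e\<^sup>2 / 2"
      using Cd unfolding Cauchy_def dist_real_def by metis
    obtain N2 where N2: "1 / (real N2 + 1) < a * e\<^sup>2 / 2"
      using ae nat_approx_posE by (metis of_nat_Suc add.commute)
    have *: "L2n \<nu> (\<lambda>x. h m x - h n x) < e" if "m \<ge> n" "n \<ge> max N1 N2" for m n
    proof -
      have "1 / (real n + 1) \<le> 1 / (real N2 + 1)" using that by (simp add: frac_le)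
      then have "a * (L2n \<nu> (\<lambda>x. h m x - h n x))\<^sup>2 < a * e\<^sup>2"
        using est[OF that(1)] N1[of m n] N2 that by auto
      then show ?thesis using a e by (intro power2_less_imp_less[of _ e]) auto
    qed
    show ?thesis
    proof (intro exI allI impI)
      fix m n assume "max N1 N2 \<le> m" "max N1 N2 \<le> n"
      then show "L2n \<nu> (\<lambda>x. h m x - h n x) < e"
        using *[of n m] *[of m n] by (cases "m \<ge> n") (auto simp: L2n_commute[of \<nu> "h m"])
    qed
  qed
  then obtain G r where G: "memL2 \<nu> G" "(\<lambda>k. L2n \<nu> (\<lambda>x. h k x - G x)) \<longlonglongrightarrow> 0" "strict_mono r"
    "AE x in \<nu>. (\<lambda>k. h (r k) x) \<longlonglongrightarrow> G x"
    by (rule L2_complete[OF memh])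
  have "I (h k) \<le> I v + 1 / (real k + 1)" if "v \<in> S k" for k v
    using d_le[OF that] h(2)[of k] by simp
  then show ?thesis using that G h(1) by blast
qed

section \<open>Reversible kernels and the edge measure\<close>

text \<open>The measure \<nu>(dx) m_x(dy) on pairs of points, on which the nonlocal gradient lives.
  It is written as a bind of the laws of (x, y) with x fixed, so that disintegration along the first
  coordinate comes from the bind rules.\<close>

definition edge :: "('a \<Rightarrow> 'a measure) \<Rightarrow> 'a measure \<Rightarrow> ('a \<times> 'a) measure" where
  "edge m \<nu> = \<nu> \<bind> (\<lambda>x. distr (m x) (\<nu> \<Otimes>\<^sub>M \<nu>) (Pair x))"

definition grad :: "('a \<Rightarrow> real) \<Rightarrow> 'a \<times> 'a \<Rightarrow> real" where
  "grad u z = u (snd z) - u (fst z)"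

locale reversible_kernel =
  fixes m :: "'a \<Rightarrow> 'a measure" and \<nu> :: "'a measure"
  assumes kernel[measurable]: "m \<in> measurable \<nu> (subprob_algebra \<nu>)"
    and prob: "\<And>x. x \<in> space \<nu> \<Longrightarrow> prob_space (m x)"
    and rev: "reversible \<nu> m \<nu>"
begin

lemma sets_m[simp]: "x \<in> space \<nu> \<Longrightarrow> sets (m x) = sets \<nu>"
  using sets_kernel[OF kernel] .

lemma space_m[simp]: "x \<in> space \<nu> \<Longrightarrow> space (m x) = space \<nu>"
  using sets_eq_imp_space_eq[OF sets_m] .

lemma pair_kernel[measurable]:
  "(\<lambda>x. distr (m x) (\<nu> \<Otimes>\<^sub>M \<nu>) (Pair x)) \<in> measurable \<nu> (subprob_algebra (\<nu> \<Otimes>\<^sub>M \<nu>))"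
  by (rule measurable_distr2[OF _ kernel]) simp

lemma sets_edge[simp, measurable_cong]: "sets (edge m \<nu>) = sets (\<nu> \<Otimes>\<^sub>M \<nu>)"
\<comment> \<open>Over an empty space \<open>bind\<close> is by convention the counting measure on
  the empty set, so this case is settled by hand.\<close>
proof (cases "space \<nu> = {}")
  case True
  then have "space (\<nu> \<Otimes>\<^sub>M \<nu>) = {}" by (simp add: space_pair_measure)
  then have "sets (\<nu> \<Otimes>\<^sub>M \<nu>) = {{}}" by (auto dest: sets.sets_into_space)
  then show ?thesis using True by (simp add: edge_def bind_empty)
next
  case False
  then show ?thesis unfolding edge_def by (intro sets_bind) auto
qed

lemma space_edge[simp]: "space (edge m \<nu>) = space \<nu> \<times> space \<nu>"
  using sets_eq_imp_space_eq[OF sets_edge] by (simp add: space_pair_measure)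

lemma nn_integral_edge:
  assumes [measurable]: "F \<in> borel_measurable (\<nu> \<Otimes>\<^sub>M \<nu>)"
  shows "(\<integral>\<^sup>+z. F z \<partial>edge m \<nu>) = (\<integral>\<^sup>+x. \<integral>\<^sup>+y. F (x, y) \<partial>m x \<partial>\<nu>)"
  unfolding edge_def
  by (subst nn_integral_bind[OF assms pair_kernel])
    (auto intro!: nn_integral_cong simp: nn_integral_distr)

lemma emeasure_edge:
  assumes [measurable]: "A \<in> sets (\<nu> \<Otimes>\<^sub>M \<nu>)"
  shows "emeasure (edge m \<nu>) A = (\<integral>\<^sup>+x. \<integral>\<^sup>+y. indicator A (x, y) \<partial>m x \<partial>\<nu>)"
proof -
  have "emeasure (edge m \<nu>) A = (\<integral>\<^sup>+z. indicator A z \<partial>edge m \<nu>)" by simp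
  also have "\<dots> = (\<integral>\<^sup>+x. \<integral>\<^sup>+y. indicator A (x, y) \<partial>m x \<partial>\<nu>)" by (rule nn_integral_edge) simp
  finally show ?thesis .
qed

lemma measurable_prod_swap[measurable]: "prod.swap \<in> measurable (\<nu> \<Otimes>\<^sub>M \<nu>) (\<nu> \<Otimes>\<^sub>M \<nu>)"
  unfolding prod.swap_def by measurable

text \<open>Reversibility in the form used from here on: the edge measure is symmetric. The
  hypothesis tests it on measurable sets of pairs, and those determine the measure.\<close>

lemma distr_edge_swap: "distr (edge m \<nu>) (\<nu> \<Otimes>\<^sub>M \<nu>) prod.swap = edge m \<nu>"
proof (rule measure_eqI)
  fix A assume "A \<in> sets (distr (edge m \<nu>) (\<nu> \<Otimes>\<^sub>M \<nu>) prod.swap)"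
  then have A[measurable]: "A \<in> sets (\<nu> \<Otimes>\<^sub>M \<nu>)" by simp
  have "emeasure (distr (edge m \<nu>) (\<nu> \<Otimes>\<^sub>M \<nu>) prod.swap) A
      = (\<integral>\<^sup>+z. indicator A z \<partial>distr (edge m \<nu>) (\<nu> \<Otimes>\<^sub>M \<nu>) prod.swap)" by simp
  also have "\<dots> = (\<integral>\<^sup>+z. indicator A (prod.swap z) \<partial>edge m \<nu>)"
    by (rule nn_integral_distr) auto
  also have "\<dots> = (\<integral>\<^sup>+x. \<integral>\<^sup>+y. indicator A (y, x) \<partial>m x \<partial>\<nu>)"
    by (subst nn_integral_edge) auto
  also have "\<dots> = emeasure (edge m \<nu>) A"
    using rev A by (simp add: reversible_def emeasure_edge)
  finally show "emeasure (distr (edge m \<nu>) (\<nu> \<Otimes>\<^sub>M \<nu>) prod.swap) A = emeasure (edge m \<nu>) A" .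
qed simp

lemma distr_edge_fst: "distr (edge m \<nu>) \<nu> fst = \<nu>"
proof (rule measure_eqI)
  fix A assume "A \<in> sets (distr (edge m \<nu>) \<nu> fst)"
  then have A[measurable]: "A \<in> sets \<nu>" by simp
  have "emeasure (distr (edge m \<nu>) \<nu> fst) A = (\<integral>\<^sup>+z. indicator A z \<partial>distr (edge m \<nu>) \<nu> fst)" by simp
  also have "\<dots> = (\<integral>\<^sup>+z. indicator A (fst z) \<partial>edge m \<nu>)" by (rule nn_integral_distr) auto
  also have "\<dots> = (\<integral>\<^sup>+x. \<integral>\<^sup>+y. indicator A x \<partial>m x \<partial>\<nu>)" by (subst nn_integral_edge) auto
  also have "\<dots> = (\<integral>\<^sup>+x. indicator A x \<partial>\<nu>)"
    by (rule nn_integral_cong) (use prob prob_space.emeasure_space_1 in force)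
  finally show "emeasure (distr (edge m \<nu>) \<nu> fst) A = emeasure \<nu> A" by simp
qed simp

text \<open>The swap exchanges the two marginals, and the first one is \<open>\<nu>\<close> because
  the kernels are probabilities. Both marginals being \<open>\<nu>\<close> lets null sets and
  integrability pass from points to edges.\<close>

lemma distr_edge_snd: "distr (edge m \<nu>) \<nu> snd = \<nu>"
proof -
  have "distr (edge m \<nu>) \<nu> snd = distr (edge m \<nu>) \<nu> (fst \<circ> prod.swap)"
    by (rule distr_cong) auto
  also have "\<dots> = distr (distr (edge m \<nu>) (\<nu> \<Otimes>\<^sub>M \<nu>) prod.swap) \<nu> fst"
    by (subst distr_distr) auto
  finally show ?thesis by (simp add: distr_edge_swap distr_edge_fst)
qed

lemma AE_edge_fst: "AE x in \<nu>. P x \<Longrightarrow> AE z in edge m \<nu>. P (fst z)"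
  using AE_distrD[of fst "edge m \<nu>" \<nu> P] unfolding distr_edge_fst by simp

lemma AE_edge_snd: "AE x in \<nu>. P x \<Longrightarrow> AE z in edge m \<nu>. P (snd z)"
  using AE_distrD[of snd "edge m \<nu>" \<nu> P] unfolding distr_edge_snd by simp

lemma integrable_edge_fst:
  fixes f :: "'a \<Rightarrow> real"
  shows "integrable \<nu> f \<Longrightarrow> integrable (edge m \<nu>) (\<lambda>z. f (fst z))"
  by (rule integrable_distr[where M'=\<nu>]) (auto simp: distr_edge_fst)

lemma integrable_edge_snd:
  fixes f :: "'a \<Rightarrow> real"
  shows "integrable \<nu> f \<Longrightarrow> integrable (edge m \<nu>) (\<lambda>z. f (snd z))"
  by (rule integrable_distr[where M'=\<nu>]) (auto simp: distr_edge_snd)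

lemma integrable_edge_swap:
  fixes F :: "'a \<times> 'a \<Rightarrow> real"
  shows "integrable (edge m \<nu>) F \<Longrightarrow> integrable (edge m \<nu>) (\<lambda>z. F (prod.swap z))"
  by (rule integrable_distr[where M'="\<nu> \<Otimes>\<^sub>M \<nu>"]) (auto simp: distr_edge_swap)

lemma integral_edge_swap:
  fixes F :: "'a \<times> 'a \<Rightarrow> real"
  assumes "F \<in> borel_measurable (\<nu> \<Otimes>\<^sub>M \<nu>)"
  shows "(\<integral>z. F (prod.swap z) \<partial>edge m \<nu>) = (\<integral>z. F z \<partial>edge m \<nu>)"
  by (subst (2) distr_edge_swap[symmetric], subst integral_distr) (use assms in auto)

lemma grad_measurable[measurable]:
  assumes [measurable]: "u \<in> borel_measurable \<nu>"
  shows "grad u \<in> borel_measurable (\<nu> \<Otimes>\<^sub>M \<nu>)"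
  unfolding grad_def[abs_def] by measurable

text \<open>Swapping the two points turns \<Phi> times \<phi> at the second point into minus \<Phi>
  times \<phi> at the first. The two halves of the gradient then contribute equally, whence the
  factor -2, and integrability of one half yields the other.\<close>

lemma integral_by_parts:
  assumes [measurable]: "\<Phi> \<in> borel_measurable (\<nu> \<Otimes>\<^sub>M \<nu>)" "\<phi> \<in> borel_measurable \<nu>"
    and anti: "\<And>z. \<Phi> (prod.swap z) = - \<Phi> z"
    and int: "integrable (edge m \<nu>) (\<lambda>z. \<Phi> z * \<phi> (fst z))"
  shows "integrable (edge m \<nu>) (\<lambda>z. \<Phi> z * grad \<phi> z)"
    and "(\<integral>z. \<Phi> z * grad \<phi> z \<partial>edge m \<nu>) = - 2 * (\<integral>z. \<Phi> z * \<phi> (fst z) \<partial>edge m \<nu>)"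
proof -
  have i2: "integrable (edge m \<nu>) (\<lambda>z. \<Phi> z * \<phi> (snd z))"
    using integrable_edge_swap[OF int] by (simp add: anti)
  have "(\<integral>z. \<Phi> z * \<phi> (fst z) \<partial>edge m \<nu>) = (\<integral>z. \<Phi> (prod.swap z) * \<phi> (fst (prod.swap z)) \<partial>edge m \<nu>)"
    by (rule integral_edge_swap[symmetric]) measurable
  also have "\<dots> = - (\<integral>z. \<Phi> z * \<phi> (snd z) \<partial>edge m \<nu>)" by (simp add: anti)
  finally have e: "(\<integral>z. \<Phi> z * \<phi> (snd z) \<partial>edge m \<nu>) = - (\<integral>z. \<Phi> z * \<phi> (fst z) \<partial>edge m \<nu>)" by simp
  show "integrable (edge m \<nu>) (\<lambda>z. \<Phi> z * grad \<phi> z)"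
    using i2 int by (simp add: grad_def algebra_simps)
  show "(\<integral>z. \<Phi> z * grad \<phi> z \<partial>edge m \<nu>) = - 2 * (\<integral>z. \<Phi> z * \<phi> (fst z) \<partial>edge m \<nu>)"
    using i2 int e by (simp add: grad_def algebra_simps)
qed

lemma kernel_nn_integral_measurable:
  assumes "F \<in> borel_measurable (\<nu> \<Otimes>\<^sub>M \<nu>)"
  shows "(\<lambda>x. \<integral>\<^sup>+y. F (x, y) \<partial>m x) \<in> borel_measurable \<nu>"
  using nn_integral_measurable_subprob_algebra2[of "\<lambda>x y. F (x, y)", OF _ kernel] assms by simp

text \<open>The integral is 0 by convention where F(x, .) is not integrable. On the measurable set
  where it is, it is a difference of two nonnegative integrals, each measurable in x.\<close>

lemma kernel_integral_measurable:
  fixes F :: "'a \<times> 'a \<Rightarrow> real"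
  assumes [measurable]: "F \<in> borel_measurable (\<nu> \<Otimes>\<^sub>M \<nu>)"
  shows "(\<lambda>x. \<integral>y. F (x, y) \<partial>m x) \<in> borel_measurable \<nu>"
proof -
  note [measurable] = kernel_nn_integral_measurable
  have eq: "(\<integral>y. F (x, y) \<partial>m x) = (if (\<integral>\<^sup>+y. ennreal \<bar>F (x, y)\<bar> \<partial>m x) < \<infinity>
      then enn2real (\<integral>\<^sup>+y. ennreal (F (x, y)) \<partial>m x) - enn2real (\<integral>\<^sup>+y. ennreal (- F (x, y)) \<partial>m x) else 0)"
    if "x \<in> space \<nu>" for x
  proof -
    have [measurable]: "(\<lambda>y. F (x, y)) \<in> borel_measurable (m x)"
      using that by (subst measurable_cong_sets[OF sets_m refl]) auto
    show ?thesis
    proof (cases "(\<integral>\<^sup>+y. ennreal \<bar>F (x, y)\<bar> \<partial>m x) < \<infinity>")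
      case True
      then have "integrable (m x) (\<lambda>y. F (x, y))" by (intro integrableI_bounded) auto
      then show ?thesis using True by (simp add: real_lebesgue_integral_def)
    next
      case False
      then have "\<not> integrable (m x) (\<lambda>y. F (x, y))" by (auto simp: integrable_iff_bounded)
      then show ?thesis using False by (simp add: not_integrable_integral_eq)
    qed
  qed
  show ?thesis by (subst measurable_cong[OF eq]) measurable
qed

text \<open>Fubini's theorem for a measure that is a kernel over \<open>\<nu>\<close> instead of a
  product: the nonnegative case is applied to |F| and to the positive and negative parts.\<close>

lemma integral_edge:
  fixes F :: "'a \<times> 'a \<Rightarrow> real"
  assumes int: "integrable (edge m \<nu>) F"
  shows "AE x in \<nu>. integrable (m x) (\<lambda>y. F (x, y))"
    and "integrable \<nu> (\<lambda>x. \<integral>y. F (x, y) \<partial>m x)"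
    and "(\<integral>z. F z \<partial>edge m \<nu>) = (\<integral>x. \<integral>y. F (x, y) \<partial>m x \<partial>\<nu>)"
proof -
  have Fm[measurable]: "F \<in> borel_measurable (\<nu> \<Otimes>\<^sub>M \<nu>)"
    using borel_measurable_integrable[OF int] by simp
  note [measurable] = kernel_nn_integral_measurable kernel_integral_measurable
  have Fx: "(\<lambda>y. F (x, y)) \<in> borel_measurable (m x)" if "x \<in> space \<nu>" for x
    using that by (subst measurable_cong_sets[OF sets_m refl]) auto
  have fin: "(\<integral>\<^sup>+x. \<integral>\<^sup>+y. ennreal \<bar>F (x, y)\<bar> \<partial>m x \<partial>\<nu>) < \<infinity>"
    using int by (subst nn_integral_edge[symmetric, of "\<lambda>z. ennreal \<bar>F z\<bar>"]) (auto simp: integrable_iff_bounded)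
  then have "AE x in \<nu>. (\<integral>\<^sup>+y. ennreal \<bar>F (x, y)\<bar> \<partial>m x) \<noteq> \<infinity>"
    by (intro nn_integral_PInf_AE) auto
  with AE_space show AEi: "AE x in \<nu>. integrable (m x) (\<lambda>y. F (x, y))"
    by eventually_elim (auto simp: integrable_iff_bounded Fx less_top)
  let ?p = "\<lambda>x. \<integral>\<^sup>+y. ennreal (F (x, y)) \<partial>m x" and ?n = "\<lambda>x. \<integral>\<^sup>+y. ennreal (- F (x, y)) \<partial>m x"
  have le: "?p x \<le> (\<integral>\<^sup>+y. ennreal \<bar>F (x, y)\<bar> \<partial>m x)" "?n x \<le> (\<integral>\<^sup>+y. ennreal \<bar>F (x, y)\<bar> \<partial>m x)" for x
    by (auto intro!: nn_integral_mono ennreal_leI)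
  have fp: "(\<integral>\<^sup>+x. ?p x \<partial>\<nu>) < \<infinity>" and fn: "(\<integral>\<^sup>+x. ?n x \<partial>\<nu>) < \<infinity>"
    by (rule le_less_trans[OF nn_integral_mono[OF le(1)] fin], rule le_less_trans[OF nn_integral_mono[OF le(2)] fin])
  have AEp: "AE x in \<nu>. ?p x \<noteq> \<infinity>" by (rule nn_integral_PInf_AE) (use fp in auto)
  have AEn: "AE x in \<nu>. ?n x \<noteq> \<infinity>" by (rule nn_integral_PInf_AE) (use fn in auto)
  have ip: "integrable \<nu> (\<lambda>x. enn2real (?p x))" "(\<integral>x. enn2real (?p x) \<partial>\<nu>) = enn2real (\<integral>\<^sup>+x. ?p x \<partial>\<nu>)"
  proof -
    have *: "(\<integral>\<^sup>+x. ennreal (enn2real (?p x)) \<partial>\<nu>) = (\<integral>\<^sup>+x. ?p x \<partial>\<nu>)"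
      by (rule nn_integral_cong_AE) (use AEp in \<open>eventually_elim, simp add: less_top\<close>)
    show "integrable \<nu> (\<lambda>x. enn2real (?p x))" by (rule integrableI_nonneg) (use * fp in auto)
    show "(\<integral>x. enn2real (?p x) \<partial>\<nu>) = enn2real (\<integral>\<^sup>+x. ?p x \<partial>\<nu>)"
      by (subst integral_eq_nn_integral) (auto simp: *)
  qed
  have inn: "integrable \<nu> (\<lambda>x. enn2real (?n x))" "(\<integral>x. enn2real (?n x) \<partial>\<nu>) = enn2real (\<integral>\<^sup>+x. ?n x \<partial>\<nu>)"
  proof -
    have *: "(\<integral>\<^sup>+x. ennreal (enn2real (?n x)) \<partial>\<nu>) = (\<integral>\<^sup>+x. ?n x \<partial>\<nu>)"
      by (rule nn_integral_cong_AE) (use AEn in \<open>eventually_elim, simp add: less_top\<close>)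
    show "integrable \<nu> (\<lambda>x. enn2real (?n x))" by (rule integrableI_nonneg) (use * fn in auto)
    show "(\<integral>x. enn2real (?n x) \<partial>\<nu>) = enn2real (\<integral>\<^sup>+x. ?n x \<partial>\<nu>)"
      by (subst integral_eq_nn_integral) (auto simp: *)
  qed
  have eq: "AE x in \<nu>. (\<integral>y. F (x, y) \<partial>m x) = enn2real (?p x) - enn2real (?n x)"
    using AEi by eventually_elim (simp add: real_lebesgue_integral_def)
  show "integrable \<nu> (\<lambda>x. \<integral>y. F (x, y) \<partial>m x)"
    by (subst integrable_cong_AE[OF _ _ eq]) (use ip inn in auto)
  have "(\<integral>x. \<integral>y. F (x, y) \<partial>m x \<partial>\<nu>) = (\<integral>x. enn2real (?p x) - enn2real (?n x) \<partial>\<nu>)"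
    by (rule integral_cong_AE[OF _ _ eq]) auto
  also have "\<dots> = enn2real (\<integral>\<^sup>+x. ?p x \<partial>\<nu>) - enn2real (\<integral>\<^sup>+x. ?n x \<partial>\<nu>)"
    using ip inn by simp
  also have "\<dots> = (\<integral>z. F z \<partial>edge m \<nu>)"
    unfolding real_lebesgue_integral_def[OF int]
    by (subst (1 2) nn_integral_edge) auto
  finally show "(\<integral>z. F z \<partial>edge m \<nu>) = (\<integral>x. \<integral>y. F (x, y) \<partial>m x \<partial>\<nu>)" ..
qed

text \<open>Each \<open>m x\<close> is a probability, so Cauchy-Schwarz against the constant 1
  bounds the squared mean by the mean square.\<close>

lemma kernel_Jensen_square:
  assumes [measurable]: "F \<in> borel_measurable (\<nu> \<Otimes>\<^sub>M \<nu>)" and int: "integrable (edge m \<nu>) (\<lambda>z. (F z)\<^sup>2)"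
  shows "memL2 \<nu> (\<lambda>x. \<integral>y. F (x, y) \<partial>m x)"
  unfolding memL2_def
proof
  note [measurable] = kernel_integral_measurable
  show "(\<lambda>x. \<integral>y. F (x, y) \<partial>m x) \<in> borel_measurable \<nu>" by measurable
  show "integrable \<nu> (\<lambda>x. (\<integral>y. F (x, y) \<partial>m x)\<^sup>2)"
  proof (rule Bochner_Integration.integrable_bound[OF integral_edge(2)[OF int]])
    show "AE x in \<nu>. norm ((\<integral>y. F (x, y) \<partial>m x)\<^sup>2) \<le> norm (\<integral>y. (F (x, y))\<^sup>2 \<partial>m x)"
      using integral_edge(1)[OF int] AE_space
    proof eventually_elim
      case (elim x)
      then interpret prob_space "m x" using prob by auto
      have Fx[measurable]: "(\<lambda>y. F (x, y)) \<in> borel_measurable (m x)"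
        using elim by (subst measurable_cong_sets[OF sets_m refl]) auto
      have "memL2 (m x) (\<lambda>y. F (x, y))" "memL2 (m x) (\<lambda>y. 1)" using elim by (auto simp: memL2_def)
      from L2_Cauchy_Schwarz[OF this] have "\<bar>\<integral>y. F (x, y) \<partial>m x\<bar> \<le> L2n (m x) (\<lambda>y. F (x, y))"
        by (simp add: L2n_def[of _ "\<lambda>y. 1"] prob_space)
      then have "\<bar>\<integral>y. F (x, y) \<partial>m x\<bar>\<^sup>2 \<le> (L2n (m x) (\<lambda>y. F (x, y)))\<^sup>2" by (intro power_mono) auto
      then show ?case by (simp add: L2n_power2)
    qed
  qed auto
qed

end

section \<open>Powers and a chain rule inequality\<close>

definition psi :: "real \<Rightarrow> real \<Rightarrow> real" where
  "psi s r = \<bar>r\<bar> powr (s - 2) * r"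

text \<open>This form shows monotonicity and continuity for s > 1 at once and includes r = 0, where
  |r|^(s-2) would be singular for s < 2 but \<open>powr\<close> returns 0.\<close>

lemma psi_eq: "psi s r = (max 0 r) powr (s - 1) - (max 0 (- r)) powr (s - 1)"
proof -
  have *: "a powr (s - 2) * a = a powr (s - 1)" if "a > 0" for a :: real
    using that powr_add[of a "s - 2" 1] by simp
  show ?thesis
    using *[of r] *[of "- r"] by (cases r "0::real" rule: linorder_cases) (auto simp: psi_def max_def)
qed

lemma abs_psi: "\<bar>psi s r\<bar> = \<bar>r\<bar> powr (s - 1)"
  by (cases r "0::real" rule: linorder_cases) (auto simp: psi_eq max_def)

lemma psi_mult_self: "s \<noteq> 0 \<Longrightarrow> psi s r * r = \<bar>r\<bar> powr s"
proof -
  assume "s \<noteq> 0"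
  have *: "a powr (s - 1) * a = a powr s" if "a > 0" for a :: real
    using that powr_add[of a "s - 1" 1] by simp
  show ?thesis
    using *[of r] *[of "- r"] \<open>s \<noteq> 0\<close>
    by (cases r "0::real" rule: linorder_cases) (auto simp: psi_eq max_def)
qed

lemma psi_mono: "1 < s \<Longrightarrow> a \<le> b \<Longrightarrow> psi s a \<le> psi s b"
  unfolding psi_eq by (intro diff_mono powr_mono2) auto

lemma continuous_on_psi: "1 < s \<Longrightarrow> continuous_on UNIV (psi s)"
  unfolding psi_eq[abs_def] by (intro continuous_intros continuous_on_powr') auto

lemma psi_measurable[measurable]: "psi s \<in> borel_measurable borel"
  unfolding psi_def[abs_def] by measurable

text \<open>Both factors are bounded by powers of max(|a|, |b|). The constant is crude on purpose:
  the inequality only provides integrable majorants.\<close>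

lemma psi_Young:
  assumes "1 < s" shows "\<bar>psi s a\<bar> * \<bar>b\<bar> \<le> \<bar>a\<bar> powr s + \<bar>b\<bar> powr s"
proof -
  have *: "c powr (s - 1) * c = c powr s" if "c \<ge> 0" for c :: real
    using that powr_add[of c "s - 1" 1] assms by (cases "c = 0") auto
  let ?c = "max \<bar>a\<bar> \<bar>b\<bar>"
  have "\<bar>psi s a\<bar> * \<bar>b\<bar> \<le> ?c powr (s - 1) * ?c"
    unfolding abs_psi using assms by (intro mult_mono powr_mono2) auto
  also have "\<dots> = ?c powr s" by (rule *) auto
  also have "\<dots> \<le> \<bar>a\<bar> powr s + \<bar>b\<bar> powr s" by (auto simp: max_def)
  finally show ?thesis .
qed

text \<open>Young's inequality with exponents s and s/(s-1) for |a| |b|^(s-1). It is the gradient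
  inequality for |.|^s, with the gradient taken at \<open>b\<close>.\<close>

lemma psi_gradient:
  assumes s: "1 < s" shows "\<bar>b\<bar> powr s - \<bar>a\<bar> powr s \<le> s * psi s b * (b - a)"
proof -
  have "\<bar>a\<bar> * \<bar>b\<bar> powr (s - 1) \<le> \<bar>a\<bar> powr s / s + (\<bar>b\<bar> powr (s - 1)) powr (s / (s - 1)) / (s / (s - 1))"
    using s by (intro Youngs_inequality) (auto simp: field_simps)
  also have "(\<bar>b\<bar> powr (s - 1)) powr (s / (s - 1)) = \<bar>b\<bar> powr s"
    using s by (simp add: powr_powr)
  finally have "s * (\<bar>a\<bar> * \<bar>b\<bar> powr (s - 1)) \<le> s * (\<bar>a\<bar> powr s / s + \<bar>b\<bar> powr s / (s / (s - 1)))"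
    using s by (intro mult_left_mono) auto
  also have "\<dots> = \<bar>a\<bar> powr s + (s - 1) * \<bar>b\<bar> powr s" using s by (simp add: field_simps)
  finally have "s * (\<bar>psi s b\<bar> * \<bar>a\<bar>) \<le> \<bar>a\<bar> powr s + (s - 1) * \<bar>b\<bar> powr s"
    by (simp add: abs_psi mult.commute)
  moreover have "s * (psi s b * a) \<le> s * (\<bar>psi s b\<bar> * \<bar>a\<bar>)"
    using s by (intro mult_left_mono) (auto simp flip: abs_mult)
  ultimately have "s * (psi s b * a) \<le> \<bar>a\<bar> powr s + (s - 1) * \<bar>b\<bar> powr s" by linarith
  moreover have "psi s b * b = \<bar>b\<bar> powr s" using s by (intro psi_mult_self) auto
  ultimately show ?thesis by (simp add: algebra_simps)
qed

text \<open>The gradient inequalities at the intermediate point, against both ends, are averaged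
  with the weights 1 - \<theta> and \<theta>; the linear terms cancel.\<close>

lemma abs_powr_convex:
  fixes s :: real
  assumes s: "1 < s" and \<theta>: "0 \<le> \<theta>" "\<theta> \<le> 1"
  shows "\<bar>(1 - \<theta>) * a + \<theta> * b\<bar> powr s \<le> (1 - \<theta>) * \<bar>a\<bar> powr s + \<theta> * \<bar>b\<bar> powr s"
proof -
  let ?c = "(1 - \<theta>) * a + \<theta> * b"
  have "(1 - \<theta>) * (\<bar>?c\<bar> powr s - \<bar>a\<bar> powr s) + \<theta> * (\<bar>?c\<bar> powr s - \<bar>b\<bar> powr s)
      \<le> (1 - \<theta>) * (s * psi s ?c * (?c - a)) + \<theta> * (s * psi s ?c * (?c - b))"
    using \<theta> by (intro add_mono mult_left_mono psi_gradient s) auto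
  also have "\<dots> = 0" by (simp add: algebra_simps)
  finally show ?thesis by (simp add: algebra_simps)
qed

lemma abs_add_powr:
  fixes a b s :: real
  assumes "0 \<le> s" shows "\<bar>a + b\<bar> powr s \<le> 2 powr s * (\<bar>a\<bar> powr s + \<bar>b\<bar> powr s)"
proof -
  let ?c = "max \<bar>a\<bar> \<bar>b\<bar>"
  have "\<bar>a + b\<bar> powr s \<le> (2 * ?c) powr s" using assms by (intro powr_mono2) auto
  also have "\<dots> = 2 powr s * ?c powr s" by (simp add: powr_mult)
  also have "\<dots> \<le> 2 powr s * (\<bar>a\<bar> powr s + \<bar>b\<bar> powr s)"
    by (intro mult_left_mono) (auto simp: max_def)
  finally show ?thesis .
qed

text \<open>A chain rule inequality for absolutely continuous curves: on a partition, the gradient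
  inequality is applied at the later endpoint of every cell, and the mesh is sent to zero.\<close>

lemma convex_chain_rule:
  fixes y v :: "real \<Rightarrow> 'e::euclidean_space" and \<Theta> :: "'e \<Rightarrow> real" and G :: "'e \<Rightarrow> 'e"
  assumes st: "s \<le> t" and v: "set_integrable lborel {s..t} v"
    and y: "\<And>r. r \<in> {s..t} \<Longrightarrow> y r = y s + (LINT \<tau>:{s..r}|lborel. v \<tau>)"
    and D: "\<And>r. r \<in> {s..t} \<Longrightarrow> y r \<in> D"
    and G: "continuous_on D G"
    and grad: "\<And>a b. a \<in> D \<Longrightarrow> b \<in> D \<Longrightarrow> \<Theta> b - \<Theta> a \<le> G b \<bullet> (b - a)"
  shows "set_integrable lborel {s..t} (\<lambda>\<tau>. G (y \<tau>) \<bullet> v \<tau>)"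
    and "\<Theta> (y t) - \<Theta> (y s) \<le> (LINT \<tau>:{s..t}|lborel. G (y \<tau>) \<bullet> v \<tau>)"
proof -
  have sub: "set_integrable lborel {s..r} v" if "r \<in> {s..t}" for r
    using v by (rule set_integrable_subset) (use that in auto)
  have yint: "y r = y s + integral {s..r} v" if "r \<in> {s..t}" for r
    using y[OF that] set_borel_integral_eq_integral(2)[OF sub[OF that]] by simp
  have vint: "v integrable_on {s..t}" using set_borel_integral_eq_integral(1)[OF v] .
  have "continuous_on {s..t} (\<lambda>r. y s + integral {s..r} v)"
    by (intro continuous_intros indefinite_integral_continuous_1 vint)
  then have cy: "continuous_on {s..t} y" by (subst continuous_on_cong[OF refl yint]) auto
  have cGy: "continuous_on {s..t} (\<lambda>r. G (y r))"
    by (rule continuous_on_compose2[OF G cy]) (use D in auto)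
  \<comment> \<open>Extension of the continuous function \<open>G (y r)\<close> by zero, which is
    Borel on the whole line and can be composed with measurable time changes.\<close>
  define H where "H r = indicator {s..t} r *\<^sub>R G (y r)" for r
  have Hm[measurable]: "H \<in> borel_measurable lborel"
    unfolding H_def using borel_measurable_continuous_on_indicator[OF _ cGy] by simp
  have "bounded ((\<lambda>r. G (y r)) ` {s..t})"
    by (intro compact_imp_bounded compact_continuous_image cGy) auto
  then obtain B where B: "\<And>r. r \<in> {s..t} \<Longrightarrow> norm (G (y r)) \<le> B"
    unfolding bounded_iff by blast
  have B0: "0 \<le> B" by (rule order_trans[OF norm_ge_zero B[of s]]) (use st in auto)
  have vm[measurable]: "(\<lambda>\<tau>. indicator {s..t} \<tau> *\<^sub>R v \<tau>) \<in> borel_measurable lborel"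
    using v unfolding set_integrable_def by measurable
  have dom: "integrable lborel (\<lambda>\<tau>. B * norm (indicator {s..t} \<tau> *\<^sub>R v \<tau>))"
    using v unfolding set_integrable_def by (intro integrable_mult_right integrable_norm)
  \<comment> \<open>Stated for an arbitrary measurable time change \<open>\<rho>\<close>, so that it
    serves both for the limit (the identity) and for the Riemann-type sums.\<close>
  have int_gen: "set_integrable lborel {s..t} (\<lambda>\<tau>. H (\<rho> \<tau>) \<bullet> v \<tau>)"
    if [measurable]: "\<rho> \<in> borel_measurable lborel" and "\<And>\<tau>. \<tau> \<in> {s..t} \<Longrightarrow> \<rho> \<tau> \<in> {s..t}" for \<rho>
    unfolding set_integrable_def
  proof (rule Bochner_Integration.integrable_bound[OF dom])
    have "(\<lambda>\<tau>. H (\<rho> \<tau>) \<bullet> (indicator {s..t} \<tau> *\<^sub>R v \<tau>)) \<in> borel_measurable lborel"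
      by measurable
    then show "(\<lambda>\<tau>. indicator {s..t} \<tau> *\<^sub>R (H (\<rho> \<tau>) \<bullet> v \<tau>)) \<in> borel_measurable lborel"
      by (simp add: mult.commute)
    show "AE \<tau> in lborel. norm (indicator {s..t} \<tau> *\<^sub>R (H (\<rho> \<tau>) \<bullet> v \<tau>))
        \<le> norm (B * norm (indicator {s..t} \<tau> *\<^sub>R v \<tau>))"
    proof (rule AE_I2)
      fix \<tau>
      show "norm (indicator {s..t} \<tau> *\<^sub>R (H (\<rho> \<tau>) \<bullet> v \<tau>)) \<le> norm (B * norm (indicator {s..t} \<tau> *\<^sub>R v \<tau>))"
      proof (cases "\<tau> \<in> {s..t}")
        case True
        then have "norm (H (\<rho> \<tau>)) \<le> B" using that(2) B B0 by (auto simp: H_def indicator_def)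
        then have "norm (H (\<rho> \<tau>)) * norm (v \<tau>) \<le> B * norm (v \<tau>)" by (intro mult_right_mono) auto
        moreover have "\<bar>H (\<rho> \<tau>) \<bullet> v \<tau>\<bar> \<le> norm (H (\<rho> \<tau>)) * norm (v \<tau>)" by (rule Cauchy_Schwarz_ineq2)
        ultimately show ?thesis using True B0 by simp
      qed simp
    qed
  qed
  have "set_integrable lborel {s..t} (\<lambda>\<tau>. H \<tau> \<bullet> v \<tau>)" by (rule int_gen[where \<rho>="\<lambda>\<tau>. \<tau>"]) auto
  then show intG: "set_integrable lborel {s..t} (\<lambda>\<tau>. G (y \<tau>) \<bullet> v \<tau>)"
    by (rule set_integrable_cong[THEN iffD1, rotated -1]) (auto simp: H_def)
  show "\<Theta> (y t) - \<Theta> (y s) \<le> (LINT \<tau>:{s..t}|lborel. G (y \<tau>) \<bullet> v \<tau>)"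
  proof (cases "s = t")
    case True
    then show ?thesis using set_borel_integral_eq_integral(2)[OF intG] by simp
  next
    case False
    then have st': "s < t" using st by simp
    define \<delta> where "\<delta> N = (t - s) / real (Suc N)" for N
    have \<delta>: "\<delta> N > 0" for N using st' by (simp add: \<delta>_def)
    \<comment> \<open>The right endpoint of the partition cell containing \<tau>. The minimum with t
      keeps the value inside the interval.\<close>
    define \<rho> where "\<rho> N \<tau> = min t (s + \<delta> N * of_int \<lceil>(\<tau> - s) / \<delta> N\<rceil>)" for N \<tau>
    have \<rho>_meas[measurable]: "\<rho> N \<in> borel_measurable lborel" for N unfolding \<rho>_def by measurable
    have \<rho>_ge: "\<tau> \<le> \<rho> N \<tau>" and \<rho>_le: "\<rho> N \<tau> \<le> \<tau> + \<delta> N" if "\<tau> \<in> {s..t}" for N \<tau>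
    proof -
      have "(\<tau> - s) / \<delta> N \<le> of_int \<lceil>(\<tau> - s) / \<delta> N\<rceil>" "of_int \<lceil>(\<tau> - s) / \<delta> N\<rceil> \<le> (\<tau> - s) / \<delta> N + 1" by linarith+
      then have "\<delta> N * ((\<tau> - s) / \<delta> N) \<le> \<delta> N * of_int \<lceil>(\<tau> - s) / \<delta> N\<rceil>"
        "\<delta> N * of_int \<lceil>(\<tau> - s) / \<delta> N\<rceil> \<le> \<delta> N * ((\<tau> - s) / \<delta> N + 1)"
        using less_imp_le[OF \<delta>[of N]] by - (rule mult_left_mono; assumption)+
      moreover have "\<delta> N * ((\<tau> - s) / \<delta> N) = \<tau> - s" using \<delta>[of N] by simp
      ultimately have "\<tau> - s \<le> \<delta> N * of_int \<lceil>(\<tau> - s) / \<delta> N\<rceil>"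
        "\<delta> N * of_int \<lceil>(\<tau> - s) / \<delta> N\<rceil> \<le> \<tau> - s + \<delta> N"
        by (simp_all only: distrib_left mult_1_right)
      then show "\<tau> \<le> \<rho> N \<tau>" "\<rho> N \<tau> \<le> \<tau> + \<delta> N"
        using \<delta>[of N] that by (auto simp: \<rho>_def min_def)
    qed
    have \<rho>_mem: "\<rho> N \<tau> \<in> {s..t}" if "\<tau> \<in> {s..t}" for N \<tau>
      using \<rho>_ge[OF that, of N] that by (auto simp: \<rho>_def)
    note int\<rho> = int_gen[OF \<rho>_meas \<rho>_mem]
    have key: "\<Theta> (y t) - \<Theta> (y s) \<le> (LINT \<tau>:{s..t}|lborel. H (\<rho> N \<tau>) \<bullet> v \<tau>)" for N
    proof -
      let ?f = "\<lambda>\<tau>. H (\<rho> N \<tau>) \<bullet> v \<tau>"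
      define ti where "ti i = s + \<delta> N * real i" for i
      have ti_mem: "ti i \<in> {s..t}" if "i \<le> Suc N" for i
      proof -
        have "\<delta> N * real i \<le> \<delta> N * real (Suc N)" using that \<delta>[of N] by (intro mult_left_mono) auto
        also have "\<dots> = t - s" by (simp add: \<delta>_def)
        finally show ?thesis using \<delta>[of N] by (auto simp: ti_def)
      qed
      have fint: "?f integrable_on {s..t}" using set_borel_integral_eq_integral(1)[OF int\<rho>] .
      have "\<Theta> (y (ti i)) - \<Theta> (y s) \<le> integral {s..ti i} ?f" if "i \<le> Suc N" for i
        using that
      proof (induction i)
        case 0
        then show ?case by (simp add: ti_def)
      next
        case (Suc i)
        let ?a = "ti i" and ?b = "ti (Suc i)"
        have ab: "?a < ?b" using \<delta>[of N] by (simp add: ti_def)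
        have a: "?a \<in> {s..t}" and b: "?b \<in> {s..t}" using Suc ti_mem[of i] ti_mem[of "Suc i"] by auto
        have "integral {?a..?b} ?f = integral {?a..?b} (\<lambda>\<tau>. G (y ?b) \<bullet> v \<tau>)"
        \<comment> \<open>The left endpoint has to be removed: the ceiling assigns it to the
          preceding cell. On the rest the gradient is frozen at \<open>?b\<close> and can be pulled
          out of the integral.\<close>
        proof (rule integral_spike[of "{?a}"])
          fix \<tau> assume \<tau>: "\<tau> \<in> {?a..?b} - {?a}"
          then have "real i < (\<tau> - s) / \<delta> N" "(\<tau> - s) / \<delta> N \<le> real (Suc i)"
            using \<delta>[of N] by (auto simp: ti_def field_simps)
          then have "\<lceil>(\<tau> - s) / \<delta> N\<rceil> = int (Suc i)" by (intro ceiling_unique) auto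
          then have "\<rho> N \<tau> = ?b" using b by (simp add: \<rho>_def ti_def)
          then show "G (y ?b) \<bullet> v \<tau> = ?f \<tau>" using b by (simp add: H_def)
        qed simp
        also have "\<dots> = G (y ?b) \<bullet> integral {?a..?b} v"
          by (rule integral_linear[OF _ bounded_linear_inner_right, unfolded o_def])
             (rule integrable_on_subinterval[OF vint], use a b in auto)
        also have "integral {?a..?b} v = y ?b - y ?a"
          using Henstock_Kurzweil_Integration.integral_combine[of s ?a ?b v] yint[OF a] yint[OF b] a b ab
            integrable_on_subinterval[OF vint, of s ?b] by (auto simp: eq_diff_eq add.commute)
        finally have "\<Theta> (y ?b) - \<Theta> (y ?a) \<le> integral {?a..?b} ?f"
          using grad[OF D[OF a] D[OF b]] by simp
        moreover have "integral {s..?a} ?f + integral {?a..?b} ?f = integral {s..?b} ?f"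
          using a b ab by (intro Henstock_Kurzweil_Integration.integral_combine
              integrable_on_subinterval[OF fint]) auto
        ultimately show ?case using Suc by auto
      qed
      from this[of "Suc N"] have "\<Theta> (y t) - \<Theta> (y s) \<le> integral {s..t} ?f"
        by (simp add: ti_def \<delta>_def)
      then show ?thesis using set_borel_integral_eq_integral(2)[OF int\<rho>, of N] by simp
    qed
    have "(\<lambda>N. LINT \<tau>:{s..t}|lborel. H (\<rho> N \<tau>) \<bullet> v \<tau>) \<longlonglongrightarrow> (LINT \<tau>:{s..t}|lborel. H \<tau> \<bullet> v \<tau>)"
      unfolding set_lebesgue_integral_def
    proof (rule integral_dominated_convergence[OF _ _ dom])
      show "(\<lambda>\<tau>. indicator {s..t} \<tau> *\<^sub>R (H \<tau> \<bullet> v \<tau>)) \<in> borel_measurable lborel"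
        using int_gen[where \<rho>="\<lambda>\<tau>. \<tau>"] unfolding set_integrable_def by auto
      show "(\<lambda>\<tau>. indicator {s..t} \<tau> *\<^sub>R (H (\<rho> N \<tau>) \<bullet> v \<tau>)) \<in> borel_measurable lborel" for N
        using int\<rho>[of N] unfolding set_integrable_def by auto
      have "\<delta> \<longlonglongrightarrow> 0"
        unfolding \<delta>_def by (rule real_tendsto_divide_at_top[OF tendsto_const])
          (rule filterlim_compose[OF filterlim_real_sequentially filterlim_Suc])
      then have \<rho>_lim: "(\<lambda>N. \<rho> N \<tau>) \<longlonglongrightarrow> \<tau>" if "\<tau> \<in> {s..t}" for \<tau>
      proof (intro tendsto_sandwich[of "\<lambda>_. \<tau>" "\<lambda>N. \<rho> N \<tau>" sequentially "\<lambda>N. \<tau> + \<delta> N"])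
        show "(\<lambda>N. \<tau> + \<delta> N) \<longlonglongrightarrow> \<tau>" using tendsto_add[OF tendsto_const \<open>\<delta> \<longlonglongrightarrow> 0\<close>, of \<tau>] by simp
      qed (use \<rho>_ge[OF that] \<rho>_le[OF that] in auto)
      show "AE \<tau> in lborel. (\<lambda>N. indicator {s..t} \<tau> *\<^sub>R (H (\<rho> N \<tau>) \<bullet> v \<tau>))
          \<longlonglongrightarrow> indicator {s..t} \<tau> *\<^sub>R (H \<tau> \<bullet> v \<tau>)"
      proof (rule AE_I2)
        fix \<tau>
        show "(\<lambda>N. indicator {s..t} \<tau> *\<^sub>R (H (\<rho> N \<tau>) \<bullet> v \<tau>)) \<longlonglongrightarrow> indicator {s..t} \<tau> *\<^sub>R (H \<tau> \<bullet> v \<tau>)"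
        proof (cases "\<tau> \<in> {s..t}")
          case True
          have "(\<lambda>N. G (y (\<rho> N \<tau>))) \<longlonglongrightarrow> G (y \<tau>)"
            by (rule continuous_on_tendsto_compose[OF cGy \<rho>_lim[OF True] True]) (use \<rho>_mem[OF True] in auto)
          then have "(\<lambda>N. H (\<rho> N \<tau>)) \<longlonglongrightarrow> H \<tau>" using True \<rho>_mem[OF True] by (simp add: H_def)
          then show ?thesis by (intro tendsto_intros)
        qed simp
      qed
      show "AE \<tau> in lborel. norm (indicator {s..t} \<tau> *\<^sub>R (H (\<rho> N \<tau>) \<bullet> v \<tau>))
          \<le> B * norm (indicator {s..t} \<tau> *\<^sub>R v \<tau>)" for N
      proof (rule AE_I2)
        fix \<tau>
        show "norm (indicator {s..t} \<tau> *\<^sub>R (H (\<rho> N \<tau>) \<bullet> v \<tau>)) \<le> B * norm (indicator {s..t} \<tau> *\<^sub>R v \<tau>)"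
        proof (cases "\<tau> \<in> {s..t}")
          case True
          then have "norm (H (\<rho> N \<tau>)) \<le> B" using \<rho>_mem[OF True] B by (auto simp: H_def)
          then have "norm (H (\<rho> N \<tau>)) * norm (v \<tau>) \<le> B * norm (v \<tau>)" by (intro mult_right_mono) auto
          moreover have "\<bar>H (\<rho> N \<tau>) \<bullet> v \<tau>\<bar> \<le> norm (H (\<rho> N \<tau>)) * norm (v \<tau>)" by (rule Cauchy_Schwarz_ineq2)
          ultimately show ?thesis using True by simp
        qed simp
      qed
    qed
    then have "\<Theta> (y t) - \<Theta> (y s) \<le> (LINT \<tau>:{s..t}|lborel. H \<tau> \<bullet> v \<tau>)"
      by (rule LIMSEQ_le_const) (use key in auto)
    also have "\<dots> = (LINT \<tau>:{s..t}|lborel. G (y \<tau>) \<bullet> v \<tau>)"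
      by (rule set_lebesgue_integral_cong) (auto simp: H_def)
    finally show ?thesis .
  qed
qed

section \<open>The energy\<close>

lemma integrable_psi_mult:
  assumes s: "1 < s" and [measurable]: "F \<in> borel_measurable N" "G \<in> borel_measurable N"
    and "integrable N (\<lambda>z. \<bar>F z\<bar> powr s)" "integrable N (\<lambda>z. \<bar>G z\<bar> powr s)"
  shows "integrable N (\<lambda>z. psi s (F z) * G z)"
proof (rule Bochner_Integration.integrable_bound)
  show "integrable N (\<lambda>z. \<bar>F z\<bar> powr s + \<bar>G z\<bar> powr s)" using assms by simp
  show "AE z in N. norm (psi s (F z) * G z) \<le> norm (\<bar>F z\<bar> powr s + \<bar>G z\<bar> powr s)"
    using psi_Young[OF s] by (auto simp: abs_mult)
qed measurable

text \<open>Fatou's lemma on a two-point space with counting measure.\<close>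

lemma ennreal_liminf_add_le:
  fixes u v :: "nat \<Rightarrow> ennreal"
  shows "liminf u + liminf v \<le> liminf (\<lambda>n. u n + v n)"
  using nn_integral_liminf[of "\<lambda>n b. if b then u n else v n" "count_space (UNIV :: bool set)"]
  by (simp add: nn_integral_count_space_finite UNIV_bool add.commute)

lemma integrable_add_powr:
  fixes s :: real and F G :: "'b \<Rightarrow> real"
  assumes s: "0 \<le> s" and [measurable]: "F \<in> borel_measurable N" "G \<in> borel_measurable N"
    and "integrable N (\<lambda>z. \<bar>F z\<bar> powr s)" "integrable N (\<lambda>z. \<bar>G z\<bar> powr s)"
  shows "integrable N (\<lambda>z. \<bar>F z + G z\<bar> powr s)"
proof (rule Bochner_Integration.integrable_bound)
  show "integrable N (\<lambda>z. 2 powr s * (\<bar>F z\<bar> powr s + \<bar>G z\<bar> powr s))" using assms by simp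
  show "AE z in N. norm (\<bar>F z + G z\<bar> powr s) \<le> norm (2 powr s * (\<bar>F z\<bar> powr s + \<bar>G z\<bar> powr s))"
    using abs_add_powr[OF s] by auto
qed measurable

context reversible_kernel
begin

lemma sLap_rel_iff:
  "sLap_rel m \<nu> s u w \<longleftrightarrow> memL2 \<nu> u \<and> memL2 \<nu> w \<and> integrable (edge m \<nu>) (\<lambda>z. \<bar>grad u z\<bar> powr s) \<and>
     (AE x in \<nu>. w x = (\<integral>y. psi s (u y - u x) \<partial>m x))"
proof (cases "memL2 \<nu> u")
  case True
  then have [measurable]: "u \<in> borel_measurable \<nu>" by (rule memL2_measurable)
  have "integrable (edge m \<nu>) (\<lambda>z. \<bar>grad u z\<bar> powr s) \<longleftrightarrow> (\<integral>\<^sup>+z. ennreal (\<bar>grad u z\<bar> powr s) \<partial>edge m \<nu>) < \<infinity>"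
    by (simp add: integrable_iff_bounded)
  also have "(\<integral>\<^sup>+z. ennreal (\<bar>grad u z\<bar> powr s) \<partial>edge m \<nu>) = (\<integral>\<^sup>+x. \<integral>\<^sup>+y. ennreal (\<bar>u y - u x\<bar> powr s) \<partial>m x \<partial>\<nu>)"
    by (subst nn_integral_edge) (auto simp: grad_def)
  finally show ?thesis unfolding sLap_rel_def psi_def by auto
qed (auto simp: sLap_rel_def)

text \<open>Weak form of the s-Laplacian: the flux \<open>psi s (grad u)\<close> is antisymmetric
  under the swap, and Young's inequality makes its product with a test function in L^s integrable
  over the edges.\<close>

lemma integral_psi_grad_fst:
  assumes s: "1 < s" and [measurable]: "u \<in> borel_measurable \<nu>" "\<phi> \<in> borel_measurable \<nu>"
    and u: "integrable (edge m \<nu>) (\<lambda>z. \<bar>grad u z\<bar> powr s)" and \<phi>: "integrable \<nu> (\<lambda>x. \<bar>\<phi> x\<bar> powr s)"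
  shows "integrable (edge m \<nu>) (\<lambda>z. psi s (grad u z) * grad \<phi> z)"
    and "integrable \<nu> (\<lambda>x. \<phi> x * (\<integral>y. psi s (u y - u x) \<partial>m x))"
    and "(\<integral>z. psi s (grad u z) * grad \<phi> z \<partial>edge m \<nu>) = - 2 * (\<integral>x. \<phi> x * (\<integral>y. psi s (u y - u x) \<partial>m x) \<partial>\<nu>)"
proof -
  have i: "integrable (edge m \<nu>) (\<lambda>z. psi s (grad u z) * \<phi> (fst z))"
    by (rule integrable_psi_mult[OF s _ _ u]) (use integrable_edge_fst[OF \<phi>] in auto)
  have anti: "psi s (grad u (prod.swap z)) = - psi s (grad u z)" for z
    by (simp add: grad_def psi_def abs_minus_commute algebra_simps)
  note parts = integral_by_parts[where \<Phi>="\<lambda>z. psi s (grad u z)", OF _ _ anti i]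
  show "integrable (edge m \<nu>) (\<lambda>z. psi s (grad u z) * grad \<phi> z)" by (rule parts(1)) auto
  have eq: "(\<integral>y. psi s (grad u (x, y)) * \<phi> (fst (x, y)) \<partial>m x) = \<phi> x * (\<integral>y. psi s (u y - u x) \<partial>m x)" for x
    by (simp add: grad_def mult.commute)
  show "integrable \<nu> (\<lambda>x. \<phi> x * (\<integral>y. psi s (u y - u x) \<partial>m x))"
    using integral_edge(2)[OF i] unfolding eq .
  show "(\<integral>z. psi s (grad u z) * grad \<phi> z \<partial>edge m \<nu>) = - 2 * (\<integral>x. \<phi> x * (\<integral>y. psi s (u y - u x) \<partial>m x) \<partial>\<nu>)"
    using parts(2) integral_edge(3)[OF i] unfolding eq by simp
qed

lemma integrable_grad_powr:
  assumes s: "0 \<le> s" and [measurable]: "\<phi> \<in> borel_measurable \<nu>" and \<phi>: "integrable \<nu> (\<lambda>x. \<bar>\<phi> x\<bar> powr s)"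
  shows "integrable (edge m \<nu>) (\<lambda>z. \<bar>grad \<phi> z\<bar> powr s)"
  using integrable_add_powr[OF s, of "\<lambda>z. \<phi> (snd z)" "edge m \<nu>" "\<lambda>z. - \<phi> (fst z)"]
    integrable_edge_fst[OF \<phi>] integrable_edge_snd[OF \<phi>]
  by (simp add: grad_def)

lemma AE_edge_lim_grad:
  assumes "AE x in \<nu>. (\<lambda>k. h k x) \<longlonglongrightarrow> G x"
  shows "AE z in edge m \<nu>. (\<lambda>k. grad (h k) z) \<longlonglongrightarrow> grad G z"
  using AE_edge_fst[OF assms] AE_edge_snd[OF assms]
  by eventually_elim (auto simp: grad_def intro!: tendsto_diff)

end

text \<open>The two-sided bound on \<open>\<mu>\<close> makes \<open>\<nu>1\<close> and
  \<open>\<nu>2\<close> comparable: they have the same null sets and the same integrable functions.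
  All assumptions survive multiplication of the space by a bounded time interval, and the locale is
  instantiated a second time there.\<close>

locale plap_space =
  K1: reversible_kernel m1 \<nu>1 + K2: reversible_kernel m2 \<nu>2 + S1: sigma_finite_measure \<nu>1
  for m1 :: "'a \<Rightarrow> 'a measure" and \<nu>1 and m2 :: "'a \<Rightarrow> 'a measure" and \<nu>2 +
  fixes \<mu> :: "'a \<Rightarrow> real" and c C p q :: real
  assumes q: "1 < q" "q \<le> 2" and p: "1 < p" and c: "0 < c"
    and mu_meas[measurable]: "\<mu> \<in> borel_measurable \<nu>1"
    and nu2: "\<nu>2 = density \<nu>1 (\<lambda>x. ennreal (\<mu> x))"
    and mu_bounds: "AE x in \<nu>1. c \<le> \<mu> x \<and> \<mu> x \<le> C"
    and fin: "emeasure \<nu>1 (space \<nu>1) < \<infinity> \<or> 2 \<le> p"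
begin

lemma sets_nu2[simp, measurable_cong]: "sets \<nu>2 = sets \<nu>1"
  by (simp add: nu2)

lemma space_nu2[simp]: "space \<nu>2 = space \<nu>1"
  by (simp add: nu2)

lemma measurable_nu2[simp]: "borel_measurable \<nu>2 = borel_measurable \<nu>1"
  by (rule measurable_cong_sets) auto

lemma AE_nu2_iff: "(AE x in \<nu>2. P x) \<longleftrightarrow> (AE x in \<nu>1. P x)"
proof -
  have "(AE x in \<nu>2. P x) \<longleftrightarrow> (AE x in \<nu>1. 0 < ennreal (\<mu> x) \<longrightarrow> P x)"
    unfolding nu2 by (rule AE_density) simp
  also have "\<dots> \<longleftrightarrow> (AE x in \<nu>1. P x)"
    by (rule eventually_subst, rule eventually_mono[OF mu_bounds]) (use c in auto)
  finally show ?thesis .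
qed

lemma integrable_nu2_iff:
  fixes f :: "'a \<Rightarrow> real"
  assumes [measurable]: "f \<in> borel_measurable \<nu>1"
  shows "integrable \<nu>2 f \<longleftrightarrow> integrable \<nu>1 f"
proof -
  have "integrable \<nu>2 f \<longleftrightarrow> integrable \<nu>1 (\<lambda>x. \<mu> x * f x)"
    unfolding nu2 using mu_bounds c
    by (subst integrable_density) (auto elim!: eventually_mono)
  also have "\<dots> \<longleftrightarrow> integrable \<nu>1 f"
  proof
    assume i: "integrable \<nu>1 (\<lambda>x. \<mu> x * f x)"
    show "integrable \<nu>1 f"
    proof (rule Bochner_Integration.integrable_bound)
      show "integrable \<nu>1 (\<lambda>x. 1 / c * (\<mu> x * f x))" using i by simp
      show "AE x in \<nu>1. norm (f x) \<le> norm (1 / c * (\<mu> x * f x))"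
        using mu_bounds
      proof eventually_elim
        case (elim x)
        then have "c * \<bar>f x\<bar> \<le> \<bar>\<mu> x\<bar> * \<bar>f x\<bar>" by (intro mult_right_mono) auto
        then show ?case using c by (simp add: abs_mult field_simps)
      qed
    qed simp
  next
    assume i: "integrable \<nu>1 f"
    show "integrable \<nu>1 (\<lambda>x. \<mu> x * f x)"
    proof (rule Bochner_Integration.integrable_bound)
      show "integrable \<nu>1 (\<lambda>x. C * f x)" using i by simp
      show "AE x in \<nu>1. norm (\<mu> x * f x) \<le> norm (C * f x)"
        using mu_bounds by eventually_elim (use c in \<open>auto simp: abs_mult intro!: mult_right_mono\<close>)
    qed simp
  qed
  finally show ?thesis .
qed

lemma integral_nu2:
  fixes f :: "'a \<Rightarrow> real"
  assumes [measurable]: "f \<in> borel_measurable \<nu>1"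
  shows "(\<integral>x. f x \<partial>\<nu>2) = (\<integral>x. \<mu> x * f x \<partial>\<nu>1)"
  unfolding nu2 using mu_bounds c
  by (subst integral_density) (auto elim!: eventually_mono)

lemma memL2_nu2_iff: "memL2 \<nu>2 u \<longleftrightarrow> memL2 \<nu>1 u"
  unfolding memL2_def by (auto simp: integrable_nu2_iff)

abbreviation "\<pi>1 \<equiv> edge m1 \<nu>1"
abbreviation "\<pi>2 \<equiv> edge m2 \<nu>2"

abbreviation "inH \<equiv> memL2 \<nu>1"
abbreviation "nH \<equiv> L2n \<nu>1"

definition dom :: "('a \<Rightarrow> real) \<Rightarrow> bool" where
  "dom u \<longleftrightarrow> inH u \<and> integrable \<pi>1 (\<lambda>z. \<bar>grad u z\<bar> powr q) \<and> integrable \<pi>2 (\<lambda>z. \<bar>grad u z\<bar> powr p)"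

text \<open>The additional 1/2 compensates for every pair of points being counted in both orders;
  with it the first variation is exactly minus the sum of the two Laplacians.\<close>

definition En :: "('a \<Rightarrow> real) \<Rightarrow> real" where
  "En u = (\<integral>z. \<bar>grad u z\<bar> powr q \<partial>\<pi>1) / (2 * q) + (\<integral>z. \<bar>grad u z\<bar> powr p \<partial>\<pi>2) / (2 * p)"

definition W1 :: "('a \<Rightarrow> real) \<Rightarrow> 'a \<Rightarrow> real" where
  "W1 u x = (\<integral>y. psi q (u y - u x) \<partial>m1 x)"

definition W2 :: "('a \<Rightarrow> real) \<Rightarrow> 'a \<Rightarrow> real" where
  "W2 u x = (\<integral>y. psi p (u y - u x) \<partial>m2 x)"

lemma dom_memL2: "dom u \<Longrightarrow> inH u" by (simp add: dom_def)

lemma dom_measurable[measurable_dest]: "dom u \<Longrightarrow> u \<in> borel_measurable \<nu>1"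
  using dom_memL2 memL2_measurable by blast

lemma W1_measurable[measurable]:
  assumes [measurable]: "u \<in> borel_measurable \<nu>1" shows "W1 u \<in> borel_measurable \<nu>1"
  using K1.kernel_integral_measurable[of "\<lambda>z. psi q (grad u z)"] by (simp add: W1_def[abs_def] grad_def)

lemma W2_measurable[measurable]:
  assumes [measurable]: "u \<in> borel_measurable \<nu>1" shows "W2 u \<in> borel_measurable \<nu>1"
proof -
  have "W2 u \<in> borel_measurable \<nu>2"
    using K2.kernel_integral_measurable[of "\<lambda>z. psi p (grad u z)"] by (simp add: W2_def[abs_def] grad_def)
  then show ?thesis by simp
qed

text \<open>The witnesses for the two Laplacians are determined a.e. by the kernel integrals, so the
  existential quantifiers can be traded for \<open>W1 u\<close> and \<open>W2 u\<close>. The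
  comparability of \<open>\<nu>1\<close> and \<open>\<nu>2\<close> brings everything to
  \<open>\<nu>1\<close>.\<close>

lemma A_rel_iff:
  "A_rel m1 \<nu>1 m2 \<nu>2 \<mu> p q u v \<longleftrightarrow> dom u \<and> inH v \<and> inH (W1 u) \<and> inH (W2 u) \<and>
     (AE x in \<nu>1. v x = - W1 u x - \<mu> x * W2 u x)" (is "?L \<longleftrightarrow> ?R")
proof
  assume ?L
  then obtain w1 w2 where *: "inH u" "inH v" "sLap_rel m1 \<nu>1 q u w1" "sLap_rel m2 \<nu>2 p u w2"
    "AE x in \<nu>1. v x = - w1 x - \<mu> x * w2 x" by (auto simp: A_rel_def)
  then have [measurable]: "u \<in> borel_measurable \<nu>1" by (simp add: memL2_def)
  have d: "dom u" and w: "inH w1" "inH w2"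
    using * by (auto simp: dom_def K1.sLap_rel_iff K2.sLap_rel_iff memL2_nu2_iff)
  have w1: "AE x in \<nu>1. W1 u x = w1 x" using *(3) by (auto simp: K1.sLap_rel_iff W1_def)
  have "AE x in \<nu>2. W2 u x = w2 x" using *(4) by (auto simp: K2.sLap_rel_iff W2_def)
  then have w2: "AE x in \<nu>1. W2 u x = w2 x" by (simp add: AE_nu2_iff)
  have "inH (W1 u)" "inH (W2 u)"
    by (rule memL2_cong_AE[OF w(1) _ w1], simp, rule memL2_cong_AE[OF w(2) _ w2], simp)
  moreover have "AE x in \<nu>1. v x = - W1 u x - \<mu> x * W2 u x"
    using *(5) w1 w2 by eventually_elim simp
  ultimately show ?R using d *(2) by auto
next
  assume R: ?R
  have "sLap_rel m1 \<nu>1 q u (W1 u)" "sLap_rel m2 \<nu>2 p u (W2 u)"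
    using R by (auto simp: K1.sLap_rel_iff K2.sLap_rel_iff W1_def W2_def dom_def memL2_nu2_iff)
  then show ?L using R unfolding A_rel_def by (auto simp: dom_def)
qed

lemma dom_zero[simp]: "dom (\<lambda>x. 0)"
  by (simp add: dom_def grad_def)

lemma En_zero[simp]: "En (\<lambda>x. 0) = 0"
  by (simp add: En_def grad_def)

lemma En_nonneg: "0 \<le> En u"
  using q p by (auto simp: En_def)

lemma dom_scale:
  assumes "dom u" shows "dom (\<lambda>x. k * u x)"
proof -
  have "\<bar>grad (\<lambda>x. k * u x) z\<bar> powr s = \<bar>k\<bar> powr s * \<bar>grad u z\<bar> powr s" for z s
    by (simp add: grad_def powr_mult[symmetric] flip: abs_mult right_diff_distrib)
  then show ?thesis using assms by (auto simp: dom_def)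
qed

lemma dom_add:
  assumes "dom u" "dom v" shows "dom (\<lambda>x. u x + v x)"
proof -
  note [measurable] = dom_measurable[OF assms(1)] dom_measurable[OF assms(2)]
  have eq: "grad (\<lambda>x. u x + v x) z = grad u z + grad v z" for z by (simp add: grad_def)
  show ?thesis
    unfolding dom_def eq using assms q p
    by (intro conjI memL2_add integrable_add_powr) (auto simp: dom_def)
qed

text \<open>Source of test functions: a bounded function supported in a set of finite measure lies
  in every L^s, whatever the growth exponents p and q are.\<close>

lemma dom_finite_support:
  assumes m[measurable]: "\<phi> \<in> borel_measurable \<nu>1" and "\<And>x. \<bar>\<phi> x\<bar> \<le> K"
    and B: "B \<in> sets \<nu>1" "emeasure \<nu>1 B < \<infinity>" "\<And>x. x \<in> space \<nu>1 \<Longrightarrow> x \<notin> B \<Longrightarrow> \<phi> x = 0"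
  shows "dom \<phi>" and "\<And>s. 0 < s \<Longrightarrow> integrable \<nu>1 (\<lambda>x. \<bar>\<phi> x\<bar> powr s)"
proof -
  have i: "integrable \<nu>1 (\<lambda>x. \<bar>\<phi> x\<bar> powr s)" if "0 < s" for s
  proof (rule Bochner_Integration.integrable_bound)
    show "integrable \<nu>1 (\<lambda>x. K powr s * indicator B x)" using B by simp
    show "AE x in \<nu>1. norm (\<bar>\<phi> x\<bar> powr s) \<le> norm (K powr s * indicator B x)"
      using B(3) assms(2) that by (auto intro!: AE_I2 powr_mono2 split: split_indicator)
  qed simp
  show "\<And>s. 0 < s \<Longrightarrow> integrable \<nu>1 (\<lambda>x. \<bar>\<phi> x\<bar> powr s)" by (rule i)
  have "inH \<phi>" using i[of 2] by (simp add: memL2_def)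
  then show "dom \<phi>"
    unfolding dom_def using q p by (auto intro!: K1.integrable_grad_powr K2.integrable_grad_powr i simp: integrable_nu2_iff)
qed

lemma En_convex:
  assumes "dom u" "dom v" and \<theta>: "0 \<le> \<theta>" "\<theta> \<le> 1"
  shows "dom (\<lambda>x. (1 - \<theta>) * u x + \<theta> * v x)"
    and "En (\<lambda>x. (1 - \<theta>) * u x + \<theta> * v x) \<le> (1 - \<theta>) * En u + \<theta> * En v"
proof -
  let ?w = "\<lambda>x. (1 - \<theta>) * u x + \<theta> * v x"
  show d: "dom ?w" by (intro dom_add dom_scale assms)
  have eq: "grad ?w z = (1 - \<theta>) * grad u z + \<theta> * grad v z" for z by (simp add: grad_def algebra_simps)
  have "(\<integral>z. \<bar>grad ?w z\<bar> powr q \<partial>\<pi>1) \<le> (\<integral>z. (1 - \<theta>) * \<bar>grad u z\<bar> powr q + \<theta> * \<bar>grad v z\<bar> powr q \<partial>\<pi>1)"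
    using assms d abs_powr_convex[OF q(1) \<theta>]
    by (intro integral_mono) (auto simp: dom_def eq)
  also have "\<dots> = (1 - \<theta>) * (\<integral>z. \<bar>grad u z\<bar> powr q \<partial>\<pi>1) + \<theta> * (\<integral>z. \<bar>grad v z\<bar> powr q \<partial>\<pi>1)"
    using assms by (simp add: dom_def)
  finally have 1: "(\<integral>z. \<bar>grad ?w z\<bar> powr q \<partial>\<pi>1) / (2 * q) \<le> ((1 - \<theta>) * (\<integral>z. \<bar>grad u z\<bar> powr q \<partial>\<pi>1) + \<theta> * (\<integral>z. \<bar>grad v z\<bar> powr q \<partial>\<pi>1)) / (2 * q)"
    using q by (intro divide_right_mono) auto
  have "(\<integral>z. \<bar>grad ?w z\<bar> powr p \<partial>\<pi>2) \<le> (\<integral>z. (1 - \<theta>) * \<bar>grad u z\<bar> powr p + \<theta> * \<bar>grad v z\<bar> powr p \<partial>\<pi>2)"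
    using assms d abs_powr_convex[OF p \<theta>]
    by (intro integral_mono) (auto simp: dom_def eq)
  also have "\<dots> = (1 - \<theta>) * (\<integral>z. \<bar>grad u z\<bar> powr p \<partial>\<pi>2) + \<theta> * (\<integral>z. \<bar>grad v z\<bar> powr p \<partial>\<pi>2)"
    using assms by (simp add: dom_def)
  finally have 2: "(\<integral>z. \<bar>grad ?w z\<bar> powr p \<partial>\<pi>2) / (2 * p) \<le> ((1 - \<theta>) * (\<integral>z. \<bar>grad u z\<bar> powr p \<partial>\<pi>2) + \<theta> * (\<integral>z. \<bar>grad v z\<bar> powr p \<partial>\<pi>2)) / (2 * p)"
    using p by (intro divide_right_mono) auto
  show "En ?w \<le> (1 - \<theta>) * En u + \<theta> * En v"
    using add_mono[OF 1 2] by (simp add: En_def add_divide_distrib distrib_left)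
qed

text \<open>Fatou on each edge measure, combined by superadditivity of the lower limit. The bound is
  a convergent sequence and not a constant, because along a minimizing sequence the energy is known
  only up to a distance term that converges.\<close>

lemma En_lsc:
  assumes d: "\<And>k. dom (h k)" and G: "inH G" and lim: "AE x in \<nu>1. (\<lambda>k. h k x) \<longlonglongrightarrow> G x"
    and le: "\<And>k. En (h k) \<le> e k" and e: "e \<longlonglongrightarrow> E"
  shows "dom G" "En G \<le> E"
proof -
  have [measurable]: "\<And>k. h k \<in> borel_measurable \<nu>1" "G \<in> borel_measurable \<nu>1"
    using d G by (auto dest: dom_measurable memL2_measurable)
  have gen: "(\<integral>\<^sup>+z. ennreal (\<bar>grad G z\<bar> powr s / (2 * s)) \<partial>N)
      \<le> liminf (\<lambda>k. \<integral>\<^sup>+z. ennreal (\<bar>grad (h k) z\<bar> powr s / (2 * s)) \<partial>N)"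
    if "1 < s" and [measurable]: "\<And>k. grad (h k) \<in> borel_measurable N" "grad G \<in> borel_measurable N"
      and l: "AE z in N. (\<lambda>k. grad (h k) z) \<longlonglongrightarrow> grad G z" for s and N
  proof -
    have "(\<integral>\<^sup>+z. ennreal (\<bar>grad G z\<bar> powr s / (2 * s)) \<partial>N)
        = (\<integral>\<^sup>+z. liminf (\<lambda>k. ennreal (\<bar>grad (h k) z\<bar> powr s / (2 * s))) \<partial>N)"
    proof (rule nn_integral_cong_AE)
      show "AE z in N. ennreal (\<bar>grad G z\<bar> powr s / (2 * s)) = liminf (\<lambda>k. ennreal (\<bar>grad (h k) z\<bar> powr s / (2 * s)))"
        using l
      proof eventually_elim
        case (elim z)
        then have "(\<lambda>k. ennreal (\<bar>grad (h k) z\<bar> powr s / (2 * s))) \<longlonglongrightarrow> ennreal (\<bar>grad G z\<bar> powr s / (2 * s))"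
          using that(1) by (intro tendsto_ennrealI tendsto_divide tendsto_powr' tendsto_rabs tendsto_const) auto
        then show ?case by (intro lim_imp_Liminf[symmetric]) auto
      qed
    qed
    also have "\<dots> \<le> liminf (\<lambda>k. \<integral>\<^sup>+z. ennreal (\<bar>grad (h k) z\<bar> powr s / (2 * s)) \<partial>N)"
      by (rule nn_integral_liminf) measurable
    finally show ?thesis .
  qed
  have lim2: "AE x in \<nu>2. (\<lambda>k. h k x) \<longlonglongrightarrow> G x" using lim by (simp add: AE_nu2_iff)
  let ?a = "\<lambda>u. \<integral>\<^sup>+z. ennreal (\<bar>grad u z\<bar> powr q / (2 * q)) \<partial>\<pi>1"
  let ?b = "\<lambda>u. \<integral>\<^sup>+z. ennreal (\<bar>grad u z\<bar> powr p / (2 * p)) \<partial>\<pi>2"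
  have m2: "u \<in> borel_measurable \<nu>1 \<Longrightarrow> grad u \<in> borel_measurable \<pi>2" for u
    using K2.grad_measurable[of u] by simp
  have m1: "u \<in> borel_measurable \<nu>1 \<Longrightarrow> grad u \<in> borel_measurable \<pi>1" for u
    using K1.grad_measurable[of u] by simp
  have "?a G + ?b G \<le> liminf (\<lambda>k. ?a (h k)) + liminf (\<lambda>k. ?b (h k))"
    using q p by (intro add_mono gen K1.AE_edge_lim_grad[OF lim] K2.AE_edge_lim_grad[OF lim2] m1 m2) auto
  also have "\<dots> \<le> liminf (\<lambda>k. ?a (h k) + ?b (h k))" by (rule ennreal_liminf_add_le)
  also have "\<dots> \<le> liminf (\<lambda>k. ennreal (e k))"
  proof (intro Liminf_mono always_eventually allI)
    fix k
    have "?a (h k) + ?b (h k) = ennreal (En (h k))"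
      unfolding En_def using d[of k] q p
      by (subst (1 2) nn_integral_eq_integral) (auto simp: dom_def)
    then show "?a (h k) + ?b (h k) \<le> ennreal (e k)" using le[of k] by (simp add: ennreal_leI)
  qed
  also have "\<dots> = ennreal E" by (intro lim_imp_Liminf tendsto_ennrealI e) auto
  finally have fin: "?a G + ?b G \<le> ennreal E" .
  then have f: "?a G < \<infinity>" "?b G < \<infinity>" by (auto simp: less_top[symmetric] top_unique)
  have "integrable \<pi>1 (\<lambda>z. \<bar>grad G z\<bar> powr q / (2 * q))" "integrable \<pi>2 (\<lambda>z. \<bar>grad G z\<bar> powr p / (2 * p))"
    using f q p m1[of G] m2[of G] by (auto intro!: integrableI_nonneg)
  from integrable_mult_right[OF this(1), of "2 * q"] integrable_mult_right[OF this(2), of "2 * p"]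
  show dG: "dom G" using q p G by (simp add: dom_def)
  have "?a G + ?b G = ennreal (En G)"
    unfolding En_def using dG q p
    by (subst (1 2) nn_integral_eq_integral) (auto simp: dom_def)
  moreover have "0 \<le> E" using LIMSEQ_le_const[OF e, of 0] En_nonneg le order_trans by blast
  ultimately show "En G \<le> E" using fin by simp
qed

end

section \<open>Subgradients and the resolvent\<close>

lemma tendsto_L2n:
  assumes "\<And>k. memL2 \<nu> (g k)" "memL2 \<nu> G" "(\<lambda>k. L2n \<nu> (\<lambda>x. g k x - G x)) \<longlonglongrightarrow> 0"
  shows "(\<lambda>k. L2n \<nu> (g k)) \<longlonglongrightarrow> L2n \<nu> G"
proof (rule LIM_zero_cancel, rule Lim_null_comparison[OF _ assms(3)])
  have "\<bar>L2n \<nu> (g k) - L2n \<nu> G\<bar> \<le> L2n \<nu> (\<lambda>x. g k x - G x)" for k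
    using L2n_triangle_diff[OF assms(1)[of k] assms(2) memL2_0] L2n_triangle_diff[OF assms(2) assms(1)[of k] memL2_0]
      L2n_commute[of \<nu> G "g k"] by simp
  then show "\<forall>\<^sub>F k in sequentially. norm (L2n \<nu> (g k) - L2n \<nu> G) \<le> L2n \<nu> (\<lambda>x. g k x - G x)" by simp
qed

lemma tendsto_integral_mult_L2:
  assumes g: "\<And>k. memL2 \<nu> (g k)" "memL2 \<nu> G" "(\<lambda>k. L2n \<nu> (\<lambda>x. g k x - G x)) \<longlonglongrightarrow> 0"
    and f: "\<And>k. memL2 \<nu> (f k)" "memL2 \<nu> F" "(\<lambda>k. L2n \<nu> (\<lambda>x. f k x - F x)) \<longlonglongrightarrow> 0"
  shows "(\<lambda>k. \<integral>x. g k x * f k x \<partial>\<nu>) \<longlonglongrightarrow> (\<integral>x. G x * F x \<partial>\<nu>)"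
proof (rule LIM_zero_cancel, rule Lim_null_comparison)
  show "(\<lambda>k. L2n \<nu> (\<lambda>x. g k x - G x) * L2n \<nu> (f k) + L2n \<nu> G * L2n \<nu> (\<lambda>x. f k x - F x)) \<longlonglongrightarrow> 0"
    using tendsto_add[OF tendsto_mult[OF g(3) tendsto_L2n[OF f]] tendsto_mult[OF tendsto_const[of "L2n \<nu> G"] f(3)]]
    by simp
  show "\<forall>\<^sub>F k in sequentially. norm ((\<integral>x. g k x * f k x \<partial>\<nu>) - (\<integral>x. G x * F x \<partial>\<nu>))
      \<le> L2n \<nu> (\<lambda>x. g k x - G x) * L2n \<nu> (f k) + L2n \<nu> G * L2n \<nu> (\<lambda>x. f k x - F x)"
  proof (intro always_eventually allI)
    fix k
    note m = memL2_mult_integrable[OF memL2_diff[OF g(1)[of k] g(2)] f(1)[of k]]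
      memL2_mult_integrable[OF g(2) memL2_diff[OF f(1)[of k] f(2)]]
    have "(\<integral>x. g k x * f k x \<partial>\<nu>) - (\<integral>x. G x * F x \<partial>\<nu>) = (\<integral>x. g k x * f k x - G x * F x \<partial>\<nu>)"
      by (simp add: memL2_mult_integrable g f)
    also have "\<dots> = (\<integral>x. (g k x - G x) * f k x + G x * (f k x - F x) \<partial>\<nu>)"
      by (rule Bochner_Integration.integral_cong) (auto simp: algebra_simps)
    also have "\<dots> = (\<integral>x. (g k x - G x) * f k x \<partial>\<nu>) + (\<integral>x. G x * (f k x - F x) \<partial>\<nu>)"
      using m by simp
    finally show "norm ((\<integral>x. g k x * f k x \<partial>\<nu>) - (\<integral>x. G x * F x \<partial>\<nu>))
      \<le> L2n \<nu> (\<lambda>x. g k x - G x) * L2n \<nu> (f k) + L2n \<nu> G * L2n \<nu> (\<lambda>x. f k x - F x)"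
      using L2_Cauchy_Schwarz[OF memL2_diff[OF g(1)[of k] g(2)] f(1)[of k]]
        L2_Cauchy_Schwarz[OF g(2) memL2_diff[OF f(1)[of k] f(2)]] by simp
  qed
qed

lemma L2n_parallelogram:
  assumes "memL2 \<nu> u" "memL2 \<nu> v" "memL2 \<nu> h"
  shows "(L2n \<nu> (\<lambda>x. (u x + v x) / 2 - h x))\<^sup>2
    = ((L2n \<nu> (\<lambda>x. u x - h x))\<^sup>2 + (L2n \<nu> (\<lambda>x. v x - h x))\<^sup>2) / 2 - (L2n \<nu> (\<lambda>x. u x - v x))\<^sup>2 / 4"
proof -
  note i = memL2_integrable[OF memL2_diff[OF assms(1,3)]] memL2_integrable[OF memL2_diff[OF assms(2,3)]]
    memL2_integrable[OF memL2_diff[OF assms(1,2)]]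
  have "(L2n \<nu> (\<lambda>x. (u x + v x) / 2 - h x))\<^sup>2
      = (\<integral>x. ((u x - h x)\<^sup>2 + (v x - h x)\<^sup>2) / 2 - (u x - v x)\<^sup>2 / 4 \<partial>\<nu>)"
    unfolding L2n_power2
    by (rule Bochner_Integration.integral_cong) (auto simp: field_simps power2_eq_square)
  also have "\<dots> = ((L2n \<nu> (\<lambda>x. u x - h x))\<^sup>2 + (L2n \<nu> (\<lambda>x. v x - h x))\<^sup>2) / 2 - (L2n \<nu> (\<lambda>x. u x - v x))\<^sup>2 / 4"
    unfolding L2n_power2 using i by simp
  finally show ?thesis .
qed

lemma L2n_power2_add:
  assumes "memL2 \<nu> u" "memL2 \<nu> v"
  shows "(L2n \<nu> (\<lambda>x. u x + k * v x))\<^sup>2 = (L2n \<nu> u)\<^sup>2 + 2 * k * (\<integral>x. u x * v x \<partial>\<nu>) + k\<^sup>2 * (L2n \<nu> v)\<^sup>2"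
proof -
  note i = memL2_integrable[OF assms(1)] memL2_integrable[OF assms(2)] memL2_mult_integrable[OF assms]
  have "(L2n \<nu> (\<lambda>x. u x + k * v x))\<^sup>2 = (\<integral>x. (u x)\<^sup>2 + 2 * k * (u x * v x) + k\<^sup>2 * (v x)\<^sup>2 \<partial>\<nu>)"
    unfolding L2n_power2
    by (rule Bochner_Integration.integral_cong) (auto simp: field_simps power2_eq_square)
  also have "\<dots> = (L2n \<nu> u)\<^sup>2 + 2 * k * (\<integral>x. u x * v x \<partial>\<nu>) + k\<^sup>2 * (L2n \<nu> v)\<^sup>2"
    unfolding L2n_power2 using i by simp
  finally show ?thesis .
qed

text \<open>Removes the second-order remainder in first-order optimality conditions by letting
  \<theta> tend to 0.\<close>

lemma nonneg_of_small_perturbation: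
  fixes a b :: real
  assumes "\<And>\<theta>. 0 < \<theta> \<Longrightarrow> \<theta> \<le> 1 \<Longrightarrow> 0 \<le> a + \<theta> * b"
  shows "0 \<le> a"
proof (rule LIMSEQ_le_const)
  show "(\<lambda>n. a + 1 / real (Suc n) * b) \<longlonglongrightarrow> a"
    using tendsto_add[OF tendsto_const tendsto_mult[OF LIMSEQ_Suc[OF lim_1_over_n] tendsto_const], of a b] by simp
  show "\<exists>N. \<forall>n\<ge>N. 0 \<le> a + 1 / real (Suc n) * b" by (intro exI allI impI assms) auto
qed

context plap_space
begin

text \<open>The relation that g lies in the subdifferential at u of the functional equal to
  \<open>En\<close> on \<open>dom\<close> and to infinity elsewhere in L^2.\<close>

definition subgradient :: "('a \<Rightarrow> real) \<Rightarrow> ('a \<Rightarrow> real) \<Rightarrow> bool" where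
  "subgradient u g \<longleftrightarrow> dom u \<and> inH g \<and>
     (\<forall>z. dom z \<longrightarrow> En u + (\<integral>x. g x * (z x - u x) \<partial>\<nu>1) \<le> En z)"

text \<open>The parallelogram law gives the distance term a midpoint gain of 1/4 of the squared
  distance; divided by 2l this is the constant 1/(8l). Convexity of \<open>En\<close> costs
  nothing.\<close>

lemma resolvent_minimizer:
  assumes h: "inH h" and l: "0 < l"
  obtains u where "dom u"
    "\<And>z. dom z \<Longrightarrow> En u + (nH (\<lambda>x. u x - h x))\<^sup>2 / (2 * l) \<le> En z + (nH (\<lambda>x. z x - h x))\<^sup>2 / (2 * l)"
proof -
  define I where "I u = En u + (nH (\<lambda>x. u x - h x))\<^sup>2 / (2 * l)" for u
  have mid: "dom (\<lambda>x. (u x + v x) / 2)" "I (\<lambda>x. (u x + v x) / 2) \<le> (I u + I v) / 2 - 1 / (8 * l) * (nH (\<lambda>x. u x - v x))\<^sup>2"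
    if d: "dom u" "dom v" for u v
  proof -
    have eq: "(\<lambda>x. (1 - 1/2) * u x + 1/2 * v x) = (\<lambda>x. (u x + v x) / 2)" by (auto simp: field_simps)
    show "dom (\<lambda>x. (u x + v x) / 2)" using En_convex(1)[OF d, of "1/2"] unfolding eq by simp
    have split: "((A + B) / 2 - D / 4) / (2 * l) = (A / (2 * l) + B / (2 * l)) / 2 - 1 / (8 * l) * D" for A B D
      using l by (simp add: field_simps)
    have gen: "e + ((A + B) / 2 - D) \<le> ((eu + A) + (ev + B)) / 2 - D" if "e \<le> (eu + ev) / 2" for e eu ev A B D :: real
      using that by argo
    have "En (\<lambda>x. (u x + v x) / 2) \<le> (En u + En v) / 2"
      using En_convex(2)[OF d, of "1/2"] unfolding eq by (simp add: add_divide_distrib)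
    then show "I (\<lambda>x. (u x + v x) / 2) \<le> (I u + I v) / 2 - 1 / (8 * l) * (nH (\<lambda>x. u x - v x))\<^sup>2"
      unfolding I_def L2n_parallelogram[OF dom_memL2[OF d(1)] dom_memL2[OF d(2)] h] split by (rule gen)
  qed
  obtain g G r where g: "\<And>k. g k \<in> Collect dom" "\<And>k v. v \<in> Collect dom \<Longrightarrow> I (g k) \<le> I v + 1 / (real k + 1)"
    and G: "inH G" "(\<lambda>k. nH (\<lambda>x. g k x - G x)) \<longlonglongrightarrow> 0" "strict_mono r"
    "AE x in \<nu>1. (\<lambda>k. g (r k) x) \<longlonglongrightarrow> G x"
  proof (rule minimizing_sequence[where S="\<lambda>_. Collect dom" and I=I and C="I (\<lambda>x. 0)" and a="1 / (8 * l)" and \<nu>=\<nu>1])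
    show "0 \<le> I u" for u using l En_nonneg[of u] by (simp add: I_def)
    show "\<exists>u\<in>Collect dom. I u \<le> I (\<lambda>x. 0)" by (rule bexI[of _ "\<lambda>x. 0"]) auto
  qed (use l mid dom_memL2 in auto)
  have dg: "dom (g k)" for k using g(1) by simp
  have *: "dom G \<and> En G \<le> I z - (nH (\<lambda>x. G x - h x))\<^sup>2 / (2 * l)" if z: "dom z" for z
  proof -
    \<comment> \<open>The distance term converges in norm along the minimizing sequence, so it is
      moved to the right-hand side and lower semicontinuity is needed for \<open>En\<close>
      alone.\<close>
    let ?e = "\<lambda>k. I z + 1 / (real (r k) + 1) - (nH (\<lambda>x. g (r k) x - h x))\<^sup>2 / (2 * l)"
    have le: "En (g (r k)) \<le> ?e k" for k using g(2)[of z "r k"] z by (simp add: I_def)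
    have "(\<lambda>k. nH (\<lambda>x. g k x - h x)) \<longlonglongrightarrow> nH (\<lambda>x. G x - h x)"
      by (rule tendsto_L2n) (use G dg h dom_memL2 in \<open>auto intro!: memL2_diff\<close>)
    from LIMSEQ_subseq_LIMSEQ[OF this G(3)]
    have "(\<lambda>k. nH (\<lambda>x. g (r k) x - h x)) \<longlonglongrightarrow> nH (\<lambda>x. G x - h x)" by (simp add: o_def)
    moreover have "(\<lambda>k. 1 / (real (r k) + 1)) \<longlonglongrightarrow> 0"
      using LIMSEQ_subseq_LIMSEQ[OF LIMSEQ_Suc[OF lim_1_over_n] G(3)] by (simp add: o_def add.commute)
    ultimately have lim: "?e \<longlonglongrightarrow> I z + 0 - (nH (\<lambda>x. G x - h x))\<^sup>2 / (2 * l)"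
      using l by (intro tendsto_intros) auto
    show ?thesis
      using En_lsc[of "\<lambda>k. g (r k)" G, OF dg G(1) G(4) le lim] by simp
  qed
  show ?thesis
  proof (rule that[of G])
    show "dom G" using *[of "\<lambda>x. 0"] by simp
    show "En G + (nH (\<lambda>x. G x - h x))\<^sup>2 / (2 * l) \<le> En z + (nH (\<lambda>x. z x - h x))\<^sup>2 / (2 * l)" if "dom z" for z
      using *[OF that] by (simp add: I_def)
  qed
qed

text \<open>First-order condition for the minimizer: it is compared with points (1 - \<theta>) u +
  \<theta> z of the segment, where convexity bounds the energy, and the inequality is divided by
  \<theta>.\<close>

lemma resolvent_subgradient:
  assumes h: "inH h" and l: "0 < l"
  obtains u where "subgradient u (\<lambda>x. (h x - u x) / l)"
proof -
  obtain u where u: "dom u"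
    "\<And>z. dom z \<Longrightarrow> En u + (nH (\<lambda>x. u x - h x))\<^sup>2 / (2 * l) \<le> En z + (nH (\<lambda>x. z x - h x))\<^sup>2 / (2 * l)"
    using resolvent_minimizer[OF h l] by blast
  note mu = dom_memL2[OF u(1)]
  have "En u + (\<integral>x. (h x - u x) / l * (z x - u x) \<partial>\<nu>1) \<le> En z" if z: "dom z" for z
  proof -
    note mz = dom_memL2[OF z]
    let ?s = "\<integral>x. (u x - h x) * (z x - u x) \<partial>\<nu>1" and ?n = "(nH (\<lambda>x. z x - u x))\<^sup>2"
    have "0 \<le> (En z - En u + ?s / l) + \<theta> * (?n / (2 * l))" if \<theta>: "0 < \<theta>" "\<theta> \<le> 1" for \<theta>
    proof -
      let ?w = "\<lambda>x. (1 - \<theta>) * u x + \<theta> * z x"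
      define ew where "ew = En ?w"
      have "En u + (nH (\<lambda>x. u x - h x))\<^sup>2 / (2 * l) \<le> ew + (nH (\<lambda>x. ?w x - h x))\<^sup>2 / (2 * l)"
        unfolding ew_def using \<theta> by (intro u En_convex z) auto
      moreover have ew: "ew \<le> (1 - \<theta>) * En u + \<theta> * En z"
        unfolding ew_def using \<theta> by (intro En_convex u z) auto
      moreover have "(\<lambda>x. ?w x - h x) = (\<lambda>x. (u x - h x) + \<theta> * (z x - u x))" by (auto simp: algebra_simps)
      then have "(nH (\<lambda>x. ?w x - h x))\<^sup>2 = (nH (\<lambda>x. u x - h x))\<^sup>2 + (2 * \<theta> * ?s + \<theta>\<^sup>2 * ?n)"
        using L2n_power2_add[OF memL2_diff[OF mu h] memL2_diff[OF mz mu], of \<theta>] by simp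
      ultimately have "0 \<le> ew - En u + (2 * \<theta> * ?s + \<theta>\<^sup>2 * ?n) / (2 * l)"
        by (simp only: add_divide_distrib)
      also have "\<dots> \<le> \<theta> * (En z - En u) + (2 * \<theta> * ?s + \<theta>\<^sup>2 * ?n) / (2 * l)"
        using ew by (intro add_right_mono) argo
      finally have "0 \<le> \<theta> * (En z - En u) + (2 * \<theta> * ?s + \<theta>\<^sup>2 * ?n) / (2 * l)" .
      also have "\<theta> * (En z - En u) + (2 * \<theta> * ?s + \<theta>\<^sup>2 * ?n) / (2 * l) = \<theta> * ((En z - En u + ?s / l) + \<theta> * (?n / (2 * l)))"
        using l by (simp add: field_simps power2_eq_square)
      finally show ?thesis using \<theta> by (simp add: zero_le_mult_iff)
    qed
    then have "0 \<le> En z - En u + ?s / l" by (rule nonneg_of_small_perturbation)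
    moreover have "(\<integral>x. (h x - u x) / l * (z x - u x) \<partial>\<nu>1) = - (?s / l)"
    proof -
      have "(\<integral>x. (h x - u x) / l * (z x - u x) \<partial>\<nu>1) = (\<integral>x. (- 1 / l) * ((u x - h x) * (z x - u x)) \<partial>\<nu>1)"
        by (rule Bochner_Integration.integral_cong) (use l in \<open>auto simp: field_simps\<close>)
      then show ?thesis by simp
    qed
    ultimately show ?thesis by simp
  qed
  then have "subgradient u (\<lambda>x. (h x - u x) / l)"
    unfolding subgradient_def using u(1) mu h by (auto intro!: memL2_divide memL2_diff)
  then show ?thesis by (rule that)
qed

lemma psi_perturbation_tendsto:
  assumes s: "1 < s" and [measurable]: "F \<in> borel_measurable N" "G \<in> borel_measurable N"
    and i: "integrable N (\<lambda>z. \<bar>F z\<bar> powr s)" "integrable N (\<lambda>z. \<bar>G z\<bar> powr s)"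
  shows "(\<lambda>n. \<integral>z. psi s (F z + 1 / real (Suc n) * G z) * G z \<partial>N) \<longlonglongrightarrow> (\<integral>z. psi s (F z) * G z \<partial>N)"
proof (rule integral_dominated_convergence[where w="\<lambda>z. 2 powr s * (\<bar>F z\<bar> powr s + \<bar>G z\<bar> powr s) + \<bar>G z\<bar> powr s"])
  show "integrable N (\<lambda>z. 2 powr s * (\<bar>F z\<bar> powr s + \<bar>G z\<bar> powr s) + \<bar>G z\<bar> powr s)" using i by simp
  show "AE z in N. (\<lambda>n. psi s (F z + 1 / real (Suc n) * G z) * G z) \<longlonglongrightarrow> psi s (F z) * G z"
  proof (rule AE_I2, rule tendsto_mult[OF _ tendsto_const])
    fix z
    have "(\<lambda>n. F z + 1 / real (Suc n) * G z) \<longlonglongrightarrow> F z"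
      using tendsto_add[OF tendsto_const tendsto_mult[OF LIMSEQ_Suc[OF lim_1_over_n] tendsto_const], of "F z" "G z"] by simp
    then show "(\<lambda>n. psi s (F z + 1 / real (Suc n) * G z)) \<longlonglongrightarrow> psi s (F z)"
      by (rule continuous_on_tendsto_compose[OF continuous_on_psi[OF s]]) auto
  qed
  show "AE z in N. norm (psi s (F z + 1 / real (Suc n) * G z) * G z) \<le> 2 powr s * (\<bar>F z\<bar> powr s + \<bar>G z\<bar> powr s) + \<bar>G z\<bar> powr s" for n
  proof (rule AE_I2)
    fix z
    let ?b = "1 / real (Suc n) * G z"
    have "\<bar>?b\<bar> \<le> 1 * \<bar>G z\<bar>" unfolding abs_mult by (intro mult_right_mono) auto
    then have b: "\<bar>?b\<bar> powr s \<le> \<bar>G z\<bar> powr s" using s by (intro powr_mono2) auto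
    have "norm (psi s (F z + ?b) * G z) \<le> \<bar>F z + ?b\<bar> powr s + \<bar>G z\<bar> powr s"
      using psi_Young[OF s] by (simp add: abs_mult)
    also have "\<bar>F z + ?b\<bar> powr s \<le> 2 powr s * (\<bar>F z\<bar> powr s + \<bar>?b\<bar> powr s)"
      using s by (intro abs_add_powr) auto
    also have "\<dots> \<le> 2 powr s * (\<bar>F z\<bar> powr s + \<bar>G z\<bar> powr s)" by (intro mult_left_mono add_left_mono b) auto
    finally show "norm (psi s (F z + ?b) * G z) \<le> 2 powr s * (\<bar>F z\<bar> powr s + \<bar>G z\<bar> powr s) + \<bar>G z\<bar> powr s" by simp
  qed
qed measurable

text \<open>The energy is never differentiated. The gradient inequality, taken at the perturbed
  point, bounds the energy increment in direction \<phi> by \<theta> times an integral whose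
  integrand converges dominatedly as \<theta> tends to 0.\<close>

lemma subgradient_le_derivative:
  assumes g: "subgradient u g" and \<phi>: "dom \<phi>"
  shows "(\<integral>x. g x * \<phi> x \<partial>\<nu>1) \<le> (\<integral>z. psi q (grad u z) * grad \<phi> z \<partial>\<pi>1) / 2 + (\<integral>z. psi p (grad u z) * grad \<phi> z \<partial>\<pi>2) / 2"
proof (rule LIMSEQ_le_const)
  have u: "dom u" and mg: "inH g" using g by (auto simp: subgradient_def)
  note [measurable] = dom_measurable[OF u] dom_measurable[OF \<phi>]
  have gm[measurable]: "grad u \<in> borel_measurable \<pi>1" "grad \<phi> \<in> borel_measurable \<pi>1"
     "grad u \<in> borel_measurable \<pi>2" "grad \<phi> \<in> borel_measurable \<pi>2"
    using K1.grad_measurable[of u] K1.grad_measurable[of \<phi>] K2.grad_measurable[of u] K2.grad_measurable[of \<phi>] by auto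
  let ?D = "\<lambda>n. (\<integral>z. psi q (grad u z + 1 / real (Suc n) * grad \<phi> z) * grad \<phi> z \<partial>\<pi>1) / 2 +
      (\<integral>z. psi p (grad u z + 1 / real (Suc n) * grad \<phi> z) * grad \<phi> z \<partial>\<pi>2) / 2"
  show "?D \<longlonglongrightarrow> (\<integral>z. psi q (grad u z) * grad \<phi> z \<partial>\<pi>1) / 2 + (\<integral>z. psi p (grad u z) * grad \<phi> z \<partial>\<pi>2) / 2"
    using u \<phi> q p gm
    by (intro tendsto_add tendsto_divide tendsto_const psi_perturbation_tendsto) (auto simp: dom_def)
  have "(\<integral>x. g x * \<phi> x \<partial>\<nu>1) \<le> ?D n" for n
  proof -
    define \<theta> where "\<theta> = 1 / real (Suc n)"
    have \<theta>: "0 < \<theta>" by (simp add: \<theta>_def)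
    let ?z = "\<lambda>x. u x + \<theta> * \<phi> x"
    have dz: "dom ?z" by (intro dom_add dom_scale u \<phi>)
    have eq: "grad ?z z = grad u z + \<theta> * grad \<phi> z" for z by (simp add: grad_def algebra_simps)
    have d: "(\<integral>z. \<bar>grad ?z z\<bar> powr s \<partial>N) / (2 * s) - (\<integral>z. \<bar>grad u z\<bar> powr s \<partial>N) / (2 * s)
        \<le> \<theta> * ((\<integral>z. psi s (grad u z + \<theta> * grad \<phi> z) * grad \<phi> z \<partial>N) / 2)"
      if s: "1 < s" and [measurable]: "grad u \<in> borel_measurable N" "grad \<phi> \<in> borel_measurable N"
        and i: "integrable N (\<lambda>z. \<bar>grad u z\<bar> powr s)" "integrable N (\<lambda>z. \<bar>grad \<phi> z\<bar> powr s)"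
         "integrable N (\<lambda>z. \<bar>grad ?z z\<bar> powr s)" for s N
    proof -
      have ip: "integrable N (\<lambda>z. psi s (grad u z + \<theta> * grad \<phi> z) * grad \<phi> z)"
        using s i by (intro integrable_psi_mult) (auto simp: eq)
      have "(\<integral>z. \<bar>grad ?z z\<bar> powr s \<partial>N) - (\<integral>z. \<bar>grad u z\<bar> powr s \<partial>N) = (\<integral>z. \<bar>grad ?z z\<bar> powr s - \<bar>grad u z\<bar> powr s \<partial>N)"
        using i by simp
      also have "\<dots> \<le> (\<integral>z. s * \<theta> * (psi s (grad u z + \<theta> * grad \<phi> z) * grad \<phi> z) \<partial>N)"
      proof (rule integral_mono)
        fix z
        have "\<bar>grad ?z z\<bar> powr s - \<bar>grad u z\<bar> powr s \<le> s * psi s (grad ?z z) * (grad ?z z - grad u z)"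
          by (rule psi_gradient[OF s])
        then show "\<bar>grad ?z z\<bar> powr s - \<bar>grad u z\<bar> powr s \<le> s * \<theta> * (psi s (grad u z + \<theta> * grad \<phi> z) * grad \<phi> z)"
          by (simp add: eq mult_ac)
      qed (use i ip in auto)
      finally show ?thesis using s by (simp add: field_simps)
    qed
    have "\<theta> * (\<integral>x. g x * \<phi> x \<partial>\<nu>1) = (\<integral>x. g x * (?z x - u x) \<partial>\<nu>1)"
      by (simp add: mult.left_commute)
    also have "\<dots> \<le> En ?z - En u" using g dz by (auto simp: subgradient_def algebra_simps)
    also have "\<dots> \<le> \<theta> * ((\<integral>z. psi q (grad u z + \<theta> * grad \<phi> z) * grad \<phi> z \<partial>\<pi>1) / 2) + \<theta> * ((\<integral>z. psi p (grad u z + \<theta> * grad \<phi> z) * grad \<phi> z \<partial>\<pi>2) / 2)"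
      unfolding En_def using d[of q \<pi>1] d[of p \<pi>2] u \<phi> dz q p gm by (simp add: dom_def)
    finally have "\<theta> * (\<integral>x. g x * \<phi> x \<partial>\<nu>1) \<le> \<theta> * ?D n" by (simp add: \<theta>_def distrib_left)
    then show ?thesis using \<theta> by simp
  qed
  then show "\<exists>N. \<forall>n\<ge>N. (\<integral>x. g x * \<phi> x \<partial>\<nu>1) \<le> ?D n" by blast
qed

lemma subgradient_eq_derivative:
  assumes g: "subgradient u g" and \<phi>: "dom \<phi>"
  shows "(\<integral>x. g x * \<phi> x \<partial>\<nu>1) = (\<integral>z. psi q (grad u z) * grad \<phi> z \<partial>\<pi>1) / 2 + (\<integral>z. psi p (grad u z) * grad \<phi> z \<partial>\<pi>2) / 2"
proof -
  have "grad (\<lambda>x. - 1 * \<phi> x) z = - grad \<phi> z" for z by (simp add: grad_def)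
  then show ?thesis
    using subgradient_le_derivative[OF g \<phi>] subgradient_le_derivative[OF g dom_scale[OF \<phi>, of "-1"]] by simp
qed

text \<open>Indicators of sets of finite measure are admissible test functions and show that the
  residual \<open>R\<close> integrates to 0 over each such set. Since \<open>R\<close> is only known
  to be integrable on sets of finite measure, the conclusion is drawn on the pieces of a
  \<sigma>-finite exhaustion.\<close>

lemma subgradient_pointwise:
  assumes g: "subgradient u g"
  shows "AE x in \<nu>1. g x = - W1 u x - \<mu> x * W2 u x"
proof -
  have u: "dom u" and mg: "inH g" using g by (auto simp: subgradient_def)
  note [measurable] = dom_measurable[OF u] memL2_measurable[OF mg]
  define R where "R x = g x + W1 u x + \<mu> x * W2 u x" for x
  have Rm[measurable]: "R \<in> borel_measurable \<nu>1" unfolding R_def by measurable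
  have *: "integrable \<nu>1 (\<lambda>x. indicator B x * R x) \<and> (\<integral>x. indicator B x * R x \<partial>\<nu>1) = 0"
    if B[measurable]: "B \<in> sets \<nu>1" and fB: "emeasure \<nu>1 B < \<infinity>" for B
  proof -
    let ?\<phi> = "indicator B :: 'a \<Rightarrow> real"
    have m\<phi>[measurable]: "?\<phi> \<in> borel_measurable \<nu>1" by simp
    have d: "dom ?\<phi>" and ip: "\<And>s. 0 < s \<Longrightarrow> integrable \<nu>1 (\<lambda>x. \<bar>?\<phi> x\<bar> powr s)"
      by (rule dom_finite_support[of ?\<phi> 1 B]; use B fB in \<open>auto split: split_indicator\<close>)+
    have ip2: "integrable \<nu>2 (\<lambda>x. \<bar>?\<phi> x\<bar> powr p)" using ip[of p] p by (simp add: integrable_nu2_iff)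
    note e1 = K1.integral_psi_grad_fst[OF q(1), of u ?\<phi>, folded W1_def]
    note e2 = K2.integral_psi_grad_fst[OF p, of u ?\<phi>, folded W2_def]
    have i1: "integrable \<nu>1 (\<lambda>x. ?\<phi> x * W1 u x)" using u ip[of q] q by (intro e1(2)) (auto simp: dom_def)
    have i2': "integrable \<nu>2 (\<lambda>x. ?\<phi> x * W2 u x)" using u ip2 by (intro e2(2)) (auto simp: dom_def)
    then have i2: "integrable \<nu>1 (\<lambda>x. \<mu> x * (?\<phi> x * W2 u x))"
      using mu_bounds c unfolding nu2
      by (subst (asm) integrable_density) (auto elim!: eventually_mono)
    have ig: "integrable \<nu>1 (\<lambda>x. g x * ?\<phi> x)" by (rule memL2_mult_integrable[OF mg dom_memL2[OF d]])
    have "(\<integral>x. g x * ?\<phi> x \<partial>\<nu>1) = - (\<integral>x. ?\<phi> x * W1 u x \<partial>\<nu>1) - (\<integral>x. ?\<phi> x * W2 u x \<partial>\<nu>2)"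
      unfolding subgradient_eq_derivative[OF g d]
      using u ip[of q] ip2 q by (subst e1(3), auto simp: dom_def) (subst e2(3), auto)
    also have "(\<integral>x. ?\<phi> x * W2 u x \<partial>\<nu>2) = (\<integral>x. \<mu> x * (?\<phi> x * W2 u x) \<partial>\<nu>1)"
      by (rule integral_nu2) measurable
    finally have z: "(\<integral>x. g x * ?\<phi> x + ?\<phi> x * W1 u x + \<mu> x * (?\<phi> x * W2 u x) \<partial>\<nu>1) = 0"
      using i1 i2 ig by simp
    have eq: "(\<lambda>x. ?\<phi> x * R x) = (\<lambda>x. g x * ?\<phi> x + ?\<phi> x * W1 u x + \<mu> x * (?\<phi> x * W2 u x))"
      by (auto simp: R_def algebra_simps)
    show ?thesis unfolding eq using z i1 i2 ig by simp
  qed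
  obtain A :: "nat \<Rightarrow> 'a set" where A: "range A \<subseteq> sets \<nu>1" "(\<Union>i. A i) = space \<nu>1" "\<And>i. emeasure \<nu>1 (A i) \<noteq> \<infinity>"
    using S1.sigma_finite by blast
  have "AE x in \<nu>1. indicator (A i) x * R x = 0" for i
  proof (rule S1.density_zero)
    have Ai[measurable]: "A i \<in> sets \<nu>1" using A by auto
    show "integrable \<nu>1 (\<lambda>x. indicator (A i) x * R x)" using *[of "A i"] A(3)[of i] by (simp add: less_top)
    fix B assume B[measurable]: "B \<in> sets \<nu>1"
    have "emeasure \<nu>1 (B \<inter> A i) \<le> emeasure \<nu>1 (A i)" by (intro emeasure_mono) auto
    also have "\<dots> < \<infinity>" using A(3)[of i] by (simp add: less_top)
    finally have "(\<integral>x. indicator (B \<inter> A i) x * R x \<partial>\<nu>1) = 0" using *[of "B \<inter> A i"] by simp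
    then show "(LINT x:B|\<nu>1. indicator (A i) x * R x) = 0"
      by (simp add: set_lebesgue_integral_def indicator_inter_arith mult.assoc)
  qed
  then have "AE x in \<nu>1. \<forall>i. indicator (A i) x * R x = 0" unfolding AE_all_countable by blast
  with AE_space show ?thesis
  proof eventually_elim
    case (elim x)
    then obtain i where "x \<in> A i" using A(2) by auto
    then have "R x = 0" using elim(2)[rule_format, of i] by simp
    then show ?case by (simp add: R_def)
  qed
qed

end

section \<open>Accretivity of the operator\<close>

text \<open>Besides large values, small ones are cut off too, by a jump to 0. For a square
  integrable argument the result is then bounded with support of finite measure, and the function
  remains monotone.\<close>

definition trunc :: "nat \<Rightarrow> real \<Rightarrow> real" where
  "trunc k r = (if \<bar>r\<bar> \<le> 1 / real (Suc k) then 0 else max (- real (Suc k)) (min (real (Suc k)) r))"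

lemma trunc_mono: "mono (trunc k)"
proof (rule monoI)
  fix x y :: real assume "x \<le> y"
  have "0 < 1 / real (Suc k)" "1 / real (Suc k) \<le> real (Suc k)"
    by (auto intro: order_trans[of _ 1])
  then show "trunc k x \<le> trunc k y" using \<open>x \<le> y\<close> unfolding trunc_def by (auto simp: max_def min_def)
qed

lemma trunc_measurable[measurable]: "trunc k \<in> borel_measurable borel"
  by (rule borel_measurable_mono[OF trunc_mono])

lemma abs_trunc_le: "\<bar>trunc k r\<bar> \<le> \<bar>r\<bar>" "\<bar>trunc k r\<bar> \<le> real (Suc k)"
  by (auto simp: trunc_def)

lemma trunc_diff_le: "\<bar>trunc k r - r\<bar> \<le> \<bar>r\<bar>"
  by (auto simp: trunc_def)

lemma trunc_tendsto: "(\<lambda>k. trunc k r) \<longlonglongrightarrow> r"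
proof (cases "r = 0")
  case False
  obtain a where a: "1 / real (Suc a) < \<bar>r\<bar>" using nat_approx_posE[of "\<bar>r\<bar>"] False by auto
  obtain b where b: "\<bar>r\<bar> < real b" using reals_Archimedean2 by blast
  have "trunc k r = r" if "k \<ge> max a b" for k
  proof -
    have "1 / real (Suc k) \<le> 1 / real (Suc a)" using that by (intro frac_le) auto
    then have 1: "\<not> \<bar>r\<bar> \<le> 1 / real (Suc k)" using a by linarith
    have "\<bar>r\<bar> < real (Suc k)" using b that by simp
    then show ?thesis unfolding trunc_def using 1 by (auto simp: max_def min_def)
  qed
  then show ?thesis by (intro tendsto_eventually) (auto simp: eventually_sequentially intro!: exI[of _ "max a b"])
qed (simp add: trunc_def)

context reversible_kernel
begin

lemma AE_edge_kernel:
  assumes [measurable]: "Measurable.pred (\<nu> \<Otimes>\<^sub>M \<nu>) P" and "AE z in edge m \<nu>. P z"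
  shows "AE x in \<nu>. AE y in m x. P (x, y)"
proof -
  have "AE x in \<nu>. AE z in distr (m x) (\<nu> \<Otimes>\<^sub>M \<nu>) (Pair x). P z"
    using assms(2) unfolding edge_def by (subst (asm) AE_bind[OF pair_kernel]) auto
  with AE_space show ?thesis
    by eventually_elim (subst (asm) AE_distr_iff, auto)
qed

text \<open>\<open>lo\<close> collects the jumps of size at most 1 and \<open>hi\<close> the others.
  The square of the flux is |grad u|^(2(s-1)), and 2(s-1) \<le> s exactly when s \<le> 2; so the
  large jumps give a square integrable function for s \<le> 2 and the small ones for s \<ge>
  2.\<close>

lemma psi_kernel_split:
  assumes s: "1 < s" and [measurable]: "u \<in> borel_measurable \<nu>"
    and i: "integrable (edge m \<nu>) (\<lambda>z. \<bar>grad u z\<bar> powr s)"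
  obtains lo hi where "lo \<in> borel_measurable \<nu>" "hi \<in> borel_measurable \<nu>"
    "AE x in \<nu>. (\<integral>y. psi s (u y - u x) \<partial>m x) = lo x + hi x"
    "\<And>x. x \<in> space \<nu> \<Longrightarrow> \<bar>lo x\<bar> \<le> 1" "integrable \<nu> hi" "s \<le> 2 \<Longrightarrow> memL2 \<nu> hi" "2 \<le> s \<Longrightarrow> memL2 \<nu> lo"
proof -
  define L where "L z = psi s (grad u z) * of_bool (\<bar>grad u z\<bar> \<le> 1)" for z
  define H where "H z = psi s (grad u z) * of_bool (\<not> \<bar>grad u z\<bar> \<le> 1)" for z
  have [measurable]: "L \<in> borel_measurable (\<nu> \<Otimes>\<^sub>M \<nu>)" "H \<in> borel_measurable (\<nu> \<Otimes>\<^sub>M \<nu>)"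
    unfolding L_def[abs_def] H_def[abs_def] by measurable
  note [measurable] = kernel_integral_measurable
  have L1: "\<bar>L z\<bar> \<le> 1" for z
    using s powr_mono2[of "s - 1" "\<bar>grad u z\<bar>" 1] by (auto simp: L_def abs_mult abs_psi)
  have H1: "\<bar>H z\<bar> \<le> \<bar>grad u z\<bar> powr s" for z
    using s by (auto simp: H_def abs_mult abs_psi intro!: powr_mono)
  have sq: "(a powr (s - 1))\<^sup>2 = a powr (2 * (s - 1))" if "0 \<le> a" for a :: real
    using powr_powr[of a "s - 1" 2] that by (simp add: mult.commute)
  have H2: "(H z)\<^sup>2 \<le> \<bar>grad u z\<bar> powr s" if "s \<le> 2" for z
  proof (cases "\<bar>grad u z\<bar> \<le> 1")
    case False
    have "(H z)\<^sup>2 = \<bar>H z\<bar>\<^sup>2" by simp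
    also have "\<dots> = \<bar>grad u z\<bar> powr (2 * (s - 1))" using False sq by (simp add: H_def abs_mult abs_psi del: power2_abs)
    also have "\<dots> \<le> \<bar>grad u z\<bar> powr s" using False that by (intro powr_mono) auto
    finally show ?thesis .
  qed (simp add: H_def)
  have L2: "(L z)\<^sup>2 \<le> \<bar>grad u z\<bar> powr s" if "2 \<le> s" for z
  proof (cases "\<bar>grad u z\<bar> \<le> 1")
    case True
    have "(L z)\<^sup>2 = \<bar>L z\<bar>\<^sup>2" by simp
    also have "\<dots> = \<bar>grad u z\<bar> powr (2 * (s - 1))" using True sq by (simp add: L_def abs_mult abs_psi del: power2_abs)
    also have "\<dots> \<le> \<bar>grad u z\<bar> powr s" using True that by (intro powr_mono') auto
    finally show ?thesis .
  qed (simp add: L_def)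
  have iH: "integrable (edge m \<nu>) H"
    by (rule Bochner_Integration.integrable_bound[OF i]) (use H1 in auto)
  have Lx: "(\<lambda>y. L (x, y)) \<in> borel_measurable (m x)" if "x \<in> space \<nu>" for x
    using that by (subst measurable_cong_sets[OF sets_m refl]) auto
  have iL: "integrable (m x) (\<lambda>y. L (x, y))" and lo1: "\<bar>\<integral>y. L (x, y) \<partial>m x\<bar> \<le> 1" if x: "x \<in> space \<nu>" for x
  proof -
    interpret prob_space "m x" using prob x by auto
    show i': "integrable (m x) (\<lambda>y. L (x, y))"
      by (rule integrable_const_bound[where B=1]) (use L1 Lx[OF x] in auto)
    have "\<bar>\<integral>y. L (x, y) \<partial>m x\<bar> \<le> (\<integral>y. \<bar>L (x, y)\<bar> \<partial>m x)" by simp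
    also have "\<dots> \<le> (\<integral>y. 1 \<partial>m x)" by (rule integral_mono) (use i' L1 in auto)
    finally show "\<bar>\<integral>y. L (x, y) \<partial>m x\<bar> \<le> 1" by (simp add: prob_space)
  qed
  show ?thesis
  proof (rule that[of "\<lambda>x. \<integral>y. L (x, y) \<partial>m x" "\<lambda>x. \<integral>y. H (x, y) \<partial>m x"])
    show "AE x in \<nu>. (\<integral>y. psi s (u y - u x) \<partial>m x) = (\<integral>y. L (x, y) \<partial>m x) + (\<integral>y. H (x, y) \<partial>m x)"
      using integral_edge(1)[OF iH] AE_space
    proof eventually_elim
      case (elim x)
      have "(\<integral>y. psi s (u y - u x) \<partial>m x) = (\<integral>y. L (x, y) + H (x, y) \<partial>m x)"
        by (rule Bochner_Integration.integral_cong) (auto simp: L_def H_def grad_def)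
      then show ?case using elim iL by simp
    qed
    show "integrable \<nu> (\<lambda>x. \<integral>y. H (x, y) \<partial>m x)" by (rule integral_edge(2)[OF iH])
    show "memL2 \<nu> (\<lambda>x. \<integral>y. H (x, y) \<partial>m x)" if "s \<le> 2"
      by (rule kernel_Jensen_square, simp, rule Bochner_Integration.integrable_bound[OF i]) (use H2[OF that] in auto)
    show "memL2 \<nu> (\<lambda>x. \<integral>y. L (x, y) \<partial>m x)" if "2 \<le> s"
      by (rule kernel_Jensen_square, simp, rule Bochner_Integration.integrable_bound[OF i]) (use L2[OF that] in auto)
  qed (use lo1 in auto)
qed

end

context plap_space
begin

abbreviation "A \<equiv> A_rel m1 \<nu>1 m2 \<nu>2 \<mu> p q"

abbreviation "solution \<equiv> strong_solution m1 \<nu>1 m2 \<nu>2 \<mu> p q"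

text \<open>Only the sum of the two Laplacians is known to be in $L^2$. The parts coming from large
  jumps of the first and small jumps of the second operator are always in $L^2$; the part from small
  jumps of the first one is bounded and lies in $L^2 + L^1$, hence in $L^2$.\<close>

lemma W_memL2:
  assumes u: "dom u" and g: "inH g" and eq: "AE x in \<nu>1. g x = - W1 u x - \<mu> x * W2 u x"
  shows "inH (W1 u)" "inH (W2 u)"
proof -
  note [measurable] = dom_measurable[OF u] memL2_measurable[OF g]
  obtain l1 h1 where 1[measurable]: "l1 \<in> borel_measurable \<nu>1" "h1 \<in> borel_measurable \<nu>1"
    and w1: "AE x in \<nu>1. W1 u x = l1 x + h1 x" "\<And>x. x \<in> space \<nu>1 \<Longrightarrow> \<bar>l1 x\<bar> \<le> 1" "inH h1"
  proof (rule K1.psi_kernel_split[OF q(1)])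
    show "u \<in> borel_measurable \<nu>1" by simp
    show "integrable \<pi>1 (\<lambda>z. \<bar>grad u z\<bar> powr q)" using u by (simp add: dom_def)
  qed (rule that; use q(2) in \<open>simp add: W1_def\<close>)
  have m2: "u \<in> borel_measurable \<nu>2" by simp
  have i2: "integrable \<pi>2 (\<lambda>z. \<bar>grad u z\<bar> powr p)" using u by (simp add: dom_def)
  obtain l2 h2 where 2: "l2 \<in> borel_measurable \<nu>2" "h2 \<in> borel_measurable \<nu>2"
    and w2': "AE x in \<nu>2. W2 u x = l2 x + h2 x" "integrable \<nu>2 h2" "2 \<le> p \<Longrightarrow> memL2 \<nu>2 l2"
    by (rule K2.psi_kernel_split[OF p m2 i2], rule that) (simp_all add: W2_def)
  have [measurable]: "l2 \<in> borel_measurable \<nu>1" "h2 \<in> borel_measurable \<nu>1" using 2 by auto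
  have w2: "AE x in \<nu>1. W2 u x = l2 x + h2 x" "integrable \<nu>1 h2" "2 \<le> p \<Longrightarrow> inH l2"
    using w2' by (auto simp: AE_nu2_iff integrable_nu2_iff memL2_nu2_iff)
  have ml1: "inH l1"
  proof (cases "2 \<le> p")
    case True
    have mul2: "inH (\<lambda>x. \<mu> x * l2 x)"
      by (rule memL2_bound[OF w2(3)[OF True], where K=C], simp)
        (use mu_bounds in eventually_elim, use c in \<open>auto simp: abs_mult intro!: mult_right_mono\<close>)
    have muh2: "integrable \<nu>1 (\<lambda>x. \<mu> x * h2 x)"
    proof (rule Bochner_Integration.integrable_bound)
      show "integrable \<nu>1 (\<lambda>x. C * h2 x)" using w2 by simp
      show "AE x in \<nu>1. norm (\<mu> x * h2 x) \<le> norm (C * h2 x)"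
        using mu_bounds by eventually_elim (use c in \<open>auto simp: abs_mult intro!: mult_right_mono\<close>)
    qed simp
    \<comment> \<open>All terms of the equation known to be in L^2; what is left besides
      \<open>l1\<close> is \<open>\<mu> x * h2 x\<close>, which is integrable.\<close>
    define L where "L x = g x + h1 x + \<mu> x * l2 x" for x
    have mL: "inH L" unfolding L_def by (intro memL2_add g w1 mul2)
    show ?thesis unfolding memL2_def
    proof (intro conjI 1, rule Bochner_Integration.integrable_bound)
      show "integrable \<nu>1 (\<lambda>x. 4 * (L x)\<^sup>2 + 2 * \<bar>\<mu> x * h2 x\<bar>)"
        using memL2_integrable[OF mL] muh2 by (intro Bochner_Integration.integrable_add integrable_mult_right integrable_abs) auto
      show "AE x in \<nu>1. norm ((l1 x)\<^sup>2) \<le> norm (4 * (L x)\<^sup>2 + 2 * \<bar>\<mu> x * h2 x\<bar>)"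
        using eq w1(1) w2(1) AE_space
      proof eventually_elim
        case (elim x)
        \<comment> \<open>Where the integrable term is dominated by L, l1 is at most 2|L|. Elsewhere
          |l1| \<le> 1 gives l1^2 \<le> |l1|, which is at most twice the integrable term.\<close>
        then have l1: "l1 x = - (L x + \<mu> x * h2 x)" by (simp add: L_def algebra_simps)
        have "(l1 x)\<^sup>2 \<le> 4 * (L x)\<^sup>2 + 2 * \<bar>\<mu> x * h2 x\<bar>"
        proof (cases "\<bar>\<mu> x * h2 x\<bar> \<le> \<bar>L x\<bar>")
          case True
          then have "\<bar>l1 x\<bar> \<le> \<bar>2 * L x\<bar>" using l1 by simp
          then have "(l1 x)\<^sup>2 \<le> (2 * L x)\<^sup>2" by (simp only: abs_le_square_iff)
          moreover have "0 \<le> \<bar>\<mu> x * h2 x\<bar>" by simp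
          ultimately show ?thesis by (simp add: power_mult_distrib)
        next
          case False
          then have "\<bar>l1 x\<bar> \<le> 2 * \<bar>\<mu> x * h2 x\<bar>" using l1 by simp
          moreover have "\<bar>l1 x\<bar>\<^sup>2 \<le> \<bar>l1 x\<bar>"
            using w1(2)[OF elim(4)] by (simp add: power2_eq_square mult_left_le del: power2_abs abs_mult_self_eq)
          moreover have "0 \<le> 4 * (L x)\<^sup>2" by simp
          ultimately show ?thesis unfolding power2_abs by linarith
        qed
        then show ?case by simp
      qed
    qed simp
  next
    case False
    then have "finite_measure \<nu>1" using fin by (auto intro!: finite_measureI)
    then have "inH (\<lambda>x. 1)" by (simp add: memL2_def finite_measure.integrable_const)
    then show ?thesis by (rule memL2_bound[where K=1]) (use w1(2) in auto)
  qed
  show mW1: "inH (W1 u)"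
    by (rule memL2_cong_AE[OF memL2_add[OF ml1 w1(3)] _ w1(1)]) simp
  show "inH (W2 u)"
  \<comment> \<open>With \<open>W1 u\<close> in L^2, the equation gives \<mu> \<open>W2 u\<close> =
    -(g + \<open>W1 u\<close>), and \<mu> \<ge> c allows the division.\<close>
  proof (rule memL2_bound[OF memL2_add[OF g mW1], where K="1 / c"])
    show "AE x in \<nu>1. \<bar>W2 u x\<bar> \<le> 1 / c * \<bar>g x + W1 u x\<bar>"
      using eq mu_bounds
    proof eventually_elim
      case (elim x)
      then have "c * \<bar>W2 u x\<bar> \<le> \<bar>\<mu> x\<bar> * \<bar>W2 u x\<bar>" by (intro mult_right_mono) auto
      also have "\<dots> = \<bar>g x + W1 u x\<bar>" using elim by (simp flip: abs_mult)
      finally show ?case using c by (simp add: field_simps)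
    qed
  qed simp
qed

lemma subgradient_imp_A:
  assumes "subgradient u g" shows "A u g"
  using W_memL2[OF _ _ subgradient_pointwise[OF assms]] subgradient_pointwise[OF assms] assms
  by (auto simp: A_rel_iff subgradient_def)

lemma A_pairing:
  assumes A: "A u g" and [measurable]: "\<phi> \<in> borel_measurable \<nu>1" and \<phi>: "inH \<phi>"
    "\<And>s. 0 < s \<Longrightarrow> integrable \<nu>1 (\<lambda>x. \<bar>\<phi> x\<bar> powr s)"
  shows "integrable \<pi>1 (\<lambda>z. psi q (grad u z) * grad \<phi> z)" "integrable \<pi>2 (\<lambda>z. psi p (grad u z) * grad \<phi> z)"
    "(\<integral>x. g x * \<phi> x \<partial>\<nu>1) = (\<integral>z. psi q (grad u z) * grad \<phi> z \<partial>\<pi>1) / 2 + (\<integral>z. psi p (grad u z) * grad \<phi> z \<partial>\<pi>2) / 2"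
proof -
  have u: "dom u" and g: "inH g" "inH (W1 u)" "inH (W2 u)"
    and eq: "AE x in \<nu>1. g x = - W1 u x - \<mu> x * W2 u x" using A by (auto simp: A_rel_iff)
  note [measurable] = dom_measurable[OF u] memL2_measurable[OF g(1)]
  have ip2: "integrable \<nu>2 (\<lambda>x. \<bar>\<phi> x\<bar> powr p)" using \<phi>(2)[of p] p by (simp add: integrable_nu2_iff)
  have ip1: "integrable \<nu>1 (\<lambda>x. \<bar>\<phi> x\<bar> powr q)" using \<phi>(2)[of q] q by simp
  have m2: "u \<in> borel_measurable \<nu>2" "\<phi> \<in> borel_measurable \<nu>2" by simp_all
  have i1: "integrable \<pi>1 (\<lambda>z. \<bar>grad u z\<bar> powr q)" and i2: "integrable \<pi>2 (\<lambda>z. \<bar>grad u z\<bar> powr p)"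
    using u by (auto simp: dom_def)
  note e1 = K1.integral_psi_grad_fst[OF q(1) _ _ i1 ip1, folded W1_def]
  note e2 = K2.integral_psi_grad_fst[OF p m2 i2 ip2, folded W2_def]
  show "integrable \<pi>1 (\<lambda>z. psi q (grad u z) * grad \<phi> z)" by (rule e1(1)) auto
  show "integrable \<pi>2 (\<lambda>z. psi p (grad u z) * grad \<phi> z)" by (rule e2(1))
  have j1: "integrable \<nu>1 (\<lambda>x. \<phi> x * W1 u x)" by (rule e1(2)) auto
  have j2: "integrable \<nu>1 (\<lambda>x. \<mu> x * (\<phi> x * W2 u x))"
    using e2(2) mu_bounds c unfolding nu2
    by (subst (asm) integrable_density) (auto elim!: eventually_mono)
  have "(\<integral>x. g x * \<phi> x \<partial>\<nu>1) = (\<integral>x. - (\<phi> x * W1 u x) - \<mu> x * (\<phi> x * W2 u x) \<partial>\<nu>1)"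
  proof (rule integral_cong_AE)
    show "AE x in \<nu>1. g x * \<phi> x = - (\<phi> x * W1 u x) - \<mu> x * (\<phi> x * W2 u x)"
      using eq
    proof eventually_elim
      case (elim x)
      show ?case unfolding elim by (simp add: algebra_simps)
    qed
  qed measurable
  also have "\<dots> = - (\<integral>x. \<phi> x * W1 u x \<partial>\<nu>1) - (\<integral>x. \<mu> x * (\<phi> x * W2 u x) \<partial>\<nu>1)"
    using j1 j2 by simp
  also have "(\<integral>x. \<mu> x * (\<phi> x * W2 u x) \<partial>\<nu>1) = (\<integral>x. \<phi> x * W2 u x \<partial>\<nu>2)"
    by (rule integral_nu2[symmetric]) measurable
  also have "- (\<integral>x. \<phi> x * W1 u x \<partial>\<nu>1) - (\<integral>x. \<phi> x * W2 u x \<partial>\<nu>2)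
    = (\<integral>z. psi q (grad u z) * grad \<phi> z \<partial>\<pi>1) / 2 + (\<integral>z. psi p (grad u z) * grad \<phi> z \<partial>\<pi>2) / 2"
    using e2(3) by (subst e1(3)) auto
  finally show "(\<integral>x. g x * \<phi> x \<partial>\<nu>1) = (\<integral>z. psi q (grad u z) * grad \<phi> z \<partial>\<pi>1) / 2 + (\<integral>z. psi p (grad u z) * grad \<phi> z \<partial>\<pi>2) / 2" .
qed

lemma emeasure_superlevel_finite:
  assumes w: "inH w" and \<epsilon>: "0 < \<epsilon>"
  shows "emeasure \<nu>1 {x \<in> space \<nu>1. \<epsilon> < \<bar>w x\<bar>} < \<infinity>"
proof -
  note [measurable] = memL2_measurable[OF w]
  have "emeasure \<nu>1 {x \<in> space \<nu>1. \<epsilon> < \<bar>w x\<bar>} = (\<integral>\<^sup>+x. indicator {x \<in> space \<nu>1. \<epsilon> < \<bar>w x\<bar>} x \<partial>\<nu>1)" by simp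
  also have "\<dots> \<le> (\<integral>\<^sup>+x. ennreal ((w x / \<epsilon>)\<^sup>2) \<partial>\<nu>1)"
  proof (rule nn_integral_mono)
    fix x
    have "1 \<le> (w x / \<epsilon>)\<^sup>2" if "\<epsilon> < \<bar>w x\<bar>"
    proof -
      have "\<bar>1::real\<bar> \<le> \<bar>w x / \<epsilon>\<bar>" using that \<epsilon> by (simp add: field_simps)
      then have "1\<^sup>2 \<le> (w x / \<epsilon>)\<^sup>2" by (simp only: abs_le_square_iff)
      then show ?thesis by simp
    qed
    then have "ennreal 1 \<le> ennreal ((w x / \<epsilon>)\<^sup>2)" if "\<epsilon> < \<bar>w x\<bar>" using that by (intro ennreal_leI) auto
    then show "indicator {x \<in> space \<nu>1. \<epsilon> < \<bar>w x\<bar>} x \<le> ennreal ((w x / \<epsilon>)\<^sup>2)"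
      by (auto split: split_indicator)
  qed
  also have "\<dots> < \<infinity>" using memL2_divide[OF w, of \<epsilon>] memL2_iff_nn_integral[of "\<lambda>x. w x / \<epsilon>" \<nu>1] by simp
  finally show ?thesis .
qed

text \<open>Since \<open>P\<close> vanishes on [-\<epsilon>, \<epsilon>], the function P(u - u') is
  supported where |u - u'| > \<epsilon>, a set of finite measure by Chebyshev, and is an admissible
  test function. On each edge the difference of the fluxes and the increment of the test function
  then have the same sign.\<close>

lemma A_accretive:
  assumes A: "A u g" "A u' g'" and P: "mono P" "\<And>r. \<bar>P r\<bar> \<le> K" "0 < \<epsilon>" "\<And>r. \<bar>r\<bar> \<le> \<epsilon> \<Longrightarrow> P r = (0::real)"
  shows "0 \<le> (\<integral>x. (g x - g' x) * P (u x - u' x) \<partial>\<nu>1)"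
proof -
  have u: "inH u" "inH u'" and g: "inH g" "inH g'" using A by (auto simp: A_rel_def)
  have [measurable]: "P \<in> borel_measurable borel" by (rule borel_measurable_mono[OF P(1)])
  note [measurable] = memL2_measurable[OF u(1)] memL2_measurable[OF u(2)]
  define \<phi> where "\<phi> x = P (u x - u' x)" for x
  have m\<phi>[measurable]: "\<phi> \<in> borel_measurable \<nu>1" unfolding \<phi>_def by measurable
  let ?B = "{x \<in> space \<nu>1. \<epsilon> < \<bar>u x - u' x\<bar>}"
  have B: "?B \<in> sets \<nu>1" "emeasure \<nu>1 ?B < \<infinity>" using emeasure_superlevel_finite[OF memL2_diff[OF u] P(3)] by auto
  have z: "\<phi> x = 0" if "x \<in> space \<nu>1" "x \<notin> ?B" for x using that P(4) by (auto simp: \<phi>_def)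
  note fs = dom_finite_support[of \<phi> K ?B, OF m\<phi> _ B z]
  have d: "dom \<phi>" by (rule fs(1)) (auto simp: \<phi>_def P)
  have ii: "\<And>s. 0 < s \<Longrightarrow> integrable \<nu>1 (\<lambda>x. \<bar>\<phi> x\<bar> powr s)" by (rule fs(2)) (auto simp: \<phi>_def P)
  note m = dom_memL2[OF d]
  note p1 = A_pairing[OF A(1) m\<phi> m ii] and p2 = A_pairing[OF A(2) m\<phi> m ii]
  have pos: "0 \<le> (psi s (grad u z) - psi s (grad u' z)) * grad \<phi> z" if s: "1 < s" for s z
  proof -
    have e: "grad u z - grad u' z = (u (snd z) - u' (snd z)) - (u (fst z) - u' (fst z))" by (simp add: grad_def)
    show ?thesis
    proof (cases "u (fst z) - u' (fst z) \<le> u (snd z) - u' (snd z)")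
      case True
      then have "psi s (grad u' z) \<le> psi s (grad u z)" "0 \<le> grad \<phi> z"
        using e P(1) by (auto intro!: psi_mono s simp: grad_def \<phi>_def mono_def)
      then show ?thesis by simp
    next
      case False
      then have "psi s (grad u z) \<le> psi s (grad u' z)" "grad \<phi> z \<le> 0"
        using e P(1) by (auto intro!: psi_mono s simp: grad_def \<phi>_def mono_def)
      then show ?thesis by (simp add: mult_nonpos_nonpos)
    qed
  qed
  have "(\<integral>x. (g x - g' x) * \<phi> x \<partial>\<nu>1) = (\<integral>x. g x * \<phi> x \<partial>\<nu>1) - (\<integral>x. g' x * \<phi> x \<partial>\<nu>1)"
    using memL2_mult_integrable[OF g(1) m] memL2_mult_integrable[OF g(2) m] by (simp add: left_diff_distrib)
  also have "\<dots> = (\<integral>z. (psi q (grad u z) - psi q (grad u' z)) * grad \<phi> z \<partial>\<pi>1) / 2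
      + (\<integral>z. (psi p (grad u z) - psi p (grad u' z)) * grad \<phi> z \<partial>\<pi>2) / 2"
    using p1 p2 by (simp add: left_diff_distrib diff_divide_distrib)
  also have "\<dots> \<ge> 0" using pos q p by (intro add_nonneg_nonneg divide_nonneg_nonneg integral_nonneg_AE) auto
  finally show ?thesis by (simp add: \<phi>_def)
qed

text \<open>The identity is neither bounded nor zero near the origin, so the case P(r) = r is
  reached as a limit of accretivity along \<open>trunc k\<close>.\<close>

lemma A_monotone:
  assumes A: "A u g" "A u' g'"
  shows "0 \<le> (\<integral>x. (g x - g' x) * (u x - u' x) \<partial>\<nu>1)"
proof -
  have u: "inH u" "inH u'" and g: "inH g" "inH g'" using A by (auto simp: A_rel_def)
  note [measurable] = memL2_measurable[OF u(1)] memL2_measurable[OF u(2)] memL2_measurable[OF g(1)] memL2_measurable[OF g(2)]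
  have "(\<lambda>k. \<integral>x. (g x - g' x) * trunc k (u x - u' x) \<partial>\<nu>1) \<longlonglongrightarrow> (\<integral>x. (g x - g' x) * (u x - u' x) \<partial>\<nu>1)"
  proof (rule integral_dominated_convergence[where w="\<lambda>x. \<bar>(g x - g' x) * (u x - u' x)\<bar>"])
    show "integrable \<nu>1 (\<lambda>x. \<bar>(g x - g' x) * (u x - u' x)\<bar>)"
      by (intro integrable_abs memL2_mult_integrable memL2_diff u g)
    show "AE x in \<nu>1. norm ((g x - g' x) * trunc k (u x - u' x)) \<le> \<bar>(g x - g' x) * (u x - u' x)\<bar>" for k
      using abs_trunc_le(1) by (auto simp: abs_mult intro!: mult_left_mono)
    show "AE x in \<nu>1. (\<lambda>k. (g x - g' x) * trunc k (u x - u' x)) \<longlonglongrightarrow> (g x - g' x) * (u x - u' x)"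
      by (intro AE_I2 tendsto_intros trunc_tendsto)
  qed measurable
  then show ?thesis
  proof (rule LIMSEQ_le_const, intro exI allI impI)
    fix k
    show "0 \<le> (\<integral>x. (g x - g' x) * trunc k (u x - u' x) \<partial>\<nu>1)"
      by (rule A_accretive[OF A trunc_mono abs_trunc_le(2), where \<epsilon>="1 / real (Suc k)"]) (auto simp: trunc_def)
  qed
qed

text \<open>Kernel integrals see u on all of X, so independence of the representative is not
  immediate. It holds because both marginals of the edge measure are \<open>\<nu>\<close>: the two
  gradients agree a.e. on edges, hence m_x-a.e. for a.e. x.\<close>

lemma A_cong:
  assumes A: "A u g" and [measurable]: "u' \<in> borel_measurable \<nu>1" "g' \<in> borel_measurable \<nu>1"
    and eq: "AE x in \<nu>1. u' x = u x" "AE x in \<nu>1. g' x = g x"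
  shows "A u' g'"
proof -
  have u: "dom u" and g: "inH g" "inH (W1 u)" "inH (W2 u)"
    and e: "AE x in \<nu>1. g x = - W1 u x - \<mu> x * W2 u x" using A by (auto simp: A_rel_iff)
  note [measurable] = dom_measurable[OF u]
  have eq2: "AE x in \<nu>2. u' x = u x" using eq by (simp add: AE_nu2_iff)
  have g1: "AE z in \<pi>1. grad u' z = grad u z"
    using K1.AE_edge_fst[OF eq(1)] K1.AE_edge_snd[OF eq(1)] by eventually_elim (simp add: grad_def)
  have g2: "AE z in \<pi>2. grad u' z = grad u z"
    using K2.AE_edge_fst[OF eq2] K2.AE_edge_snd[OF eq2] by eventually_elim (simp add: grad_def)
  have gm: "grad v \<in> borel_measurable \<pi>1" "grad v \<in> borel_measurable \<pi>2" if "v \<in> borel_measurable \<nu>1" for v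
    using K1.grad_measurable[of v] K2.grad_measurable[of v] that by auto
  note [measurable] = gm[of u] gm[of u']
  have d: "dom u'"
    unfolding dom_def
  proof (intro conjI)
    show "inH u'" by (rule memL2_cong_AE[OF dom_memL2[OF u] _ eq(1)]) simp
    have "integrable \<pi>1 (\<lambda>z. \<bar>grad u' z\<bar> powr q) \<longleftrightarrow> integrable \<pi>1 (\<lambda>z. \<bar>grad u z\<bar> powr q)"
      by (rule integrable_cong_AE) (use g1 gm[of u] gm[of u'] in auto)
    then show "integrable \<pi>1 (\<lambda>z. \<bar>grad u' z\<bar> powr q)" using u by (simp add: dom_def)
    have "integrable \<pi>2 (\<lambda>z. \<bar>grad u' z\<bar> powr p) \<longleftrightarrow> integrable \<pi>2 (\<lambda>z. \<bar>grad u z\<bar> powr p)"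
      by (rule integrable_cong_AE) (use g2 gm[of u] gm[of u'] in auto)
    then show "integrable \<pi>2 (\<lambda>z. \<bar>grad u' z\<bar> powr p)" using u by (simp add: dom_def)
  qed
  have pm1: "Measurable.pred (\<nu>1 \<Otimes>\<^sub>M \<nu>1) (\<lambda>z. grad u' z = grad u z)" by measurable
  have [measurable]: "u \<in> borel_measurable \<nu>2" "u' \<in> borel_measurable \<nu>2" by simp_all
  have pm2: "Measurable.pred (\<nu>2 \<Otimes>\<^sub>M \<nu>2) (\<lambda>z. grad u' z = grad u z)" by measurable
  have w1: "AE x in \<nu>1. W1 u' x = W1 u x"
    using K1.AE_edge_kernel[OF pm1 g1] AE_space
  proof eventually_elim
    case (elim x)
    have [measurable]: "u \<in> borel_measurable (m1 x)" "u' \<in> borel_measurable (m1 x)"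
      using elim(2) by (simp_all add: measurable_cong_sets[OF K1.sets_m refl])
    show ?case unfolding W1_def
      by (rule integral_cong_AE) (use elim(1) in \<open>auto simp: grad_def\<close>)
  qed
  have "AE x in \<nu>2. W2 u' x = W2 u x"
    using K2.AE_edge_kernel[OF pm2 g2] AE_space
  proof eventually_elim
    case (elim x)
    have [measurable]: "u \<in> borel_measurable (m2 x)" "u' \<in> borel_measurable (m2 x)"
      using elim(2) by (simp_all add: measurable_cong_sets[OF K2.sets_m refl])
    show ?case unfolding W2_def
      by (rule integral_cong_AE) (use elim(1) in \<open>auto simp: grad_def\<close>)
  qed
  then have w2: "AE x in \<nu>1. W2 u' x = W2 u x" by (simp add: AE_nu2_iff)
  have "AE x in \<nu>1. g' x = - W1 u' x - \<mu> x * W2 u' x"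
    using w1 w2 e eq by eventually_elim simp
  moreover have "inH g'" by (rule memL2_cong_AE[OF g(1) _ eq(2)]) simp
  moreover have "inH (W1 u')" by (rule memL2_cong_AE[OF g(2) _ w1]) simp
  moreover have "inH (W2 u')" by (rule memL2_cong_AE[OF g(3) _ w2]) simp
  ultimately show ?thesis using d by (simp add: A_rel_iff)
qed

end

section \<open>The operator on space-time functions\<close>

abbreviation unc :: "('b \<Rightarrow> 'c \<Rightarrow> 'd) \<Rightarrow> 'b \<times> 'c \<Rightarrow> 'd" where
  "unc h \<equiv> \<lambda>z. h (fst z) (snd z)"

text \<open>Lebesgue measure on [a, b], but kept on the Borel sets of the whole line. Joint
  measurability in time and space is thus one condition, the same for all time intervals.\<close>

definition time_measure :: "real \<Rightarrow> real \<Rightarrow> real measure" where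
  "time_measure a b = density lborel (indicator {a..b})"

text \<open>Walks on space-time which leave the time coordinate fixed. Solving the resolvent equation for
  them solves it for almost every time at once, with joint measurability for free.\<close>

definition time_kernel :: "('a \<Rightarrow> 'a measure) \<Rightarrow> 'a measure \<Rightarrow> real \<times> 'a \<Rightarrow> (real \<times> 'a) measure" where
  "time_kernel m \<nu> z = distr (m (snd z)) (borel \<Otimes>\<^sub>M \<nu>) (Pair (fst z))"

lemma sets_time_measure[simp, measurable_cong]: "sets (time_measure a b) = sets borel"
  by (simp add: time_measure_def)

lemma space_time_measure[simp]: "space (time_measure a b) = UNIV"
  by (simp add: time_measure_def)

lemma AE_time_measure: "(AE t in time_measure a b. P t) \<longleftrightarrow> (AE t in lborel. t \<in> {a..b} \<longrightarrow> P t)"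
proof -
  have "(AE t in time_measure a b. P t) \<longleftrightarrow> (AE t in lborel. 0 < (indicator {a..b} t :: ennreal) \<longrightarrow> P t)"
    unfolding time_measure_def by (rule AE_density) simp
  also have "\<dots> \<longleftrightarrow> (AE t in lborel. t \<in> {a..b} \<longrightarrow> P t)" by (simp add: indicator_def)
  finally show ?thesis .
qed

lemma nn_integral_time_measure:
  "f \<in> borel_measurable borel \<Longrightarrow> (\<integral>\<^sup>+t. f t \<partial>time_measure a b) = (\<integral>\<^sup>+t\<in>{a..b}. f t \<partial>lborel)"
  unfolding time_measure_def by (subst nn_integral_density) (auto simp: mult.commute)

lemma finite_time_measure: "finite_measure (time_measure a b)"
proof (rule finite_measureI)
  have "emeasure (time_measure a b) UNIV = (\<integral>\<^sup>+t. 1 \<partial>time_measure a b)" by simp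
  also have "\<dots> = emeasure lborel {a..b}" by (subst nn_integral_time_measure) auto
  finally show "emeasure (time_measure a b) (space (time_measure a b)) \<noteq> \<infinity>"
    by (simp add: emeasure_lborel_Icc_eq)
qed

lemma (in reversible_kernel) nn_integral_kernel_swap:
  assumes [measurable]: "F \<in> borel_measurable (\<nu> \<Otimes>\<^sub>M \<nu>)"
  shows "(\<integral>\<^sup>+x. \<integral>\<^sup>+y. F (x, y) \<partial>m x \<partial>\<nu>) = (\<integral>\<^sup>+x. \<integral>\<^sup>+y. F (y, x) \<partial>m x \<partial>\<nu>)"
proof -
  have "(\<integral>\<^sup>+x. \<integral>\<^sup>+y. F (x, y) \<partial>m x \<partial>\<nu>) = (\<integral>\<^sup>+z. F z \<partial>distr (edge m \<nu>) (\<nu> \<Otimes>\<^sub>M \<nu>) prod.swap)"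
    by (simp add: nn_integral_edge distr_edge_swap)
  also have "\<dots> = (\<integral>\<^sup>+z. F (prod.swap z) \<partial>edge m \<nu>)" by (rule nn_integral_distr) auto
  also have "\<dots> = (\<integral>\<^sup>+x. \<integral>\<^sup>+y. F (y, x) \<partial>m x \<partial>\<nu>)" by (subst nn_integral_edge) auto
  finally show ?thesis .
qed

section \<open>Space-time as another instance of the same setting\<close>

context plap_space
begin

abbreviation spt :: "real \<Rightarrow> real \<Rightarrow> (real \<times> 'a) measure" where
  "spt a b \<equiv> time_measure a b \<Otimes>\<^sub>M \<nu>1"

abbreviation jmeas :: "(real \<times> 'a \<Rightarrow> 'b::topological_space) set" where
  "jmeas \<equiv> borel_measurable (borel \<Otimes>\<^sub>M \<nu>1)"

lemma sets_spt: "sets (spt a b) = sets (borel \<Otimes>\<^sub>M \<nu>1)"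
  by (rule sets_pair_measure_cong) auto

lemma measurable_spt: "borel_measurable (spt a b) = jmeas"
  by (rule measurable_cong_sets[OF sets_spt refl])

lemma pair_sigma_finite_spt: "pair_sigma_finite (time_measure a b) \<nu>1"
  by (intro pair_sigma_finite.intro finite_measure.axioms(1)[OF finite_time_measure] S1.sigma_finite_measure_axioms)

lemma time_kernel_measurable:
  assumes m[measurable]: "m \<in> measurable \<nu>1 (subprob_algebra \<nu>1)"
  shows "time_kernel m \<nu>1 \<in> measurable (spt a b) (subprob_algebra (spt a b))"
proof -
  have "(\<lambda>z. distr (m (snd z)) (borel \<Otimes>\<^sub>M \<nu>1) (Pair (fst z))) \<in> measurable (spt a b) (subprob_algebra (borel \<Otimes>\<^sub>M \<nu>1))"
    by (rule measurable_distr2[where M=\<nu>1]) measurable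
  then show ?thesis
    unfolding time_kernel_def[abs_def] by (subst subprob_algebra_cong[OF sets_spt])
qed

lemma time_kernel_prob:
  assumes m: "m \<in> measurable \<nu>1 (subprob_algebra \<nu>1)" "\<And>x. x \<in> space \<nu>1 \<Longrightarrow> prob_space (m x)"
    and z: "z \<in> space (spt a b)"
  shows "prob_space (time_kernel m \<nu>1 z)"
proof -
  have "snd z \<in> space \<nu>1" using z by (auto simp: space_pair_measure)
  then show ?thesis
    unfolding time_kernel_def using sets_kernel[OF m(1)]
    by (intro prob_space.prob_space_distr m(2)) (auto simp: measurable_cong_sets[of "m (snd z)" \<nu>1])
qed

lemma nn_integral_time_kernel:
  assumes m: "m \<in> measurable \<nu>1 (subprob_algebra \<nu>1)" and x: "x \<in> space \<nu>1"
    and F[measurable]: "F \<in> jmeas"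
  shows "(\<integral>\<^sup>+w. F w \<partial>time_kernel m \<nu>1 (t, x)) = (\<integral>\<^sup>+y. F (t, y) \<partial>m x)"
  unfolding time_kernel_def using sets_kernel[OF m x]
  by (subst nn_integral_distr) (auto simp: measurable_cong_sets[of "m x" \<nu>1])

lemma integral_time_kernel:
  fixes F :: "real \<times> 'a \<Rightarrow> real"
  assumes m: "m \<in> measurable \<nu>1 (subprob_algebra \<nu>1)" and x: "x \<in> space \<nu>1"
    and F[measurable]: "F \<in> jmeas"
  shows "(\<integral>w. F w \<partial>time_kernel m \<nu>1 (t, x)) = (\<integral>y. F (t, y) \<partial>m x)"
  unfolding time_kernel_def using sets_kernel[OF m x]
  by (subst integral_distr) (auto simp: measurable_cong_sets[of "m x" \<nu>1])

lemma kernel2: "m2 \<in> measurable \<nu>1 (subprob_algebra \<nu>1)"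
proof -
  have "measurable \<nu>2 (subprob_algebra \<nu>2) = measurable \<nu>1 (subprob_algebra \<nu>1)"
    by (rule measurable_cong_sets[OF sets_nu2]) (simp only: subprob_algebra_cong[OF sets_nu2])
  then show ?thesis using K2.kernel by simp
qed

text \<open>The inner integral sees only the slice through the starting point. The weight
  \<open>h\<close> is 1 for the first walk and \<open>\<mu>\<close> for the second, whose invariant
  measure has that density.\<close>

lemma nn_integral_double_time_kernel:
  assumes m[measurable]: "m \<in> measurable \<nu>1 (subprob_algebra \<nu>1)" and [measurable]: "h \<in> borel_measurable \<nu>1"
    and F[measurable]: "F \<in> borel_measurable (spt a b \<Otimes>\<^sub>M spt a b)"
  shows "(\<integral>\<^sup>+z. h (snd z) * (\<integral>\<^sup>+w. F (z, w) \<partial>time_kernel m \<nu>1 z) \<partial>spt a b)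
    = (\<integral>\<^sup>+t. \<integral>\<^sup>+x. h x * (\<integral>\<^sup>+y. F ((t, x), (t, y)) \<partial>m x) \<partial>\<nu>1 \<partial>time_measure a b)"
proof -
  have [measurable]: "(\<lambda>z. \<integral>\<^sup>+w. F (z, w) \<partial>time_kernel m \<nu>1 z) \<in> borel_measurable (spt a b)"
    by (rule nn_integral_measurable_subprob_algebra2[where N="spt a b"]) (use time_kernel_measurable[OF m] in auto)
  have "(\<integral>\<^sup>+z. h (snd z) * (\<integral>\<^sup>+w. F (z, w) \<partial>time_kernel m \<nu>1 z) \<partial>spt a b)
    = (\<integral>\<^sup>+t. \<integral>\<^sup>+x. h x * (\<integral>\<^sup>+w. F ((t, x), w) \<partial>time_kernel m \<nu>1 (t, x)) \<partial>\<nu>1 \<partial>time_measure a b)"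
    by (subst S1.nn_integral_fst[symmetric]) auto
  also have "\<dots> = (\<integral>\<^sup>+t. \<integral>\<^sup>+x. h x * (\<integral>\<^sup>+y. F ((t, x), (t, y)) \<partial>m x) \<partial>\<nu>1 \<partial>time_measure a b)"
  proof (intro nn_integral_cong)
    fix t x assume x: "x \<in> space \<nu>1"
    have "Pair (t, x) \<in> measurable (spt a b) (spt a b \<Otimes>\<^sub>M spt a b)"
      by (rule measurable_Pair1') (use x in \<open>auto simp: space_pair_measure\<close>)
    then have "(\<lambda>w. F ((t, x), w)) \<in> borel_measurable (spt a b)" by measurable
    then have "(\<lambda>w. F ((t, x), w)) \<in> jmeas" by (simp add: measurable_spt)
    then show "h x * (\<integral>\<^sup>+w. F ((t, x), w) \<partial>time_kernel m \<nu>1 (t, x)) = h x * (\<integral>\<^sup>+y. F ((t, x), (t, y)) \<partial>m x)"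
      by (simp add: nn_integral_time_kernel[OF m x])
  qed
  finally show ?thesis .
qed

lemma slice_measurable:
  assumes F: "F \<in> borel_measurable (spt a b \<Otimes>\<^sub>M spt a b)"
  shows "(\<lambda>(x, y). F ((t, x), (t, y))) \<in> borel_measurable (\<nu>1 \<Otimes>\<^sub>M \<nu>1)"
proof -
  have "(\<lambda>(x, y). ((t, x), (t, y))) \<in> measurable (\<nu>1 \<Otimes>\<^sub>M \<nu>1) (spt a b \<Otimes>\<^sub>M spt a b)" by measurable
  from measurable_compose[OF this F] show ?thesis by (simp add: split_beta)
qed

lemma nn_integral_nu2:
  assumes [measurable]: "f \<in> borel_measurable \<nu>1"
  shows "(\<integral>\<^sup>+x. ennreal (\<mu> x) * f x \<partial>\<nu>1) = (\<integral>\<^sup>+x. f x \<partial>\<nu>2)"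
  unfolding nu2 by (subst nn_integral_density) auto

lemma kernel_nn_integral_measurable2:
  assumes "F \<in> borel_measurable (\<nu>1 \<Otimes>\<^sub>M \<nu>1)"
  shows "(\<lambda>x. \<integral>\<^sup>+y. F (x, y) \<partial>m2 x) \<in> borel_measurable \<nu>1"
  using nn_integral_measurable_subprob_algebra2[of "\<lambda>x y. F (x, y)", OF _ kernel2] assms by simp

text \<open>Reversibility holds slice by slice and is integrated over time. If \<open>\<nu>1\<close>
  is finite, so is its product with a bounded time interval; otherwise 2 \<le> p is
  inherited.\<close>

lemma plap_space_spt:
  "plap_space (time_kernel m1 \<nu>1) (spt a b) (time_kernel m2 \<nu>1)
     (density (spt a b) (\<lambda>z. ennreal (\<mu> (snd z)))) (\<lambda>z. \<mu> (snd z)) c C p q"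
proof -
  interpret PS: pair_sigma_finite "time_measure a b" \<nu>1 by (rule pair_sigma_finite_spt)
  let ?N2 = "density (spt a b) (\<lambda>z. ennreal (\<mu> (snd z)))"
  have prob2: "\<And>x. x \<in> space \<nu>1 \<Longrightarrow> prob_space (m2 x)" using K2.prob by simp
  have 1: "reversible_kernel (time_kernel m1 \<nu>1) (spt a b)"
  proof (rule reversible_kernel.intro)
    show "time_kernel m1 \<nu>1 \<in> measurable (spt a b) (subprob_algebra (spt a b))"
      by (rule time_kernel_measurable[OF K1.kernel])
    show "prob_space (time_kernel m1 \<nu>1 z)" if "z \<in> space (spt a b)" for z
      by (rule time_kernel_prob[OF K1.kernel K1.prob that])
    show "reversible (spt a b) (time_kernel m1 \<nu>1) (spt a b)"
      unfolding reversible_def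
    proof
      fix E assume E[measurable]: "E \<in> sets (spt a b \<Otimes>\<^sub>M spt a b)"
      let ?I = "\<lambda>z. indicator E z :: ennreal" and ?J = "\<lambda>z. indicator E (snd z, fst z) :: ennreal"
      have "(\<integral>\<^sup>+z. \<integral>\<^sup>+w. ?I (z, w) \<partial>time_kernel m1 \<nu>1 z \<partial>spt a b)
          = (\<integral>\<^sup>+t. \<integral>\<^sup>+x. \<integral>\<^sup>+y. ?I ((t, x), (t, y)) \<partial>m1 x \<partial>\<nu>1 \<partial>time_measure a b)"
        using nn_integral_double_time_kernel[OF K1.kernel, of "\<lambda>_. 1" ?I] by simp
      also have "\<dots> = (\<integral>\<^sup>+t. \<integral>\<^sup>+x. \<integral>\<^sup>+y. ?I ((t, y), (t, x)) \<partial>m1 x \<partial>\<nu>1 \<partial>time_measure a b)"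
        using K1.nn_integral_kernel_swap[OF slice_measurable[of ?I]] by (intro nn_integral_cong[of "time_measure a b"]) auto
      also have "\<dots> = (\<integral>\<^sup>+z. \<integral>\<^sup>+w. ?I (w, z) \<partial>time_kernel m1 \<nu>1 z \<partial>spt a b)"
        using nn_integral_double_time_kernel[OF K1.kernel, of "\<lambda>_. 1" ?J] by simp
      finally show "(\<integral>\<^sup>+z. \<integral>\<^sup>+w. ?I (z, w) \<partial>time_kernel m1 \<nu>1 z \<partial>spt a b)
        = (\<integral>\<^sup>+z. \<integral>\<^sup>+w. ?I (w, z) \<partial>time_kernel m1 \<nu>1 z \<partial>spt a b)" .
    qed
  qed
  have 2: "reversible_kernel (time_kernel m2 \<nu>1) ?N2"
  proof (rule reversible_kernel.intro)
    show "time_kernel m2 \<nu>1 \<in> measurable ?N2 (subprob_algebra ?N2)"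
    proof -
      have s: "sets ?N2 = sets (spt a b)" by simp
      have "measurable ?N2 (subprob_algebra ?N2) = measurable (spt a b) (subprob_algebra (spt a b))"
        by (rule measurable_cong_sets[OF s]) (simp only: subprob_algebra_cong[OF s])
      then show ?thesis using time_kernel_measurable[OF kernel2, of a b] by simp
    qed
    show "prob_space (time_kernel m2 \<nu>1 z)" if "z \<in> space ?N2" for z
      using time_kernel_prob[OF kernel2 prob2, of z a b] that by simp
    show "reversible ?N2 (time_kernel m2 \<nu>1) ?N2"
      unfolding reversible_def
    proof
      fix E assume "E \<in> sets (?N2 \<Otimes>\<^sub>M ?N2)"
      then have E[measurable]: "E \<in> sets (spt a b \<Otimes>\<^sub>M spt a b)"
        using sets_pair_measure_cong[of ?N2 "spt a b" ?N2 "spt a b"] by simp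
      let ?I = "\<lambda>z. indicator E z :: ennreal" and ?J = "\<lambda>z. indicator E (snd z, fst z) :: ennreal"
      have dens: "(\<integral>\<^sup>+z. \<integral>\<^sup>+w. F (z, w) \<partial>time_kernel m2 \<nu>1 z \<partial>?N2)
          = (\<integral>\<^sup>+t. \<integral>\<^sup>+x. \<integral>\<^sup>+y. F ((t, x), (t, y)) \<partial>m2 x \<partial>\<nu>2 \<partial>time_measure a b)"
        if F[measurable]: "F \<in> borel_measurable (spt a b \<Otimes>\<^sub>M spt a b)" for F
      proof -
        have m: "(\<lambda>z. \<integral>\<^sup>+w. F (z, w) \<partial>time_kernel m2 \<nu>1 z) \<in> borel_measurable (spt a b)"
          by (rule nn_integral_measurable_subprob_algebra2[where N="spt a b"]) (use time_kernel_measurable[OF kernel2] in auto)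
        have "(\<integral>\<^sup>+z. \<integral>\<^sup>+w. F (z, w) \<partial>time_kernel m2 \<nu>1 z \<partial>?N2)
           = (\<integral>\<^sup>+z. ennreal (\<mu> (snd z)) * (\<integral>\<^sup>+w. F (z, w) \<partial>time_kernel m2 \<nu>1 z) \<partial>spt a b)"
          using m by (subst nn_integral_density) auto
        also have "\<dots> = (\<integral>\<^sup>+t. \<integral>\<^sup>+x. ennreal (\<mu> x) * (\<integral>\<^sup>+y. F ((t, x), (t, y)) \<partial>m2 x) \<partial>\<nu>1 \<partial>time_measure a b)"
          using nn_integral_double_time_kernel[OF kernel2, of "\<lambda>x. ennreal (\<mu> x)" F] by simp
        also have "\<dots> = (\<integral>\<^sup>+t. \<integral>\<^sup>+x. \<integral>\<^sup>+y. F ((t, x), (t, y)) \<partial>m2 x \<partial>\<nu>2 \<partial>time_measure a b)"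
          using kernel_nn_integral_measurable2[OF slice_measurable[OF F]]
          by (intro nn_integral_cong[of "time_measure a b"] nn_integral_nu2) auto
        finally show ?thesis .
      qed
      have sl: "(\<lambda>(x, y). ?I ((t, x), (t, y))) \<in> borel_measurable (\<nu>2 \<Otimes>\<^sub>M \<nu>2)" for t
        using slice_measurable[of ?I] by (simp add: measurable_cong_sets[OF sets_pair_measure_cong[OF sets_nu2 sets_nu2] refl])
      have "(\<integral>\<^sup>+z. \<integral>\<^sup>+w. ?I (z, w) \<partial>time_kernel m2 \<nu>1 z \<partial>?N2)
          = (\<integral>\<^sup>+t. \<integral>\<^sup>+x. \<integral>\<^sup>+y. ?I ((t, x), (t, y)) \<partial>m2 x \<partial>\<nu>2 \<partial>time_measure a b)"
        by (rule dens) simp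
      also have "\<dots> = (\<integral>\<^sup>+t. \<integral>\<^sup>+x. \<integral>\<^sup>+y. ?I ((t, y), (t, x)) \<partial>m2 x \<partial>\<nu>2 \<partial>time_measure a b)"
        using K2.nn_integral_kernel_swap[OF sl] by (intro nn_integral_cong[of "time_measure a b"]) auto
      also have "\<dots> = (\<integral>\<^sup>+z. \<integral>\<^sup>+w. ?I (w, z) \<partial>time_kernel m2 \<nu>1 z \<partial>?N2)"
        using dens[of ?J] by simp
      finally show "(\<integral>\<^sup>+z. \<integral>\<^sup>+w. ?I (z, w) \<partial>time_kernel m2 \<nu>1 z \<partial>?N2)
        = (\<integral>\<^sup>+z. \<integral>\<^sup>+w. ?I (w, z) \<partial>time_kernel m2 \<nu>1 z \<partial>?N2)" .
    qed
  qed
  show ?thesis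
  proof (intro plap_space.intro plap_space_axioms.intro 1 2 q p c refl)
    show "sigma_finite_measure (spt a b)" by (rule PS.P.sigma_finite_measure_axioms)
    show "(\<lambda>z. \<mu> (snd z)) \<in> borel_measurable (spt a b)" by measurable
    show "AE z in spt a b. c \<le> \<mu> (snd z) \<and> \<mu> (snd z) \<le> C"
    proof (rule PS.AE_pair_measure)
      show "{z \<in> space (spt a b). c \<le> \<mu> (snd z) \<and> \<mu> (snd z) \<le> C} \<in> sets (spt a b)" by measurable
    qed (use mu_bounds in auto)
    show "emeasure (spt a b) (space (spt a b)) < \<infinity> \<or> 2 \<le> p"
    proof (cases "2 \<le> p")
      case False
      then have "emeasure \<nu>1 (space \<nu>1) < \<infinity>" using fin by auto
      moreover have "emeasure (time_measure a b) UNIV < \<infinity>"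
        using finite_measure.emeasure_finite[OF finite_time_measure, of a b UNIV] by (simp add: less_top)
      ultimately show ?thesis
        using S1.emeasure_pair_measure_Times[of UNIV "time_measure a b" "space \<nu>1"]
        by (simp add: space_pair_measure ennreal_mult_less_top)
    qed simp
  qed
qed

lemma AE_memL2_slice:
  assumes z: "memL2 (spt a b) z"
  shows "AE t in time_measure a b. inH (\<lambda>x. z (t, x))"
proof -
  note [measurable] = memL2_measurable[OF z]
  have "(\<integral>\<^sup>+t. \<integral>\<^sup>+x. ennreal ((z (t, x))\<^sup>2) \<partial>\<nu>1 \<partial>time_measure a b) = (\<integral>\<^sup>+w. ennreal ((z w)\<^sup>2) \<partial>spt a b)"
    by (subst S1.nn_integral_fst[symmetric]) auto
  also have "\<dots> \<noteq> \<infinity>" using z memL2_iff_nn_integral[of z "spt a b"] by auto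
  finally have "AE t in time_measure a b. (\<integral>\<^sup>+x. ennreal ((z (t, x))\<^sup>2) \<partial>\<nu>1) \<noteq> \<infinity>"
    by (intro nn_integral_PInf_AE) auto
  then show ?thesis by eventually_elim (subst memL2_iff_nn_integral, auto simp: less_top)
qed

text \<open>Kernel integrals on space-time are the kernel integrals of the slices at every point;
  finiteness of the space-time energy and norms passes to almost every slice by Tonelli.\<close>

lemma A_spt_slice:
  assumes A: "A_rel (time_kernel m1 \<nu>1) (spt a b) (time_kernel m2 \<nu>1)
     (density (spt a b) (\<lambda>z. ennreal (\<mu> (snd z)))) (\<lambda>z. \<mu> (snd z)) p q z \<zeta>"
  shows "AE t in time_measure a b. A (\<lambda>x. z (t, x)) (\<lambda>x. \<zeta> (t, x))"
proof -
  interpret ST: plap_space "time_kernel m1 \<nu>1" "spt a b" "time_kernel m2 \<nu>1"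
     "density (spt a b) (\<lambda>z. ennreal (\<mu> (snd z)))" "\<lambda>z. \<mu> (snd z)" c C p q
    by (rule plap_space_spt)
  have d: "ST.dom z" and \<zeta>: "memL2 (spt a b) \<zeta>" and W: "memL2 (spt a b) (ST.W1 z)" "memL2 (spt a b) (ST.W2 z)"
    and eq: "AE w in spt a b. \<zeta> w = - ST.W1 z w - \<mu> (snd w) * ST.W2 z w"
    using A by (auto simp: ST.A_rel_iff)
  note [measurable] = ST.dom_measurable[OF d] memL2_measurable[OF \<zeta>]
  have zm: "z \<in> jmeas" using ST.dom_measurable[OF d] by (simp add: measurable_spt)
  have w1: "ST.W1 z (t, x) = W1 (\<lambda>x. z (t, x)) x" if "x \<in> space \<nu>1" for t x
    unfolding ST.W1_def W1_def using zm
    by (subst integral_time_kernel[OF K1.kernel that]) auto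
  have w2: "ST.W2 z (t, x) = W2 (\<lambda>x. z (t, x)) x" if "x \<in> space \<nu>1" for t x
    unfolding ST.W2_def W2_def using zm
    by (subst integral_time_kernel[OF kernel2 that]) auto
  have gm: "grad z \<in> borel_measurable (spt a b \<Otimes>\<^sub>M spt a b)" by measurable
  have sl: "(\<lambda>(x, y). ennreal (\<bar>z (t, y) - z (t, x)\<bar> powr s)) \<in> borel_measurable (\<nu>1 \<Otimes>\<^sub>M \<nu>1)" for t s
    using slice_measurable[of "\<lambda>w. ennreal (\<bar>grad z w\<bar> powr s)" a b t] gm by (simp add: grad_def)
  have m1: "(\<lambda>t. \<integral>\<^sup>+x. \<integral>\<^sup>+y. ennreal (\<bar>z (t, y) - z (t, x)\<bar> powr q) \<partial>m1 x \<partial>\<nu>1) \<in> borel_measurable (time_measure a b)"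
  proof -
    have [measurable]: "(\<lambda>w. \<integral>\<^sup>+y. ennreal (\<bar>z (fst w, y) - z w\<bar> powr q) \<partial>m1 (snd w)) \<in> borel_measurable (spt a b)"
      by (rule nn_integral_measurable_subprob_algebra2[where N=\<nu>1]) measurable
    have "(\<lambda>t. \<integral>\<^sup>+x. (\<lambda>w. \<integral>\<^sup>+y. ennreal (\<bar>z (fst w, y) - z w\<bar> powr q) \<partial>m1 (snd w)) (t, x) \<partial>\<nu>1) \<in> borel_measurable (time_measure a b)"
      by measurable
    then show ?thesis by simp
  qed
  have m2: "(\<lambda>t. \<integral>\<^sup>+x. ennreal (\<mu> x) * (\<integral>\<^sup>+y. ennreal (\<bar>z (t, y) - z (t, x)\<bar> powr p) \<partial>m2 x) \<partial>\<nu>1) \<in> borel_measurable (time_measure a b)"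
  proof -
    note kernel2[measurable]
    have [measurable]: "(\<lambda>w. \<integral>\<^sup>+y. ennreal (\<bar>z (fst w, y) - z w\<bar> powr p) \<partial>m2 (snd w)) \<in> borel_measurable (spt a b)"
      by (rule nn_integral_measurable_subprob_algebra2[where N=\<nu>1]) measurable
    have "(\<lambda>t. \<integral>\<^sup>+x. (\<lambda>w. ennreal (\<mu> (snd w)) * (\<integral>\<^sup>+y. ennreal (\<bar>z (fst w, y) - z w\<bar> powr p) \<partial>m2 (snd w))) (t, x) \<partial>\<nu>1) \<in> borel_measurable (time_measure a b)"
      by measurable
    then show ?thesis by simp
  qed
  have "(\<integral>\<^sup>+t. \<integral>\<^sup>+x. \<integral>\<^sup>+y. ennreal (\<bar>z (t, y) - z (t, x)\<bar> powr q) \<partial>m1 x \<partial>\<nu>1 \<partial>time_measure a b)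
     = (\<integral>\<^sup>+w. \<integral>\<^sup>+w'. ennreal (\<bar>grad z (w, w')\<bar> powr q) \<partial>time_kernel m1 \<nu>1 w \<partial>spt a b)"
    using nn_integral_double_time_kernel[OF K1.kernel, of "\<lambda>_. 1" "\<lambda>w. ennreal (\<bar>grad z w\<bar> powr q)" a b] by (simp add: grad_def)
  also have "\<dots> = (\<integral>\<^sup>+w. ennreal (\<bar>grad z w\<bar> powr q) \<partial>ST.\<pi>1)"
    by (subst ST.K1.nn_integral_edge) auto
  also have "\<dots> \<noteq> \<infinity>" using d by (auto simp: ST.dom_def integrable_iff_bounded)
  finally have AE1: "AE t in time_measure a b. (\<integral>\<^sup>+x. \<integral>\<^sup>+y. ennreal (\<bar>z (t, y) - z (t, x)\<bar> powr q) \<partial>m1 x \<partial>\<nu>1) \<noteq> \<infinity>"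
    by (intro nn_integral_PInf_AE m1)
  have "(\<integral>\<^sup>+t. \<integral>\<^sup>+x. ennreal (\<mu> x) * (\<integral>\<^sup>+y. ennreal (\<bar>z (t, y) - z (t, x)\<bar> powr p) \<partial>m2 x) \<partial>\<nu>1 \<partial>time_measure a b)
     = (\<integral>\<^sup>+w. ennreal (\<mu> (snd w)) * (\<integral>\<^sup>+w'. ennreal (\<bar>grad z (w, w')\<bar> powr p) \<partial>time_kernel m2 \<nu>1 w) \<partial>spt a b)"
    using nn_integral_double_time_kernel[OF kernel2, of "\<lambda>x. ennreal (\<mu> x)" "\<lambda>w. ennreal (\<bar>grad z w\<bar> powr p)" a b] by (simp add: grad_def)
  also have "\<dots> = (\<integral>\<^sup>+w. \<integral>\<^sup>+w'. ennreal (\<bar>grad z (w, w')\<bar> powr p) \<partial>time_kernel m2 \<nu>1 w \<partial>density (spt a b) (\<lambda>z. ennreal (\<mu> (snd z))))"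
    by (rule ST.nn_integral_nu2, rule ST.kernel_nn_integral_measurable2) (use gm in measurable)
  also have "\<dots> = (\<integral>\<^sup>+w. ennreal (\<bar>grad z w\<bar> powr p) \<partial>ST.\<pi>2)"
    by (subst ST.K2.nn_integral_edge) auto
  also have "\<dots> \<noteq> \<infinity>" using d by (auto simp: ST.dom_def integrable_iff_bounded)
  finally have AE2: "AE t in time_measure a b. (\<integral>\<^sup>+x. ennreal (\<mu> x) * (\<integral>\<^sup>+y. ennreal (\<bar>z (t, y) - z (t, x)\<bar> powr p) \<partial>m2 x) \<partial>\<nu>1) \<noteq> \<infinity>"
    by (intro nn_integral_PInf_AE m2)
  have AE3: "AE t in time_measure a b. AE x in \<nu>1. \<zeta> (t, x) = - ST.W1 z (t, x) - \<mu> x * ST.W2 z (t, x)"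
    using pair_sigma_finite.AE_pair[OF pair_sigma_finite_spt eq] by simp
  show ?thesis
    using AE1 AE2 AE3 AE_memL2_slice[OF ST.dom_memL2[OF d]] AE_memL2_slice[OF \<zeta>] AE_memL2_slice[OF W(1)] AE_memL2_slice[OF W(2)]
  proof eventually_elim
    case (elim t)
    note [measurable] = memL2_measurable[OF elim(4)]
    have 1: "integrable \<pi>1 (\<lambda>w. \<bar>grad (\<lambda>x. z (t, x)) w\<bar> powr q)"
      using elim(1) by (auto simp: integrable_iff_bounded K1.nn_integral_edge grad_def less_top)
    have zm2: "(\<lambda>x. z (t, x)) \<in> borel_measurable \<nu>2" by simp
    have "(\<integral>\<^sup>+w. ennreal (\<bar>grad (\<lambda>x. z (t, x)) w\<bar> powr p) \<partial>\<pi>2)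
        = (\<integral>\<^sup>+x. \<integral>\<^sup>+y. ennreal (\<bar>z (t, y) - z (t, x)\<bar> powr p) \<partial>m2 x \<partial>\<nu>2)"
      using K2.grad_measurable[OF zm2] by (subst K2.nn_integral_edge) (auto simp: grad_def)
    also have "\<dots> = (\<integral>\<^sup>+x. ennreal (\<mu> x) * (\<integral>\<^sup>+y. ennreal (\<bar>z (t, y) - z (t, x)\<bar> powr p) \<partial>m2 x) \<partial>\<nu>1)"
      using kernel_nn_integral_measurable2[OF sl[of t p]] by (intro nn_integral_nu2[symmetric]) auto
    finally have 2: "integrable \<pi>2 (\<lambda>w. \<bar>grad (\<lambda>x. z (t, x)) w\<bar> powr p)"
      using elim(2) K2.grad_measurable[OF zm2] by (auto simp: integrable_iff_bounded less_top)
    have "inH (W1 (\<lambda>x. z (t, x)))"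
      by (rule memL2_cong_AE[OF elim(6)]) (auto simp: w1)
    moreover have "inH (W2 (\<lambda>x. z (t, x)))"
      by (rule memL2_cong_AE[OF elim(7)]) (auto simp: w2)
    moreover have "AE x in \<nu>1. \<zeta> (t, x) = - W1 (\<lambda>x. z (t, x)) x - \<mu> x * W2 (\<lambda>x. z (t, x)) x"
      using elim(3) AE_space by eventually_elim (simp add: w1 w2)
    ultimately show ?case unfolding A_rel_iff dom_def using elim 1 2 by auto
  qed
qed

text \<open>The resolvent with parameter 1 for almost every time at once, by one that is jointly
  measurable. The Minty argument compares the limit with this z.\<close>

lemma spt_resolvent:
  assumes h: "memL2 (spt a b) h"
  obtains z where "memL2 (spt a b) z"
    "AE t in time_measure a b. A (\<lambda>x. z (t, x)) (\<lambda>x. h (t, x) - z (t, x))"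
proof -
  interpret ST: plap_space "time_kernel m1 \<nu>1" "spt a b" "time_kernel m2 \<nu>1"
     "density (spt a b) (\<lambda>z. ennreal (\<mu> (snd z)))" "\<lambda>z. \<mu> (snd z)" c C p q
    by (rule plap_space_spt)
  obtain z where z: "ST.subgradient z (\<lambda>w. (h w - z w) / 1)" using ST.resolvent_subgradient[OF h, of 1] by auto
  then have "memL2 (spt a b) z" by (simp add: ST.subgradient_def ST.dom_def)
  moreover have "AE t in time_measure a b. A (\<lambda>x. z (t, x)) (\<lambda>x. (h (t, x) - z (t, x)) / 1)"
    by (rule A_spt_slice[OF ST.subgradient_imp_A[OF z]])
  ultimately show ?thesis using that by simp
qed

end

section \<open>The implicit Euler scheme\<close>

text \<open>Index of the time cell containing t, for cells closed on the left. After N steps of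
  length T/N the endpoint T itself has index N, one more than the last proper cell.\<close>

definition cell :: "real \<Rightarrow> real \<Rightarrow> nat" where
  "cell \<tau> t = nat \<lfloor>t / \<tau>\<rfloor>"

lemma cell_measurable[measurable]: "cell \<tau> \<in> measurable borel (count_space UNIV)"
  unfolding cell_def by measurable

lemma cell_bounds:
  assumes "0 < \<tau>" "0 \<le> t"
  shows "\<tau> * real (cell \<tau> t) \<le> t" "t < \<tau> * (real (cell \<tau> t) + 1)"
proof -
  have "0 \<le> \<lfloor>t / \<tau>\<rfloor>" using assms by simp
  then have *: "real (cell \<tau> t) = of_int \<lfloor>t / \<tau>\<rfloor>" by (simp add: cell_def)
  have "real (cell \<tau> t) \<le> t / \<tau>" "t / \<tau> < real (cell \<tau> t) + 1" unfolding * by linarith+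
  then show "\<tau> * real (cell \<tau> t) \<le> t" "t < \<tau> * (real (cell \<tau> t) + 1)"
    using assms by (auto simp: field_simps)
qed

lemma cell_eqI:
  assumes "0 < \<tau>" "\<tau> * real k \<le> t" "t < \<tau> * (real k + 1)"
  shows "cell \<tau> t = k"
proof -
  have "\<lfloor>t / \<tau>\<rfloor> = int k" using assms by (intro floor_unique) (auto simp: field_simps)
  then show ?thesis by (simp add: cell_def)
qed

lemma cell_mono: "0 < \<tau> \<Longrightarrow> s \<le> t \<Longrightarrow> cell \<tau> s \<le> cell \<tau> t"
  unfolding cell_def by (intro nat_mono floor_mono divide_right_mono) auto

lemma cell_end: "0 < T \<Longrightarrow> 0 < N \<Longrightarrow> cell (T / real N) T = N"
  by (rule cell_eqI) (auto simp: field_simps)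

lemma step_has_integral:
  fixes \<Gamma> :: "nat \<Rightarrow> real"
  assumes \<tau>: "0 < \<tau>" and "\<tau> * real k \<le> t" "t \<le> \<tau> * (real k + 1)"
  shows "((\<lambda>s. \<Gamma> (cell \<tau> s)) has_integral \<tau> * (\<Sum>j<k. \<Gamma> j) + (t - \<tau> * real k) * \<Gamma> k) {0..t}"
  using assms(2,3)
proof (induction k arbitrary: t)
  case (0 t)
  have "((\<lambda>s. \<Gamma> 0) has_integral (t - 0) * \<Gamma> 0) {0..t}"
    using 0 has_integral_const_real[of "\<Gamma> 0" 0 t] by simp
  then have "((\<lambda>s. \<Gamma> (cell \<tau> s)) has_integral (t - 0) * \<Gamma> 0) {0..t}"
  proof (rule has_integral_spike_finite[of "{t}", rotated 2])
    fix s assume s: "s \<in> {0..t} - {t}"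
    have "cell \<tau> s = 0" using \<tau> s 0 by (intro cell_eqI) auto
    then show "\<Gamma> (cell \<tau> s) = \<Gamma> 0" by simp
  qed simp
  then show ?case by simp
next
  case (Suc k t)
  let ?a = "\<tau> * real (Suc k)"
  have 1: "((\<lambda>s. \<Gamma> (cell \<tau> s)) has_integral \<tau> * (\<Sum>j<k. \<Gamma> j) + (?a - \<tau> * real k) * \<Gamma> k) {0..?a}"
    using \<tau> by (intro Suc.IH) (auto simp: algebra_simps)
  have "((\<lambda>s. \<Gamma> (Suc k)) has_integral (t - ?a) * \<Gamma> (Suc k)) {?a..t}"
    using Suc.prems has_integral_const_real[of "\<Gamma> (Suc k)" ?a t] by simp
  then have 2: "((\<lambda>s. \<Gamma> (cell \<tau> s)) has_integral (t - ?a) * \<Gamma> (Suc k)) {?a..t}"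
  proof (rule has_integral_spike_finite[of "{t}", rotated 2])
    fix s assume s: "s \<in> {?a..t} - {t}"
    have "cell \<tau> s = Suc k" using \<tau> s Suc.prems by (intro cell_eqI) auto
    then show "\<Gamma> (cell \<tau> s) = \<Gamma> (Suc k)" by simp
  qed simp
  have "((\<lambda>s. \<Gamma> (cell \<tau> s)) has_integral
      (\<tau> * (\<Sum>j<k. \<Gamma> j) + (?a - \<tau> * real k) * \<Gamma> k) + (t - ?a) * \<Gamma> (Suc k)) {0..t}"
    using \<tau> Suc.prems by (intro has_integral_combine[OF _ _ 1 2]) auto
  then show ?case by (simp add: algebra_simps)
qed

lemma step_set_integrable:
  fixes \<Gamma> :: "nat \<Rightarrow> real"
  assumes \<tau>: "0 < \<tau>"
  shows "set_integrable lborel {a..t} (\<lambda>s. \<Gamma> (cell \<tau> s))"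
  unfolding set_integrable_def
proof (rule Bochner_Integration.integrable_bound)
  let ?B = "\<Sum>j\<le>cell \<tau> t. \<bar>\<Gamma> j\<bar>"
  show "integrable lborel (\<lambda>s. ?B * indicator {a..t} s)"
    by (intro integrable_mult_right) (auto simp: emeasure_lborel_Icc_eq)
  show "(\<lambda>s. indicator {a..t} s *\<^sub>R \<Gamma> (cell \<tau> s)) \<in> borel_measurable lborel" by measurable
  have "\<bar>\<Gamma> (cell \<tau> s)\<bar> \<le> ?B" if "s \<le> t" for s
    by (rule member_le_sum) (use cell_mono[OF \<tau> that] in auto)
  then show "AE s in lborel. norm (indicator {a..t} s *\<^sub>R \<Gamma> (cell \<tau> s)) \<le> norm (?B * indicator {a..t} s)"
    by (intro AE_I2) (auto split: split_indicator intro: order_trans)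
qed

lemma step_integral:
  fixes \<Gamma> :: "nat \<Rightarrow> real"
  assumes \<tau>: "0 < \<tau>" and t: "0 \<le> t"
  shows "(LINT s:{0..t}|lborel. \<Gamma> (cell \<tau> s)) = \<tau> * (\<Sum>j<cell \<tau> t. \<Gamma> j) + (t - \<tau> * real (cell \<tau> t)) * \<Gamma> (cell \<tau> t)"
  using step_has_integral[OF \<tau> cell_bounds(1)[OF assms] less_imp_le[OF cell_bounds(2)[OF assms]], of \<Gamma>]
    set_borel_integral_eq_integral(2)[OF step_set_integrable[OF \<tau>, of 0 t \<Gamma>]]
  by (simp add: integral_unique)

lemma set_integral_Icc_combine:
  fixes f :: "real \<Rightarrow> real"
  assumes "a \<le> b" "b \<le> d" "set_integrable lborel {a..d} f"
  shows "(LINT s:{a..d}|lborel. f s) = (LINT s:{a..b}|lborel. f s) + (LINT s:{b..d}|lborel. f s)"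
proof -
  have i: "set_integrable lborel {a..b} f" "set_integrable lborel {b..d} f"
    using assms by (auto intro: set_integrable_subset[OF assms(3)])
  show ?thesis
    using Henstock_Kurzweil_Integration.integral_combine[OF assms(1,2) set_borel_integral_eq_integral(1)[OF assms(3)]]
    by (simp add: set_borel_integral_eq_integral(2) assms(3) i)
qed

lemma nn_step_integral:
  fixes \<Gamma> :: "nat \<Rightarrow> real"
  assumes T: "0 < T" "0 < N" and pos: "\<And>k. 0 \<le> \<Gamma> k"
  shows "(\<integral>\<^sup>+t. ennreal (\<Gamma> (cell (T / real N) t)) \<partial>time_measure 0 T) = ennreal (T / real N * (\<Sum>j<N. \<Gamma> j))"
proof -
  let ?\<tau> = "T / real N"
  have \<tau>: "0 < ?\<tau>" using T by simp
  have "(\<integral>\<^sup>+t. ennreal (\<Gamma> (cell ?\<tau> t)) \<partial>time_measure 0 T) = (\<integral>\<^sup>+t. ennreal (indicator {0..T} t *\<^sub>R \<Gamma> (cell ?\<tau> t)) \<partial>lborel)"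
    by (subst nn_integral_time_measure) (auto intro!: nn_integral_cong split: split_indicator)
  also have "\<dots> = ennreal (LINT t:{0..T}|lborel. \<Gamma> (cell ?\<tau> t))"
    unfolding set_lebesgue_integral_def
    by (rule nn_integral_eq_integral)
      (use step_set_integrable[OF \<tau>, of 0 T \<Gamma>] pos in \<open>auto simp: set_integrable_def\<close>)
  also have "(LINT t:{0..T}|lborel. \<Gamma> (cell ?\<tau> t)) = ?\<tau> * (\<Sum>j<N. \<Gamma> j)"
    using T \<tau> by (subst step_integral) (auto simp: cell_end)
  finally show ?thesis .
qed

section \<open>A priori estimates for one implicit Euler sequence\<close>

context plap_space
begin

text \<open>\<open>F k\<close> acts on the cell with index k, and the subgradient is taken at the
  new value \<open>U (Suc k)\<close>. The sequence is infinite; the number of steps appears only in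
  the estimates.\<close>

definition euler_seq :: "real \<Rightarrow> (nat \<Rightarrow> 'a \<Rightarrow> real) \<Rightarrow> (nat \<Rightarrow> 'a \<Rightarrow> real) \<Rightarrow> bool" where
  "euler_seq \<tau> F U \<longleftrightarrow> 0 < \<tau> \<and> dom (U 0) \<and> (\<forall>k. inH (F k)) \<and>
     (\<forall>k. subgradient (U (Suc k)) (\<lambda>x. F k x - (U (Suc k) x - U k x) / \<tau>))"

lemma euler_seq_exists:
  assumes \<tau>: "0 < \<tau>" and u0: "dom u0" and F: "\<And>k. inH (F k)"
  obtains U where "euler_seq \<tau> F U" "U 0 = u0"
proof -
  define J where "J h = (SOME u. subgradient u (\<lambda>x. (h x - u x) / \<tau>))" for h
  have J: "subgradient (J h) (\<lambda>x. (h x - J h x) / \<tau>)" if "inH h" for h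
    unfolding J_def
    by (rule someI_ex[of "\<lambda>u. subgradient u (\<lambda>x. (h x - u x) / \<tau>)"], rule resolvent_subgradient[OF that \<tau>]) blast
  define U where "U = rec_nat u0 (\<lambda>k u. J (\<lambda>x. u x + \<tau> * F k x))"
  have U: "U 0 = u0" "\<And>k. U (Suc k) = J (\<lambda>x. U k x + \<tau> * F k x)" by (auto simp: U_def)
  have step: "subgradient (U (Suc k)) (\<lambda>x. (U k x + \<tau> * F k x - U (Suc k) x) / \<tau>)" if "dom (U k)" for k
    using J[of "\<lambda>x. U k x + \<tau> * F k x"] dom_memL2[OF that] F by (simp add: U memL2_add memL2_cmult)
  have d: "dom (U k)" for k
    by (induction k) (use u0 step in \<open>auto simp: U(1) subgradient_def\<close>)
  have "(\<lambda>x. (U k x + \<tau> * F k x - U (Suc k) x) / \<tau>) = (\<lambda>x. F k x - (U (Suc k) x - U k x) / \<tau>)" for k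
    using \<tau> by (auto simp: field_simps)
  then have "euler_seq \<tau> F U" unfolding euler_seq_def using step[OF d] \<tau> F d by auto
  then show ?thesis using that U by blast
qed

context
  fixes \<tau> F U V
  assumes E: "euler_seq \<tau> F U"
  defines "V \<equiv> \<lambda>k x. (U (Suc k) x - U k x) / \<tau>"
begin

lemma euler_tau: "0 < \<tau>" using E by (simp add: euler_seq_def)

lemma euler_subgradient: "subgradient (U (Suc k)) (\<lambda>x. F k x - V k x)"
  using E by (simp add: euler_seq_def V_def)

lemma euler_dom: "dom (U k)"
  using E by (cases k) (auto simp: euler_seq_def subgradient_def)

lemma euler_memL2: "inH (U k)" "inH (V k)" "inH (F k)"
  using E dom_memL2[OF euler_dom] by (auto simp: V_def euler_seq_def intro!: memL2_divide memL2_diff)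

text \<open>The subgradient inequality at the new value is tested with the old value
  \<open>U k\<close>. Half of the square of the difference quotient absorbs its product with the
  force.\<close>

lemma euler_energy:
  "En (U (Suc k)) + \<tau> / 2 * (nH (V k))\<^sup>2 \<le> En (U k) + \<tau> / 2 * (nH (F k))\<^sup>2"
proof -
  note [simp] = memL2_mult_integrable[OF euler_memL2(3)[of k] euler_memL2(2)[of k]] memL2_integrable[OF euler_memL2(2)[of k]]
    memL2_integrable[OF euler_memL2(3)[of k]]
  have "En (U (Suc k)) + (\<integral>x. (F k x - V k x) * (U k x - U (Suc k) x) \<partial>\<nu>1) \<le> En (U k)"
    using euler_subgradient[of k] euler_dom[of k] by (auto simp: subgradient_def)
  also have "(\<integral>x. (F k x - V k x) * (U k x - U (Suc k) x) \<partial>\<nu>1) = (\<integral>x. \<tau> * ((V k x)\<^sup>2 - F k x * V k x) \<partial>\<nu>1)"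
  proof (rule Bochner_Integration.integral_cong)
    fix x
    have "U k x - U (Suc k) x = - (\<tau> * V k x)" using euler_tau by (simp add: V_def)
    then show "(F k x - V k x) * (U k x - U (Suc k) x) = \<tau> * ((V k x)\<^sup>2 - F k x * V k x)"
      by (simp only:) (simp add: algebra_simps power2_eq_square)
  qed simp
  finally have 1: "En (U (Suc k)) + (\<integral>x. \<tau> * ((V k x)\<^sup>2 - F k x * V k x) \<partial>\<nu>1) \<le> En (U k)" .
  have "(\<integral>x. \<tau> * ((V k x)\<^sup>2 / 2 - (F k x)\<^sup>2 / 2) \<partial>\<nu>1) \<le> (\<integral>x. \<tau> * ((V k x)\<^sup>2 - F k x * V k x) \<partial>\<nu>1)"
  proof (rule integral_mono)
    fix x
    have "0 \<le> (F k x - V k x)\<^sup>2" by simp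
    then have "(V k x)\<^sup>2 / 2 - (F k x)\<^sup>2 / 2 \<le> (V k x)\<^sup>2 - F k x * V k x" by (simp add: power2_diff)
    then show "\<tau> * ((V k x)\<^sup>2 / 2 - (F k x)\<^sup>2 / 2) \<le> \<tau> * ((V k x)\<^sup>2 - F k x * V k x)"
      using euler_tau by (intro mult_left_mono) auto
  qed simp_all
  also have "(\<integral>x. \<tau> * ((V k x)\<^sup>2 / 2 - (F k x)\<^sup>2 / 2) \<partial>\<nu>1) = \<tau> / 2 * (nH (V k))\<^sup>2 - \<tau> / 2 * (nH (F k))\<^sup>2"
    by (simp add: L2n_power2 right_diff_distrib)
  finally show ?thesis using 1 by linarith
qed

text \<open>Tested with 0, where the energy vanishes. The energy thereby appears on the left with
  factor \<tau>, which after summation bounds its time integral without reference to the initial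
  energy.\<close>

lemma euler_zero_test:
  "\<tau> * En (U (Suc k)) + (nH (U (Suc k)))\<^sup>2 / 2 \<le> (nH (U k))\<^sup>2 / 2 + \<tau> * (nH (F k) * nH (U (Suc k)))"
proof -
  note [simp] = memL2_mult_integrable[OF euler_memL2(3)[of k] euler_memL2(1)[of "Suc k"]] memL2_integrable[OF euler_memL2(1)[of k]]
    memL2_integrable[OF euler_memL2(1)[of "Suc k"]] memL2_mult_integrable[OF euler_memL2(2)[of k] euler_memL2(1)[of "Suc k"]]
  have "En (U (Suc k)) + (\<integral>x. (F k x - V k x) * (0 - U (Suc k) x) \<partial>\<nu>1) \<le> En (\<lambda>x. 0)"
    using euler_subgradient[of k] dom_zero unfolding subgradient_def by blast
  also have "(\<integral>x. (F k x - V k x) * (0 - U (Suc k) x) \<partial>\<nu>1) = (\<integral>x. V k x * U (Suc k) x \<partial>\<nu>1) - (\<integral>x. F k x * U (Suc k) x \<partial>\<nu>1)"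
    by (subst Bochner_Integration.integral_diff[symmetric]) (auto simp: algebra_simps)
  finally have 1: "En (U (Suc k)) + (\<integral>x. V k x * U (Suc k) x \<partial>\<nu>1) \<le> (\<integral>x. F k x * U (Suc k) x \<partial>\<nu>1)" by simp
  have "(nH (U (Suc k)))\<^sup>2 / 2 - (nH (U k))\<^sup>2 / 2 = (\<integral>x. (U (Suc k) x)\<^sup>2 / 2 - (U k x)\<^sup>2 / 2 \<partial>\<nu>1)"
    by (simp add: L2n_power2)
  also have "\<dots> \<le> (\<integral>x. \<tau> * (V k x * U (Suc k) x) \<partial>\<nu>1)"
  proof (rule integral_mono)
    fix x
    have "0 \<le> (U (Suc k) x - U k x)\<^sup>2" by simp
    moreover have "\<tau> * (V k x * U (Suc k) x) = (U (Suc k) x - U k x) * U (Suc k) x" using euler_tau by (simp add: V_def)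
    ultimately show "(U (Suc k) x)\<^sup>2 / 2 - (U k x)\<^sup>2 / 2 \<le> \<tau> * (V k x * U (Suc k) x)"
      by (simp add: power2_eq_square algebra_simps)
  qed simp_all
  also have "\<dots> = \<tau> * (\<integral>x. V k x * U (Suc k) x \<partial>\<nu>1)" by simp
  finally have 2: "(nH (U (Suc k)))\<^sup>2 / 2 - (nH (U k))\<^sup>2 / 2 \<le> \<tau> * (\<integral>x. V k x * U (Suc k) x \<partial>\<nu>1)" .
  have "En (U (Suc k)) + (\<integral>x. V k x * U (Suc k) x \<partial>\<nu>1) \<le> nH (F k) * nH (U (Suc k))"
    using 1 L2_Cauchy_Schwarz[OF euler_memL2(3)[of k] euler_memL2(1)[of "Suc k"]] by simp
  then have "\<tau> * (En (U (Suc k)) + (\<integral>x. V k x * U (Suc k) x \<partial>\<nu>1)) \<le> \<tau> * (nH (F k) * nH (U (Suc k)))"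
    using euler_tau by (intro mult_left_mono) auto
  then show ?thesis using 2 by (simp add: distrib_left)
qed

text \<open>The zero test bounds the increase of the norm by 2\<tau> times the norm of the force.
  The final replacement of 2f by 1 + f^2 lets the sum of squared forces be the only datum of the
  later bounds.\<close>

lemma euler_norm_step: "nH (U (Suc k)) \<le> nH (U k) + \<tau> * (1 + (nH (F k))\<^sup>2)"
proof -
  let ?a = "nH (U (Suc k))" and ?b = "nH (U k)" and ?f = "nH (F k)"
  have "?a \<le> ?b + 2 * \<tau> * ?f"
  proof (rule ccontr)
    assume "\<not> ?thesis"
    then have "2 * \<tau> * ?f < ?a - ?b" by simp
    moreover have "0 \<le> 2 * \<tau> * ?f" using euler_tau by simp
    ultimately have "0 < ?a - ?b" by linarith
    then have "0 < ?a" using L2n_nonneg[of \<nu>1 "U k"] by linarith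
    then have "2 * \<tau> * ?f * ?a < (?a - ?b) * ?a"
      using \<open>2 * \<tau> * ?f < ?a - ?b\<close> by (intro mult_strict_right_mono)
    also have "\<dots> \<le> (?a - ?b) * (?a + ?b)" using \<open>0 < ?a - ?b\<close> by (intro mult_left_mono) auto
    finally have "2 * \<tau> * ?f * ?a < (?a - ?b) * (?a + ?b)" .
    moreover have "0 \<le> \<tau> * En (U (Suc k))" using euler_tau En_nonneg by simp
    ultimately show False using euler_zero_test[of k] by (simp add: algebra_simps power2_eq_square)
  qed
  also have "2 * \<tau> * ?f \<le> \<tau> * (1 + ?f\<^sup>2)"
  proof -
    have "0 \<le> (1 - ?f)\<^sup>2" by simp
    then have "2 * ?f \<le> 1 + ?f\<^sup>2" by (simp add: power2_diff)
    then have "\<tau> * (2 * ?f) \<le> \<tau> * (1 + ?f\<^sup>2)" using euler_tau by (intro mult_left_mono) auto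
    then show ?thesis by (simp add: mult_ac)
  qed
  finally show ?thesis by simp
qed

lemma euler_norm: "nH (U k) \<le> nH (U 0) + \<tau> * real k + \<tau> * (\<Sum>j<k. (nH (F j))\<^sup>2)"
proof (induction k)
  case (Suc k)
  then show ?case using euler_norm_step[of k] by (simp add: algebra_simps)
qed simp

lemma euler_sum_V: "\<tau> * (\<Sum>j<k. (nH (V j))\<^sup>2) + 2 * En (U k) \<le> 2 * En (U 0) + \<tau> * (\<Sum>j<k. (nH (F j))\<^sup>2)"
proof (induction k)
  case (Suc k)
  then show ?case using euler_energy[of k] by (simp add: algebra_simps)
qed simp

text \<open>Summation of the zero test. Only the L^2 norm of the initial value enters, and this is
  what makes the weighted estimate usable for data of infinite energy.\<close>

lemma euler_sum_En:
  assumes "\<And>j. j \<le> N \<Longrightarrow> nH (U j) \<le> R" and "k \<le> N"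
  shows "\<tau> * (\<Sum>j<k. En (U (Suc j))) + (nH (U k))\<^sup>2 / 2 \<le> (nH (U 0))\<^sup>2 / 2 + R * (\<tau> * real k + \<tau> * (\<Sum>j<k. (nH (F j))\<^sup>2))"
  using assms(2)
proof (induction k)
  case (Suc k)
  let ?f = "nH (F k)"
  have R: "0 \<le> R" using assms(1)[of 0] L2n_nonneg[of \<nu>1 "U 0"] by linarith
  have f: "?f \<le> 1 + ?f\<^sup>2"
  proof -
    have "0 \<le> (1 - ?f)\<^sup>2" by simp
    then have "2 * ?f \<le> 1 + ?f\<^sup>2" by (simp add: power2_diff)
    then show ?thesis using L2n_nonneg[of \<nu>1 "F k"] by linarith
  qed
  have "?f * nH (U (Suc k)) \<le> (1 + ?f\<^sup>2) * R"
    by (intro mult_mono f assms) (use Suc in auto)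
  then have "\<tau> * (?f * nH (U (Suc k))) \<le> \<tau> * ((1 + ?f\<^sup>2) * R)" using euler_tau by (intro mult_left_mono) auto
  then show ?case using Suc euler_zero_test[of k] by (simp add: algebra_simps)
qed simp

text \<open>The energy inequality multiplied by the time \<tau> k and summed by parts, a discrete
  version of testing with t u_t. The weight kills the initial energy, and the sum of energies on the
  right is controlled by \<open>euler_sum_En\<close>.\<close>

lemma euler_weighted:
  assumes "k \<le> N" "\<tau> * real N \<le> T"
  shows "\<tau> * (\<Sum>j<k. \<tau> * real j * (nH (V j))\<^sup>2) + 2 * (\<tau> * real k) * En (U k)
     \<le> 2 * (\<tau> * (\<Sum>j<k. En (U (Suc j)))) + T * (\<tau> * (\<Sum>j<k. (nH (F j))\<^sup>2))"
  using assms(1)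
proof (induction k)
  case (Suc k)
  let ?v = "(nH (V k))\<^sup>2" and ?f = "(nH (F k))\<^sup>2" and ?e = "En (U k)" and ?e' = "En (U (Suc k))"
  have k0: "0 \<le> \<tau> * real k" using euler_tau by simp
  have "\<tau> * real k \<le> \<tau> * real N" using Suc.prems euler_tau by (intro mult_left_mono) auto
  then have kT: "\<tau> * real k \<le> T" using assms by simp
  have "\<tau> * ?v \<le> 2 * (?e - ?e') + \<tau> * ?f" using euler_energy[of k] by argo
  then have "(\<tau> * real k) * (\<tau> * ?v) \<le> (\<tau> * real k) * (2 * (?e - ?e') + \<tau> * ?f)"
    using k0 by (intro mult_left_mono) auto
  moreover have "(\<tau> * real k) * (\<tau> * ?f) \<le> T * (\<tau> * ?f)"
    using kT euler_tau by (intro mult_right_mono) auto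
  ultimately show ?case using Suc by (simp add: algebra_simps)
qed simp

end

end

lemma step_measurable:
  assumes [measurable]: "\<And>k. G k \<in> borel_measurable \<nu>"
  shows "(\<lambda>(t, x). G (cell \<tau> t) x :: real) \<in> borel_measurable (borel \<Otimes>\<^sub>M \<nu>)"
  using measurable_compose_countable[of "\<lambda>i z. G i (snd z)" "borel \<Otimes>\<^sub>M \<nu>" borel "\<lambda>z. cell \<tau> (fst z)"]
  by (simp add: split_beta)

section \<open>Euler sequences as functions of continuous time\<close>

context plap_space
begin

text \<open>\<open>ub\<close> and \<open>uh\<close> are the piecewise constant and piecewise linear interpolants of an implicit Euler
  scheme with step \<open>\<tau>\<close>, and \<open>vb\<close> is the derivative of \<open>uh\<close>. The bound on \<open>vb\<close> with weight \<open>t\<close> does not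
  involve the initial energy, hence survives the passage to initial data of infinite energy.\<close>

definition approx_solution :: "real \<Rightarrow> real \<Rightarrow> ('a \<Rightarrow> real) \<Rightarrow> (real \<Rightarrow> 'a \<Rightarrow> real) \<Rightarrow> real \<Rightarrow>
    (real \<Rightarrow> 'a \<Rightarrow> real) \<Rightarrow> (real \<Rightarrow> 'a \<Rightarrow> real) \<Rightarrow> (real \<Rightarrow> 'a \<Rightarrow> real) \<Rightarrow> bool" where
  "approx_solution T \<tau> u0 f S ub uh vb \<longleftrightarrow>
    0 < \<tau> \<and> dom u0 \<and> 0 \<le> S \<and>
    case_prod f \<in> jmeas \<and> case_prod ub \<in> jmeas \<and>
    case_prod uh \<in> jmeas \<and> case_prod vb \<in> jmeas \<and>
    (\<forall>t\<ge>0. subgradient (ub t) (\<lambda>x. f t x - vb t x) \<and> inH (f t) \<and> inH (vb t) \<and> dom (uh t)) \<and>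
    uh 0 = u0 \<and>
    (\<forall>x s t. 0 \<le> s \<longrightarrow> s \<le> t \<longrightarrow> set_integrable lborel {s..t} (\<lambda>r. vb r x) \<and>
        uh t x - uh s x = (LINT r:{s..t}|lborel. vb r x)) \<and>
    (\<forall>t\<ge>0. \<forall>x. \<bar>uh t x - ub t x\<bar> \<le> \<tau> * \<bar>vb t x\<bar> \<and> 0 \<le> vb t x * (ub t x - uh t x)) \<and>
    (\<exists>\<epsilon>. \<epsilon> \<in> borel_measurable borel \<and> (\<forall>t\<ge>0. 0 \<le> \<epsilon> t \<and> En (uh t) - En (ub t) \<le> \<epsilon> t) \<and>
        (\<integral>\<^sup>+t. ennreal (\<epsilon> t) \<partial>time_measure 0 T) \<le> ennreal (\<tau> * (En u0 + S / 2))) \<and>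
    (\<integral>\<^sup>+t. ennreal ((nH (f t))\<^sup>2) \<partial>time_measure 0 T) \<le> ennreal S \<and>
    (\<integral>\<^sup>+t. ennreal ((nH (vb t))\<^sup>2) \<partial>time_measure 0 T) \<le> ennreal (2 * En u0 + S) \<and>
    (\<integral>\<^sup>+t. ennreal (t * of_bool (\<tau> \<le> t) * (nH (vb t))\<^sup>2) \<partial>time_measure 0 T)
      \<le> ennreal (2 * ((nH u0)\<^sup>2 + 2 * (nH u0 + T + S) * (T + S) + T * S)) \<and>
    (\<forall>t\<in>{0..T}. nH (uh t) \<le> nH u0 + T + S)"

lemma euler_approx_solution:
  assumes E: "euler_seq \<tau> F U" and T: "0 < T" "0 < N" and \<tau>: "\<tau> = T / real N"
  defines "V \<equiv> \<lambda>k x. (U (Suc k) x - U k x) / \<tau>"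
  shows "approx_solution T \<tau> (U 0) (\<lambda>t. F (cell \<tau> t)) (\<tau> * (\<Sum>j<N. (nH (F j))\<^sup>2))
    (\<lambda>t. U (Suc (cell \<tau> t))) (\<lambda>t x. U (cell \<tau> t) x + (t - \<tau> * real (cell \<tau> t)) * V (cell \<tau> t) x) (\<lambda>t. V (cell \<tau> t))"
proof -
  have Vkx: "V k x = (U (Suc k) x - U k x) / \<tau>" for k x by (simp add: V_def)
  note eV = Vkx[symmetric]
  note mem = euler_memL2[OF E, folded Vkx]
  note d = euler_dom[OF E]
  let ?S = "\<tau> * (\<Sum>j<N. (nH (F j))\<^sup>2)"
  let ?R = "nH (U 0) + T + ?S"
  have t0: "0 < \<tau>" by (rule euler_tau[OF E])
  have \<tau>N: "\<tau> * real N = T" using T \<tau> by simp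
  have [measurable]: "U k \<in> borel_measurable \<nu>1" "V k \<in> borel_measurable \<nu>1" "F k \<in> borel_measurable \<nu>1" for k
    using mem by (auto dest: memL2_measurable)
  have S0: "0 \<le> ?S" using t0 by (intro mult_nonneg_nonneg sum_nonneg) auto
  have Sk: "\<tau> * (\<Sum>j<k. (nH (F j))\<^sup>2) \<le> ?S" if "k \<le> N" for k
    using t0 that by (intro mult_left_mono sum_mono2) auto
  have R: "nH (U k) \<le> ?R" if k: "k \<le> N" for k
  proof -
    have "\<tau> * real k \<le> \<tau> * real N" using t0 k by (intro mult_left_mono) auto
    then show ?thesis using euler_norm[OF E, of k] Sk[OF k] \<tau>N by linarith
  qed
  \<comment> \<open>On its cell the linear interpolant is a convex combination of the old and the
    new value, so convexity of \<open>En\<close> and the triangle inequality apply to it.\<close>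
  have conv: "U (cell \<tau> t) x + (t - \<tau> * real (cell \<tau> t)) * V (cell \<tau> t) x
      = (1 - (t - \<tau> * real (cell \<tau> t)) / \<tau>) * U (cell \<tau> t) x + (t - \<tau> * real (cell \<tau> t)) / \<tau> * U (Suc (cell \<tau> t)) x" for t x
    using t0 by (simp add: V_def field_simps)
  have th: "0 \<le> (t - \<tau> * real (cell \<tau> t)) / \<tau>" "(t - \<tau> * real (cell \<tau> t)) / \<tau> \<le> 1" if "0 \<le> t" for t
    using cell_bounds[OF t0 that] t0 by (auto simp: field_simps)
  have U_sum: "U k x = U 0 x + \<tau> * (\<Sum>j<k. V j x)" for k x
  proof (induction k)
    case (Suc k)
    have "\<tau> * V k x = U (Suc k) x - U k x" using t0 by (simp add: V_def)
    then show ?case using Suc by (simp add: distrib_left)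
  qed simp
  have uh_int: "U (cell \<tau> t) x + (t - \<tau> * real (cell \<tau> t)) * V (cell \<tau> t) x
      = U 0 x + (LINT r:{0..t}|lborel. V (cell \<tau> r) x)" if "0 \<le> t" for t x
    unfolding step_integral[OF t0 that, of "\<lambda>k. V k x"] by (subst U_sum) simp
  show ?thesis
    unfolding approx_solution_def
  proof (intro conjI allI impI ballI)
    show "(\<lambda>(t, x). U (cell \<tau> t) x + (t - \<tau> * real (cell \<tau> t)) * V (cell \<tau> t) x) \<in> jmeas"
    proof -
      note step_measurable[of U \<nu>1 \<tau>, unfolded split_beta, measurable] step_measurable[of V \<nu>1 \<tau>, unfolded split_beta, measurable]
      show ?thesis unfolding split_beta by measurable
    qed
    show "subgradient (U (Suc (cell \<tau> t))) (\<lambda>x. F (cell \<tau> t) x - V (cell \<tau> t) x)" for t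
      using euler_subgradient[OF E, of "cell \<tau> t"] unfolding eV .
    show "dom (\<lambda>x. U (cell \<tau> t) x + (t - \<tau> * real (cell \<tau> t)) * V (cell \<tau> t) x)" if "0 \<le> t" for t
      unfolding conv by (rule En_convex(1)[OF d d th[OF that]])
    show "(\<lambda>x. U (cell \<tau> 0) x + (0 - \<tau> * real (cell \<tau> 0)) * V (cell \<tau> 0) x) = U 0"
      by (simp add: cell_def)
    show "set_integrable lborel {s..t} (\<lambda>r. V (cell \<tau> r) x)" for x s t
      by (rule step_set_integrable[OF t0])
    show "U (cell \<tau> t) x + (t - \<tau> * real (cell \<tau> t)) * V (cell \<tau> t) x -
        (U (cell \<tau> s) x + (s - \<tau> * real (cell \<tau> s)) * V (cell \<tau> s) x) = (LINT r:{s..t}|lborel. V (cell \<tau> r) x)"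
      if "0 \<le> s" "s \<le> t" for s t x
      using set_integral_Icc_combine[OF that step_set_integrable[OF t0], of "\<lambda>k. V k x"] that
      by (subst (1 2) uh_int) auto
    fix t :: real assume t: "0 \<le> t"
    \<comment> \<open>The two interpolants differ by the time remaining in the cell times the
      difference quotient. This factor lies between 0 and \<tau>, which gives both the size and the
      sign condition.\<close>
    have diff: "U (Suc (cell \<tau> t)) x - (U (cell \<tau> t) x + (t - \<tau> * real (cell \<tau> t)) * V (cell \<tau> t) x)
        = (\<tau> * (real (cell \<tau> t) + 1) - t) * V (cell \<tau> t) x" for x
    proof -
      have "U (Suc (cell \<tau> t)) x = U (cell \<tau> t) x + \<tau> * V (cell \<tau> t) x" using t0 by (simp add: V_def)
      then show ?thesis by (simp add: algebra_simps)
    qed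
    have w: "0 \<le> \<tau> * (real (cell \<tau> t) + 1) - t" "\<tau> * (real (cell \<tau> t) + 1) - t \<le> \<tau>"
      using cell_bounds[OF t0 t] by (auto simp: algebra_simps)
    show "\<bar>U (cell \<tau> t) x + (t - \<tau> * real (cell \<tau> t)) * V (cell \<tau> t) x - U (Suc (cell \<tau> t)) x\<bar> \<le> \<tau> * \<bar>V (cell \<tau> t) x\<bar>" for x
      unfolding abs_minus_commute[of _ "U (Suc (cell \<tau> t)) x"] diff abs_mult using w by (intro mult_right_mono) auto
    show "0 \<le> V (cell \<tau> t) x * (U (Suc (cell \<tau> t)) x - (U (cell \<tau> t) x + (t - \<tau> * real (cell \<tau> t)) * V (cell \<tau> t) x))" for x
      unfolding diff mult.left_commute[of "V (cell \<tau> t) x"]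
      using w by (intro mult_nonneg_nonneg[OF w(1)]) simp
  next
    \<comment> \<open>The error function: the energy lost in one step plus the work of the force. It
      is nonnegative by \<open>euler_energy\<close> and telescopes when summed, leaving \<tau> times
      the initial energy.\<close>
    let ?\<Gamma> = "\<lambda>k. En (U k) - En (U (Suc k)) + \<tau> / 2 * (nH (F k))\<^sup>2"
    have \<Gamma>0: "0 \<le> ?\<Gamma> k" for k
    proof -
      have "0 \<le> \<tau> / 2 * (nH (V k))\<^sup>2" using t0 by simp
      then show ?thesis using euler_energy[OF E, of k] unfolding eV by linarith
    qed
    show "\<exists>\<epsilon>. \<epsilon> \<in> borel_measurable borel \<and> (\<forall>t\<ge>0. 0 \<le> \<epsilon> t \<and>
        En (\<lambda>x. U (cell \<tau> t) x + (t - \<tau> * real (cell \<tau> t)) * V (cell \<tau> t) x) - En (U (Suc (cell \<tau> t))) \<le> \<epsilon> t) \<and>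
        (\<integral>\<^sup>+t. ennreal (\<epsilon> t) \<partial>time_measure 0 T) \<le> ennreal (\<tau> * (En (U 0) + ?S / 2))"
    proof (intro exI[of _ "\<lambda>t. ?\<Gamma> (cell \<tau> t)"] conjI allI impI \<Gamma>0)
      show "(\<lambda>t. ?\<Gamma> (cell \<tau> t)) \<in> borel_measurable borel" by measurable
      fix t :: real assume t: "0 \<le> t"
      let ?k = "cell \<tau> t" and ?\<theta> = "(t - \<tau> * real (cell \<tau> t)) / \<tau>"
      have "En (\<lambda>x. U ?k x + (t - \<tau> * real ?k) * V ?k x) \<le> (1 - ?\<theta>) * En (U ?k) + ?\<theta> * En (U (Suc ?k))"
        unfolding conv by (rule En_convex(2)[OF d d th[OF t]])
      also have "\<dots> = (1 - ?\<theta>) * (En (U ?k) - En (U (Suc ?k))) + En (U (Suc ?k))" by (simp add: algebra_simps)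
      also have "(1 - ?\<theta>) * (En (U ?k) - En (U (Suc ?k))) \<le> (1 - ?\<theta>) * ?\<Gamma> ?k"
        using th[OF t] t0 by (intro mult_left_mono) auto
      also have "\<dots> \<le> 1 * ?\<Gamma> ?k" using th[OF t] \<Gamma>0[of ?k] by (intro mult_right_mono) auto
      finally show "En (\<lambda>x. U ?k x + (t - \<tau> * real ?k) * V ?k x) - En (U (Suc ?k)) \<le> ?\<Gamma> ?k" by simp
    next
      have "(\<integral>\<^sup>+t. ennreal (?\<Gamma> (cell \<tau> t)) \<partial>time_measure 0 T) = ennreal (\<tau> * (\<Sum>j<N. ?\<Gamma> j))"
        unfolding \<tau> by (rule nn_step_integral[OF T]) (use \<Gamma>0 in \<open>simp add: \<tau>\<close>)
      also have "(\<Sum>j<N. ?\<Gamma> j) = En (U 0) - En (U N) + ?S / 2"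
        using sum_lessThan_telescope'[of "\<lambda>k. En (U k)" N] by (simp add: sum.distrib sum_distrib_left sum_divide_distrib)

      also have "ennreal (\<tau> * (En (U 0) - En (U N) + ?S / 2)) \<le> ennreal (\<tau> * (En (U 0) + ?S / 2))"
        using t0 En_nonneg[of "U N"] by (intro ennreal_leI mult_left_mono) auto
      finally show "(\<integral>\<^sup>+t. ennreal (?\<Gamma> (cell \<tau> t)) \<partial>time_measure 0 T) \<le> ennreal (\<tau> * (En (U 0) + ?S / 2))" .
    qed
    show "(\<integral>\<^sup>+t. ennreal ((nH (F (cell \<tau> t)))\<^sup>2) \<partial>time_measure 0 T) \<le> ennreal ?S"
      unfolding \<tau> by (subst nn_step_integral[OF T]) auto
    have "(\<integral>\<^sup>+t. ennreal ((nH (V (cell \<tau> t)))\<^sup>2) \<partial>time_measure 0 T) = ennreal (\<tau> * (\<Sum>j<N. (nH (V j))\<^sup>2))"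
      unfolding \<tau> by (subst nn_step_integral[OF T]) auto
    also have "\<dots> \<le> ennreal (2 * En (U 0) + ?S)"
      using euler_sum_V[OF E, of N] En_nonneg[of "U N"] unfolding eV by (intro ennreal_leI) linarith
    finally show "(\<integral>\<^sup>+t. ennreal ((nH (V (cell \<tau> t)))\<^sup>2) \<partial>time_measure 0 T) \<le> ennreal (2 * En (U 0) + ?S)" .
    have "(\<integral>\<^sup>+t. ennreal (t * of_bool (\<tau> \<le> t) * (nH (V (cell \<tau> t)))\<^sup>2) \<partial>time_measure 0 T)
      \<le> (\<integral>\<^sup>+t. ennreal (2 * (\<tau> * real (cell \<tau> t) * (nH (V (cell \<tau> t)))\<^sup>2)) \<partial>time_measure 0 T)"
    proof (intro nn_integral_mono ennreal_leI)
      fix t :: real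
      \<comment> \<open>From the second cell on, t is less than \<tau>(k+1) \<le> 2\<tau>k. On the
        first cell the discrete weight is 0 and cannot dominate t, hence the cut-off.\<close>
      have "t * of_bool (\<tau> \<le> t) \<le> 2 * (\<tau> * real (cell \<tau> t))"
      proof (cases "\<tau> \<le> t")
        case True
        then have "0 \<le> t" using t0 by simp
        have "1 \<le> cell \<tau> t" using cell_mono[OF t0 True] cell_eqI[OF t0, of 1 \<tau>] t0 by simp
        then have "\<tau> * 1 \<le> \<tau> * real (cell \<tau> t)" using t0 by (intro mult_left_mono) auto
        then show ?thesis using cell_bounds(2)[OF t0 \<open>0 \<le> t\<close>] True by (simp add: distrib_left)
      qed (use t0 in simp)
      then have "t * of_bool (\<tau> \<le> t) * (nH (V (cell \<tau> t)))\<^sup>2 \<le> 2 * (\<tau> * real (cell \<tau> t)) * (nH (V (cell \<tau> t)))\<^sup>2"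
        by (intro mult_right_mono) auto
      then show "t * of_bool (\<tau> \<le> t) * (nH (V (cell \<tau> t)))\<^sup>2 \<le> 2 * (\<tau> * real (cell \<tau> t) * (nH (V (cell \<tau> t)))\<^sup>2)"
        by (simp add: mult.assoc)
    qed
    also have "\<dots> = ennreal (\<tau> * (\<Sum>j<N. 2 * (\<tau> * real j * (nH (V j))\<^sup>2)))"
      unfolding \<tau> by (rule nn_step_integral[OF T]) (use t0 T in \<open>simp add: \<tau>\<close>)
    also have "\<dots> \<le> ennreal (2 * ((nH (U 0))\<^sup>2 + 2 * ?R * (T + ?S) + T * ?S))"
    proof (rule ennreal_leI)
      have a: "\<tau> * (\<Sum>j<N. \<tau> * real j * (nH (V j))\<^sup>2) + 2 * (\<tau> * real N) * En (U N)
         \<le> 2 * (\<tau> * (\<Sum>j<N. En (U (Suc j)))) + T * ?S"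
        using euler_weighted[OF E, of N N T] \<tau>N unfolding eV by simp
      have b: "\<tau> * (\<Sum>j<N. En (U (Suc j))) + (nH (U N))\<^sup>2 / 2 \<le> (nH (U 0))\<^sup>2 / 2 + ?R * (T + ?S)"
        using euler_sum_En[OF E R, of N N] \<tau>N by simp
      have sum2: "\<tau> * (\<Sum>j<N. 2 * (\<tau> * real j * (nH (V j))\<^sup>2)) = 2 * (\<tau> * (\<Sum>j<N. \<tau> * real j * (nH (V j))\<^sup>2))"
        by (simp add: sum_distrib_left mult.left_commute)
      have "0 \<le> 2 * (\<tau> * real N) * En (U N)" using t0 En_nonneg by simp
      moreover have "0 \<le> (nH (U N))\<^sup>2 / 2" by simp
      ultimately have "\<tau> * (\<Sum>j<N. \<tau> * real j * (nH (V j))\<^sup>2) \<le> (nH (U 0))\<^sup>2 + 2 * (?R * (T + ?S)) + T * ?S"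
        using a b by linarith
      then show "\<tau> * (\<Sum>j<N. 2 * (\<tau> * real j * (nH (V j))\<^sup>2)) \<le> 2 * ((nH (U 0))\<^sup>2 + 2 * ?R * (T + ?S) + T * ?S)"
        unfolding sum2 mult.assoc[of 2 ?R] by (intro mult_left_mono) auto
    qed
    finally show "(\<integral>\<^sup>+t. ennreal (t * of_bool (\<tau> \<le> t) * (nH (V (cell \<tau> t)))\<^sup>2) \<partial>time_measure 0 T)
      \<le> ennreal (2 * ((nH (U 0))\<^sup>2 + 2 * ?R * (T + ?S) + T * ?S))" .
    fix t assume t: "t \<in> {0..T}"
    let ?k = "cell \<tau> t" and ?\<theta> = "(t - \<tau> * real (cell \<tau> t)) / \<tau>"
    have "cell \<tau> t \<le> N" using cell_mono[OF t0, of t T] t cell_end[OF T] by (simp add: \<tau>)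
    show "nH (\<lambda>x. U ?k x + (t - \<tau> * real ?k) * V ?k x) \<le> ?R"
    \<comment> \<open>The index N occurs only at t = T. There the weight of \<open>V N\<close>,
      which involves the uncontrolled value \<open>U (Suc N)\<close>, is zero.\<close>
    proof (cases "?k = N")
      case True
      then have "t = T" using cell_bounds(1)[OF t0, of t] t \<tau>N by auto
      then have "(\<lambda>x. U ?k x + (t - \<tau> * real ?k) * V ?k x) = U N" using True \<tau>N by simp
      then show ?thesis using R[of N] by simp
    next
      case False
      then have k: "Suc ?k \<le> N" using \<open>cell \<tau> t \<le> N\<close> by simp
      have th': "0 \<le> ?\<theta>" "?\<theta> \<le> 1" using th[of t] t by auto
      have "nH (\<lambda>x. U ?k x + (t - \<tau> * real ?k) * V ?k x) \<le> nH (\<lambda>x. (1 - ?\<theta>) * U ?k x) + nH (\<lambda>x. ?\<theta> * U (Suc ?k) x)"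
        unfolding conv by (intro L2n_triangle memL2_cmult mem)
      also have "\<dots> = (1 - ?\<theta>) * nH (U ?k) + ?\<theta> * nH (U (Suc ?k))"
        unfolding L2n_cmult using th' by (simp only: abs_of_nonneg diff_ge_0_iff_ge)
      also have "\<dots> \<le> (1 - ?\<theta>) * ?R + ?\<theta> * ?R"
        using th' R[of ?k] R[of "Suc ?k"] k by (intro add_mono mult_left_mono) auto
      also have "\<dots> = ?R" by (simp add: algebra_simps)
      finally show ?thesis .
    qed
  qed (use t0 d S0 mem step_measurable[of _ \<nu>1 \<tau>] in auto)
qed

end

section \<open>Integrals over time intervals and norms over space-time\<close>

lemma integrable_time_measure:
  fixes f :: "real \<Rightarrow> real"
  assumes [measurable]: "f \<in> borel_measurable borel"
  shows "integrable (time_measure a b) f \<longleftrightarrow> set_integrable lborel {a..b} f"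
proof -
  have "time_measure a b = density lborel (\<lambda>t. ennreal (indicator {a..b} t))"
    unfolding time_measure_def by (simp add: ennreal_indicator)
  then show ?thesis by (simp add: integrable_density set_integrable_def)
qed

lemma integral_time_measure:
  fixes f :: "real \<Rightarrow> real"
  assumes [measurable]: "f \<in> borel_measurable borel"
  shows "(\<integral>t. f t \<partial>time_measure a b) = (LINT t:{a..b}|lborel. f t)"
proof -
  have "time_measure a b = density lborel (\<lambda>t. ennreal (indicator {a..b} t))"
    unfolding time_measure_def by (simp add: ennreal_indicator)
  then show ?thesis by (simp add: integral_density set_lebesgue_integral_def)
qed

lemma nn_integral_time_measure_mono:
  assumes [measurable]: "f \<in> borel_measurable borel" and "{a..b} \<subseteq> {a'..b'}"
  shows "(\<integral>\<^sup>+t. f t \<partial>time_measure a b) \<le> (\<integral>\<^sup>+t. f t \<partial>time_measure a' b')"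
  unfolding nn_integral_time_measure[OF assms(1)]
  by (rule nn_integral_mono) (use assms(2) in \<open>auto split: split_indicator\<close>)

text \<open>Splits the integrated error in the comparison of two schemes: two energy errors, for
  each scheme a bracket weighted by its step size, and the contribution of the forces.\<close>

lemma nn_integral_weighted_sum:
  assumes [measurable]: "a \<in> borel_measurable M" "b \<in> borel_measurable M" "c \<in> borel_measurable M" "d \<in> borel_measurable M"
    "e \<in> borel_measurable M" "g \<in> borel_measurable M" "h \<in> borel_measurable M"
  shows "(\<integral>\<^sup>+s. 2 * (a s + b s + k * (c s + d s) + l * (e s + g s) + h s) \<partial>M)
    = 2 * ((\<integral>\<^sup>+s. a s \<partial>M) + (\<integral>\<^sup>+s. b s \<partial>M) + k * ((\<integral>\<^sup>+s. c s \<partial>M) + (\<integral>\<^sup>+s. d s \<partial>M))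
      + l * ((\<integral>\<^sup>+s. e s \<partial>M) + (\<integral>\<^sup>+s. g s \<partial>M)) + (\<integral>\<^sup>+s. h s \<partial>M))"
proof -
  have "(\<integral>\<^sup>+s. 2 * (a s + b s + k * (c s + d s) + l * (e s + g s) + h s) \<partial>M)
      = 2 * (\<integral>\<^sup>+s. a s + b s + k * (c s + d s) + l * (e s + g s) + h s \<partial>M)"
    by (rule nn_integral_cmult) measurable
  also have "(\<integral>\<^sup>+s. a s + b s + k * (c s + d s) + l * (e s + g s) + h s \<partial>M)
      = (\<integral>\<^sup>+s. a s \<partial>M) + (\<integral>\<^sup>+s. b s \<partial>M) + (\<integral>\<^sup>+s. k * (c s + d s) \<partial>M) + (\<integral>\<^sup>+s. l * (e s + g s) \<partial>M) + (\<integral>\<^sup>+s. h s \<partial>M)"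
    by (simp add: nn_integral_add)
  also have "(\<integral>\<^sup>+s. k * (c s + d s) \<partial>M) = k * ((\<integral>\<^sup>+s. c s \<partial>M) + (\<integral>\<^sup>+s. d s \<partial>M))"
    by (subst nn_integral_cmult) (simp_all add: nn_integral_add)
  also have "(\<integral>\<^sup>+s. l * (e s + g s) \<partial>M) = l * ((\<integral>\<^sup>+s. e s \<partial>M) + (\<integral>\<^sup>+s. g s \<partial>M))"
    by (subst nn_integral_cmult) (simp_all add: nn_integral_add)
  finally show ?thesis .
qed

lemma ennreal_weighted_sum:
  assumes "0 \<le> a" "0 \<le> b" "0 \<le> c" "0 \<le> d" "0 \<le> e" "0 \<le> g" "0 \<le> h" "0 \<le> k" "0 \<le> l"
  shows "2 * (ennreal a + ennreal b + ennreal k * (ennreal c + ennreal d) + ennreal l * (ennreal e + ennreal g) + ennreal h)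
    = ennreal (2 * (a + b + k * (c + d) + l * (e + g) + h))"
  using assms by (simp add: ennreal_mult)

lemma AE_time_measure_I: "(\<And>t. a \<le> t \<Longrightarrow> t \<le> b \<Longrightarrow> P t) \<Longrightarrow> AE t in time_measure a b. P t"
  unfolding AE_time_measure by (rule AE_I2) auto

lemma emeasure_time_measure_UNIV: "a \<le> b \<Longrightarrow> emeasure (time_measure a b) UNIV = ennreal (b - a)"
proof -
  assume "a \<le> b"
  have "emeasure (time_measure a b) UNIV = (\<integral>\<^sup>+t. 1 \<partial>time_measure a b)" by simp
  also have "\<dots> = emeasure lborel {a..b}" by (subst nn_integral_time_measure) auto
  finally show ?thesis using \<open>a \<le> b\<close> by simp
qed

context plap_space
begin

lemma nn_integral_spt:
  assumes [measurable]: "h \<in> jmeas"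
  shows "(\<integral>\<^sup>+w. h w \<partial>spt a b) = (\<integral>\<^sup>+t. \<integral>\<^sup>+x. h (t, x) \<partial>\<nu>1 \<partial>time_measure a b)"
  by (rule S1.nn_integral_fst[symmetric]) (simp add: measurable_spt)

lemma memL2_spt_mono:
  assumes h: "memL2 (spt a' b') h" and sub: "{a..b} \<subseteq> {a'..b'}"
  shows "memL2 (spt a b) h" "L2n (spt a b) h \<le> L2n (spt a' b') h"
proof -
  have [measurable]: "h \<in> jmeas" using memL2_measurable[OF h] by (simp add: measurable_spt)
  have "(\<integral>\<^sup>+w. ennreal ((h w)\<^sup>2) \<partial>spt a b) \<le> (\<integral>\<^sup>+w. ennreal ((h w)\<^sup>2) \<partial>spt a' b')"
    by (subst (1 2) nn_integral_spt) (auto intro!: nn_integral_time_measure_mono sub)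
  also have "\<dots> = ennreal ((L2n (spt a' b') h)\<^sup>2)" by (rule nn_integral_L2n[OF h])
  finally have *: "(\<integral>\<^sup>+w. ennreal ((h w)\<^sup>2) \<partial>spt a b) \<le> ennreal ((L2n (spt a' b') h)\<^sup>2)" .
  show "memL2 (spt a b) h" "L2n (spt a b) h \<le> L2n (spt a' b') h"
    by (rule memL2_nn_integralI[OF _ *]; simp add: measurable_spt)+
qed

lemma memL2_sptI:
  assumes m: "case_prod h \<in> jmeas"
    and mem: "\<And>t. t \<in> {a..b} \<Longrightarrow> inH (h t)"
    and B: "(\<integral>\<^sup>+t. ennreal ((nH (h t))\<^sup>2) \<partial>time_measure a b) \<le> ennreal B" "0 \<le> B"
  shows "memL2 (spt a b) (unc h)" "(L2n (spt a b) (unc h))\<^sup>2 \<le> B"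
proof -
  have [measurable]: "(unc h) \<in> jmeas"
    using m by (simp add: split_beta)
  have "(\<integral>\<^sup>+w. ennreal ((h (fst w) (snd w))\<^sup>2) \<partial>spt a b) = (\<integral>\<^sup>+t. \<integral>\<^sup>+x. ennreal ((h t x)\<^sup>2) \<partial>\<nu>1 \<partial>time_measure a b)"
    by (subst nn_integral_spt) auto
  also have "\<dots> = (\<integral>\<^sup>+t. ennreal ((nH (h t))\<^sup>2) \<partial>time_measure a b)"
    by (rule nn_integral_cong_AE, rule AE_time_measure_I, rule nn_integral_L2n[OF mem]) auto
  also have "\<dots> \<le> ennreal ((sqrt B)\<^sup>2)" using B by simp
  finally have *: "(\<integral>\<^sup>+w. ennreal ((h (fst w) (snd w))\<^sup>2) \<partial>spt a b) \<le> ennreal ((sqrt B)\<^sup>2)" .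
  show "memL2 (spt a b) (unc h)"
    by (rule memL2_nn_integralI(1)[OF _ *]) (use B in \<open>auto simp: measurable_spt\<close>)
  have "L2n (spt a b) (unc h) \<le> sqrt B"
    by (rule memL2_nn_integralI(2)[OF _ *]) (use B in \<open>auto simp: measurable_spt\<close>)
  then have "(L2n (spt a b) (unc h))\<^sup>2 \<le> (sqrt B)\<^sup>2" by (intro power_mono) auto
  then show "(L2n (spt a b) (unc h))\<^sup>2 \<le> B" using B by simp
qed

lemma memL2_spt_bounded:
  assumes m: "case_prod h \<in> jmeas" and ab: "a \<le> b"
    and mem: "\<And>t. t \<in> {a..b} \<Longrightarrow> inH (h t)" and R: "\<And>t. t \<in> {a..b} \<Longrightarrow> nH (h t) \<le> R"
  shows "memL2 (spt a b) (unc h)" "(L2n (spt a b) (unc h))\<^sup>2 \<le> (b - a) * R\<^sup>2"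
proof -
  have "(\<integral>\<^sup>+t. ennreal ((nH (h t))\<^sup>2) \<partial>time_measure a b) \<le> (\<integral>\<^sup>+t. ennreal (R\<^sup>2) \<partial>time_measure a b)"
    by (rule nn_integral_mono_AE, rule AE_time_measure_I, intro ennreal_leI power_mono R) auto
  also have "\<dots> = ennreal ((b - a) * R\<^sup>2)"
    using ab by (simp add: emeasure_time_measure_UNIV ennreal_mult mult.commute)
  finally have *: "(\<integral>\<^sup>+t. ennreal ((nH (h t))\<^sup>2) \<partial>time_measure a b) \<le> ennreal ((b - a) * R\<^sup>2)" .
  show "memL2 (spt a b) (unc h)" "(L2n (spt a b) (unc h))\<^sup>2 \<le> (b - a) * R\<^sup>2"
    by (rule memL2_sptI[OF m mem *]; use ab in simp)+
qed

section \<open>Comparison of two approximate solutions\<close>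

lemma approx_solutionD:
  assumes "approx_solution T \<tau> u0 f S ub uh vb"
  shows "0 < \<tau>" "dom u0" "0 \<le> S"
    "case_prod f \<in> jmeas" "case_prod ub \<in> jmeas"
    "case_prod uh \<in> jmeas" "case_prod vb \<in> jmeas"
    "\<And>t. 0 \<le> t \<Longrightarrow> subgradient (ub t) (\<lambda>x. f t x - vb t x)" "\<And>t. 0 \<le> t \<Longrightarrow> inH (f t)"
    "\<And>t. 0 \<le> t \<Longrightarrow> inH (vb t)" "\<And>t. 0 \<le> t \<Longrightarrow> dom (uh t)"
    "uh 0 = u0"
    "\<And>x s t. 0 \<le> s \<Longrightarrow> s \<le> t \<Longrightarrow> set_integrable lborel {s..t} (\<lambda>r. vb r x)"
    "\<And>x s t. 0 \<le> s \<Longrightarrow> s \<le> t \<Longrightarrow> uh t x - uh s x = (LINT r:{s..t}|lborel. vb r x)"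
    "\<And>t x. 0 \<le> t \<Longrightarrow> \<bar>uh t x - ub t x\<bar> \<le> \<tau> * \<bar>vb t x\<bar>" "\<And>t x. 0 \<le> t \<Longrightarrow> 0 \<le> vb t x * (ub t x - uh t x)"
    "\<exists>\<epsilon>. \<epsilon> \<in> borel_measurable borel \<and> (\<forall>t\<ge>0. 0 \<le> \<epsilon> t \<and> En (uh t) - En (ub t) \<le> \<epsilon> t) \<and>
        (\<integral>\<^sup>+t. ennreal (\<epsilon> t) \<partial>time_measure 0 T) \<le> ennreal (\<tau> * (En u0 + S / 2))"
    "(\<integral>\<^sup>+t. ennreal ((nH (f t))\<^sup>2) \<partial>time_measure 0 T) \<le> ennreal S"
    "(\<integral>\<^sup>+t. ennreal ((nH (vb t))\<^sup>2) \<partial>time_measure 0 T) \<le> ennreal (2 * En u0 + S)"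
    "(\<integral>\<^sup>+t. ennreal (t * of_bool (\<tau> \<le> t) * (nH (vb t))\<^sup>2) \<partial>time_measure 0 T)
      \<le> ennreal (2 * ((nH u0)\<^sup>2 + 2 * (nH u0 + T + S) * (T + S) + T * S))"
    "\<And>t. t \<in> {0..T} \<Longrightarrow> nH (uh t) \<le> nH u0 + T + S"
  using assms unfolding approx_solution_def by blast+

lemma approx_solution_ub_memL2:
  "approx_solution T \<tau> u0 f S ub uh vb \<Longrightarrow> 0 \<le> t \<Longrightarrow> inH (ub t)"
  using approx_solutionD(8) dom_memL2 unfolding subgradient_def by blast

lemma approx_solution_spt:
  assumes "approx_solution T \<tau> u0 f S ub uh vb" and T: "0 \<le> T"
  shows "memL2 (spt 0 T) (unc f)" "memL2 (spt 0 T) (unc vb)"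
    "memL2 (spt 0 T) (unc uh)"
    "(L2n (spt 0 T) (unc vb))\<^sup>2 \<le> 2 * En u0 + S"
    "(L2n (spt 0 T) (unc uh))\<^sup>2 \<le> T * (nH u0 + T + S)\<^sup>2"
    "(L2n (spt 0 T) (unc f))\<^sup>2 \<le> S"
proof -
  note D = approx_solutionD[OF assms(1)]
  have pos: "0 \<le> 2 * En u0 + S" using En_nonneg[of u0] D(3) by simp
  show "memL2 (spt 0 T) (unc f)" "(L2n (spt 0 T) (unc f))\<^sup>2 \<le> S"
    by (rule memL2_sptI[OF D(4) D(9) D(18) D(3)]; simp)+
  show "memL2 (spt 0 T) (unc vb)" "(L2n (spt 0 T) (unc vb))\<^sup>2 \<le> 2 * En u0 + S"
    by (rule memL2_sptI[OF D(7) D(10) D(19) pos]; simp)+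
  have "inH (uh t)" if "t \<in> {0..T}" for t using dom_memL2[OF D(11)] that by simp
  note * = memL2_spt_bounded[OF D(6) T this D(21)]
  show "memL2 (spt 0 T) (unc uh)" "(L2n (spt 0 T) (unc uh))\<^sup>2 \<le> T * (nH u0 + T + S)\<^sup>2"
    using * by simp_all
qed

text \<open>Comparing two schemes, each subgradient inequality is tested with the piecewise linear
  interpolant of the other scheme. All error terms then involve one scheme only, which allows the
  initial energies to blow up along the sequence of schemes.\<close>

lemma approx_solution_instant:
  assumes A: "approx_solution T \<tau> u0 f S ub uh vb" and A': "approx_solution T \<tau>' u0' f' S' ub' uh' vb'" and s: "0 \<le> s"
    and e: "En (uh s) - En (ub s) \<le> e" and e': "En (uh' s) - En (ub' s) \<le> e'"
  shows "(\<integral>x. (vb s x - vb' s x) * (uh s x - uh' s x) \<partial>\<nu>1)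
    \<le> e + e' + \<tau> * ((nH (f s))\<^sup>2 + (nH (vb s))\<^sup>2) + \<tau>' * ((nH (f' s))\<^sup>2 + (nH (vb' s))\<^sup>2)
      + (\<integral>x. \<bar>(f s x - f' s x) * (uh s x - uh' s x)\<bar> \<partial>\<nu>1)"
proof -
  note D = approx_solutionD[OF A] and D' = approx_solutionD[OF A']
  have m: "inH (f s)" "inH (vb s)" "inH (uh s)" "inH (ub s)"
    "inH (f' s)" "inH (vb' s)" "inH (uh' s)" "inH (ub' s)"
    using D(9,10)[OF s] D'(9,10)[OF s] dom_memL2[OF D(11)[OF s]] dom_memL2[OF D'(11)[OF s]]
      approx_solution_ub_memL2[OF A s] approx_solution_ub_memL2[OF A' s] by auto
  have 1: "En (ub s) + (\<integral>x. (f s x - vb s x) * (uh' s x - ub s x) \<partial>\<nu>1) \<le> En (uh' s)"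
    using D(8)[OF s] D'(11)[OF s] unfolding subgradient_def by blast
  have 2: "En (ub' s) + (\<integral>x. (f' s x - vb' s x) * (uh s x - ub' s x) \<partial>\<nu>1) \<le> En (uh s)"
    using D'(8)[OF s] D(11)[OF s] unfolding subgradient_def by blast
  let ?a = "\<lambda>x. (f s x - vb s x) * (uh' s x - ub s x)" and ?a' = "\<lambda>x. (f' s x - vb' s x) * (uh s x - ub' s x)"
  let ?r = "\<lambda>x. \<tau> * ((f s x)\<^sup>2 + (vb s x)\<^sup>2) + \<tau>' * ((f' s x)\<^sup>2 + (vb' s x)\<^sup>2) + \<bar>(f s x - f' s x) * (uh s x - uh' s x)\<bar>"
  \<comment> \<open>Prices the product of a force with the gap between the two interpolants of the
    same scheme, which is at most \<tau> times the derivative.\<close>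
  have young: "f0 * d \<le> t * (f0\<^sup>2 + v\<^sup>2)" if "\<bar>d\<bar> \<le> t * \<bar>v\<bar>" "0 < t" for f0 d v t :: real
  proof -
    have "f0 * d \<le> \<bar>f0\<bar> * \<bar>d\<bar>" by (simp flip: abs_mult)
    also have "\<dots> \<le> \<bar>f0\<bar> * (t * \<bar>v\<bar>)" using that by (intro mult_left_mono) auto
    also have "\<dots> = t * (\<bar>f0\<bar> * \<bar>v\<bar>)" by simp
    also have "\<bar>f0\<bar> * \<bar>v\<bar> \<le> f0\<^sup>2 + v\<^sup>2"
    proof -
      have "0 \<le> (\<bar>f0\<bar> - \<bar>v\<bar>)\<^sup>2" "0 \<le> \<bar>f0\<bar> * \<bar>v\<bar>" by auto
      then show ?thesis unfolding power2_diff power2_abs by linarith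
    qed
    finally show ?thesis using that by simp
  qed
  have ia: "integrable \<nu>1 ?a" "integrable \<nu>1 ?a'" by (intro memL2_mult_integrable memL2_diff m)+
  have i4: "integrable \<nu>1 (\<lambda>x. \<bar>(f s x - f' s x) * (uh s x - uh' s x)\<bar>)"
    by (intro integrable_abs memL2_mult_integrable memL2_diff m)
  have ir: "integrable \<nu>1 ?r"
    using memL2_integrable[OF m(1)] memL2_integrable[OF m(2)] memL2_integrable[OF m(5)] memL2_integrable[OF m(6)] i4
    by (intro Bochner_Integration.integrable_add integrable_mult_right) auto
  have "(\<integral>x. (vb s x - vb' s x) * (uh s x - uh' s x) \<partial>\<nu>1) \<le> (\<integral>x. ?a x + ?a' x + ?r x \<partial>\<nu>1)"
  proof (rule integral_mono)
    show "integrable \<nu>1 (\<lambda>x. (vb s x - vb' s x) * (uh s x - uh' s x))" by (intro memL2_mult_integrable memL2_diff m)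
    show "integrable \<nu>1 (\<lambda>x. ?a x + ?a' x + ?r x)" by (rule Bochner_Integration.integrable_add[OF Bochner_Integration.integrable_add[OF ia] ir])
    fix x
    have "f s x * (ub s x - uh s x) \<le> \<tau> * ((f s x)\<^sup>2 + (vb s x)\<^sup>2)"
      by (rule young) (use D(15)[OF s, of x] D(1) in \<open>auto simp: abs_minus_commute\<close>)
    moreover have "f' s x * (ub' s x - uh' s x) \<le> \<tau>' * ((f' s x)\<^sup>2 + (vb' s x)\<^sup>2)"
      by (rule young) (use D'(15)[OF s, of x] D'(1) in \<open>auto simp: abs_minus_commute\<close>)
    moreover have "(f s x - f' s x) * (uh s x - uh' s x) \<le> \<bar>(f s x - f' s x) * (uh s x - uh' s x)\<bar>" by simp
    \<comment> \<open>After regrouping, the last two products have a favourable sign by the sign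
      condition of each scheme and are dropped.\<close>
    moreover have "(vb s x - vb' s x) * (uh s x - uh' s x) = ?a x + ?a' x + f s x * (ub s x - uh s x) + f' s x * (ub' s x - uh' s x)
        + (f s x - f' s x) * (uh s x - uh' s x) - vb s x * (ub s x - uh s x) - vb' s x * (ub' s x - uh' s x)"
      by (simp add: algebra_simps)
    ultimately show "(vb s x - vb' s x) * (uh s x - uh' s x) \<le> ?a x + ?a' x + ?r x"
      using D(16)[OF s, of x] D'(16)[OF s, of x] by linarith
  qed
  also have "\<dots> = (\<integral>x. ?a x \<partial>\<nu>1) + (\<integral>x. ?a' x \<partial>\<nu>1) + (\<integral>x. ?r x \<partial>\<nu>1)"
    unfolding Bochner_Integration.integral_add[OF Bochner_Integration.integrable_add[OF ia] ir]
      Bochner_Integration.integral_add[OF ia] ..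
  also have "(\<integral>x. ?r x \<partial>\<nu>1) = \<tau> * ((nH (f s))\<^sup>2 + (nH (vb s))\<^sup>2) + \<tau>' * ((nH (f' s))\<^sup>2 + (nH (vb' s))\<^sup>2)
      + (\<integral>x. \<bar>(f s x - f' s x) * (uh s x - uh' s x)\<bar> \<partial>\<nu>1)"
    using memL2_integrable[OF m(1)] memL2_integrable[OF m(2)] memL2_integrable[OF m(5)] memL2_integrable[OF m(6)] i4
    by (simp add: L2n_power2)
  finally show ?thesis using 1 2 e e' by linarith
qed

text \<open>For fixed x the interpolants are absolutely continuous in time, so the chain rule
  inequality bounds the growth of their squared difference. Integration over x, Fubini and the
  instantaneous estimate finish; each initial energy appears only with the factor of its own step
  size.\<close>

lemma approx_solution_compare:
  assumes A: "approx_solution T \<tau> u0 f S ub uh vb" and A': "approx_solution T \<tau>' u0' f' S' ub' uh' vb'"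
    and t: "t \<in> {0..T}"
  shows "(nH (\<lambda>x. uh t x - uh' t x))\<^sup>2 \<le> (nH (\<lambda>x. u0 x - u0' x))\<^sup>2
    + 2 * (4 * \<tau> * (En u0 + S) + 4 * \<tau>' * (En u0' + S')
      + L2n (spt 0 T) (\<lambda>w. f (fst w) (snd w) - f' (fst w) (snd w)) * L2n (spt 0 T) (\<lambda>w. uh (fst w) (snd w) - uh' (fst w) (snd w)))"
proof -
  note D = approx_solutionD[OF A] and D' = approx_solutionD[OF A']
  have T: "0 \<le> T" using t by simp
  note M = approx_solution_spt[OF A T] and M' = approx_solution_spt[OF A' T]
  note [measurable] = D(4,6,7)[unfolded split_beta] D'(4,6,7)[unfolded split_beta]
  interpret PS: pair_sigma_finite "time_measure 0 t" \<nu>1 by (rule pair_sigma_finite_spt)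
  interpret PT: pair_sigma_finite "time_measure 0 T" \<nu>1 by (rule pair_sigma_finite_spt)
  obtain \<epsilon> where \<epsilon>[measurable]: "\<epsilon> \<in> borel_measurable borel" and \<epsilon>': "\<And>t. 0 \<le> t \<Longrightarrow> 0 \<le> \<epsilon> t" "\<And>t. 0 \<le> t \<Longrightarrow> En (uh t) - En (ub t) \<le> \<epsilon> t"
    "(\<integral>\<^sup>+t. ennreal (\<epsilon> t) \<partial>time_measure 0 T) \<le> ennreal (\<tau> * (En u0 + S / 2))" using D(17) by blast
  obtain \<eta> where \<eta>[measurable]: "\<eta> \<in> borel_measurable borel" and \<eta>': "\<And>t. 0 \<le> t \<Longrightarrow> 0 \<le> \<eta> t" "\<And>t. 0 \<le> t \<Longrightarrow> En (uh' t) - En (ub' t) \<le> \<eta> t"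
    "(\<integral>\<^sup>+t. ennreal (\<eta> t) \<partial>time_measure 0 T) \<le> ennreal (\<tau>' * (En u0' + S' / 2))" using D'(17) by blast
  let ?w = "\<lambda>s x. uh s x - uh' s x" and ?b = "\<lambda>s x. vb s x - vb' s x"
  let ?wf = "\<lambda>z. uh (fst z) (snd z) - uh' (fst z) (snd z)" and ?bf = "\<lambda>z. vb (fst z) (snd z) - vb' (fst z) (snd z)"
  let ?ff = "\<lambda>z. f (fst z) (snd z) - f' (fst z) (snd z)"
  have mw: "memL2 (spt 0 T) ?wf" "memL2 (spt 0 T) ?bf" "memL2 (spt 0 T) ?ff"
    by (intro memL2_diff M M')+
  have sub: "{0..t} \<subseteq> {0..T}" using t by auto
  have ih: "integrable (spt 0 t) (\<lambda>z. 2 * (?wf z * ?bf z))"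
    using memL2_mult_integrable[OF memL2_spt_mono(1)[OF mw(1) sub] memL2_spt_mono(1)[OF mw(2) sub]] by simp
  have ih': "integrable (spt 0 t) (\<lambda>(s, x). 2 * (?w s x * ?b s x))" using ih unfolding split_beta .
  have chain: "(?w t x)\<^sup>2 - (?w 0 x)\<^sup>2 \<le> (LINT s:{0..t}|lborel. 2 * (?w s x * ?b s x))" for x
  proof -
    have "(?w t x)\<^sup>2 - (?w 0 x)\<^sup>2 \<le> (LINT s:{0..t}|lborel. (2 * ?w s x) \<bullet> ?b s x)"
    proof (rule convex_chain_rule(2)[where \<Theta>="\<lambda>y. y\<^sup>2" and G="\<lambda>y. 2 * y" and D=UNIV])
      show "set_integrable lborel {0..t} (\<lambda>s. ?b s x)"
        using t by (intro set_integral_diff D(13) D'(13)) auto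
      show "?w r x = ?w 0 x + (LINT s:{0..r}|lborel. ?b s x)" if "r \<in> {0..t}" for r
        using that D(14)[of 0 r x] D'(14)[of 0 r x] D(13)[of 0 r x] D'(13)[of 0 r x]
        by (subst set_integral_diff) auto
      show "b\<^sup>2 - a\<^sup>2 \<le> (2 * b) \<bullet> (b - a)" for a b :: real
      proof -
        have "0 \<le> (b - a)\<^sup>2" by simp
        then show ?thesis by (simp add: power2_eq_square algebra_simps)
      qed
    qed (use t in \<open>auto intro!: continuous_intros\<close>)
    then show ?thesis by (simp only: inner_real_def mult.assoc)
  qed
  have mt: "inH (?w r)" if "0 \<le> r" for r
    using dom_memL2[OF D(11)[OF that]] dom_memL2[OF D'(11)[OF that]] by (rule memL2_diff)
  have "(nH (?w t))\<^sup>2 - (nH (?w 0))\<^sup>2 = (\<integral>x. (?w t x)\<^sup>2 - (?w 0 x)\<^sup>2 \<partial>\<nu>1)"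
    using memL2_integrable[OF mt[of t]] memL2_integrable[OF mt[of 0]] t by (simp add: L2n_power2)
  also have "\<dots> \<le> (\<integral>x. (\<integral>s. 2 * (?w s x * ?b s x) \<partial>time_measure 0 t) \<partial>\<nu>1)"
  proof (rule integral_mono_AE)
    show "integrable \<nu>1 (\<lambda>x. (?w t x)\<^sup>2 - (?w 0 x)\<^sup>2)"
      using memL2_integrable[OF mt[of t]] memL2_integrable[OF mt[of 0]] t by simp
    show "integrable \<nu>1 (\<lambda>x. \<integral>s. 2 * (?w s x * ?b s x) \<partial>time_measure 0 t)"
      by (rule PS.integrable_snd[OF ih'])
    show "AE x in \<nu>1. (?w t x)\<^sup>2 - (?w 0 x)\<^sup>2 \<le> (\<integral>s. 2 * (?w s x * ?b s x) \<partial>time_measure 0 t)"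
      using AE_space
    proof eventually_elim
      case (elim x)
      have [measurable]: "(\<lambda>s. uh s x) \<in> borel_measurable borel" "(\<lambda>s. uh' s x) \<in> borel_measurable borel"
         "(\<lambda>s. vb s x) \<in> borel_measurable borel" "(\<lambda>s. vb' s x) \<in> borel_measurable borel"
        using measurable_compose[OF measurable_Pair2'[OF elim] D(6)] measurable_compose[OF measurable_Pair2'[OF elim] D'(6)]
          measurable_compose[OF measurable_Pair2'[OF elim] D(7)] measurable_compose[OF measurable_Pair2'[OF elim] D'(7)] by auto
      have "(\<integral>s. 2 * (?w s x * ?b s x) \<partial>time_measure 0 t) = (LINT s:{0..t}|lborel. 2 * (?w s x * ?b s x))"
        by (rule integral_time_measure) measurable
      then show ?case using chain[of x] by (simp only:)
    qed
  qed
  also have "\<dots> = (\<integral>s. (\<integral>x. 2 * (?w s x * ?b s x) \<partial>\<nu>1) \<partial>time_measure 0 t)"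
    by (rule PS.Fubini_integral[OF ih'])
  also have "\<dots> \<le> 2 * (4 * \<tau> * (En u0 + S) + 4 * \<tau>' * (En u0' + S') + L2n (spt 0 T) ?ff * L2n (spt 0 T) ?wf)" (is "_ \<le> ?K")
  proof (rule integral_real_bounded)
    let ?E = "\<tau> * (En u0 + S / 2)" and ?E' = "\<tau>' * (En u0' + S' / 2)"
    have pos: "0 \<le> ?E" "0 \<le> ?E'" "0 \<le> \<tau>" "0 \<le> \<tau>'" "0 \<le> 2 * En u0 + S" "0 \<le> 2 * En u0' + S'" "0 \<le> S" "0 \<le> S'"
      using D(1,3) D'(1,3) En_nonneg[of u0] En_nonneg[of u0'] by auto
    show "0 \<le> ?K" using D(1,3) D'(1,3) En_nonneg[of u0] En_nonneg[of u0'] by (intro mult_nonneg_nonneg add_nonneg_nonneg) auto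
    let ?B = "\<lambda>s. ennreal (\<epsilon> s) + ennreal (\<eta> s) + ennreal \<tau> * (ennreal ((nH (f s))\<^sup>2) + ennreal ((nH (vb s))\<^sup>2))
       + ennreal \<tau>' * (ennreal ((nH (f' s))\<^sup>2) + ennreal ((nH (vb' s))\<^sup>2))
       + ennreal (\<integral>x. \<bar>(f s x - f' s x) * ?w s x\<bar> \<partial>\<nu>1)"
    have [measurable]: "?B \<in> borel_measurable borel" unfolding L2n_def by measurable
    have "(\<integral>\<^sup>+s. ennreal (\<integral>x. 2 * (?w s x * ?b s x) \<partial>\<nu>1) \<partial>time_measure 0 t) \<le> (\<integral>\<^sup>+s. 2 * ?B s \<partial>time_measure 0 t)"
    proof (rule nn_integral_mono_AE, rule AE_time_measure_I)
      fix s assume s: "0 \<le> s" "s \<le> t"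
      have "(\<integral>x. 2 * (?w s x * ?b s x) \<partial>\<nu>1) \<le> 2 * (\<epsilon> s + \<eta> s + \<tau> * ((nH (f s))\<^sup>2 + (nH (vb s))\<^sup>2) + \<tau>' * ((nH (f' s))\<^sup>2 + (nH (vb' s))\<^sup>2)
         + (\<integral>x. \<bar>(f s x - f' s x) * ?w s x\<bar> \<partial>\<nu>1))"
        using approx_solution_instant[OF A A' s(1) \<epsilon>'(2)[OF s(1)] \<eta>'(2)[OF s(1)]] by (simp add: mult.commute)
      also have "ennreal (\<dots>) = 2 * ?B s"
        using \<epsilon>'(1)[OF s(1)] \<eta>'(1)[OF s(1)] pos by (simp add: ennreal_mult)
      finally show "ennreal (\<integral>x. 2 * (?w s x * ?b s x) \<partial>\<nu>1) \<le> 2 * ?B s" by (simp add: ennreal_leI)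
    qed
    also have "\<dots> \<le> (\<integral>\<^sup>+s. 2 * ?B s \<partial>time_measure 0 T)"
      by (rule nn_integral_time_measure_mono[OF _ sub]) measurable
    also have "\<dots> = 2 * ((\<integral>\<^sup>+s. ennreal (\<epsilon> s) \<partial>time_measure 0 T) + (\<integral>\<^sup>+s. ennreal (\<eta> s) \<partial>time_measure 0 T)
        + ennreal \<tau> * ((\<integral>\<^sup>+s. ennreal ((nH (f s))\<^sup>2) \<partial>time_measure 0 T) + (\<integral>\<^sup>+s. ennreal ((nH (vb s))\<^sup>2) \<partial>time_measure 0 T))
        + ennreal \<tau>' * ((\<integral>\<^sup>+s. ennreal ((nH (f' s))\<^sup>2) \<partial>time_measure 0 T) + (\<integral>\<^sup>+s. ennreal ((nH (vb' s))\<^sup>2) \<partial>time_measure 0 T))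
        + (\<integral>\<^sup>+s. ennreal (\<integral>x. \<bar>(f s x - f' s x) * ?w s x\<bar> \<partial>\<nu>1) \<partial>time_measure 0 T))"
    proof -
      have [measurable]: "(\<lambda>s. ennreal ((nH (f s))\<^sup>2)) \<in> borel_measurable borel" "(\<lambda>s. ennreal ((nH (vb s))\<^sup>2)) \<in> borel_measurable borel"
        "(\<lambda>s. ennreal ((nH (f' s))\<^sup>2)) \<in> borel_measurable borel" "(\<lambda>s. ennreal ((nH (vb' s))\<^sup>2)) \<in> borel_measurable borel"
        "(\<lambda>s. ennreal (\<integral>x. \<bar>(f s x - f' s x) * ?w s x\<bar> \<partial>\<nu>1)) \<in> borel_measurable borel"
        unfolding L2n_def by measurable
      show ?thesis by (rule nn_integral_weighted_sum) measurable
    qed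
    also have "\<dots> \<le> 2 * (ennreal ?E + ennreal ?E' + ennreal \<tau> * (ennreal S + ennreal (2 * En u0 + S))
        + ennreal \<tau>' * (ennreal S' + ennreal (2 * En u0' + S')) + ennreal (L2n (spt 0 T) ?ff * L2n (spt 0 T) ?wf))"
    proof (intro mult_left_mono add_mono \<epsilon>' \<eta>' D(18,19) D'(18,19))
      have i: "integrable (spt 0 T) (\<lambda>z. \<bar>?ff z * ?wf z\<bar>)" by (intro integrable_abs memL2_mult_integrable mw)
      then have i': "integrable (spt 0 T) (\<lambda>(s, x). \<bar>(f s x - f' s x) * ?w s x\<bar>)" unfolding split_beta .
      have "(\<integral>\<^sup>+s. ennreal (\<integral>x. \<bar>(f s x - f' s x) * ?w s x\<bar> \<partial>\<nu>1) \<partial>time_measure 0 T)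
          = ennreal (\<integral>s. (\<integral>x. \<bar>(f s x - f' s x) * ?w s x\<bar> \<partial>\<nu>1) \<partial>time_measure 0 T)"
        using PT.integrable_fst[OF i'] by (intro nn_integral_eq_integral) auto
      also have "(\<integral>s. (\<integral>x. \<bar>(f s x - f' s x) * ?w s x\<bar> \<partial>\<nu>1) \<partial>time_measure 0 T) = (\<integral>z. \<bar>?ff z * ?wf z\<bar> \<partial>spt 0 T)"
        using PT.integral_fst[OF i'] unfolding split_beta by simp
      also have "\<dots> = (\<integral>z. \<bar>?ff z\<bar> * \<bar>?wf z\<bar> \<partial>spt 0 T)" by (simp add: abs_mult)
      also have "\<dots> \<le> L2n (spt 0 T) (\<lambda>z. \<bar>?ff z\<bar>) * L2n (spt 0 T) (\<lambda>z. \<bar>?wf z\<bar>)"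
        using L2_Cauchy_Schwarz[OF memL2_abs[OF mw(3)] memL2_abs[OF mw(1)]] by simp
      also have "\<dots> = L2n (spt 0 T) ?ff * L2n (spt 0 T) ?wf" by (simp add: L2n_def)
      finally show "(\<integral>\<^sup>+s. ennreal (\<integral>x. \<bar>(f s x - f' s x) * ?w s x\<bar> \<partial>\<nu>1) \<partial>time_measure 0 T) \<le> ennreal (L2n (spt 0 T) ?ff * L2n (spt 0 T) ?wf)"
        by (simp add: ennreal_leI)
    qed auto
    also have "\<dots> = ennreal (2 * (?E + ?E' + \<tau> * (S + (2 * En u0 + S)) + \<tau>' * (S' + (2 * En u0' + S')) + L2n (spt 0 T) ?ff * L2n (spt 0 T) ?wf))"
      using pos by (intro ennreal_weighted_sum mult_nonneg_nonneg) auto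
    also have "\<dots> \<le> ennreal ?K"
    proof (rule ennreal_leI, rule mult_left_mono)
      \<comment> \<open>The contributions of one scheme add up to 3 times its energy plus 5/2 times
        \<open>S\<close>, times \<tau>; 4 is a convenient upper bound for both coefficients.\<close>
      have "?E + \<tau> * (S + (2 * En u0 + S)) \<le> 4 * \<tau> * (En u0 + S)"
        using pos En_nonneg[of u0] by (simp add: algebra_simps)
      moreover have "?E' + \<tau>' * (S' + (2 * En u0' + S')) \<le> 4 * \<tau>' * (En u0' + S')"
        using pos En_nonneg[of u0'] by (simp add: algebra_simps)
      ultimately show "?E + ?E' + \<tau> * (S + (2 * En u0 + S)) + \<tau>' * (S' + (2 * En u0' + S')) + L2n (spt 0 T) ?ff * L2n (spt 0 T) ?wf
        \<le> 4 * \<tau> * (En u0 + S) + 4 * \<tau>' * (En u0' + S') + L2n (spt 0 T) ?ff * L2n (spt 0 T) ?wf" by linarith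
    qed simp
    finally show "(\<integral>\<^sup>+s. ennreal (\<integral>x. 2 * (?w s x * ?b s x) \<partial>\<nu>1) \<partial>time_measure 0 t) \<le> ennreal ?K" .
  qed
  finally show ?thesis unfolding D(12) D'(12) by simp
qed

end

section \<open>Weak limits and density of step functions\<close>

text \<open>The convex hulls of the tails decrease, and the squared norm has the quadratic midpoint
  gain; minimizing it over the hulls yields a strongly convergent sequence of convex combinations,
  without passing through weak limits.\<close>

lemma Mazur_L2:
  fixes g :: "nat \<Rightarrow> 'b \<Rightarrow> real"
  assumes g: "\<And>n. memL2 \<rho> (g n)" and B: "\<And>n. L2n \<rho> (g n) \<le> B"
  obtains a :: "nat \<Rightarrow> nat \<Rightarrow> real" and N G where "\<And>k n. 0 \<le> a k n" "\<And>k n. n < k \<Longrightarrow> a k n = 0"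
    "\<And>k. (\<Sum>n<N k. a k n) = 1" "memL2 \<rho> G" "(\<lambda>k. L2n \<rho> (\<lambda>x. (\<Sum>n<N k. a k n * g n x) - G x)) \<longlonglongrightarrow> 0"
proof -
  \<comment> \<open>Coefficients vanish before index k, so that only the tail is used, and from N
    on, so that two combinations can be extended to a common length when midpoints are
    formed.\<close>
  define comb where "comb k a N h \<longleftrightarrow> (\<forall>n. 0 \<le> a n) \<and> (\<forall>n<k. a n = 0) \<and> (\<forall>n\<ge>N. a n = 0) \<and> (\<Sum>n<N. a n) = 1 \<and>
      h = (\<lambda>x. \<Sum>n<N. a n * g n x)" for k and a :: "nat \<Rightarrow> real" and N :: nat and h
  define S where "S k = {h. \<exists>a N. comb k a N h}" for k
  define I where "I h = (L2n \<rho> h)\<^sup>2" for h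
  have mem: "memL2 \<rho> h" if "h \<in> S k" for h k
    using that g by (auto simp: S_def comb_def intro!: memL2_sum memL2_cmult)
  have mid: "(\<lambda>x. (u x + v x) / 2) \<in> S k" if uv: "u \<in> S k" "v \<in> S k" for u v k
  proof -
    obtain a N b M where a: "comb k a N u" and b: "comb k b M v" using uv by (auto simp: S_def)
    let ?K = "max N M"
    have ext: "(\<Sum>n<?K. f n * w n) = (\<Sum>n<L. f n * w n)" if "\<forall>n\<ge>L. f n = 0" "L \<le> ?K" for f w :: "nat \<Rightarrow> real" and L
      using that by (intro sum.mono_neutral_right) auto
    have ext1: "(\<Sum>n<?K. f n) = (\<Sum>n<L. f n)" if "\<forall>n\<ge>L. f n = 0" "L \<le> ?K" for f :: "nat \<Rightarrow> real" and L
      using that by (intro sum.mono_neutral_right) auto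
    have "comb k (\<lambda>n. (a n + b n) / 2) ?K (\<lambda>x. (u x + v x) / 2)"
      unfolding comb_def
    proof (intro conjI)
      have "(\<Sum>n<?K. (a n + b n) / 2) = ((\<Sum>n<?K. a n) + (\<Sum>n<?K. b n)) / 2"
        by (simp add: sum.distrib sum_divide_distrib[symmetric])
      also have "\<dots> = 1" using a b ext1[of N a] ext1[of M b] by (simp add: comb_def)
      finally show "(\<Sum>n<?K. (a n + b n) / 2) = 1" .
      show "(\<lambda>x. (u x + v x) / 2) = (\<lambda>x. \<Sum>n<?K. (a n + b n) / 2 * g n x)"
      proof
        fix x
        have "(\<Sum>n<?K. (a n + b n) / 2 * g n x) = ((\<Sum>n<?K. a n * g n x) + (\<Sum>n<?K. b n * g n x)) / 2"
          by (simp add: sum.distrib[symmetric] sum_divide_distrib distrib_right add_divide_distrib)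
        also have "\<dots> = (u x + v x) / 2" using a b ext[of N a] ext[of M b] by (simp add: comb_def)
        finally show "(u x + v x) / 2 = (\<Sum>n<?K. (a n + b n) / 2 * g n x)" ..
      qed
    qed (use a b in \<open>auto simp: comb_def\<close>)
    then show ?thesis by (auto simp: S_def)
  qed
  have single: "g k \<in> S k" for k
  proof -
    have "comb k (\<lambda>n. of_bool (n = k)) (Suc k) (g k)"
      by (auto simp: comb_def)
    then show ?thesis by (auto simp: S_def)
  qed
  obtain h G r where h: "\<And>k. h k \<in> S k" and G: "memL2 \<rho> G" "(\<lambda>k. L2n \<rho> (\<lambda>x. h k x - G x)) \<longlonglongrightarrow> 0"
  proof (rule minimizing_sequence[where S=S and I=I and \<nu>=\<rho> and C="B\<^sup>2" and a="1/4"])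
    have "comb k a N h" if "comb (Suc k) a N h" for k a N h using that by (simp add: comb_def)
    then show "S (Suc k) \<subseteq> S k" for k unfolding S_def by blast
    show "\<exists>u\<in>S k. I u \<le> B\<^sup>2" for k
      using single[of k] B[of k] by (auto simp: I_def intro!: bexI[of _ "g k"] power_mono)
    show "I (\<lambda>x. (u x + v x) / 2) \<le> (I u + I v) / 2 - 1/4 * (L2n \<rho> (\<lambda>x. u x - v x))\<^sup>2" if "u \<in> S 0" "v \<in> S 0" for u v
      using L2n_parallelogram[OF mem[OF that(1)] mem[OF that(2)] memL2_0] by (simp add: I_def)
  qed (use mem mid in \<open>auto simp: I_def\<close>)
  have "\<forall>k. \<exists>a N. comb k a N (h k)" using h by (auto simp: S_def)
  then obtain a N where *: "\<And>k. comb k (a k) (N k) (h k)" by metis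
  then have hk: "h k = (\<lambda>x. \<Sum>n<N k. a k n * g n x)" for k by (auto simp: comb_def)
  show ?thesis by (rule that[of a N G]) (use * G in \<open>auto simp: comb_def hk\<close>)
qed

lemma cell_refine:
  assumes "0 < T" "0 < N" "0 < M"
  shows "cell (T / real N) t = cell (T / real (N * M)) t div M"
proof -
  have eq: "t / (T / real N) = t / (T / real (N * M)) / real_of_int (int M)" using assms by (simp add: field_simps)
  have "\<lfloor>t / (T / real N)\<rfloor> = \<lfloor>t / (T / real (N * M))\<rfloor> div int M"
    unfolding eq by (rule floor_divide_real_eq_div) simp
  then show ?thesis unfolding cell_def by (simp add: nat_div_distrib')
qed

section \<open>Density of step functions in time\<close>

context plap_space
begin

definition step_fun :: "real \<Rightarrow> nat \<Rightarrow> (nat \<Rightarrow> 'a \<Rightarrow> real) \<Rightarrow> real \<times> 'a \<Rightarrow> real" where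
  "step_fun T N F w = F (cell (T / real N) (fst w)) (snd w)"

lemma step_fun_memL2:
  assumes "0 < T" "0 < N" "\<And>k. inH (F k)"
  shows "memL2 (spt 0 T) (step_fun T N F)"
  unfolding step_fun_def[abs_def]
proof (rule memL2_sptI(1)[where h="\<lambda>t. F (cell (T / real N) t)"])
  show "(\<lambda>(t, x). F (cell (T / real N) t) x) \<in> jmeas"
    by (rule step_measurable) (use assms memL2_measurable in auto)
  show "(\<integral>\<^sup>+t. ennreal ((nH (F (cell (T / real N) t)))\<^sup>2) \<partial>time_measure 0 T)
      \<le> ennreal (T / real N * (\<Sum>j<N. (nH (F j))\<^sup>2))"
    using assms by (subst nn_step_integral) auto
  show "0 \<le> T / real N * (\<Sum>j<N. (nH (F j))\<^sup>2)" using assms by (intro mult_nonneg_nonneg sum_nonneg) auto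
qed (use assms in auto)

text \<open>Two uniform grids with N and M cells are both refined by the one with N M cells, which
  is why step functions over uniform grids form a vector space.\<close>

lemma step_fun_refine:
  assumes "0 < T" "0 < N" "0 < M"
  shows "step_fun T N F = step_fun T (N * M) (\<lambda>k. F (k div M))"
  unfolding step_fun_def[abs_def] using cell_refine[OF assms] by simp

text \<open>Uniform grids cut time only at grid points; rectangles with an arbitrary time edge are
  obtained as limits of step functions over ever finer grids. Such rectangles generate the
  \<sigma>-algebra, and a Dynkin argument transfers vanishing integrals to all measurable sets. The
  pieces \<open>Af i\<close> provide integrability.\<close>

lemma orthogonal_step_fun_zero:
  assumes T: "0 < T" and r: "memL2 (spt 0 T) r"
    and orth: "\<And>N F. 0 < N \<Longrightarrow> (\<And>k. inH (F k)) \<Longrightarrow> (\<integral>w. r w * step_fun T N F w \<partial>spt 0 T) = 0"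
  shows "AE w in spt 0 T. r w = 0"
proof -
  interpret PS: pair_sigma_finite "time_measure 0 T" \<nu>1 by (rule pair_sigma_finite_spt)
  note [measurable] = memL2_measurable[OF r]
  obtain Af :: "nat \<Rightarrow> 'a set" where Af: "range Af \<subseteq> sets \<nu>1" "(\<Union>i. Af i) = space \<nu>1" "\<And>i. emeasure \<nu>1 (Af i) \<noteq> \<infinity>"
    using S1.sigma_finite by blast
  have indL2: "inH (indicator B)" if [measurable]: "B \<in> sets \<nu>1" and "emeasure \<nu>1 B < \<infinity>" for B
    using that by (simp add: memL2_def power2_eq_square flip: indicator_inter_arith)
  have indT: "memL2 (spt 0 T) (\<lambda>w. indicator B (snd w))" if "B \<in> sets \<nu>1" "emeasure \<nu>1 B < \<infinity>" for B
    using step_fun_memL2[OF T, of 1 "\<lambda>_. indicator B"] indL2[OF that] by (simp add: step_fun_def[abs_def])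
  have rect: "(\<integral>w. r w * (of_bool (fst w < a) * indicator B (snd w)) \<partial>spt 0 T) = 0"
    if B[measurable]: "B \<in> sets \<nu>1" and fB: "emeasure \<nu>1 B < \<infinity>" for a B
  proof -
    \<comment> \<open>The time indicator of [0, a) rounded down to the grid of step T/(n+1). It is 0
      at once for t \<ge> a and becomes 1 for t < a once the mesh is smaller than a - t.\<close>
    let ?v = "\<lambda>n w. of_bool (cell (T / real (Suc n)) (fst w) < nat \<lfloor>real (Suc n) * a / T\<rfloor>) * indicator B (snd w) :: real"
    have "(\<integral>w. r w * ?v n w \<partial>spt 0 T) = 0" for n
    proof -
      have "(\<integral>w. r w * step_fun T (Suc n) (\<lambda>k x. of_bool (k < nat \<lfloor>real (Suc n) * a / T\<rfloor>) * indicator B x) w \<partial>spt 0 T) = 0"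
        by (rule orth) (auto intro!: memL2_cmult indL2 that)
      then show ?thesis unfolding step_fun_def .
    qed
    moreover have "(\<lambda>n. \<integral>w. r w * ?v n w \<partial>spt 0 T) \<longlonglongrightarrow> (\<integral>w. r w * (of_bool (fst w < a) * indicator B (snd w)) \<partial>spt 0 T)"
    proof (rule integral_dominated_convergence[where w="\<lambda>w. \<bar>r w * indicator B (snd w)\<bar>"])
      show "integrable (spt 0 T) (\<lambda>w. \<bar>r w * indicator B (snd w)\<bar>)"
        by (intro integrable_abs memL2_mult_integrable r indT that)
      show "AE w in spt 0 T. norm (r w * ?v n w) \<le> \<bar>r w * indicator B (snd w)\<bar>" for n
        by (rule AE_I2) (auto simp: abs_mult split: split_indicator)
      have lim: "(\<lambda>n. of_bool (cell (T / real (Suc n)) t < nat \<lfloor>real (Suc n) * a / T\<rfloor>) :: real) \<longlonglongrightarrow> of_bool (t < a)" if t: "0 \<le> t" for t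
      proof (cases "t < a")
        case False
        have "cell (T / real (Suc n)) t \<ge> nat \<lfloor>real (Suc n) * a / T\<rfloor>" for n
        proof -
          have "real (Suc n) * a / T \<le> t / (T / real (Suc n))"
            unfolding divide_divide_eq_right mult.commute[of t] using False T
            by (intro divide_right_mono mult_left_mono) auto
          then show ?thesis unfolding cell_def by (intro nat_mono floor_mono)
        qed
        then show ?thesis using False by (simp add: leD)
      next
        case True
        obtain n0 where n0: "T / (a - t) < real n0" using reals_Archimedean2 by blast
        have "cell (T / real (Suc n)) t < nat \<lfloor>real (Suc n) * a / T\<rfloor>" if "n \<ge> n0" for n
        proof -
          have "T / (a - t) \<le> real (Suc n)" using n0 that by simp
          then have "T \<le> real (Suc n) * (a - t)" using True by (simp add: pos_divide_le_eq)
          then have "T / T \<le> real (Suc n) * (a - t) / T" using T by (intro divide_right_mono) auto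
          also have "\<dots> = real (Suc n) * a / T - t / (T / real (Suc n))"
            by (simp only: right_diff_distrib left_diff_distrib diff_divide_distrib divide_divide_eq_right mult.commute)
          finally have "t / (T / real (Suc n)) + 1 \<le> real (Suc n) * a / T" using T by simp
          then have "\<lfloor>t / (T / real (Suc n)) + 1\<rfloor> \<le> \<lfloor>real (Suc n) * a / T\<rfloor>" by (rule floor_mono)
          moreover have "0 \<le> \<lfloor>t / (T / real (Suc n))\<rfloor>" using t T by simp
          moreover have "nat p < nat q" if "0 \<le> p" "p + 1 \<le> q" for p q :: int using that by simp
          ultimately show ?thesis unfolding cell_def by (simp only: floor_add2[OF disjI2[OF Ints_1]] floor_one)
        qed
        then have "eventually (\<lambda>n. of_bool (cell (T / real (Suc n)) t < nat \<lfloor>real (Suc n) * a / T\<rfloor>) = (of_bool (t < a) :: real)) sequentially"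
          using True by (auto simp: eventually_sequentially)
        then show ?thesis by (rule tendsto_eventually)
      qed
      have "AE w in spt 0 T. 0 \<le> fst w"
      proof (rule PS.AE_pair_measure)
        show "{x \<in> space (spt 0 T). 0 \<le> fst x} \<in> sets (spt 0 T)" by measurable
        show "AE x in time_measure 0 T. AE y in \<nu>1. 0 \<le> fst (x, y)" by (rule AE_time_measure_I) simp
      qed
      then show "AE w in spt 0 T. (\<lambda>n. r w * ?v n w) \<longlonglongrightarrow> r w * (of_bool (fst w < a) * indicator B (snd w))"
        by eventually_elim (intro tendsto_mult tendsto_const lim)
    qed measurable
    ultimately show ?thesis by (simp add: LIMSEQ_const_iff)
  qed
  have "AE w in spt 0 T. indicator (Af i) (snd w) * r w = 0" for i
  proof (rule PS.P.density_zero)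
    let ?R = "\<lambda>w. indicator (Af i) (snd w) * r w"
    have Ai[measurable]: "Af i \<in> sets \<nu>1" and fA: "emeasure \<nu>1 (Af i) < \<infinity>" using Af by (auto simp: less_top)
    show iR: "integrable (spt 0 T) ?R" by (rule memL2_mult_integrable[OF indT[OF Ai fA] r])
    have rect': "(LINT w:{..<a} \<times> B|spt 0 T. ?R w) = 0" if [measurable]: "B \<in> sets \<nu>1" for a B
    proof -
      have "emeasure \<nu>1 (B \<inter> Af i) \<le> emeasure \<nu>1 (Af i)" by (intro emeasure_mono) auto
      then have "emeasure \<nu>1 (B \<inter> Af i) < \<infinity>" using fA by (rule le_less_trans)
      then have "(\<integral>w. r w * (of_bool (fst w < a) * indicator (B \<inter> Af i) (snd w)) \<partial>spt 0 T) = 0"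
        by (intro rect) auto
      also have "(\<integral>w. r w * (of_bool (fst w < a) * indicator (B \<inter> Af i) (snd w)) \<partial>spt 0 T) = (LINT w:{..<a} \<times> B|spt 0 T. ?R w)"
        unfolding set_lebesgue_integral_def
        by (rule Bochner_Integration.integral_cong) (auto split: split_indicator)
      finally show ?thesis .
    qed
    let ?\<G> = "{a \<times> b | a b. a \<in> (range lessThan :: real set set) \<and> b \<in> sets \<nu>1}"
    have "sets (borel \<Otimes>\<^sub>M \<nu>1) = sets (sigma (space borel \<times> space \<nu>1) ?\<G>)"
    proof (rule sets_pair_eq)
      show "sets borel = sigma_sets (space borel) (range lessThan :: real set set)"
        using arg_cong[OF borel_Iio, of sets] by simp
      show "sets \<nu>1 = sigma_sets (space \<nu>1) (sets \<nu>1)" by (simp add: sets.sigma_sets_eq)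
      show "countable (range (\<lambda>n. {..<real n}))" "range (\<lambda>n. {..<real n}) \<subseteq> range lessThan" by auto
      show "\<Union> (range (\<lambda>n. {..<real n})) = space borel" using reals_Archimedean2 by auto
      show "countable {space \<nu>1}" "{space \<nu>1} \<subseteq> sets \<nu>1" "\<Union> {space \<nu>1} = space \<nu>1" by auto
    qed (auto dest: sets.sets_into_space)
    then have gen: "sets (spt 0 T) = sigma_sets (UNIV \<times> space \<nu>1) ?\<G>"
      unfolding sets_spt by (subst (asm) sets_measure_of) (auto dest: sets.sets_into_space)
    \<comment> \<open>Needed for complements in the Dynkin argument. The time measure is carried by
      [0, T], so the rectangle with time edge T + 1 has full measure.\<close>
    have whole: "(\<integral>w. ?R w \<partial>spt 0 T) = 0"
    proof -
      have "(\<integral>w. ?R w \<partial>spt 0 T) = (LINT w:{..<T + 1} \<times> space \<nu>1|spt 0 T. ?R w)"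
        unfolding set_lebesgue_integral_def
      proof (rule integral_cong_AE)
        have "AE w in spt 0 T. fst w \<le> T"
        proof (rule PS.AE_pair_measure)
          show "{x \<in> space (spt 0 T). fst x \<le> T} \<in> sets (spt 0 T)" by measurable
          show "AE x in time_measure 0 T. AE y in \<nu>1. fst (x, y) \<le> T" by (rule AE_time_measure_I) simp
        qed
        then show "AE w in spt 0 T. ?R w = indicator ({..<T + 1} \<times> space \<nu>1) w *\<^sub>R ?R w"
          using AE_space
        proof eventually_elim
          case (elim w)
          then have "w \<in> {..<T + 1} \<times> space \<nu>1" by (cases w) (auto simp: space_pair_measure)
          then show ?case by simp
        qed
      qed (auto intro!: borel_measurable_times borel_measurable_indicator)
      then show ?thesis using rect'[of "space \<nu>1"] by simp
    qed
    fix E assume E: "E \<in> sets (spt 0 T)"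
    show "(LINT w:E|spt 0 T. ?R w) = 0"
    proof (rule sigma_sets_induct_disjoint[where G="?\<G>" and \<Omega>="UNIV \<times> space \<nu>1" and A=E and P="\<lambda>E. (LINT w:E|spt 0 T. ?R w) = 0"])
      show "E \<in> sigma_sets (UNIV \<times> space \<nu>1) ?\<G>" using E by (simp only: gen)
      show "Int_stable ?\<G>"
      proof (rule Int_stableI)
        fix x y assume "x \<in> ?\<G>" "y \<in> ?\<G>"
        then obtain a b B D where "x = {..<a} \<times> B" "y = {..<b} \<times> D" "B \<in> sets \<nu>1" "D \<in> sets \<nu>1" by auto
        moreover from this have "x \<inter> y = {..<min a b} \<times> (B \<inter> D)" by auto
        ultimately show "x \<inter> y \<in> ?\<G>" by blast
      qed
      show "?\<G> \<subseteq> Pow (UNIV \<times> space \<nu>1)" by (auto dest: sets.sets_into_space)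
    next
      fix E assume "E \<in> ?\<G>"
      then show "(LINT w:E|spt 0 T. ?R w) = 0" using rect' by auto
    next
      show "(LINT w:{}|spt 0 T. ?R w) = 0" by (simp add: set_lebesgue_integral_def)
    next
      fix E assume E: "E \<in> sigma_sets (UNIV \<times> space \<nu>1) ?\<G>" and z: "(LINT w:E|spt 0 T. ?R w) = 0"
      have Em[measurable]: "E \<in> sets (spt 0 T)" using E by (simp only: gen)
      have i: "integrable (spt 0 T) (\<lambda>w. indicator E w *\<^sub>R ?R w)"
        by (rule integrable_mult_indicator[OF Em iR])
      have "(LINT w:UNIV \<times> space \<nu>1 - E|spt 0 T. ?R w) = (\<integral>w. ?R w - indicator E w *\<^sub>R ?R w \<partial>spt 0 T)"
        unfolding set_lebesgue_integral_def
        by (rule Bochner_Integration.integral_cong) (auto simp: space_pair_measure split: split_indicator)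
      also have "\<dots> = 0" using iR i whole z by (simp add: set_lebesgue_integral_def)
      finally show "(LINT w:UNIV \<times> space \<nu>1 - E|spt 0 T. ?R w) = 0" .
    next
      fix D :: "nat \<Rightarrow> (real \<times> 'a) set"
      assume D: "disjoint_family D" "range D \<subseteq> sigma_sets (UNIV \<times> space \<nu>1) ?\<G>" "\<And>n. (LINT w:D n|spt 0 T. ?R w) = 0"
      have Dm: "D n \<in> sets (spt 0 T)" for n using D(2) by (auto simp only: gen)
      have "(LINT w:(\<Union>n. D n)|spt 0 T. ?R w) = (\<Sum>n. LINT w:D n|spt 0 T. ?R w)"
      proof (rule lebesgue_integral_countable_add)
        show "set_integrable (spt 0 T) (\<Union>n. D n) ?R"
          unfolding set_integrable_def by (rule integrable_mult_indicator[OF _ iR]) (use Dm in auto)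
      qed (use Dm D(1) in \<open>auto simp: disjoint_family_on_def\<close>)
      then show "(LINT w:(\<Union>n. D n)|spt 0 T. ?R w) = 0" using D(3) by simp
    qed
  qed
  then have "AE w in spt 0 T. \<forall>i. indicator (Af i) (snd w) * r w = 0" unfolding AE_all_countable by blast
  with AE_space show ?thesis
  proof eventually_elim
    case (elim w)
    then have "snd w \<in> space \<nu>1" by (auto simp: space_pair_measure)
    then obtain i where "snd w \<in> Af i" using Af(2) by auto
    then show ?case using elim(2)[rule_format, of i] by simp
  qed
qed

text \<open>Projection argument: minimizing the distance to f over step functions gives a limit G
  with G - f orthogonal to all of them, hence zero. Perturbations of the near-minimizers by \<theta>
  v of either sign yield the orthogonality in the limit.\<close>

lemma step_fun_dense:
  assumes T: "0 < T" and f: "memL2 (spt 0 T) f" and e: "0 < e"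
  obtains N F where "0 < N" "\<And>k. inH (F k)" "L2n (spt 0 T) (\<lambda>w. step_fun T N F w - f w) < e"
proof -
  define S where "S = {h. \<exists>N F. 0 < N \<and> (\<forall>k. inH (F k)) \<and> h = step_fun T N F}"
  define I where "I h = (L2n (spt 0 T) (\<lambda>w. h w - f w))\<^sup>2" for h
  have mem: "memL2 (spt 0 T) h" if "h \<in> S" for h using that step_fun_memL2[OF T] by (auto simp: S_def)
  have lin: "(\<lambda>w. a * u w + b * v w) \<in> S" if uv: "u \<in> S" "v \<in> S" for u v a b
  proof -
    obtain N F M G where *: "0 < N" "\<And>k. inH (F k)" "u = step_fun T N F" "0 < M" "\<And>k. inH (G k)" "v = step_fun T M G"
      using uv by (auto simp: S_def)
    have u: "u = step_fun T (N * M) (\<lambda>k. F (k div M))" using step_fun_refine[OF T *(1) *(4)] * by simp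
    have v: "v = step_fun T (N * M) (\<lambda>k. G (k div N))" using step_fun_refine[OF T *(4) *(1)] * by (simp add: mult.commute)
    have "(\<lambda>w. a * u w + b * v w) = step_fun T (N * M) (\<lambda>k x. a * F (k div M) x + b * G (k div N) x)"
      unfolding u v by (auto simp: step_fun_def)
    then show ?thesis unfolding S_def mem_Collect_eq
      using * by (intro exI[of _ "N * M"] exI[of _ "\<lambda>k x. a * F (k div M) x + b * G (k div N) x"] conjI allI memL2_add memL2_cmult) auto
  qed
  have zero: "(\<lambda>w. 0) \<in> S" unfolding S_def by (auto intro!: exI[of _ 1] exI[of _ "\<lambda>_ _. 0"] simp: step_fun_def[abs_def])
  have mid: "(\<lambda>x. (u x + v x) / 2) \<in> S" if "u \<in> S" "v \<in> S" for u v
    using lin[OF that, of "1/2" "1/2"] by (simp add: add_divide_distrib)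
  obtain h G r where h: "\<And>k::nat. h k \<in> S" "\<And>k v. v \<in> S \<Longrightarrow> I (h k) \<le> I v + 1 / (real k + 1)"
    and G: "memL2 (spt 0 T) G" "(\<lambda>k. L2n (spt 0 T) (\<lambda>x. h k x - G x)) \<longlonglongrightarrow> 0"
  proof (rule minimizing_sequence[where S="\<lambda>_. S" and I=I and \<nu>="spt 0 T" and C="I (\<lambda>w. 0)" and a="1/4"])
    show "\<exists>u\<in>S. I u \<le> I (\<lambda>w. 0)" using zero by auto
    show "I (\<lambda>x. (u x + v x) / 2) \<le> (I u + I v) / 2 - 1/4 * (L2n (spt 0 T) (\<lambda>x. u x - v x))\<^sup>2" if "u \<in> S" "v \<in> S" for u v
      using L2n_parallelogram[OF mem[OF that(1)] mem[OF that(2)] f] by (simp add: I_def)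
  qed (use mem mid in \<open>auto simp: I_def\<close>)
  have mr: "memL2 (spt 0 T) (\<lambda>w. G w - f w)" by (intro memL2_diff G f)
  have orth: "(\<integral>w. (G w - f w) * v w \<partial>spt 0 T) = 0" if v: "v \<in> S" for v
  proof -
    have ge: "0 \<le> 2 * \<theta> * (\<integral>w. (G w - f w) * v w \<partial>spt 0 T) + \<theta>\<^sup>2 * (L2n (spt 0 T) v)\<^sup>2" for \<theta>
    proof -
      have "(\<integral>w. (h k w - f w) * v w \<partial>spt 0 T) * (2 * \<theta>) + \<theta>\<^sup>2 * (L2n (spt 0 T) v)\<^sup>2 + 1 / (real k + 1) \<ge> 0" for k
      proof -
        have "I (h k) \<le> I (\<lambda>w. 1 * h k w + \<theta> * v w) + 1 / (real k + 1)" by (intro h lin v)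
        moreover have "I (\<lambda>w. 1 * h k w + \<theta> * v w) = (L2n (spt 0 T) (\<lambda>w. (h k w - f w) + \<theta> * v w))\<^sup>2"
          unfolding I_def by (simp add: algebra_simps)
        ultimately show ?thesis
          using L2n_power2_add[OF memL2_diff[OF mem[OF h(1)[of k]] f] mem[OF v], of \<theta>] by (simp add: I_def algebra_simps)
      qed
      moreover have "(\<lambda>k. (\<integral>w. (h k w - f w) * v w \<partial>spt 0 T) * (2 * \<theta>) + \<theta>\<^sup>2 * (L2n (spt 0 T) v)\<^sup>2 + 1 / (real k + 1))
          \<longlonglongrightarrow> (\<integral>w. (G w - f w) * v w \<partial>spt 0 T) * (2 * \<theta>) + \<theta>\<^sup>2 * (L2n (spt 0 T) v)\<^sup>2 + 0"
      proof (intro tendsto_add tendsto_mult tendsto_const)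
        show "(\<lambda>k. \<integral>w. (h k w - f w) * v w \<partial>spt 0 T) \<longlonglongrightarrow> (\<integral>w. (G w - f w) * v w \<partial>spt 0 T)"
          by (rule tendsto_integral_mult_L2) (use G f mem[OF h(1)] mem[OF v] in \<open>auto intro!: memL2_diff\<close>)
        show "(\<lambda>k. 1 / (real k + 1)) \<longlonglongrightarrow> 0" using LIMSEQ_Suc[OF lim_1_over_n] by (simp add: add.commute)
      qed
      ultimately have "0 \<le> (\<integral>w. (G w - f w) * v w \<partial>spt 0 T) * (2 * \<theta>) + \<theta>\<^sup>2 * (L2n (spt 0 T) v)\<^sup>2 + 0"
        by (intro LIMSEQ_le_const) auto
      then show ?thesis by (simp add: mult.commute)
    qed
    let ?i = "\<integral>w. (G w - f w) * v w \<partial>spt 0 T" and ?n = "(L2n (spt 0 T) v)\<^sup>2"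
    have "0 \<le> 2 * ?i + \<theta> * ?n" if "0 < \<theta>" "\<theta> \<le> 1" for \<theta>
    proof -
      have "0 \<le> \<theta> * (2 * ?i + \<theta> * ?n)" using ge[of \<theta>] by (simp add: algebra_simps power2_eq_square)
      then show ?thesis using that by (simp add: zero_le_mult_iff)
    qed
    then have "0 \<le> 2 * ?i" by (rule nonneg_of_small_perturbation)
    moreover have "0 \<le> - (2 * ?i) + \<theta> * ?n" if "0 < \<theta>" "\<theta> \<le> 1" for \<theta>
    proof -
      have "0 \<le> \<theta> * (- (2 * ?i) + \<theta> * ?n)" using ge[of "- \<theta>"] by (simp add: algebra_simps power2_eq_square)
      then show ?thesis using that by (simp add: zero_le_mult_iff)
    qed
    then have "0 \<le> - (2 * ?i)" by (rule nonneg_of_small_perturbation)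
    ultimately show ?thesis by simp
  qed
  have "AE w in spt 0 T. G w - f w = 0"
    by (rule orthogonal_step_fun_zero[OF T mr], rule orth) (auto simp: S_def)
  then have z: "L2n (spt 0 T) (\<lambda>w. G w - f w) = 0"
    using L2n_cong_AE[OF memL2_measurable[OF mr], of "\<lambda>w. 0"] by simp
  have "(\<lambda>k. L2n (spt 0 T) (\<lambda>w. h k w - f w)) \<longlonglongrightarrow> 0"
  proof (rule Lim_null_comparison[OF _ G(2)])
    show "\<forall>\<^sub>F k in sequentially. norm (L2n (spt 0 T) (\<lambda>w. h k w - f w)) \<le> L2n (spt 0 T) (\<lambda>x. h k x - G x)"
      using L2n_triangle_diff[OF mem[OF h(1)] G(1) f] z by (auto intro!: always_eventually)
  qed
  then have "eventually (\<lambda>k. L2n (spt 0 T) (\<lambda>w. h k w - f w) < e) sequentially" using e by (rule order_tendstoD)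
  then obtain k where "L2n (spt 0 T) (\<lambda>w. h k w - f w) < e" by (auto simp: eventually_sequentially)
  moreover obtain N F where "0 < N" "\<And>j. inH (F j)" "h k = step_fun T N F" using h(1)[of k] by (auto simp: S_def)
  ultimately show ?thesis using that by auto
qed

end

section \<open>Existence of strong solutions\<close>

lemma L2n_time_measure_Cauchy_Schwarz:
  assumes ab: "a \<le> b" and [measurable]: "v \<in> borel_measurable borel" and v: "memL2 (time_measure a b) v"
  shows "set_integrable lborel {a..b} v" "(LINT r:{a..b}|lborel. v r)\<^sup>2 \<le> (b - a) * (L2n (time_measure a b) v)\<^sup>2"
proof -
  interpret finite_measure "time_measure a b" by (rule finite_time_measure)
  have one: "memL2 (time_measure a b) (\<lambda>r. 1)" by (simp add: memL2_def)
  have "measure (time_measure a b) UNIV = b - a"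
    using ab emeasure_time_measure_UNIV by (simp add: measure_def)
  then have L1: "(L2n (time_measure a b) (\<lambda>r. 1))\<^sup>2 = b - a" by (simp add: L2n_power2)
  have i: "integrable (time_measure a b) v" using memL2_mult_integrable[OF one v] by simp
  then show "set_integrable lborel {a..b} v" by (simp add: integrable_time_measure)
  have "\<bar>\<integral>r. v r \<partial>time_measure a b\<bar>\<^sup>2 \<le> (L2n (time_measure a b) (\<lambda>r. 1) * L2n (time_measure a b) v)\<^sup>2"
    using L2_Cauchy_Schwarz[OF one v] by (intro power_mono) auto
  then show "(LINT r:{a..b}|lborel. v r)\<^sup>2 \<le> (b - a) * (L2n (time_measure a b) v)\<^sup>2"
    by (simp add: integral_time_measure power_mult_distrib L1)
qed

context plap_space
begin

text \<open>Cauchy-Schwarz in time for almost every x, then Tonelli. The factor sqrt(b - a) makes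
  primitives Hoelder continuous of order 1/2 with values in L^2.\<close>

lemma L2n_time_integral:
  assumes ab: "a \<le> b" and vm: "case_prod v \<in> jmeas"
    and v: "memL2 (spt a b) (unc v)"
  shows "AE x in \<nu>1. set_integrable lborel {a..b} (\<lambda>r. v r x)"
    and "inH (\<lambda>x. LINT r:{a..b}|lborel. v r x)"
    and "nH (\<lambda>x. LINT r:{a..b}|lborel. v r x) \<le> sqrt (b - a) * L2n (spt a b) (unc v)"
proof -
  interpret PS: pair_sigma_finite "time_measure a b" \<nu>1 by (rule pair_sigma_finite_spt)
  have [measurable]: "(unc v) \<in> jmeas" using vm by (simp add: split_beta)
  have [measurable]: "(\<lambda>w. v (snd w) (fst w)) \<in> borel_measurable (\<nu>1 \<Otimes>\<^sub>M borel)"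
    using measurable_pair_swap[OF vm] by (simp add: split_beta)
  have vx: "(\<lambda>r. v r x) \<in> borel_measurable borel" if "x \<in> space \<nu>1" for x
    using measurable_compose[OF measurable_Pair2'[OF that] vm] by simp
  have sw: "(\<integral>\<^sup>+x. \<integral>\<^sup>+r. ennreal ((v r x)\<^sup>2) \<partial>time_measure a b \<partial>\<nu>1) = ennreal ((L2n (spt a b) (unc v))\<^sup>2)"
    unfolding nn_integral_L2n[OF v, symmetric]
    using PS.nn_integral_snd[of "\<lambda>w. ennreal ((v (fst w) (snd w))\<^sup>2)"] by (simp add: measurable_spt)
  have nm: "(\<lambda>x. \<integral>\<^sup>+r. ennreal ((v r x)\<^sup>2) \<partial>time_measure a b) \<in> borel_measurable \<nu>1"
    by measurable
  have "AE x in \<nu>1. (\<integral>\<^sup>+r. ennreal ((v r x)\<^sup>2) \<partial>time_measure a b) \<noteq> \<infinity>"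
    by (rule nn_integral_PInf_AE[OF nm]) (simp add: sw)
  with AE_space have mem: "AE x in \<nu>1. x \<in> space \<nu>1 \<and> memL2 (time_measure a b) (\<lambda>r. v r x)"
    by eventually_elim (use vx in \<open>auto simp: memL2_iff_nn_integral less_top measurable_cong_sets[of "time_measure a b" borel]\<close>)
  then show "AE x in \<nu>1. set_integrable lborel {a..b} (\<lambda>r. v r x)"
    by eventually_elim (use L2n_time_measure_Cauchy_Schwarz(1)[OF ab vx] in auto)
  have [measurable]: "(\<lambda>x. LINT r:{a..b}|lborel. v r x) \<in> borel_measurable \<nu>1"
    unfolding set_lebesgue_integral_def by measurable
  have "(\<integral>\<^sup>+x. ennreal ((LINT r:{a..b}|lborel. v r x)\<^sup>2) \<partial>\<nu>1) \<le> (\<integral>\<^sup>+x. ennreal (b - a) * (\<integral>\<^sup>+r. ennreal ((v r x)\<^sup>2) \<partial>time_measure a b) \<partial>\<nu>1)"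
  proof (rule nn_integral_mono_AE)
    show "AE x in \<nu>1. ennreal ((LINT r:{a..b}|lborel. v r x)\<^sup>2) \<le> ennreal (b - a) * (\<integral>\<^sup>+r. ennreal ((v r x)\<^sup>2) \<partial>time_measure a b)"
      using mem
    proof eventually_elim
      case (elim x)
      then have m: "memL2 (time_measure a b) (\<lambda>r. v r x)" and xs: "x \<in> space \<nu>1" by auto
      show ?case unfolding nn_integral_L2n[OF m]
        using L2n_time_measure_Cauchy_Schwarz(2)[OF ab vx[OF xs] m] ab by (simp add: ennreal_leI flip: ennreal_mult)
    qed
  qed
  also have "\<dots> = ennreal (b - a) * ennreal ((L2n (spt a b) (unc v))\<^sup>2)"
    using nm by (simp add: nn_integral_cmult sw)
  also have "\<dots> = ennreal ((sqrt (b - a) * L2n (spt a b) (unc v))\<^sup>2)"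
    using ab by (simp add: power_mult_distrib ennreal_mult)
  finally have *: "(\<integral>\<^sup>+x. ennreal ((LINT r:{a..b}|lborel. v r x)\<^sup>2) \<partial>\<nu>1) \<le> ennreal ((sqrt (b - a) * L2n (spt a b) (unc v))\<^sup>2)" .
  show "inH (\<lambda>x. LINT r:{a..b}|lborel. v r x)"
    by (rule memL2_nn_integralI(1)[OF _ *]) (use ab in auto)
  show "nH (\<lambda>x. LINT r:{a..b}|lborel. v r x) \<le> sqrt (b - a) * L2n (spt a b) (unc v)"
    by (rule memL2_nn_integralI(2)[OF _ *]) (use ab in auto)
qed

text \<open>The truncations \<open>trunc k (u x)\<close> have finite energy because they are bounded
  with support of finite measure, and they converge to u dominated by |u|.\<close>

lemma dom_dense:
  assumes u: "inH u" and e: "0 < e"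
  obtains w where "dom w" "nH (\<lambda>x. w x - u x) < e"
proof -
  note [measurable] = memL2_measurable[OF u]
  have d: "dom (\<lambda>x. trunc k (u x))" for k
  proof (rule dom_finite_support(1)[where K="real (Suc k)" and B="{x \<in> space \<nu>1. 1 / real (Suc k) < \<bar>u x\<bar>}"])
    show "emeasure \<nu>1 {x \<in> space \<nu>1. 1 / real (Suc k) < \<bar>u x\<bar>} < \<infinity>"
      by (rule emeasure_superlevel_finite[OF u]) simp
  qed (use abs_trunc_le in \<open>auto simp: trunc_def\<close>)
  have "(\<lambda>k. \<integral>x. (trunc k (u x) - u x)\<^sup>2 \<partial>\<nu>1) \<longlonglongrightarrow> (\<integral>x. 0 \<partial>\<nu>1)"
  proof (rule integral_dominated_convergence[where w="\<lambda>x. (u x)\<^sup>2"])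
    show "integrable \<nu>1 (\<lambda>x. (u x)\<^sup>2)" by (rule memL2_integrable[OF u])
    show "AE x in \<nu>1. (\<lambda>k. (trunc k (u x) - u x)\<^sup>2) \<longlonglongrightarrow> 0"
    proof (rule AE_I2)
      fix x
      have "(\<lambda>k. (trunc k (u x) - u x)\<^sup>2) \<longlonglongrightarrow> (u x - u x)\<^sup>2" by (intro tendsto_intros trunc_tendsto)
      then show "(\<lambda>k. (trunc k (u x) - u x)\<^sup>2) \<longlonglongrightarrow> 0" by simp
    qed
    show "AE x in \<nu>1. norm ((trunc k (u x) - u x)\<^sup>2) \<le> (u x)\<^sup>2" for k
      using trunc_diff_le by (auto simp: abs_le_square_iff)
  qed measurable
  then have "(\<lambda>k. sqrt (\<integral>x. (trunc k (u x) - u x)\<^sup>2 \<partial>\<nu>1)) \<longlonglongrightarrow> sqrt 0" by (intro tendsto_intros) simp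
  then have "(\<lambda>k. nH (\<lambda>x. trunc k (u x) - u x)) \<longlonglongrightarrow> 0" by (simp add: L2n_def)
  then have "eventually (\<lambda>k. nH (\<lambda>x. trunc k (u x) - u x) < e) sequentially" using e by (rule order_tendstoD)
  then obtain k where "nH (\<lambda>x. trunc k (u x) - u x) < e" by (auto simp: eventually_sequentially)
  then show ?thesis using d that by blast
qed

lemma L2n_step_fun:
  assumes "0 < T" "0 < N" and F: "\<And>k. inH (F k)"
  shows "(L2n (spt 0 T) (step_fun T N F))\<^sup>2 = T / real N * (\<Sum>j<N. (nH (F j))\<^sup>2)"
proof -
  note m = step_fun_memL2[OF assms]
  have [measurable]: "step_fun T N F \<in> jmeas" using memL2_measurable[OF m] by (simp add: measurable_spt)
  have "ennreal ((L2n (spt 0 T) (step_fun T N F))\<^sup>2) = (\<integral>\<^sup>+t. \<integral>\<^sup>+x. ennreal ((step_fun T N F (t, x))\<^sup>2) \<partial>\<nu>1 \<partial>time_measure 0 T)"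
    unfolding nn_integral_L2n[OF m, symmetric] by (rule nn_integral_spt) measurable
  also have "\<dots> = (\<integral>\<^sup>+t. ennreal ((nH (F (cell (T / real N) t)))\<^sup>2) \<partial>time_measure 0 T)"
    by (rule nn_integral_cong) (simp add: step_fun_def nn_integral_L2n[OF F])
  also have "\<dots> = ennreal (T / real N * (\<Sum>j<N. (nH (F j))\<^sup>2))"
    using assms by (subst nn_step_integral) auto
  finally show ?thesis
    by (rule ennreal_inj[THEN iffD1, rotated 2]) (use assms in \<open>auto intro!: mult_nonneg_nonneg divide_nonneg_nonneg sum_nonneg\<close>)
qed

text \<open>The force is discretized first, on N cells. Subdividing each cell into M leaves this
  force and its norm unchanged, so that M can be chosen afterwards, depending on the energy of the
  initial value, to make \<tau>(En u0 + S + 1) small.\<close>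

lemma approx_solution_exists:
  assumes T: "0 < T" and u0: "dom u0" and f: "memL2 (spt 0 T) f" and e: "0 < e"
  obtains \<tau> f' S ub uh vb where "approx_solution T \<tau> u0 f' S ub uh vb" "\<tau> * (En u0 + S + 1) \<le> e"
    "L2n (spt 0 T) (\<lambda>w. f' (fst w) (snd w) - f w) < e" "S \<le> (L2n (spt 0 T) f + e)\<^sup>2"
proof -
  obtain N F where N: "0 < N" and F: "\<And>k. inH (F k)" and d: "L2n (spt 0 T) (\<lambda>w. step_fun T N F w - f w) < e"
    using step_fun_dense[OF T f e] by blast
  define S where "S = (L2n (spt 0 T) (step_fun T N F))\<^sup>2"
  obtain M0 where M0: "T * (En u0 + S + 1) / (real N * e) < real M0" using reals_Archimedean2 by blast
  define M where "M = Suc M0"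
  define \<tau> where "\<tau> = T / real (N * M)"
  have M: "0 < M" by (simp add: M_def)
  let ?F = "\<lambda>k. F (k div M)"
  have eq: "step_fun T N F = step_fun T (N * M) ?F" by (rule step_fun_refine[OF T N M])
  obtain U where U: "euler_seq \<tau> ?F U" "U 0 = u0"
    using euler_seq_exists[of \<tau> u0 ?F] T N M u0 F by (auto simp: \<tau>_def)
  have "0 < N * M" using N M by simp
  note A = euler_approx_solution[OF U(1) T this \<tau>_def, unfolded U(2)]
  have S: "S = \<tau> * (\<Sum>j<N * M. (nH (?F j))\<^sup>2)"
    unfolding S_def eq \<tau>_def by (rule L2n_step_fun) (use T N M F in auto)
  have "T * (En u0 + S + 1) < real M0 * (real N * e)" using M0 N e by (simp add: pos_divide_less_eq)
  also have "\<dots> \<le> real M * (real N * e)" using e by (intro mult_right_mono) (auto simp: M_def)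
  finally have "T * (En u0 + S + 1) \<le> e * real (N * M)" by (simp add: mult_ac)
  then have 1: "\<tau> * (En u0 + S + 1) \<le> e" using N M by (simp add: \<tau>_def pos_divide_le_eq)
  have "L2n (spt 0 T) (step_fun T N F) \<le> L2n (spt 0 T) (\<lambda>w. step_fun T N F w - f w) + L2n (spt 0 T) f"
    using L2n_triangle[OF memL2_diff[OF step_fun_memL2[OF T N F] f] f] by simp
  then have 2: "S \<le> (L2n (spt 0 T) f + e)\<^sup>2" unfolding S_def using d by (intro power_mono) auto
  have 3: "L2n (spt 0 T) (\<lambda>w. ?F (cell \<tau> (fst w)) (snd w) - f w) < e"
    using d unfolding eq step_fun_def \<tau>_def .
  show ?thesis using that[OF A[folded S] 1 3 2] .
qed

lemma memL2T_spt:
  assumes "memL2T \<nu>1 T f"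
  shows "case_prod f \<in> jmeas" "memL2 (spt 0 T) (unc f)"
proof -
  have s: "sets (lborel \<Otimes>\<^sub>M \<nu>1) = sets (borel \<Otimes>\<^sub>M \<nu>1)" by (rule sets_pair_measure_cong) auto
  show m: "case_prod f \<in> jmeas"
    using assms measurable_cong_sets[OF s refl] by (auto simp: memL2T_def)
  then have [measurable]: "(unc f) \<in> jmeas" by (simp add: split_beta)
  have "(\<integral>\<^sup>+w. ennreal ((f (fst w) (snd w))\<^sup>2) \<partial>spt 0 T) = (\<integral>\<^sup>+t\<in>{0..T}. (\<integral>\<^sup>+x. ennreal ((f t x)\<^sup>2) \<partial>\<nu>1) \<partial>lborel)"
    by (subst nn_integral_spt, measurable, subst nn_integral_time_measure) auto
  then show "memL2 (spt 0 T) (unc f)"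
    using assms by (subst memL2_iff_nn_integral) (auto simp: measurable_spt memL2T_def)
qed

end

text \<open>The weights of the k-th average sit on indices at least k and have total mass 1;
  averages over tails inherit null limits.\<close>

lemma weighted_sum_tendsto_zero:
  fixes a :: "nat \<Rightarrow> nat \<Rightarrow> real" and r :: "nat \<Rightarrow> real"
  assumes a: "\<And>k n. 0 \<le> a k n" "\<And>k n. n < k \<Longrightarrow> a k n = 0" "\<And>k. (\<Sum>n<N k. a k n) = 1" and r: "r \<longlonglongrightarrow> 0"
  shows "(\<lambda>k. \<Sum>n<N k. a k n * r n) \<longlonglongrightarrow> 0"
proof (rule LIMSEQ_I)
  fix e :: real assume "0 < e"
  then obtain K where K: "\<And>n. n \<ge> K \<Longrightarrow> \<bar>r n\<bar> < e / 2" using LIMSEQ_D[OF r, of "e / 2"] by auto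
  show "\<exists>K. \<forall>k\<ge>K. norm ((\<Sum>n<N k. a k n * r n) - 0) < e"
  proof (intro exI allI impI)
    fix k assume k: "k \<ge> K"
    have "\<bar>\<Sum>n<N k. a k n * r n\<bar> \<le> (\<Sum>n<N k. \<bar>a k n * r n\<bar>)" by (rule sum_abs)
    also have "\<dots> \<le> (\<Sum>n<N k. a k n * (e / 2))"
    proof (rule sum_mono)
      fix n
      show "\<bar>a k n * r n\<bar> \<le> a k n * (e / 2)"
      proof (cases "n < k")
        case False
        then show ?thesis unfolding abs_mult using a(1)[of k n] K[of n] k by (intro mult_mono) auto
      qed (simp add: a(2))
    qed
    also have "\<dots> = e / 2" by (simp only: sum_distrib_right[symmetric] a(3) mult_1_left)
    finally show "norm ((\<Sum>n<N k. a k n * r n) - 0) < e" using \<open>0 < e\<close> by simp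
  qed
qed

lemma L2n_diff_le:
  assumes "memL2 \<nu> u" "memL2 \<nu> v"
  shows "L2n \<nu> (\<lambda>x. u x - v x) \<le> L2n \<nu> u + L2n \<nu> v"
  using L2n_triangle[OF assms(1) memL2_uminus[OF assms(2)]] by (simp add: L2n_uminus)

lemma L2n_sum_le:
  assumes "\<And>n. n \<in> I \<Longrightarrow> memL2 \<nu> (g n)" "\<And>n. n \<in> I \<Longrightarrow> 0 \<le> a n"
  shows "L2n \<nu> (\<lambda>x. \<Sum>n\<in>I. a n * g n x) \<le> (\<Sum>n\<in>I. a n * L2n \<nu> (g n))"
  using assms
proof (induction I rule: infinite_finite_induct)
  case (insert i I)
  have "L2n \<nu> (\<lambda>x. a i * g i x + (\<Sum>n\<in>I. a n * g n x)) \<le> L2n \<nu> (\<lambda>x. a i * g i x) + L2n \<nu> (\<lambda>x. \<Sum>n\<in>I. a n * g n x)"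
    by (rule L2n_triangle) (use insert in \<open>auto intro!: memL2_cmult memL2_sum\<close>)
  then show ?case using insert by (simp add: L2n_cmult)
qed auto

text \<open>All error parameters are tied to one geometric sequence, so that the schemes themselves,
  without subsequences, converge uniformly in time and pointwise a.e. in space at each time. The
  derivative is then recovered from averages and the equation is checked on intervals bounded away
  from 0.\<close>

lemma (in plap_space) strong_solution_exists:
  assumes T: "0 < T" and u0: "inH u0" and fT: "memL2T \<nu>1 T f"
  shows "\<exists>u. solution T u0 f u"
proof -
  let ?f = "\<lambda>w. f (fst w) (snd w)"
  note fm = memL2T_spt(1)[OF fT] and f = memL2T_spt(2)[OF fT]

  \<comment> \<open>Choice of the approximating schemes\<close>
  define Y where "Y = nH u0 + 1"
  define Sb where "Sb = (L2n (spt 0 T) ?f + 1)\<^sup>2"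
  define R where "R = Y + T + Sb"
  \<comment> \<open>Chosen to match the comparison estimate: 20 = 4 + 2(4 + 4) collects the initial
    values and the two step-size errors, the rest comes from the product of the force difference
    with the difference of the interpolants.\<close>
  define K where "K = 20 + 4 * (2 * (sqrt T * R))"
  have Sb0: "0 \<le> Sb" and Y0: "1 \<le> Y" and R0: "0 \<le> R" using T by (auto simp: Sb_def Y_def R_def)
  have K1: "1 \<le> K" unfolding K_def using T R0 by simp
  \<comment> \<open>Then K \<open>e n\<close> \<le> 4^(-n), whose square root 2^(-n) is the speed
    required for fast convergence.\<close>
  define e where "e n = (1/4::real) ^ n / (2 * K)" for n
  have e0: "0 < e n" and e1: "e n \<le> 1" and e_half: "e n \<le> (1/2) ^ n" for n
  proof -
    show "0 < e n" using K1 by (simp add: e_def)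
    have "e n \<le> (1/4) ^ n / 1" unfolding e_def using K1 by (intro divide_left_mono) auto
    moreover have "(1/4::real) ^ n \<le> 1" by (rule power_le_one) auto
    moreover have "(1/4::real) ^ n \<le> (1/2) ^ n" by (rule power_mono) auto
    ultimately show "e n \<le> 1" "e n \<le> (1/2) ^ n" by simp_all
  qed
  have e_Suc: "e (Suc n) \<le> e n" for n using K1 by (simp add: e_def field_simps)
  have "\<forall>n. \<exists>w. dom w \<and> nH (\<lambda>x. w x - u0 x) < e n" 
  proof
    fix n
    obtain w where "dom w" "nH (\<lambda>x. w x - u0 x) < e n" by (rule dom_dense[OF u0 e0[of n]])
    then show "\<exists>w. dom w \<and> nH (\<lambda>x. w x - u0 x) < e n" by blast
  qed
  then obtain w where w: "\<And>n. dom (w n)" "\<And>n. nH (\<lambda>x. w n x - u0 x) < e n" by metis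
  have "\<forall>n. \<exists>\<tau> f' S ub uh vb. approx_solution T \<tau> (w n) f' S ub uh vb \<and> \<tau> * (En (w n) + S + 1) \<le> e n \<and>
    L2n (spt 0 T) (\<lambda>w. f' (fst w) (snd w) - ?f w) < e n \<and> S \<le> (L2n (spt 0 T) ?f + e n)\<^sup>2"
  proof
    fix n
    show "\<exists>\<tau> f' S ub uh vb. approx_solution T \<tau> (w n) f' S ub uh vb \<and> \<tau> * (En (w n) + S + 1) \<le> e n \<and>
      L2n (spt 0 T) (\<lambda>w. f' (fst w) (snd w) - ?f w) < e n \<and> S \<le> (L2n (spt 0 T) ?f + e n)\<^sup>2"
      by (rule approx_solution_exists[OF T w(1)[of n] f e0[of n]]) blast
  qed
  from this[unfolded choice_iff] obtain \<tau> fn S ub uh vb where A: "\<And>n. approx_solution T (\<tau> n) (w n) (fn n) (S n) (ub n) (uh n) (vb n)"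
    and \<tau>e: "\<And>n. \<tau> n * (En (w n) + S n + 1) \<le> e n" and fne: "\<And>n. L2n (spt 0 T) (\<lambda>w. fn n (fst w) (snd w) - ?f w) < e n"
    and Sn: "\<And>n. S n \<le> (L2n (spt 0 T) ?f + e n)\<^sup>2"
    by blast
  note D = approx_solutionD[OF A] and M = approx_solution_spt[OF A less_imp_le[OF T]]
  have SnS: "S n \<le> Sb" for n
    using Sn[of n] e1[of n] e0[of n] unfolding Sb_def by (intro order_trans[OF Sn] power_mono) auto
  have wY: "nH (w n) \<le> Y" for n
    using L2n_triangle[OF memL2_diff[OF dom_memL2[OF w(1)[of n]] u0] u0] w(2)[of n] e1[of n] by (simp add: Y_def)
  have RnR: "nH (w n) + T + S n \<le> R" for n using SnS[of n] wY[of n] by (simp add: R_def)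
  have Rn0: "0 \<le> nH (w n) + T + S n" for n using D(3)[of n] T by simp
  have \<tau>0: "0 < \<tau> n" for n by (rule D(1))
  have \<tau>E: "\<tau> n * (En (w n) + S n) \<le> e n" and \<tau>1: "\<tau> n \<le> e n" for n
  proof -
    have "0 \<le> \<tau> n * (En (w n) + S n)" using \<tau>0[of n] D(3)[of n] En_nonneg[of "w n"] by simp
    then show "\<tau> n * (En (w n) + S n) \<le> e n" "\<tau> n \<le> e n" using \<tau>e[of n] \<tau>0[of n] by (simp_all add: distrib_left)
  qed
  have uhm: "inH (uh n t)" if "0 \<le> t" for n t using dom_memL2[OF D(11)[OF that]] .
  have uhL: "L2n (spt 0 T) (unc (uh n)) \<le> sqrt T * R" for n
  proof -
    have "T * (nH (w n) + T + S n)\<^sup>2 \<le> T * R\<^sup>2" using T RnR Rn0 by (intro mult_left_mono power_mono) auto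
    also have "\<dots> = (sqrt T * R)\<^sup>2" using T by (simp add: power_mult_distrib)
    finally have "(L2n (spt 0 T) (unc (uh n)))\<^sup>2 \<le> (sqrt T * R)\<^sup>2" using M(5)[of n] by simp
    then show ?thesis by (rule power2_le_imp_le) (use T R0 in auto)
  qed

  \<comment> \<open>Cauchy estimate, uniform in time, and the limit function\<close>
  have step: "nH (\<lambda>x. uh (Suc n) t x - uh n t x) \<le> (1/2) ^ n" if t: "t \<in> {0..T}" for n t
  proof -
    let ?a = "nH (\<lambda>x. w (Suc n) x - w n x)" and ?F = "L2n (spt 0 T) (\<lambda>w. fn (Suc n) (fst w) (snd w) - fn n (fst w) (snd w))"
      and ?U = "L2n (spt 0 T) (\<lambda>w. uh (Suc n) (fst w) (snd w) - uh n (fst w) (snd w))"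
    have cmp: "(nH (\<lambda>x. uh (Suc n) t x - uh n t x))\<^sup>2 \<le> ?a\<^sup>2 + 2 * (4 * \<tau> (Suc n) * (En (w (Suc n)) + S (Suc n)) + 4 * \<tau> n * (En (w n) + S n) + ?F * ?U)"
      by (rule approx_solution_compare[OF A A t])
    have gen: "X \<le> a' + 2 * (b' + c' + d')" if "D' \<le> d'" "B' \<le> b'" "C' \<le> c'" "X \<le> A' + 2 * (B' + C' + D')" "A' \<le> a'"
      for X A' B' C' D' a' b' c' d' :: real using that by argo
    have a2: "?a \<le> 2 * e n"
      using L2n_triangle_diff[OF dom_memL2[OF w(1)[of "Suc n"]] u0 dom_memL2[OF w(1)[of n]]] L2n_commute[of \<nu>1 u0 "w n"]
        w(2)[of n] w(2)[of "Suc n"] e_Suc[of n] by simp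
    then have "?a\<^sup>2 \<le> (2 * e n)\<^sup>2" by (intro power_mono) auto
    also have "(2 * e n)\<^sup>2 \<le> 4 * e n"
      using e1[of n] e0[of n] by (simp add: power2_eq_square mult_le_one)
    finally have a3: "?a\<^sup>2 \<le> 4 * e n" .
    have "?F \<le> 2 * e n"
      using L2n_triangle_diff[OF M(1)[of "Suc n"] f M(1)[of n]] L2n_commute[of "spt 0 T" ?f "\<lambda>w. fn n (fst w) (snd w)"]
        fne[of n] fne[of "Suc n"] e_Suc[of n] by simp
    moreover have "?U \<le> 2 * (sqrt T * R)"
      using L2n_triangle_diff[OF M(3)[of "Suc n"] memL2_0 M(3)[of n]] uhL[of n] uhL[of "Suc n"] by (simp add: L2n_uminus)
    ultimately have "?F * ?U \<le> 2 * e n * (2 * (sqrt T * R))" using e0[of n] by (intro mult_mono) auto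
    moreover have "4 * \<tau> (Suc n) * (En (w (Suc n)) + S (Suc n)) \<le> 4 * e n" "4 * \<tau> n * (En (w n) + S n) \<le> 4 * e n"
      using \<tau>E[of "Suc n"] \<tau>E[of n] e_Suc[of n] by (simp_all add: mult.assoc)
    ultimately have "(nH (\<lambda>x. uh (Suc n) t x - uh n t x))\<^sup>2 \<le> 4 * e n + 2 * (4 * e n + 4 * e n + 2 * e n * (2 * (sqrt T * R)))"
      using cmp a3 gen by blast
    also have "\<dots> = K * e n" by (simp add: K_def algebra_simps)
    also have "\<dots> \<le> (1/4) ^ n" using K1 by (simp add: e_def)
    also have "(1/4::real) ^ n = ((1/2) ^ n)\<^sup>2" by (simp add: power2_eq_square power_mult_distrib[symmetric])
    finally show ?thesis by (rule power2_le_imp_le) simp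
  qed
  \<comment> \<open>A pointwise limit, hence jointly measurable. \<open>lim\<close> has no meaning
    where the sequence diverges, but for each t in [0, T] this happens on a null set only.\<close>
  define u where "u t x = lim (\<lambda>n. uh n t x)" for t x
  have fast: "inH (u t)" "nH (\<lambda>x. uh n t x - u t x) \<le> 2 * (1/2) ^ n" if t: "t \<in> {0..T}" for t n
    unfolding u_def using L2_complete_fast(2,3)[of \<nu>1 "\<lambda>n. uh n t", OF uhm step[OF t]] t by auto
  have [measurable]: "(unc (uh n)) \<in> jmeas" "(unc (vb n)) \<in> jmeas"
      "(unc (ub n)) \<in> jmeas" "(unc (fn n)) \<in> jmeas"
      "(unc f) \<in> jmeas" for n
    using D(4-7)[of n] fm by (simp_all add: split_beta)
  have um[measurable]: "(unc u) \<in> jmeas"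
    unfolding u_def by measurable
  have half0: "(\<lambda>n. (1/2::real) ^ n) \<longlonglongrightarrow> 0" by (rule LIMSEQ_power_zero) simp
  have e_lim: "e \<longlonglongrightarrow> 0"
    by (rule tendsto_sandwich[of "\<lambda>_. 0" e sequentially "\<lambda>n. (1/2) ^ n"]) (use e0 e_half half0 in \<open>auto intro!: always_eventually less_imp_le\<close>)

  \<comment> \<open>Continuity in time and the initial value\<close>
  have cont: "((\<lambda>s. L2dist \<nu>1 (u s) (u t)) \<longlongrightarrow> 0) (at t within {0..T})" if t: "t \<in> {0..T}" for t
  proof (rule tendstoI)
    fix \<eta> :: real assume \<eta>: "0 < \<eta>"
    obtain n where n: "(1/2::real) ^ n < \<eta> / 8" using real_arch_pow_inv[of "\<eta> / 8" "1/2"] \<eta> by auto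
    \<comment> \<open>Hoelder constant of the n-th interpolant. It may blow up with n, which is
      harmless: n is fixed by the uniform convergence before s approaches t.\<close>
    define Cn where "Cn = L2n (spt 0 T) (unc (vb n)) + 1"
    have Cn: "0 < Cn" by (simp add: Cn_def add_nonneg_pos)
    have lip: "nH (\<lambda>x. uh n b x - uh n a x) \<le> sqrt (b - a) * Cn" if ab: "0 \<le> a" "a \<le> b" "b \<le> T" for a b
    proof -
      have sub: "{a..b} \<subseteq> {0..T}" using ab by auto
      have "nH (\<lambda>x. uh n b x - uh n a x) = nH (\<lambda>x. LINT r:{a..b}|lborel. vb n r x)"
        using D(14)[OF ab(1,2)] by simp
      also have "\<dots> \<le> sqrt (b - a) * L2n (spt a b) (unc (vb n))"
        by (rule L2n_time_integral(3)[OF ab(2) D(7) memL2_spt_mono(1)[OF M(2) sub]])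
      also have "\<dots> \<le> sqrt (b - a) * Cn"
        using memL2_spt_mono(2)[OF M(2)[of n] sub] ab by (intro mult_left_mono) (auto simp: Cn_def)
      finally show ?thesis .
    qed
    have lip': "nH (\<lambda>x. uh n s x - uh n t x) \<le> sqrt \<bar>s - t\<bar> * Cn" if "s \<in> {0..T}" for s
      using lip[of t s] lip[of s t] L2n_commute[of \<nu>1 "uh n s" "uh n t"] that t by (cases "t \<le> s") auto
    have "((\<lambda>s. sqrt \<bar>s - t\<bar> * Cn) \<longlongrightarrow> sqrt \<bar>t - t\<bar> * Cn) (at t within {0..T})"
      by (intro tendsto_intros)
    then have "eventually (\<lambda>s. sqrt \<bar>s - t\<bar> * Cn < \<eta> / 2) (at t within {0..T})"
      using \<eta> by (intro order_tendstoD(2)[of _ "sqrt \<bar>t - t\<bar> * Cn"]) auto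
    moreover have "eventually (\<lambda>s. s \<in> {0..T}) (at t within {0..T})" by (simp add: eventually_at_filter)
    ultimately show "eventually (\<lambda>s. dist (L2dist \<nu>1 (u s) (u t)) 0 < \<eta>) (at t within {0..T})"
    proof eventually_elim
      case (elim s)
      have "nH (\<lambda>x. u s x - u t x) \<le> nH (\<lambda>x. u s x - uh n s x) + nH (\<lambda>x. uh n s x - u t x)"
        using fast(1)[OF elim(2)] fast(1)[OF t] uhm[of s n] elim(2) by (intro L2n_triangle_diff) auto
      also have "nH (\<lambda>x. uh n s x - u t x) \<le> nH (\<lambda>x. uh n s x - uh n t x) + nH (\<lambda>x. uh n t x - u t x)"
        using fast(1)[OF t] uhm[of s n] uhm[of t n] elim(2) t by (intro L2n_triangle_diff) auto
      finally have "nH (\<lambda>x. u s x - u t x) < \<eta>"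
        using fast(2)[OF elim(2), of n] fast(2)[OF t, of n] lip'[OF elim(2)] elim(1) n L2n_commute[of \<nu>1 "u s" "uh n s"] by linarith
      then show ?case by (simp add: L2dist_eq_L2n dist_real_def)
    qed
  qed

  have init: "AE x in \<nu>1. u 0 x = u0 x"
  proof -
    have z: "0 \<in> {0..T}" using T by simp
    have "nH (\<lambda>x. u 0 x - u0 x) \<le> 2 * (1/2) ^ n + e n" for n
      using L2n_triangle_diff[OF fast(1)[OF z] dom_memL2[OF w(1)[of n]] u0] fast(2)[OF z, of n] w(2)[of n]
        L2n_commute[of \<nu>1 "u 0" "w n"] D(12)[of n] by simp
    moreover have "(\<lambda>n. 2 * (1/2) ^ n + e n) \<longlonglongrightarrow> 2 * 0 + 0" by (intro tendsto_intros half0 e_lim)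
    ultimately have "nH (\<lambda>x. u 0 x - u0 x) \<le> 2 * 0 + 0" by (intro LIMSEQ_le_const) auto
    then have "AE x in \<nu>1. u 0 x - u0 x = 0" by (intro L2n_eq_0_AE memL2_diff fast(1)[OF z] u0) simp
    then show ?thesis by eventually_elim simp
  qed

  txt \<open>Mazur combinations of the weighted derivatives converge strongly to \<open>sqrt t * v\<close>.\<close>
  define g where "g n z = sqrt (fst z) * of_bool (\<tau> n \<le> fst z) * vb n (fst z) (snd z)" for n z
  have gm[measurable]: "g n \<in> jmeas" for n unfolding g_def by measurable
  define Bd where "Bd = 2 * (Y\<^sup>2 + 2 * R * (T + Sb) + T * Sb)"
  have g: "memL2 (spt 0 T) (g n)" and gB: "L2n (spt 0 T) (g n) \<le> sqrt Bd" for n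
  proof -
    let ?h = "\<lambda>t x. sqrt t * of_bool (\<tau> n \<le> t) * vb n t x"
    have eq: "ennreal ((nH (?h t))\<^sup>2) = ennreal (t * of_bool (\<tau> n \<le> t) * (nH (vb n t))\<^sup>2)" if "0 \<le> t" for t
      using that by (simp add: L2n_cmult power_mult_distrib)
    have Bn: "2 * ((nH (w n))\<^sup>2 + 2 * (nH (w n) + T + S n) * (T + S n) + T * S n) \<le> Bd"
      unfolding Bd_def using wY[of n] RnR[of n] SnS[of n] T D(3)[of n] R0
      by (intro mult_left_mono add_mono power_mono mult_mono) auto
    have Bd0: "0 \<le> Bd" unfolding Bd_def using T Sb0 R0 by simp
    have "(\<integral>\<^sup>+t. ennreal ((nH (?h t))\<^sup>2) \<partial>time_measure 0 T) = (\<integral>\<^sup>+t. ennreal (t * of_bool (\<tau> n \<le> t) * (nH (vb n t))\<^sup>2) \<partial>time_measure 0 T)"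
      by (rule nn_integral_cong_AE, rule AE_time_measure_I, rule eq)
    also have "\<dots> \<le> ennreal Bd" using D(20)[of n] Bn by (meson ennreal_leI order_trans)
    finally have B: "(\<integral>\<^sup>+t. ennreal ((nH (?h t))\<^sup>2) \<partial>time_measure 0 T) \<le> ennreal Bd" .
    have hm: "(\<lambda>(t, x). ?h t x) \<in> jmeas" unfolding split_beta by measurable
    have hL: "inH (?h t)" if "t \<in> {0..T}" for t using D(10)[of t n] that by (auto intro!: memL2_cmult)
    show "memL2 (spt 0 T) (g n)" using memL2_sptI(1)[OF hm hL B Bd0] by (simp add: g_def[abs_def])
    have "(L2n (spt 0 T) (g n))\<^sup>2 \<le> Bd" using memL2_sptI(2)[OF hm hL B Bd0] by (simp add: g_def[abs_def])
    then show "L2n (spt 0 T) (g n) \<le> sqrt Bd" by (rule real_le_rsqrt)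
  qed
  obtain a :: "nat \<Rightarrow> nat \<Rightarrow> real" and N G where a: "\<And>k n. 0 \<le> a k n" "\<And>k n. n < k \<Longrightarrow> a k n = 0"
    "\<And>k. (\<Sum>n<N k. a k n) = 1" and G: "memL2 (spt 0 T) G"
    and Glim: "(\<lambda>k. L2n (spt 0 T) (\<lambda>x. (\<Sum>n<N k. a k n * g n x) - G x)) \<longlonglongrightarrow> 0"
    by (rule Mazur_L2[of "spt 0 T" g "sqrt Bd", OF g gB]) blast
  have Gm[measurable]: "G \<in> jmeas" using memL2_measurable[OF G] by (simp add: measurable_spt)
  \<comment> \<open>Undoes the weight. The quotient is square integrable only away from t = 0, in
    accordance with the local Sobolev condition on solutions.\<close>
  define v where "v t x = G (t, x) / sqrt t" for t x
  have vm: "case_prod v \<in> jmeas" unfolding v_def split_beta by measurable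
  then have [measurable]: "(unc v) \<in> jmeas" by (simp add: split_beta)

  \<comment> \<open>Away from 0, on times at least \<alpha>, dividing by sqrt t costs a factor of at
    most 1/sqrt \<alpha>.\<close>
  have scale: "memL2 (spt \<alpha> \<beta>) (\<lambda>z. h z / sqrt (fst z)) \<and> L2n (spt \<alpha> \<beta>) (\<lambda>z. h z / sqrt (fst z)) \<le> 1 / sqrt \<alpha> * L2n (spt 0 T) h"
    if h: "memL2 (spt 0 T) h" and \<alpha>: "0 < \<alpha>" "\<beta> \<le> T" for h \<alpha> \<beta>
  proof -
    interpret PS: pair_sigma_finite "time_measure \<alpha> \<beta>" \<nu>1 by (rule pair_sigma_finite_spt)
    have sub: "{\<alpha>..\<beta>} \<subseteq> {0..T}" using \<alpha> by auto
    note h' = memL2_spt_mono[OF h sub]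
    have [measurable]: "h \<in> borel_measurable (spt \<alpha> \<beta>)" using h'(1) by (rule memL2_measurable)
    have "AE z in spt \<alpha> \<beta>. \<alpha> \<le> fst z"
    proof (rule PS.AE_pair_measure)
      show "{x \<in> space (spt \<alpha> \<beta>). \<alpha> \<le> fst x} \<in> sets (spt \<alpha> \<beta>)" by measurable
      show "AE x in time_measure \<alpha> \<beta>. AE y in \<nu>1. \<alpha> \<le> fst (x, y)" by (rule AE_time_measure_I) simp
    qed
    then have le: "AE z in spt \<alpha> \<beta>. \<bar>h z / sqrt (fst z)\<bar> \<le> \<bar>1 / sqrt \<alpha> * h z\<bar>"
    proof eventually_elim
      case (elim z)
      have "\<bar>h z\<bar> / sqrt (fst z) \<le> \<bar>h z\<bar> / sqrt \<alpha>" using elim \<alpha> by (intro divide_left_mono mult_pos_pos) auto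
      then show ?case using elim \<alpha> by (simp add: abs_mult)
    qed
    have m: "memL2 (spt \<alpha> \<beta>) (\<lambda>z. 1 / sqrt \<alpha> * h z)" by (intro memL2_cmult h')
    have "memL2 (spt \<alpha> \<beta>) (\<lambda>z. h z / sqrt (fst z))"
      by (rule memL2_bound[OF m, where K=1]) (use le in auto)
    moreover have "L2n (spt \<alpha> \<beta>) (\<lambda>z. h z / sqrt (fst z)) \<le> L2n (spt \<alpha> \<beta>) (\<lambda>z. 1 / sqrt \<alpha> * h z)"
      by (rule L2n_mono[OF m _ le]) measurable
    moreover have "L2n (spt \<alpha> \<beta>) (\<lambda>z. 1 / sqrt \<alpha> * h z) \<le> 1 / sqrt \<alpha> * L2n (spt 0 T) h"
      unfolding L2n_cmult using h'(2) \<alpha> by (simp add: divide_right_mono)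
    ultimately show ?thesis by linarith
  qed
  have vL2: "memL2 (spt \<alpha> \<beta>) (unc v)" if "0 < \<alpha>" "\<beta> \<le> T" for \<alpha> \<beta>
    using scale[OF G that] by (simp add: v_def)
  \<comment> \<open>Once \<tau> n \<le> \<alpha>, the cut-off in \<open>g n\<close> is inactive on
    times at least \<alpha>, and the approximate derivative can be read off from
    \<open>g n\<close>.\<close>
  have vb_eq: "vb n (fst z) (snd z) = g n z / sqrt (fst z)" if "\<tau> n \<le> \<alpha>" "\<alpha> \<le> fst z" for n \<alpha> z
  proof -
    have "0 < fst z" "\<tau> n \<le> fst z" using that \<tau>0[of n] by auto
    then show ?thesis by (simp add: g_def)
  qed
  have \<tau>small: "\<exists>k0. \<forall>n\<ge>k0. \<tau> n \<le> \<alpha>" if \<alpha>0: "0 < \<alpha>" for \<alpha>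
  proof -
    obtain k0 where k0: "\<And>n. n \<ge> k0 \<Longrightarrow> \<bar>e n\<bar> < \<alpha>" using LIMSEQ_D[OF e_lim \<alpha>0] by auto
    have "\<tau> n \<le> \<alpha>" if "n \<ge> k0" for n using k0[OF that] \<tau>1[of n] by linarith
    then show ?thesis by blast
  qed

  \<comment> \<open>The limit v is the time derivative of u\<close>
  have deriv: "AE x in \<nu>1. u t x - u s x = (LINT r:{s..t}|lborel. v r x)" if st: "0 < s" "s \<le> t" "t < T" for s t
  proof -
    have sT: "s \<in> {0..T}" and tT: "t \<in> {0..T}" using st by auto
    obtain k0 where k0: "\<And>n. n \<ge> k0 \<Longrightarrow> \<tau> n \<le> s" using \<tau>small[OF st(1)] by blast
    \<comment> \<open>Mazur averages of the increments of the interpolants between s and t. They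
      converge in L^2 both to the increment of u and to the integral of v, which identifies the
      two.\<close>
    define cc where "cc k x = (\<Sum>n<N k. a k n * (uh n t x - uh n s x))" for k x
    define dd where "dd k z = ((\<Sum>n<N k. a k n * g n z) - G z) / sqrt (fst z)" for k z
    have mI: "inH (\<lambda>x. LINT r:{s..t}|lborel. v r x)"
      using st by (intro L2n_time_integral(2)[OF st(2) vm] vL2) auto
    have mU: "inH (\<lambda>x. u t x - u s x)" by (intro memL2_diff fast sT tT)
    have mcc: "inH (cc k)" for k
      unfolding cc_def using st by (intro memL2_sum memL2_cmult memL2_diff uhm) auto
    have md: "inH (\<lambda>x. (uh n t x - u t x) - (uh n s x - u s x))" for n
      using st by (intro memL2_diff uhm fast(1) sT tT) auto
    have 1: "nH (\<lambda>x. cc k x - (u t x - u s x)) \<le> (\<Sum>n<N k. a k n * (4 * (1/2) ^ n))" for k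
    proof -
      have "cc k x - (u t x - u s x) = (\<Sum>n<N k. a k n * ((uh n t x - u t x) - (uh n s x - u s x)))" for x
      proof -
        have "(\<Sum>n<N k. a k n * ((uh n t x - u t x) - (uh n s x - u s x))) = (\<Sum>n<N k. a k n * (uh n t x - uh n s x) - a k n * (u t x - u s x))"
          by (rule sum.cong) (auto simp: algebra_simps)
        also have "\<dots> = cc k x - (u t x - u s x)"
          by (simp only: sum_subtractf sum_distrib_right[symmetric] a(3) mult_1_left cc_def)
        finally show ?thesis ..
      qed
      then have "(\<lambda>x. cc k x - (u t x - u s x)) = (\<lambda>x. \<Sum>n<N k. a k n * ((uh n t x - u t x) - (uh n s x - u s x)))" by blast
      then have "nH (\<lambda>x. cc k x - (u t x - u s x)) \<le> (\<Sum>n<N k. a k n * nH (\<lambda>x. (uh n t x - u t x) - (uh n s x - u s x)))"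
        using L2n_sum_le[of "{..<N k}" \<nu>1 "\<lambda>n x. (uh n t x - u t x) - (uh n s x - u s x)" "a k", OF md a(1)] by (simp only:)
      also have "\<dots> \<le> (\<Sum>n<N k. a k n * (4 * (1/2) ^ n))"
      proof (intro sum_mono mult_left_mono a(1))
        fix n
        have "nH (\<lambda>x. (uh n t x - u t x) - (uh n s x - u s x)) \<le> nH (\<lambda>x. uh n t x - u t x) + nH (\<lambda>x. uh n s x - u s x)"
          using st by (intro L2n_diff_le memL2_diff uhm fast(1) sT tT) auto
        then show "nH (\<lambda>x. (uh n t x - u t x) - (uh n s x - u s x)) \<le> 4 * (1/2) ^ n"
          using fast(2)[OF tT, of n] fast(2)[OF sT, of n] by argo
      qed
      finally show ?thesis .
    qed
    have "(\<lambda>k. \<Sum>n<N k. a k n * (4 * (1/2) ^ n)) \<longlonglongrightarrow> 0"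
    proof (rule weighted_sum_tendsto_zero[where a=a and N=N and r="\<lambda>n. 4 * (1/2) ^ n", OF a])
      have "(\<lambda>n. 4 * (1/2::real) ^ n) \<longlonglongrightarrow> 4 * 0" by (intro tendsto_mult tendsto_const half0)
      then show "(\<lambda>n. 4 * (1/2::real) ^ n) \<longlonglongrightarrow> 0" unfolding mult_zero_right .
    qed
    then have lim1: "(\<lambda>k. nH (\<lambda>x. cc k x - (u t x - u s x))) \<longlonglongrightarrow> 0"
      by (rule Lim_null_comparison[rotated]) (use 1 in auto)
    have 2: "nH (\<lambda>x. cc k x - (LINT r:{s..t}|lborel. v r x)) \<le> sqrt (t - s) * (1 / sqrt s * L2n (spt 0 T) (\<lambda>x. (\<Sum>n<N k. a k n * g n x) - G x))"
      if k: "k \<ge> k0" for k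
    proof -
      let ?h = "\<lambda>x. (\<Sum>n<N k. a k n * g n x) - G x"
      have mh: "memL2 (spt 0 T) ?h" by (intro memL2_diff memL2_sum memL2_cmult g G)
      have tT': "t \<le> T" using st by simp
      have md: "memL2 (spt s t) (\<lambda>w. dd k (fst w, snd w))" "L2n (spt s t) (\<lambda>w. dd k (fst w, snd w)) \<le> 1 / sqrt s * L2n (spt 0 T) ?h"
        using scale[OF mh st(1) tT'] by (simp_all add: dd_def)
      have dm: "(\<lambda>(r, x). dd k (r, x)) \<in> jmeas" unfolding dd_def by measurable
      have AE: "AE x in \<nu>1. cc k x - (LINT r:{s..t}|lborel. v r x) = (LINT r:{s..t}|lborel. dd k (r, x))"
        using L2n_time_integral(1)[OF st(2) vm vL2[OF st(1) tT']]
      proof eventually_elim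
        case (elim x)
        have iv: "set_integrable lborel {s..t} (\<lambda>r. vb n r x)" for n using D(13)[of s t n x] st by simp
        have iv': "set_integrable lborel {s..t} (\<lambda>r. a k n * vb n r x)" for n using iv[of n] by (rule set_integrable_mult_right)
        have "cc k x = (\<Sum>n<N k. LINT r:{s..t}|lborel. a k n * vb n r x)"
          unfolding cc_def using D(14)[of s t] st by simp
        also have "\<dots> = (\<integral>r. (\<Sum>n<N k. indicator {s..t} r *\<^sub>R (a k n * vb n r x)) \<partial>lborel)"
          unfolding set_lebesgue_integral_def
          by (rule Bochner_Integration.integral_sum[symmetric]) (use iv' in \<open>simp only: set_integrable_def\<close>)
        also have "\<dots> = (LINT r:{s..t}|lborel. \<Sum>n<N k. a k n * vb n r x)"
          by (simp only: set_lebesgue_integral_def scaleR_sum_right)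
        also have "\<dots> - (LINT r:{s..t}|lborel. v r x) = (LINT r:{s..t}|lborel. (\<Sum>n<N k. a k n * vb n r x) - v r x)"
        proof (rule set_integral_diff(2)[symmetric, OF _ elim])
          show "set_integrable lborel {s..t} (\<lambda>r. \<Sum>n<N k. a k n * vb n r x)"
            unfolding set_integrable_def scaleR_sum_right
            by (rule Bochner_Integration.integrable_sum) (use iv' in \<open>simp only: set_integrable_def\<close>)
        qed
        also have "\<dots> = (LINT r:{s..t}|lborel. dd k (r, x))"
        proof (rule set_lebesgue_integral_cong)
          show "\<forall>r. r \<in> {s..t} \<longrightarrow> (\<Sum>n<N k. a k n * vb n r x) - v r x = dd k (r, x)"
          proof (intro allI impI)
            fix r assume r: "r \<in> {s..t}"
            \<comment> \<open>Indices n < k have weight 0; for the others n \<ge> \<open>k0\<close>,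
              so the cut-off is inactive.\<close>
            have "a k n * vb n r x = a k n * g n (r, x) / sqrt r" for n
            proof (cases "n < k")
              case False
              then have "vb n r x = g n (r, x) / sqrt r" using vb_eq[OF k0[of n], of "(r, x)"] k r by simp
              then show ?thesis by simp
            qed (simp add: a(2))
            then have "(\<Sum>n<N k. a k n * vb n r x) = (\<Sum>n<N k. a k n * g n (r, x)) / sqrt r"
              by (simp add: sum_divide_distrib)
            then show "(\<Sum>n<N k. a k n * vb n r x) - v r x = dd k (r, x)" by (simp add: dd_def v_def diff_divide_distrib)
          qed
        qed simp
        finally show ?case .
      qed
      have "nH (\<lambda>x. cc k x - (LINT r:{s..t}|lborel. v r x)) = nH (\<lambda>x. LINT r:{s..t}|lborel. dd k (r, x))"
        using memL2_measurable[OF memL2_diff[OF mcc[of k] mI]] memL2_measurable[OF L2n_time_integral(2)[OF st(2) dm md(1)]]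
        by (rule L2n_cong_AE[OF _ _ AE])
      also have "\<dots> \<le> sqrt (t - s) * L2n (spt s t) (\<lambda>w. dd k (fst w, snd w))"
        by (rule L2n_time_integral(3)[OF st(2) dm md(1)])
      also have "\<dots> \<le> sqrt (t - s) * (1 / sqrt s * L2n (spt 0 T) ?h)"
        using md(2) st by (intro mult_left_mono) auto
      finally show ?thesis .
    qed
    have "(\<lambda>k. sqrt (t - s) * (1 / sqrt s * L2n (spt 0 T) (\<lambda>x. (\<Sum>n<N k. a k n * g n x) - G x))) \<longlonglongrightarrow> sqrt (t - s) * (1 / sqrt s * 0)"
      by (intro tendsto_mult tendsto_const Glim)
    then have lim2': "(\<lambda>k. sqrt (t - s) * (1 / sqrt s * L2n (spt 0 T) (\<lambda>x. (\<Sum>n<N k. a k n * g n x) - G x))) \<longlonglongrightarrow> 0"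
      unfolding mult_zero_right .
    have lim2: "(\<lambda>k. nH (\<lambda>x. cc k x - (LINT r:{s..t}|lborel. v r x))) \<longlonglongrightarrow> 0"
      by (rule Lim_null_comparison[OF _ lim2'], rule eventually_sequentiallyI[of k0]) (use 2 in simp)
    have "nH (\<lambda>x. (u t x - u s x) - (LINT r:{s..t}|lborel. v r x))
        \<le> nH (\<lambda>x. cc k x - (u t x - u s x)) + nH (\<lambda>x. cc k x - (LINT r:{s..t}|lborel. v r x))" for k
      using L2n_triangle_diff[OF mU mcc[of k] mI] L2n_commute[of \<nu>1 "\<lambda>x. u t x - u s x" "cc k"] by simp
    then have "nH (\<lambda>x. (u t x - u s x) - (LINT r:{s..t}|lborel. v r x)) \<le> 0 + 0"
      by (intro LIMSEQ_le_const[OF tendsto_add[OF lim1 lim2]]) auto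
    then have "AE x in \<nu>1. (u t x - u s x) - (LINT r:{s..t}|lborel. v r x) = 0"
      by (intro L2n_eq_0_AE memL2_diff mU mI) simp
    then show ?thesis by eventually_elim simp
  qed

  \<comment> \<open>Strong convergence of both interpolants in space-time\<close>
  have uL2: "memL2 (spt 0 T) (unc u)"
    and uhu: "L2n (spt 0 T) (\<lambda>z. uh n (fst z) (snd z) - u (fst z) (snd z)) \<le> sqrt T * (2 * (1/2) ^ n)" for n
  proof -
    have m: "(\<lambda>(t, x). uh n t x - u t x) \<in> jmeas" for n unfolding split_beta by measurable
    have mm: "inH (\<lambda>x. uh n t x - u t x)" if "t \<in> {0..T}" for n t using fast(1)[OF that] uhm[of t n] that by auto
    note b = memL2_spt_bounded[OF m[of n] less_imp_le[OF T] mm[of _ n] fast(2)[of _ n]]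
    show "memL2 (spt 0 T) (unc u)"
      using memL2_diff[OF M(3)[of n] b(1)] by simp
    have "(L2n (spt 0 T) (\<lambda>z. uh n (fst z) (snd z) - u (fst z) (snd z)))\<^sup>2 \<le> (sqrt T * (2 * (1/2) ^ n))\<^sup>2"
      using b(2) T by (simp add: power_mult_distrib)
    then show "L2n (spt 0 T) (\<lambda>z. uh n (fst z) (snd z) - u (fst z) (snd z)) \<le> sqrt T * (2 * (1/2) ^ n)"
      by (rule power2_le_imp_le) (use T in auto)
  qed
  have ubL: "memL2 (spt 0 T) (unc (ub n))"
    and ubu: "L2n (spt 0 T) (\<lambda>z. ub n (fst z) (snd z) - u (fst z) (snd z)) \<le> sqrt (2 * e n) + sqrt T * (2 * (1/2) ^ n)" for n
  proof -
    interpret PS: pair_sigma_finite "time_measure 0 T" \<nu>1 by (rule pair_sigma_finite_spt)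
    have "AE z in spt 0 T. 0 \<le> fst z"
    proof (rule PS.AE_pair_measure)
      show "{x \<in> space (spt 0 T). 0 \<le> fst x} \<in> sets (spt 0 T)" by measurable
      show "AE x in time_measure 0 T. AE y in \<nu>1. 0 \<le> fst (x, y)" by (rule AE_time_measure_I) simp
    qed
    then have le: "AE z in spt 0 T. \<bar>ub n (fst z) (snd z) - uh n (fst z) (snd z)\<bar> \<le> \<bar>\<tau> n * vb n (fst z) (snd z)\<bar>"
      by eventually_elim (use D(15)[of _ n] \<tau>0[of n] in \<open>auto simp: abs_mult abs_minus_commute\<close>)
    have mv: "memL2 (spt 0 T) (\<lambda>z. \<tau> n * vb n (fst z) (snd z))" by (intro memL2_cmult M)
    have ms: "(\<lambda>z. ub n (fst z) (snd z) - uh n (fst z) (snd z)) \<in> borel_measurable (spt 0 T)"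
      unfolding measurable_spt by measurable
    have md: "memL2 (spt 0 T) (\<lambda>z. ub n (fst z) (snd z) - uh n (fst z) (snd z))"
      by (rule memL2_bound[OF mv ms, where K=1]) (use le in simp)
    from memL2_add[OF md M(3)[of n]] show ubm: "memL2 (spt 0 T) (unc (ub n))" by simp
    \<comment> \<open>The unweighted bound on the derivatives may diverge with the initial energies,
      but multiplied by \<tau>^2 it tends to 0: one factor \<tau> is at most 1, the other beats the
      energy by the choice of \<tau>.\<close>
    have "(L2n (spt 0 T) (\<lambda>z. \<tau> n * vb n (fst z) (snd z)))\<^sup>2 = \<tau> n * (\<tau> n * (L2n (spt 0 T) (unc (vb n)))\<^sup>2)"
      by (simp add: L2n_cmult power_mult_distrib power2_eq_square)
    also have "\<dots> \<le> \<tau> n * (\<tau> n * (2 * En (w n) + S n))"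
      using M(4)[of n] \<tau>0[of n] by (intro mult_left_mono) auto
    also have "\<dots> \<le> 1 * (2 * e n)"
    proof (rule mult_mono)
      have "\<tau> n * (2 * En (w n) + S n) \<le> \<tau> n * (2 * (En (w n) + S n))" using \<tau>0[of n] D(3)[of n] by (intro mult_left_mono) auto
      also have "\<dots> = 2 * (\<tau> n * (En (w n) + S n))" by (rule mult.left_commute)
      also have "\<dots> \<le> 2 * e n" using \<tau>E[of n] by (intro mult_left_mono) auto
      finally show "\<tau> n * (2 * En (w n) + S n) \<le> 2 * e n" .
      show "\<tau> n \<le> 1" using \<tau>1[of n] e1[of n] by linarith
    qed (use \<tau>0[of n] D(3)[of n] En_nonneg[of "w n"] in auto)
    finally have "L2n (spt 0 T) (\<lambda>z. \<tau> n * vb n (fst z) (snd z)) \<le> sqrt (2 * e n)" by (intro real_le_rsqrt) simp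
    moreover have "L2n (spt 0 T) (\<lambda>z. ub n (fst z) (snd z) - uh n (fst z) (snd z)) \<le> L2n (spt 0 T) (\<lambda>z. \<tau> n * vb n (fst z) (snd z))"
      by (rule L2n_mono[OF mv ms le])
    ultimately show "L2n (spt 0 T) (\<lambda>z. ub n (fst z) (snd z) - u (fst z) (snd z)) \<le> sqrt (2 * e n) + sqrt T * (2 * (1/2) ^ n)"
      using L2n_triangle_diff[OF ubm M(3)[of n] uL2] uhu[of n] by linarith
  qed

  \<comment> \<open>Identification of the operator by monotonicity\<close>
  have inclusion: "AE t in time_measure \<alpha> T. A (u t) (\<lambda>x. f t x - v t x)" if \<alpha>: "0 < \<alpha>" "\<alpha> \<le> T" for \<alpha>
  proof -
    interpret PS: pair_sigma_finite "time_measure \<alpha> T" \<nu>1 by (rule pair_sigma_finite_spt)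
    let ?\<rho> = "spt \<alpha> T"
    have sub: "{\<alpha>..T} \<subseteq> {0..T}" using \<alpha> by auto
    let ?u = "\<lambda>z. u (fst z) (snd z)" and ?v = "\<lambda>z. v (fst z) (snd z)"
    let ?ub = "\<lambda>n z. ub n (fst z) (snd z)" and ?fn = "\<lambda>n z. fn n (fst z) (snd z)" and ?vb = "\<lambda>n z. vb n (fst z) (snd z)"
    have mem: "memL2 ?\<rho> ?u" "memL2 ?\<rho> ?f" "memL2 ?\<rho> ?v" "\<And>n. memL2 ?\<rho> (?ub n)" "\<And>n. memL2 ?\<rho> (?fn n)" "\<And>n. memL2 ?\<rho> (?vb n)"
      using memL2_spt_mono(1)[OF uL2 sub] memL2_spt_mono(1)[OF f sub] vL2[OF \<alpha>(1), of T] memL2_spt_mono(1)[OF ubL sub]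
        memL2_spt_mono(1)[OF M(1) sub] memL2_spt_mono(1)[OF M(2) sub] by auto
    obtain z where z: "memL2 ?\<rho> z" "AE t in time_measure \<alpha> T. A (\<lambda>x. z (t, x)) (\<lambda>x. (?u (t, x) + ?f (t, x) - ?v (t, x)) - z (t, x))"
      by (rule spt_resolvent[of \<alpha> T "\<lambda>w. ?u w + ?f w - ?v w"]) (use mem in auto)
    obtain k0 where k0: "\<And>n. n \<ge> k0 \<Longrightarrow> \<tau> n \<le> \<alpha>" using \<tau>small[OF \<alpha>(1)] by blast
    let ?X = "\<lambda>n w. (?fn n w - ?vb n w) - ((?u w + ?f w - ?v w) - z w)"
    have mX: "memL2 ?\<rho> (?X n)" for n by (intro memL2_diff memL2_add mem z)
    have pos: "0 \<le> (\<integral>w. ?X n w * (?ub n w - z w) \<partial>?\<rho>)" for n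
    proof -
      have i: "integrable ?\<rho> (\<lambda>w. ?X n w * (?ub n w - z w))" by (intro memL2_mult_integrable mX memL2_diff mem z)
      have "integrable ?\<rho> (\<lambda>(t, x). ?X n (t, x) * (?ub n (t, x) - z (t, x))) \<longleftrightarrow> integrable ?\<rho> (\<lambda>w. ?X n w * (?ub n w - z w))"
        by (rule Bochner_Integration.integrable_cong) auto
      with i have i': "integrable ?\<rho> (\<lambda>(t, x). ?X n (t, x) * (?ub n (t, x) - z (t, x)))" by blast
      have "AE t in time_measure \<alpha> T. t \<in> {\<alpha>..T}" by (rule AE_time_measure_I) simp
      then have "AE t in time_measure \<alpha> T. 0 \<le> (\<integral>x. ?X n (t, x) * (?ub n (t, x) - z (t, x)) \<partial>\<nu>1)"
        using z(2)
      proof eventually_elim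
        case (elim t)
        then have "A (ub n t) (\<lambda>x. fn n t x - vb n t x)" using subgradient_imp_A[OF D(8)[of t n]] \<alpha> by simp
        from A_monotone[OF this elim(2)] show ?case by simp
      qed
      then have "0 \<le> (\<integral>t. (\<integral>x. ?X n (t, x) * (?ub n (t, x) - z (t, x)) \<partial>\<nu>1) \<partial>time_measure \<alpha> T)"
        by (rule integral_nonneg_AE)
      also have "\<dots> = (\<integral>w. (\<lambda>(t, x). ?X n (t, x) * (?ub n (t, x) - z (t, x))) w \<partial>?\<rho>)" by (rule PS.integral_fst[OF i'])
      also have "\<dots> = (\<integral>w. ?X n w * (?ub n w - z w) \<partial>?\<rho>)" by (rule Bochner_Integration.integral_cong) auto
      finally show ?thesis .
    qed
    \<comment> \<open>The terms having a strongly vanishing factor, f_n - f or ub_n - u. What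
      remains of the monotonicity inequality is affine in \<open>vb n\<close>, so that it may be
      averaged with the Mazur weights.\<close>
    define r where "r n = (\<integral>w. (?fn n w - ?f w) * (?ub n w - z w) \<partial>?\<rho>) + (\<integral>w. ((?v w - ?vb n w) - (?u w - z w)) * (?ub n w - ?u w) \<partial>?\<rho>)" for n
    have decomp: "(\<integral>w. ?X n w * (?ub n w - z w) \<partial>?\<rho>) = r n + (\<integral>w. ((?v w - ?vb n w) - (?u w - z w)) * (?u w - z w) \<partial>?\<rho>)" for n
    proof -
      have i: "integrable ?\<rho> (\<lambda>w. (?fn n w - ?f w) * (?ub n w - z w))" "integrable ?\<rho> (\<lambda>w. ((?v w - ?vb n w) - (?u w - z w)) * (?ub n w - ?u w))"
        "integrable ?\<rho> (\<lambda>w. ((?v w - ?vb n w) - (?u w - z w)) * (?u w - z w))"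
        by (intro memL2_mult_integrable memL2_diff mem z)+
      have "(\<integral>w. ?X n w * (?ub n w - z w) \<partial>?\<rho>) = (\<integral>w. ((?fn n w - ?f w) * (?ub n w - z w) + ((?v w - ?vb n w) - (?u w - z w)) * (?ub n w - ?u w))
          + ((?v w - ?vb n w) - (?u w - z w)) * (?u w - z w) \<partial>?\<rho>)"
        by (rule Bochner_Integration.integral_cong) (auto simp: algebra_simps)
      also have "\<dots> = r n + (\<integral>w. ((?v w - ?vb n w) - (?u w - z w)) * (?u w - z w) \<partial>?\<rho>)"
        unfolding r_def Bochner_Integration.integral_add[OF Bochner_Integration.integrable_add[OF i(1,2)] i(3)]
          Bochner_Integration.integral_add[OF i(1,2)] ..
      finally show ?thesis .
    qed
    let ?V = "1 / sqrt \<alpha> * sqrt Bd"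
    have ge: "AE z in ?\<rho>. \<alpha> \<le> fst z"
    proof (rule PS.AE_pair_measure)
      show "{x \<in> space ?\<rho>. \<alpha> \<le> fst x} \<in> sets ?\<rho>" by measurable
      show "AE x in time_measure \<alpha> T. AE y in \<nu>1. \<alpha> \<le> fst (x, y)" by (rule AE_time_measure_I) simp
    qed
    have vbB: "L2n ?\<rho> (?vb n) \<le> ?V" if n: "n \<ge> k0" for n
    proof -
      have "L2n ?\<rho> (?vb n) = L2n ?\<rho> (\<lambda>z. g n z / sqrt (fst z))"
        by (rule L2n_cong_AE[OF memL2_measurable[OF mem(6)] memL2_measurable])
          (use scale[OF g \<alpha>(1) order_refl] ge vb_eq[OF k0[OF n]] in auto)
      also have "\<dots> \<le> 1 / sqrt \<alpha> * L2n (spt 0 T) (g n)" using scale[OF g \<alpha>(1) order_refl] by blast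
      also have "\<dots> \<le> ?V" using gB[of n] \<alpha> by (intro mult_left_mono) auto
      finally show ?thesis .
    qed
    have ubu0: "(\<lambda>n. L2n ?\<rho> (\<lambda>w. ?ub n w - ?u w)) \<longlonglongrightarrow> 0"
    proof (rule Lim_null_comparison)
      have "(\<lambda>n. sqrt (2 * e n) + sqrt T * (2 * (1/2) ^ n)) \<longlonglongrightarrow> sqrt (2 * 0) + sqrt T * (2 * 0)" by (intro tendsto_intros e_lim half0)
      then show "(\<lambda>n. sqrt (2 * e n) + sqrt T * (2 * (1/2) ^ n)) \<longlonglongrightarrow> 0" by simp
      show "\<forall>\<^sub>F n in sequentially. norm (L2n ?\<rho> (\<lambda>w. ?ub n w - ?u w)) \<le> sqrt (2 * e n) + sqrt T * (2 * (1/2) ^ n)"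
        using order_trans[OF memL2_spt_mono(2)[OF memL2_diff[OF ubL uL2] sub] ubu] by (intro always_eventually allI) simp
    qed
    have r0: "r \<longlonglongrightarrow> 0"
    proof -
      have 1: "(\<lambda>n. \<integral>w. (?fn n w - ?f w) * (?ub n w - z w) \<partial>?\<rho>) \<longlonglongrightarrow> (\<integral>w. 0 * (?u w - z w) \<partial>?\<rho>)"
      proof (rule tendsto_integral_mult_L2)
        have "(\<lambda>n. L2n ?\<rho> (\<lambda>w. ?fn n w - ?f w)) \<longlonglongrightarrow> 0"
          by (rule Lim_null_comparison[OF _ e_lim])
            (use order_trans[OF memL2_spt_mono(2)[OF memL2_diff[OF M(1) f] sub] less_imp_le[OF fne]] in auto)
        then show "(\<lambda>n. L2n ?\<rho> (\<lambda>w. ?fn n w - ?f w - 0)) \<longlonglongrightarrow> 0" by simp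
        show "(\<lambda>n. L2n ?\<rho> (\<lambda>w. ?ub n w - z w - (?u w - z w))) \<longlonglongrightarrow> 0" using ubu0 by simp
      qed (auto intro!: memL2_diff mem z)
      have 2: "(\<lambda>n. \<integral>w. ((?v w - ?vb n w) - (?u w - z w)) * (?ub n w - ?u w) \<partial>?\<rho>) \<longlonglongrightarrow> 0"
      proof (rule Lim_null_comparison)
        let ?Q = "L2n ?\<rho> ?v + ?V + L2n ?\<rho> (\<lambda>w. ?u w - z w)"
        show "(\<lambda>n. ?Q * L2n ?\<rho> (\<lambda>w. ?ub n w - ?u w)) \<longlonglongrightarrow> 0"
          using tendsto_mult[OF tendsto_const[of ?Q] ubu0] by simp
        have "norm (\<integral>w. ((?v w - ?vb n w) - (?u w - z w)) * (?ub n w - ?u w) \<partial>?\<rho>) \<le> ?Q * L2n ?\<rho> (\<lambda>w. ?ub n w - ?u w)" if n: "n \<ge> k0" for n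
        proof -
          have m: "memL2 ?\<rho> (\<lambda>w. (?v w - ?vb n w) - (?u w - z w))" by (intro memL2_diff mem z)
          have "L2n ?\<rho> (\<lambda>w. (?v w - ?vb n w) - (?u w - z w)) \<le> L2n ?\<rho> (\<lambda>w. ?v w - ?vb n w) + L2n ?\<rho> (\<lambda>w. ?u w - z w)"
            by (rule L2n_diff_le[OF memL2_diff[OF mem(3) mem(6)[of n]] memL2_diff[OF mem(1) z(1)]])
          moreover have "L2n ?\<rho> (\<lambda>w. ?v w - ?vb n w) \<le> L2n ?\<rho> ?v + L2n ?\<rho> (?vb n)"
            by (rule L2n_diff_le[OF mem(3) mem(6)[of n]])
          ultimately have "L2n ?\<rho> (\<lambda>w. (?v w - ?vb n w) - (?u w - z w)) \<le> ?Q" using vbB[OF n] by linarith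
          then have "L2n ?\<rho> (\<lambda>w. (?v w - ?vb n w) - (?u w - z w)) * L2n ?\<rho> (\<lambda>w. ?ub n w - ?u w) \<le> ?Q * L2n ?\<rho> (\<lambda>w. ?ub n w - ?u w)"
            by (intro mult_right_mono) auto
          then show ?thesis using L2_Cauchy_Schwarz[OF m memL2_diff[OF mem(4)[of n] mem(1)]] by simp
        qed
        then show "\<forall>\<^sub>F n in sequentially. norm (\<integral>w. ((?v w - ?vb n w) - (?u w - z w)) * (?ub n w - ?u w) \<partial>?\<rho>) \<le> ?Q * L2n ?\<rho> (\<lambda>w. ?ub n w - ?u w)"
          by (auto simp: eventually_sequentially)
      qed
      show ?thesis using tendsto_add[OF 1 2] unfolding r_def by simp
    qed
    txt \<open>Minty: \<open>z\<close> solves the resolvent equation for \<open>u + f - v\<close>, and monotonicity forces \<open>z = u\<close>.\<close>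
    define hv where "hv k w = (\<Sum>n<N k. a k n * ?vb n w)" for k w
    have mhv: "memL2 ?\<rho> (hv k)" for k unfolding hv_def by (intro memL2_sum memL2_cmult mem)
    have hv_lim: "(\<lambda>k. L2n ?\<rho> (\<lambda>w. hv k w - ?v w)) \<longlonglongrightarrow> 0"
    proof (rule Lim_null_comparison)
      show "(\<lambda>k. 1 / sqrt \<alpha> * L2n (spt 0 T) (\<lambda>x. (\<Sum>n<N k. a k n * g n x) - G x)) \<longlonglongrightarrow> 0"
        using tendsto_mult[OF tendsto_const[of "1 / sqrt \<alpha>"] Glim] by simp
      have "L2n ?\<rho> (\<lambda>w. hv k w - ?v w) \<le> 1 / sqrt \<alpha> * L2n (spt 0 T) (\<lambda>x. (\<Sum>n<N k. a k n * g n x) - G x)" if k: "k \<ge> k0" for k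
      proof -
        let ?h = "\<lambda>x. (\<Sum>n<N k. a k n * g n x) - G x"
        have mh: "memL2 (spt 0 T) ?h" by (intro memL2_diff memL2_sum memL2_cmult g G)
        have "AE w in ?\<rho>. hv k w - ?v w = ?h w / sqrt (fst w)"
          using ge
        proof eventually_elim
          case (elim w)
          have "a k n * ?vb n w = a k n * g n w / sqrt (fst w)" for n
          proof (cases "n < k")
            case False
            then have "?vb n w = g n w / sqrt (fst w)" using vb_eq[OF k0[of n] elim] k by simp
            then show ?thesis by simp
          qed (simp add: a(2))
          then show ?case by (simp add: hv_def v_def sum_divide_distrib diff_divide_distrib)
        qed
        then have "L2n ?\<rho> (\<lambda>w. hv k w - ?v w) = L2n ?\<rho> (\<lambda>w. ?h w / sqrt (fst w))"
          by (rule L2n_cong_AE[OF memL2_measurable[OF memL2_diff[OF mhv mem(3)]] memL2_measurable, rotated])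
            (use scale[OF mh \<alpha>(1) order_refl] in blast)
        also have "\<dots> \<le> 1 / sqrt \<alpha> * L2n (spt 0 T) ?h" using scale[OF mh \<alpha>(1) order_refl] by blast
        finally show ?thesis .
      qed
      then show "\<forall>\<^sub>F k in sequentially. norm (L2n ?\<rho> (\<lambda>w. hv k w - ?v w)) \<le> 1 / sqrt \<alpha> * L2n (spt 0 T) (\<lambda>x. (\<Sum>n<N k. a k n * g n x) - G x)"
        by (auto simp: eventually_sequentially)
    qed
    have muz: "memL2 ?\<rho> (\<lambda>w. ?u w - z w)" by (intro memL2_diff mem z)
    \<comment> \<open>The inequalities for single n are averaged with weights \<open>a k n\<close>;
      because these sum to 1, the derivatives are replaced by the strongly convergent
      \<open>hv k\<close>.\<close>
    have ineq: "0 \<le> (\<Sum>n<N k. a k n * r n) + (\<integral>w. ((?v w - hv k w) - (?u w - z w)) * (?u w - z w) \<partial>?\<rho>)" for k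
    proof -
      have i: "integrable ?\<rho> (\<lambda>w. ((?v w - ?vb n w) - (?u w - z w)) * (?u w - z w))" for n
        by (intro memL2_mult_integrable memL2_diff mem z)
      have "0 \<le> (\<Sum>n<N k. a k n * (r n + (\<integral>w. ((?v w - ?vb n w) - (?u w - z w)) * (?u w - z w) \<partial>?\<rho>)))"
        using pos a(1) unfolding decomp by (intro sum_nonneg mult_nonneg_nonneg) auto
      also have "\<dots> = (\<Sum>n<N k. a k n * r n) + (\<Sum>n<N k. \<integral>w. a k n * (((?v w - ?vb n w) - (?u w - z w)) * (?u w - z w)) \<partial>?\<rho>)"
        by (simp add: distrib_left sum.distrib)
      also have "(\<Sum>n<N k. \<integral>w. a k n * (((?v w - ?vb n w) - (?u w - z w)) * (?u w - z w)) \<partial>?\<rho>)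
          = (\<integral>w. (\<Sum>n<N k. a k n * (((?v w - ?vb n w) - (?u w - z w)) * (?u w - z w))) \<partial>?\<rho>)"
        by (rule Bochner_Integration.integral_sum[symmetric], rule integrable_mult_right) (rule i)
      also have "\<dots> = (\<integral>w. ((?v w - hv k w) - (?u w - z w)) * (?u w - z w) \<partial>?\<rho>)"
      proof (rule Bochner_Integration.integral_cong[OF refl])
        fix w
        have "(\<Sum>n<N k. a k n * (((?v w - ?vb n w) - (?u w - z w)) * (?u w - z w)))
           = (\<Sum>n<N k. a k n * (?v w - (?u w - z w)) - a k n * ?vb n w) * (?u w - z w)"
          unfolding sum_distrib_right by (rule sum.cong) (auto simp: algebra_simps)
        also have "(\<Sum>n<N k. a k n * (?v w - (?u w - z w)) - a k n * ?vb n w) = (?v w - (?u w - z w)) - hv k w"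
          by (simp only: sum_subtractf sum_distrib_right[symmetric] a(3) mult_1_left hv_def)
        finally show "(\<Sum>n<N k. a k n * (((?v w - ?vb n w) - (?u w - z w)) * (?u w - z w))) = ((?v w - hv k w) - (?u w - z w)) * (?u w - z w)"
          by (simp add: algebra_simps)
      qed
      finally show ?thesis .
    qed
    have lim3: "(\<lambda>k. \<integral>w. ((?v w - hv k w) - (?u w - z w)) * (?u w - z w) \<partial>?\<rho>) \<longlonglongrightarrow> (\<integral>w. (- (?u w - z w)) * (?u w - z w) \<partial>?\<rho>)"
    proof (rule tendsto_integral_mult_L2[where \<nu>="?\<rho>" and g="\<lambda>k w. (?v w - hv k w) - (?u w - z w)" and G="\<lambda>w. - (?u w - z w)" and f="\<lambda>k w. ?u w - z w" and F="\<lambda>w. ?u w - z w"])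
      show "(\<lambda>k. L2n ?\<rho> (\<lambda>w. ?v w - hv k w - (?u w - z w) - - (?u w - z w))) \<longlonglongrightarrow> 0"
        using hv_lim L2n_commute[of ?\<rho> ?v] by simp
    qed (auto intro!: memL2_diff memL2_uminus mhv mem z)
    have ws: "(\<lambda>k. \<Sum>n<N k. a k n * r n) \<longlonglongrightarrow> 0" by (rule weighted_sum_tendsto_zero) (use a r0 in auto)
    have "0 \<le> 0 + (\<integral>w. (- (?u w - z w)) * (?u w - z w) \<partial>?\<rho>)"
      by (rule LIMSEQ_le_const[OF tendsto_add[OF ws lim3]]) (intro exI allI impI ineq)
    also have "\<dots> = (\<integral>w. - ((?u w - z w)\<^sup>2) \<partial>?\<rho>)"
      unfolding add_0 by (rule Bochner_Integration.integral_cong[OF refl]) (simp only: power2_eq_square mult_minus_left)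
    also have "\<dots> = - (L2n ?\<rho> (\<lambda>w. ?u w - z w))\<^sup>2"
      unfolding L2n_power2 by (rule Bochner_Integration.integral_minus)
    finally have "L2n ?\<rho> (\<lambda>w. ?u w - z w) \<le> 0" by simp
    then have "AE w in ?\<rho>. ?u w - z w = 0" by (rule L2n_eq_0_AE[OF muz])
    then have AEuz: "AE t in time_measure \<alpha> T. AE x in \<nu>1. ?u (t, x) - z (t, x) = 0" by (rule PS.AE_pair)
    have "AE t in time_measure \<alpha> T. t \<in> {\<alpha>..T}" by (rule AE_time_measure_I) simp
    with AEuz z(2) show ?thesis
    proof eventually_elim
      case (elim t)
      show ?case
      proof (rule A_cong[OF elim(2)])
        show "u t \<in> borel_measurable \<nu>1" using fast(1)[of t] elim(3) \<alpha> by (auto intro: memL2_measurable)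
        show "(\<lambda>x. f t x - v t x) \<in> borel_measurable \<nu>1"
        proof -
          have t1: "t \<in> space (borel :: real measure)" by simp
          from measurable_compose[OF measurable_Pair1'[OF t1] fm] measurable_compose[OF measurable_Pair1'[OF t1] vm] show ?thesis by simp
        qed
        show "AE x in \<nu>1. u t x = z (t, x)" using elim(1) by eventually_elim simp
        show "AE x in \<nu>1. f t x - v t x = ?u (t, x) + ?f (t, x) - ?v (t, x) - z (t, x)" using elim(1) by eventually_elim simp
      qed
    qed
  qed

  \<comment> \<open>The countably many starting times \<alpha> = T/(j+1) exhaust (0, T), so one null
    set of times suffices.\<close>
  have incl: "AE t in lborel. t \<in> {0<..<T} \<longrightarrow> A (u t) (\<lambda>x. f t x - v t x)"
  proof -
    have "AE t in lborel. t \<in> {T / real (Suc j)..T} \<longrightarrow> A (u t) (\<lambda>x. f t x - v t x)" for j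
      using inclusion[of "T / real (Suc j)"] T unfolding AE_time_measure by (simp add: field_simps)
    then have "AE t in lborel. \<forall>j. t \<in> {T / real (Suc j)..T} \<longrightarrow> A (u t) (\<lambda>x. f t x - v t x)" unfolding AE_all_countable by blast
    then show ?thesis
    proof eventually_elim
      case (elim t)
      show ?case
      proof
        assume t: "t \<in> {0<..<T}"
        obtain j where "T / t < real j" using reals_Archimedean2 by blast
        then have "T / real (Suc j) \<le> t" using t by (simp add: field_simps)
        then show "A (u t) (\<lambda>x. f t x - v t x)" using elim t by auto
      qed
    qed
  qed
  have "solution T u0 f u"
    unfolding strong_solution_def
  proof (intro conjI ballI exI[of _ v] allI impI fast(1) cont init incl)
    have s: "sets (lborel \<Otimes>\<^sub>M \<nu>1) = sets (borel \<Otimes>\<^sub>M \<nu>1)" by (rule sets_pair_measure_cong) auto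
    show "case_prod v \<in> borel_measurable (lborel \<Otimes>\<^sub>M \<nu>1)" using vm measurable_cong_sets[OF s refl] by auto
    show "(\<integral>\<^sup>+t\<in>{\<alpha>..\<beta>}. (\<integral>\<^sup>+x. ennreal ((v t x)\<^sup>2) \<partial>\<nu>1) \<partial>lborel) < \<infinity>" if "0 < \<alpha>" "\<alpha> \<le> \<beta>" "\<beta> < T" for \<alpha> \<beta>
    proof -
      have m: "memL2 (spt \<alpha> \<beta>) (unc v)" using that by (intro vL2) auto
      have "(\<integral>\<^sup>+t\<in>{\<alpha>..\<beta>}. (\<integral>\<^sup>+x. ennreal ((v t x)\<^sup>2) \<partial>\<nu>1) \<partial>lborel) = (\<integral>\<^sup>+z. ennreal ((v (fst z) (snd z))\<^sup>2) \<partial>spt \<alpha> \<beta>)"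
        by (subst nn_integral_spt, measurable, subst nn_integral_time_measure) auto
      also have "\<dots> < \<infinity>" unfolding nn_integral_L2n[OF m] by simp
      finally show ?thesis .
    qed
    show "AE x in \<nu>1. u t x - u s x = (\<integral>\<tau>\<in>{s..t}. v \<tau> x \<partial>lborel)" if "0 < s" "s \<le> t" "t < T" for s t
      by (rule deriv[OF that])
  qed
  then show ?thesis by blast
qed

section \<open>Contraction estimates\<close>

text \<open>A convex function \<open>j\<close> with derivative \<open>P\<close>. The estimates are proved for the perspective
  \<open>k * j (w / k)\<close>, which is jointly convex in \<open>(w, k)\<close>; letting \<open>k\<close> grow at the rate of the norm of the
  forcing avoids differentiating the norm of the solution.\<close>

definition gauge :: "(real \<Rightarrow> real) \<Rightarrow> (real \<Rightarrow> real) \<Rightarrow> real \<Rightarrow> real \<Rightarrow> bool" where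
  "gauge P j K \<epsilon> \<longleftrightarrow> 0 < \<epsilon> \<and> mono P \<and> continuous_on UNIV P \<and> (\<forall>r. 0 \<le> P r \<and> P r \<le> K) \<and> (\<forall>r\<le>\<epsilon>. P r = 0) \<and>
     j 0 = 0 \<and> (\<forall>a b. j b - j a \<le> P b * (b - a))"

lemma gaugeD:
  assumes "gauge P j K \<epsilon>"
  shows "0 < \<epsilon>" "mono P" "continuous_on UNIV P" "\<And>r. 0 \<le> P r" "\<And>r. P r \<le> K" "\<And>r. r \<le> \<epsilon> \<Longrightarrow> P r = 0" "j 0 = 0"
    "\<And>a b. j b - j a \<le> P b * (b - a)" "0 \<le> K"
  using assms order_trans[of 0 "P 0" K] unfolding gauge_def by blast+

text \<open>\<open>P\<close> is zero up to \<epsilon> and at most \<open>K\<close> beyond. The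
  linear bound makes P(w) square integrable together with w.\<close>

lemma gauge_P_le:
  assumes g: "gauge P j K \<epsilon>" shows "P r \<le> K / \<epsilon> * \<bar>r\<bar>"
proof (cases "r \<le> \<epsilon>")
  case True
  then show ?thesis using gaugeD(1,6,9)[OF g] by simp
next
  case False
  then have "1 \<le> \<bar>r\<bar> / \<epsilon>" using gaugeD(1)[OF g] by (simp add: field_simps)
  then have "K * 1 \<le> K * (\<bar>r\<bar> / \<epsilon>)" using gaugeD(9)[OF g] by (intro mult_left_mono)
  then show ?thesis using gaugeD(5)[OF g, of r] by simp
qed

text \<open>The derivative grows at most linearly, so j grows at most quadratically and is Lipschitz
  with a constant linear in the arguments. This makes its integral finite and continuous on
  L^2.\<close>

lemma gauge_j:
  assumes g: "gauge P j K \<epsilon>"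
  shows "0 \<le> j r" "r \<le> \<epsilon> \<Longrightarrow> j r = 0" "j r \<le> r * P r" "0 \<le> r * P r" "r * P r \<le> K / \<epsilon> * r\<^sup>2" "j \<in> borel_measurable borel"
    "\<bar>j b - j a\<bar> \<le> K / \<epsilon> * (\<bar>b - a\<bar> * (\<bar>a\<bar> + \<bar>b\<bar>))" "continuous_on UNIV j"
proof -
  note D = gaugeD[OF g]
  show nn: "0 \<le> j r" for r using D(8)[where b=0 and a=r] D(1,6,7) by simp
  show le: "j r \<le> r * P r" for r using D(8)[where b=r and a=0] D(7) by (simp add: mult.commute)
  show "j r = 0" if "r \<le> \<epsilon>" using nn[of r] le[of r] D(6)[OF that] by simp
  show "0 \<le> r * P r" using D(1) D(4)[of r] D(6)[of r] by (cases "r \<le> 0") auto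
  show "r * P r \<le> K / \<epsilon> * r\<^sup>2"
  proof (cases "r \<le> 0")
    case True
    then show ?thesis using D(1,6,9) by simp
  next
    case False
    then have "r * P r \<le> r * (K / \<epsilon> * \<bar>r\<bar>)" using gauge_P_le[OF g, of r] by (intro mult_left_mono) auto
    then show ?thesis using False by (simp add: power2_eq_square mult_ac)
  qed
  have "mono j"
  proof (rule monoI)
    fix x y :: real assume "x \<le> y"
    then have "P x * (x - y) \<le> 0" using D(4)[of x] by (simp add: mult_nonneg_nonpos)
    then show "j x \<le> j y" using D(8)[where b=x and a=y] by simp
  qed
  then show "j \<in> borel_measurable borel" by (rule borel_measurable_mono)
  have diff: "\<bar>j b - j a\<bar> \<le> \<bar>b - a\<bar> * max (P a) (P b)" for a b
  proof -
    have "P b * (b - a) \<le> \<bar>b - a\<bar> * max (P a) (P b)"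
      using mult_mono[of "b - a" "\<bar>b - a\<bar>" "P b" "max (P a) (P b)"] D(4)[of b] by (simp add: mult.commute)
    moreover have "P a * (a - b) \<le> \<bar>b - a\<bar> * max (P a) (P b)"
      using mult_mono[of "a - b" "\<bar>b - a\<bar>" "P a" "max (P a) (P b)"] D(4)[of a] by (simp add: mult.commute)
    ultimately show ?thesis using D(8)[of b a] D(8)[of a b] by linarith
  qed
  show "\<bar>j b - j a\<bar> \<le> K / \<epsilon> * (\<bar>b - a\<bar> * (\<bar>a\<bar> + \<bar>b\<bar>))"
  proof -
    have Ke: "0 \<le> K / \<epsilon>" using D(1,9) by simp
    have "K / \<epsilon> * \<bar>a\<bar> \<le> K / \<epsilon> * (\<bar>a\<bar> + \<bar>b\<bar>)" "K / \<epsilon> * \<bar>b\<bar> \<le> K / \<epsilon> * (\<bar>a\<bar> + \<bar>b\<bar>)"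
      using Ke by (auto intro!: mult_left_mono simp del: times_divide_eq_left)
    then have "max (P a) (P b) \<le> K / \<epsilon> * (\<bar>a\<bar> + \<bar>b\<bar>)" using gauge_P_le[OF g, of a] gauge_P_le[OF g, of b] by simp
    then have "\<bar>b - a\<bar> * max (P a) (P b) \<le> \<bar>b - a\<bar> * (K / \<epsilon> * (\<bar>a\<bar> + \<bar>b\<bar>))" by (intro mult_left_mono) auto
    then show ?thesis using diff[of b a] by (simp add: mult.left_commute)
  qed
  have "\<bar>j b - j a\<bar> \<le> K * \<bar>b - a\<bar>" for a b
  proof -
    have "\<bar>b - a\<bar> * max (P a) (P b) \<le> \<bar>b - a\<bar> * K" using D(5) by (intro mult_left_mono) auto
    then show ?thesis using diff[of b a] by (simp add: mult.commute)
  qed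
  then have "K-lipschitz_on UNIV j" using D(9) by (auto simp: lipschitz_on_def dist_real_def)
  then show "continuous_on UNIV j" by (rule lipschitz_on_continuous_on)
qed

text \<open>Gradient inequality for (w, k) \<mapsto> k j(w/k): at y = w'/k' its gradient is (P(y),
  j(y) - y P(y)). It results from the inequality for j between w/k and w'/k' multiplied by the old
  scale k.\<close>

lemma gauge_perspective:
  assumes g: "gauge P j K \<epsilon>" and k: "0 < k" "0 < (k'::real)"
  shows "k' * j (w' / k') - k * j (w / k) \<le> P (w' / k') * (w' - w) + (j (w' / k') - w' / k' * P (w' / k')) * (k' - k)"
proof -
  obtain a b where [simp]: "w = k * a" "w' = k' * b"
    using that[of "w / k" "w' / k'"] k by simp
  have "k * (j b - j a) \<le> k * (P b * (b - a))" using gaugeD(8)[OF g] k by (intro mult_left_mono) auto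
  then show ?thesis using k by (simp add: algebra_simps)
qed

text \<open>The derivative in the scale, j(y) - y P(y), is nonpositive because j(0) = 0.\<close>

lemma gauge_perspective_antimono:
  assumes g: "gauge P j K \<epsilon>" and k: "0 < k" "k \<le> (k'::real)"
  shows "k' * j (w / k') \<le> k * j (w / k)"
proof -
  have "(j (w / k') - w / k' * P (w / k')) * (k' - k) \<le> 0"
    using gauge_j(3)[OF g, of "w / k'"] k by (intro mult_nonpos_nonneg) auto
  then show ?thesis using gauge_perspective[OF g k(1), of k' w w] k by simp
qed

lemma set_lebesgue_integral_singleton:
  fixes h :: "real \<Rightarrow> real" shows "(LINT \<rho>:{s..s}|lborel. h \<rho>) = 0"
  unfolding set_lebesgue_integral_def
  by (rule integral_eq_zero_AE) (use AE_lborel_singleton[of s] in \<open>eventually_elim, auto\<close>)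

lemma set_integrable_Pair:
  fixes f g :: "real \<Rightarrow> real"
  assumes "set_integrable lborel S f" "set_integrable lborel S g"
  shows "set_integrable lborel S (\<lambda>t. (f t, g t))"
    and "(LINT t:S|lborel. (f t, g t)) = (LINT t:S|lborel. f t, LINT t:S|lborel. g t)"
proof -
  have eq: "indicator S t *\<^sub>R (f t, g t) = (indicator S t *\<^sub>R f t) *\<^sub>R (1, 0) + (indicator S t *\<^sub>R g t) *\<^sub>R (0, 1)" for t
    by simp
  have i: "integrable lborel (\<lambda>t. (indicator S t *\<^sub>R f t) *\<^sub>R ((1, 0) :: real \<times> real))"
    "integrable lborel (\<lambda>t. (indicator S t *\<^sub>R g t) *\<^sub>R ((0, 1) :: real \<times> real))"
    using assms unfolding set_integrable_def by (intro integrable_scaleR_left; simp)+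
  show "set_integrable lborel S (\<lambda>t. (f t, g t))"
    unfolding set_integrable_def eq using i by (rule Bochner_Integration.integrable_add)
  have s1: "(\<integral>t. (indicator S t *\<^sub>R f t) *\<^sub>R ((1, 0) :: real \<times> real) \<partial>lborel) = (LINT t:S|lborel. f t) *\<^sub>R (1, 0)"
    "(\<integral>t. (indicator S t *\<^sub>R g t) *\<^sub>R ((0, 1) :: real \<times> real) \<partial>lborel) = (LINT t:S|lborel. g t) *\<^sub>R (0, 1)"
    unfolding set_lebesgue_integral_def using assms unfolding set_integrable_def
    by (intro integral_scaleR_left; simp only: simp_thms)+
  show "(LINT t:S|lborel. (f t, g t)) = (LINT t:S|lborel. f t, LINT t:S|lborel. g t)"
    unfolding set_lebesgue_integral_def[of lborel S "\<lambda>t. (f t, g t)"] eq Bochner_Integration.integral_add[OF i] s1 by simp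
qed

lemma (in pair_sigma_finite) integrable_product_fst_snd:
  fixes f :: "'a \<Rightarrow> real" and g :: "'b \<Rightarrow> real"
  assumes f: "integrable M1 f" and g: "integrable M2 g"
  shows "integrable (M1 \<Otimes>\<^sub>M M2) (\<lambda>z. f (fst z) * g (snd z))"
proof -
  have [measurable]: "f \<in> borel_measurable M1" "g \<in> borel_measurable M2" using f g by auto
  have "(\<integral>\<^sup>+z. ennreal (norm (f (fst z) * g (snd z))) \<partial>(M1 \<Otimes>\<^sub>M M2)) = (\<integral>\<^sup>+x. \<integral>\<^sup>+y. ennreal \<bar>f x\<bar> * ennreal \<bar>g y\<bar> \<partial>M2 \<partial>M1)"
    by (subst M2.nn_integral_fst[symmetric]) (auto simp: abs_mult ennreal_mult)
  also have "\<dots> = (\<integral>\<^sup>+x. ennreal \<bar>f x\<bar> \<partial>M1) * (\<integral>\<^sup>+y. ennreal \<bar>g y\<bar> \<partial>M2)"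
    by (simp add: nn_integral_cmult nn_integral_multc)
  also have "\<dots> < \<infinity>" using f g by (simp add: integrable_iff_bounded ennreal_mult_less_top)
  finally show ?thesis by (intro integrableI_bounded) auto
qed

section \<open>The scaled gauge integral along two solutions\<close>

context plap_space
begin

lemma gauge_integrable:
  assumes g: "gauge P j K \<epsilon>" and w: "inH w"
  shows "integrable \<nu>1 (\<lambda>x. j (w x / k))" "integrable \<nu>1 (\<lambda>x. w x / k * P (w x / k))" "inH (\<lambda>x. P (w x / k))"
proof -
  note [measurable] = memL2_measurable[OF w] gauge_j(6)[OF g] borel_measurable_mono[OF gaugeD(2)[OF g]]
  have i: "integrable \<nu>1 (\<lambda>x. K / \<epsilon> * (w x / k)\<^sup>2)" using memL2_integrable[OF memL2_divide[OF w, of k]] by (rule integrable_mult_right)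
  have le: "j r \<le> K / \<epsilon> * r\<^sup>2" for r using gauge_j(3,5)[OF g, of r] by linarith
  show "integrable \<nu>1 (\<lambda>x. j (w x / k))"
  proof (rule Bochner_Integration.integrable_bound[OF i])
    show "AE x in \<nu>1. norm (j (w x / k)) \<le> norm (K / \<epsilon> * (w x / k)\<^sup>2)"
    proof (rule AE_I2)
      fix x
      show "norm (j (w x / k)) \<le> norm (K / \<epsilon> * (w x / k)\<^sup>2)"
        using le[of "w x / k"] gauge_j(1)[OF g, of "w x / k"] unfolding real_norm_def by linarith
    qed
  qed measurable
  show "integrable \<nu>1 (\<lambda>x. w x / k * P (w x / k))"
  proof (rule Bochner_Integration.integrable_bound[OF i])
    show "AE x in \<nu>1. norm (w x / k * P (w x / k)) \<le> norm (K / \<epsilon> * (w x / k)\<^sup>2)"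
    proof (rule AE_I2)
      fix x
      have "0 \<le> w x / k * P (w x / k)" "w x / k * P (w x / k) \<le> K / \<epsilon> * (w x / k)\<^sup>2" by (rule gauge_j[OF g])+
      then show "norm (w x / k * P (w x / k)) \<le> norm (K / \<epsilon> * (w x / k)\<^sup>2)" unfolding real_norm_def by linarith
    qed
  qed measurable
  show "inH (\<lambda>x. P (w x / k))"
  proof (rule memL2_bound[OF memL2_divide[OF w, of k], where K="K / \<epsilon>"])
    show "AE x in \<nu>1. \<bar>P (w x / k)\<bar> \<le> K / \<epsilon> * \<bar>w x / k\<bar>"
    proof (rule AE_I2)
      fix x
      show "\<bar>P (w x / k)\<bar> \<le> K / \<epsilon> * \<bar>w x / k\<bar>"
        using gauge_P_le[OF g, of "w x / k"] gaugeD(4)[OF g, of "w x / k"] by linarith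
    qed
  qed measurable
qed

text \<open>The Lipschitz bound of j grows linearly, so Cauchy-Schwarz estimates the difference of
  the integrals by the L^2 distance times the sum of the norms.\<close>

lemma gauge_tendsto:
  assumes g: "gauge P j K \<epsilon>" and w: "\<And>n. inH (w n)" "inH W" "(\<lambda>n. nH (\<lambda>x. w n x - W x)) \<longlonglongrightarrow> 0" and k: "0 < k"
  shows "(\<lambda>n. \<integral>x. j (w n x / k) \<partial>\<nu>1) \<longlonglongrightarrow> (\<integral>x. j (W x / k) \<partial>\<nu>1)"
proof (rule LIM_zero_cancel, rule Lim_null_comparison)
  let ?c = "K / \<epsilon> * (1 / k * (1 / k))"
  show "(\<lambda>n. ?c * (nH (\<lambda>x. w n x - W x) * (nH (w n) + nH W))) \<longlonglongrightarrow> 0"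
  proof -
    have "(\<lambda>n. ?c * (nH (\<lambda>x. w n x - W x) * (nH (w n) + nH W))) \<longlonglongrightarrow> ?c * (0 * (nH W + nH W))"
      by (intro tendsto_mult tendsto_const tendsto_add w(3) tendsto_L2n[OF w])
    then show ?thesis by simp
  qed
  show "\<forall>\<^sub>F n in sequentially. norm ((\<integral>x. j (w n x / k) \<partial>\<nu>1) - (\<integral>x. j (W x / k) \<partial>\<nu>1))
      \<le> ?c * (nH (\<lambda>x. w n x - W x) * (nH (w n) + nH W))"
  proof (intro always_eventually allI)
    fix n
    note i = gauge_integrable(1)[OF g w(1)[of n], of k] gauge_integrable(1)[OF g w(2), of k]
    have m: "inH (\<lambda>x. \<bar>w n x - W x\<bar>)" "inH (\<lambda>x. \<bar>w n x\<bar> + \<bar>W x\<bar>)"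
      using w by (auto intro!: memL2_abs memL2_diff memL2_add)
    have c0: "0 \<le> ?c" using gaugeD(1,9)[OF g] k by simp
    have "norm ((\<integral>x. j (w n x / k) \<partial>\<nu>1) - (\<integral>x. j (W x / k) \<partial>\<nu>1)) = norm (\<integral>x. j (w n x / k) - j (W x / k) \<partial>\<nu>1)"
      using i by simp
    also have "\<dots> \<le> (\<integral>x. norm (j (w n x / k) - j (W x / k)) \<partial>\<nu>1)" by (rule integral_norm_bound)
    also have "\<dots> \<le> (\<integral>x. ?c * (\<bar>w n x - W x\<bar> * (\<bar>w n x\<bar> + \<bar>W x\<bar>)) \<partial>\<nu>1)"
    proof (rule integral_mono)
      show "integrable \<nu>1 (\<lambda>x. norm (j (w n x / k) - j (W x / k)))" using i by (intro integrable_norm Bochner_Integration.integrable_diff)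
      show "integrable \<nu>1 (\<lambda>x. ?c * (\<bar>w n x - W x\<bar> * (\<bar>w n x\<bar> + \<bar>W x\<bar>)))"
        by (intro integrable_mult_right memL2_mult_integrable m)
      fix x
      have "\<bar>j (w n x / k) - j (W x / k)\<bar> \<le> K / \<epsilon> * (\<bar>w n x / k - W x / k\<bar> * (\<bar>W x / k\<bar> + \<bar>w n x / k\<bar>))"
        by (rule gauge_j(7)[OF g])
      also have "\<bar>w n x / k - W x / k\<bar> * (\<bar>W x / k\<bar> + \<bar>w n x / k\<bar>) = (1 / k * (1 / k)) * (\<bar>w n x - W x\<bar> * (\<bar>w n x\<bar> + \<bar>W x\<bar>))"
      proof -
        have "w n x / k - W x / k = (w n x - W x) / k" by (simp add: diff_divide_distrib)
        then show ?thesis using k by (simp add: abs_divide field_simps)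
      qed
      finally show "norm (j (w n x / k) - j (W x / k)) \<le> ?c * (\<bar>w n x - W x\<bar> * (\<bar>w n x\<bar> + \<bar>W x\<bar>))"
        by (simp only: real_norm_def mult.assoc)
    qed
    also have "\<dots> = ?c * (\<integral>x. \<bar>w n x - W x\<bar> * (\<bar>w n x\<bar> + \<bar>W x\<bar>) \<partial>\<nu>1)" by (rule integral_mult_right_zero)
    also have "\<dots> \<le> ?c * (nH (\<lambda>x. w n x - W x) * (nH (w n) + nH W))"
    proof (rule mult_left_mono[OF _ c0])
      have "(\<integral>x. \<bar>w n x - W x\<bar> * (\<bar>w n x\<bar> + \<bar>W x\<bar>) \<partial>\<nu>1) \<le> nH (\<lambda>x. \<bar>w n x - W x\<bar>) * nH (\<lambda>x. \<bar>w n x\<bar> + \<bar>W x\<bar>)"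
        using L2_Cauchy_Schwarz[OF m] by linarith
      also have "nH (\<lambda>x. \<bar>w n x - W x\<bar>) = nH (\<lambda>x. w n x - W x)" by (simp add: L2n_def)
      also have "nH (\<lambda>x. \<bar>w n x\<bar> + \<bar>W x\<bar>) \<le> nH (w n) + nH W"
        using L2n_triangle[OF memL2_abs[OF w(1)[of n]] memL2_abs[OF w(2)]] by (simp add: L2n_def)
      finally show "(\<integral>x. \<bar>w n x - W x\<bar> * (\<bar>w n x\<bar> + \<bar>W x\<bar>) \<partial>\<nu>1) \<le> nH (\<lambda>x. w n x - W x) * (nH (w n) + nH W)"
        by (simp add: mult_left_mono)
    qed
    finally show "norm ((\<integral>x. j (w n x / k) \<partial>\<nu>1) - (\<integral>x. j (W x / k) \<partial>\<nu>1)) \<le> ?c * (nH (\<lambda>x. w n x - W x) * (nH (w n) + nH W))" .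
  qed
qed

text \<open>Accretivity, tested with r \<mapsto> P(r/k), replaces the derivatives by the forces.
  With y = (u - u')/k and a = (f - f')/\<kappa>, the gradient inequality in the form P(y) a + j(y) -
  y P(y) \<le> j(a), multiplied by \<kappa>, bounds the remaining integrand.\<close>

lemma gauge_instant:
  assumes g: "gauge P j K \<epsilon>" and k: "0 < k" and \<kappa>: "0 < \<kappa>"
    and A: "A u (\<lambda>x. f x - v x)" "A u' (\<lambda>x. f' x - v' x)" and f: "inH f" "inH f'"
    and \<beta>: "(\<integral>x. j ((f x - f' x) / \<kappa>) \<partial>\<nu>1) \<le> \<beta>"
  shows "(\<integral>x. P ((u x - u' x) / k) * (v x - v' x) + (j ((u x - u' x) / k) - (u x - u' x) / k * P ((u x - u' x) / k)) * \<kappa> \<partial>\<nu>1) \<le> \<beta> * \<kappa>"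
proof -
  have u: "inH u" "inH u'" and mfv: "inH (\<lambda>x. f x - v x)" "inH (\<lambda>x. f' x - v' x)"
    using A by (auto simp: A_rel_def)
  have v: "inH v" "inH v'" using memL2_diff[OF f(1) mfv(1)] memL2_diff[OF f(2) mfv(2)] by auto
  let ?w = "\<lambda>x. u x - u' x" and ?F = "\<lambda>x. f x - f' x" and ?b = "\<lambda>x. v x - v' x"
  have w: "inH ?w" "inH ?F" "inH ?b" by (intro memL2_diff u f v)+
  note gi = gauge_integrable[OF g w(1), of k]
  have acc: "0 \<le> (\<integral>x. ((f x - v x) - (f' x - v' x)) * P (?w x / k) \<partial>\<nu>1)"
  proof (rule A_accretive[OF A, where P="\<lambda>r. P (r / k)" and K=K and \<epsilon>="\<epsilon> * k"])
    show "mono (\<lambda>r. P (r / k))"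
      using gaugeD(2)[OF g] k by (auto simp: mono_def divide_right_mono)
    show "\<bar>P (r / k)\<bar> \<le> K" for r using gaugeD(4,5)[OF g, of "r / k"] by simp
    show "0 < \<epsilon> * k" using gaugeD(1)[OF g] k by simp
    show "P (r / k) = 0" if "\<bar>r\<bar> \<le> \<epsilon> * k" for r
      using that k by (intro gaugeD(6)[OF g]) (auto simp: pos_divide_le_eq)
  qed
  have iF: "integrable \<nu>1 (\<lambda>x. P (?w x / k) * ?F x)" and ib: "integrable \<nu>1 (\<lambda>x. P (?w x / k) * ?b x)"
    by (intro memL2_mult_integrable gi(3) w)+
  have "(\<integral>x. ((f x - v x) - (f' x - v' x)) * P (?w x / k) \<partial>\<nu>1) = (\<integral>x. P (?w x / k) * ?F x - P (?w x / k) * ?b x \<partial>\<nu>1)"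
    by (rule Bochner_Integration.integral_cong) (auto simp: algebra_simps)
  also have "\<dots> = (\<integral>x. P (?w x / k) * ?F x \<partial>\<nu>1) - (\<integral>x. P (?w x / k) * ?b x \<partial>\<nu>1)"
    by (rule Bochner_Integration.integral_diff[OF iF ib])
  finally have 1: "(\<integral>x. P (?w x / k) * ?b x \<partial>\<nu>1) \<le> (\<integral>x. P (?w x / k) * ?F x \<partial>\<nu>1)" using acc by linarith
  have ij: "integrable \<nu>1 (\<lambda>x. j (?F x / \<kappa>))" by (rule gauge_integrable(1)[OF g w(2)])
  let ?m = "\<lambda>x. (j (?w x / k) - ?w x / k * P (?w x / k)) * \<kappa>"
  have im: "integrable \<nu>1 ?m" by (intro integrable_mult_left Bochner_Integration.integrable_diff gi)
  have "(\<integral>x. P (?w x / k) * ?b x + ?m x \<partial>\<nu>1) = (\<integral>x. P (?w x / k) * ?b x \<partial>\<nu>1) + (\<integral>x. ?m x \<partial>\<nu>1)"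
    by (rule Bochner_Integration.integral_add[OF ib im])
  also have "\<dots> \<le> (\<integral>x. P (?w x / k) * ?F x \<partial>\<nu>1) + (\<integral>x. ?m x \<partial>\<nu>1)" using 1 by simp
  also have "\<dots> = (\<integral>x. P (?w x / k) * ?F x + ?m x \<partial>\<nu>1)" by (rule Bochner_Integration.integral_add[OF iF im, symmetric])
  also have "\<dots> \<le> (\<integral>x. \<kappa> * j (?F x / \<kappa>) \<partial>\<nu>1)"
  proof (rule integral_mono)
    show "integrable \<nu>1 (\<lambda>x. P (?w x / k) * ?F x + ?m x)" by (rule Bochner_Integration.integrable_add[OF iF im])
    show "integrable \<nu>1 (\<lambda>x. \<kappa> * j (?F x / \<kappa>))" using ij by (rule integrable_mult_right)
    fix x
    let ?y = "?w x / k" and ?a = "?F x / \<kappa>"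
    have "j ?y - j ?a \<le> P ?y * (?y - ?a)" by (rule gaugeD(8)[OF g])
    then have "P ?y * ?a + (j ?y - ?y * P ?y) \<le> j ?a" by (simp add: algebra_simps)
    then have "\<kappa> * (P ?y * ?a + (j ?y - ?y * P ?y)) \<le> \<kappa> * j ?a" using \<kappa> by (intro mult_left_mono) auto
    moreover have "\<kappa> * (P ?y * ?a + (j ?y - ?y * P ?y)) = P ?y * ?F x + (j ?y - ?y * P ?y) * \<kappa>"
      using \<kappa> by (simp add: distrib_left mult.commute)
    ultimately show "P ?y * ?F x + ?m x \<le> \<kappa> * j ?a" by linarith
  qed
  also have "\<dots> = \<kappa> * (\<integral>x. j (?F x / \<kappa>) \<partial>\<nu>1)" by (rule integral_mult_right_zero)
  also have "\<dots> \<le> \<beta> * \<kappa>" using \<beta> \<kappa> by (simp add: mult.commute)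
  finally show ?thesis .
qed

text \<open>For a.e. x the chain rule is applied to the curve r \<mapsto> (W r x, k r) and the
  perspective of j; integrating over x and exchanging the integrals leaves the instantaneous bound.
  \<open>W\<close> is a genuine primitive of b at every x, as the chain rule demands.\<close>

lemma gauge_evolution:
  assumes g: "gauge P j K \<epsilon>" and st: "s \<le> t"
    and bm: "case_prod b \<in> jmeas" and b: "memL2 (spt s t) (unc b)"
    and w0: "inH w0" and [measurable]: "\<kappa> \<in> borel_measurable borel"
    and \<kappa>0: "\<And>r. 0 \<le> \<kappa> r" and \<kappa>i: "set_integrable lborel {s..t} \<kappa>" and k0: "0 < k0"
    and W: "\<And>r x. W r x = w0 x + (LINT \<rho>:{s..r}|lborel. b \<rho> x)" and k: "\<And>r. k r = k0 + (LINT \<rho>:{s..r}|lborel. \<kappa> \<rho>)"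
    and inst: "AE r in time_measure s t. (\<integral>x. P (W r x / k r) * b r x + (j (W r x / k r) - W r x / k r * P (W r x / k r)) * \<kappa> r \<partial>\<nu>1) \<le> \<beta> * \<kappa> r"
  shows "k t * (\<integral>x. j (W t x / k t) \<partial>\<nu>1) - k0 * (\<integral>x. j (w0 x / k0) \<partial>\<nu>1) \<le> \<beta> * (LINT \<rho>:{s..t}|lborel. \<kappa> \<rho>)"
proof -
  interpret PS: pair_sigma_finite "time_measure s t" \<nu>1 by (rule pair_sigma_finite_spt)
  note [measurable] = memL2_measurable[OF w0] gauge_j(6)[OF g] borel_measurable_mono[OF gaugeD(2)[OF g]]
  have [measurable]: "(unc b) \<in> jmeas" using bm by (simp add: split_beta)
  have [measurable]: "(\<lambda>z. b (snd z) (snd (fst z))) \<in> borel_measurable ((borel \<Otimes>\<^sub>M \<nu>1) \<Otimes>\<^sub>M borel)"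
  proof -
    have "(\<lambda>z. (snd z, snd (fst z))) \<in> measurable ((borel \<Otimes>\<^sub>M \<nu>1) \<Otimes>\<^sub>M borel) (borel \<Otimes>\<^sub>M \<nu>1)" by measurable
    from measurable_compose[OF this bm] show ?thesis by simp
  qed
  have [measurable]: "(unc W) \<in> jmeas"
  proof -
    have "(\<lambda>z. LINT \<rho>|lborel. (if s \<le> \<rho> \<and> \<rho> \<le> fst z then b \<rho> (snd z) else 0)) \<in> jmeas"
      by measurable
    also have "(\<lambda>z. LINT \<rho>|lborel. (if s \<le> \<rho> \<and> \<rho> \<le> fst z then b \<rho> (snd z) else 0)) = (\<lambda>z. LINT \<rho>:{s..fst z}|lborel. b \<rho> (snd z))"
      unfolding set_lebesgue_integral_def by (intro ext Bochner_Integration.integral_cong) (auto simp: indicator_def)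
    finally show ?thesis unfolding W by measurable
  qed
  have [measurable]: "k \<in> borel_measurable borel"
  proof -
    have "(\<lambda>r. LINT \<rho>|lborel. (if s \<le> \<rho> \<and> \<rho> \<le> r then \<kappa> \<rho> else 0)) \<in> borel_measurable borel"
      by measurable
    also have "(\<lambda>r. LINT \<rho>|lborel. (if s \<le> \<rho> \<and> \<rho> \<le> r then \<kappa> \<rho> else 0)) = (\<lambda>r. LINT \<rho>:{s..r}|lborel. \<kappa> \<rho>)"
      unfolding set_lebesgue_integral_def by (intro ext Bochner_Integration.integral_cong) (auto simp: indicator_def)
    finally show ?thesis unfolding k[abs_def] by measurable
  qed
  have kge: "k0 \<le> k r" for r
    unfolding k set_lebesgue_integral_def using \<kappa>0 by (auto intro!: integral_nonneg_AE)
  \<comment> \<open>A square integrable majorant of W that does not depend on time. It dominates the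
    integrand Q on space-time, which Fubini's theorem requires.\<close>
  define H where "H x = \<bar>w0 x\<bar> + (LINT \<rho>:{s..t}|lborel. \<bar>b \<rho> x\<bar>)" for x
  define Q where "Q r x = P (W r x / k r) * b r x + (j (W r x / k r) - W r x / k r * P (W r x / k r)) * \<kappa> r" for r x
  have babs: "memL2 (spt s t) (\<lambda>z. \<bar>b (fst z) (snd z)\<bar>)" using b by (rule memL2_abs)
  have bam: "(\<lambda>(r, x). \<bar>b r x\<bar>) \<in> jmeas" by (simp add: split_beta)
  have H: "inH H" unfolding H_def by (intro memL2_add memL2_abs w0 L2n_time_integral(2)[OF st bam babs])
  note [measurable] = memL2_measurable[OF H]
  have bi: "AE x in \<nu>1. set_integrable lborel {s..t} (\<lambda>r. b r x)" by (rule L2n_time_integral(1)[OF st bm b])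
  have WH: "\<bar>W r x\<bar> \<le> H x" if bx: "set_integrable lborel {s..t} (\<lambda>r. b r x)" and r: "r \<in> {s..t}" for r x
  proof -
    have sr: "set_integrable lborel {s..r} (\<lambda>r. b r x)" by (rule set_integrable_subset[OF bx]) (use r in auto)
    have "\<bar>LINT \<rho>:{s..r}|lborel. b \<rho> x\<bar> \<le> (LINT \<rho>:{s..r}|lborel. \<bar>b \<rho> x\<bar>)"
      using set_integral_norm_bound[OF sr] by simp
    also have "\<dots> \<le> (LINT \<rho>:{s..t}|lborel. \<bar>b \<rho> x\<bar>)"
      unfolding set_lebesgue_integral_def
    proof (rule integral_mono)
      show "integrable lborel (\<lambda>\<rho>. indicator {s..r} \<rho> *\<^sub>R \<bar>b \<rho> x\<bar>)" "integrable lborel (\<lambda>\<rho>. indicator {s..t} \<rho> *\<^sub>R \<bar>b \<rho> x\<bar>)"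
        using set_integrable_abs[OF bx] set_integrable_abs[OF sr] by (auto simp: set_integrable_def)
    qed (use r in \<open>auto simp: indicator_def\<close>)
    finally show ?thesis unfolding W H_def by linarith
  qed
  have Qm[measurable]: "(unc Q) \<in> jmeas"
    unfolding Q_def by measurable
  let ?D = "\<lambda>z. K / \<epsilon> * (1 / k0) * (H (snd z) * \<bar>b (fst z) (snd z)\<bar>) + K / \<epsilon> * (1 / k0)\<^sup>2 * (\<kappa> (fst z) * (H (snd z))\<^sup>2)"
  have Di: "integrable (spt s t) ?D"
  proof (intro Bochner_Integration.integrable_add integrable_mult_right)
    have "memL2 (spt s t) (\<lambda>z. H (snd z))"
      using memL2_spt_bounded(1)[of "\<lambda>r. H" s t "nH H"] st H by (simp add: split_beta)
    then show "integrable (spt s t) (\<lambda>z. H (snd z) * \<bar>b (fst z) (snd z)\<bar>)" by (rule memL2_mult_integrable[OF _ babs])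
    show "integrable (spt s t) (\<lambda>z. \<kappa> (fst z) * (H (snd z))\<^sup>2)"
      by (rule PS.integrable_product_fst_snd) (use \<kappa>i memL2_integrable[OF H] in \<open>auto simp: integrable_time_measure\<close>)
  qed
  have Qle: "\<bar>Q r x\<bar> \<le> ?D (r, x)" if bx: "set_integrable lborel {s..t} (\<lambda>r. b r x)" and r: "r \<in> {s..t}" for r x
  proof -
    let ?y = "W r x / k r"
    have Ke: "0 \<le> K / \<epsilon>" using gaugeD(1,9)[OF g] by simp
    have y: "\<bar>?y\<bar> \<le> 1 / k0 * H x"
    proof -
      have "\<bar>?y\<bar> = \<bar>W r x\<bar> / k r" using kge[of r] k0 by simp
      also have "\<dots> \<le> H x / k0" using WH[OF bx r] kge[of r] k0 by (intro frac_le) auto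
      finally show ?thesis by simp
    qed
    have "P ?y \<le> K / \<epsilon> * \<bar>?y\<bar>" by (rule gauge_P_le[OF g])
    also have "\<dots> \<le> K / \<epsilon> * (1 / k0 * H x)" using y Ke by (rule mult_left_mono)
    finally have "P ?y * \<bar>b r x\<bar> \<le> K / \<epsilon> * (1 / k0 * H x) * \<bar>b r x\<bar>" by (rule mult_right_mono) simp
    then have 1: "\<bar>P ?y * b r x\<bar> \<le> K / \<epsilon> * (1 / k0 * H x) * \<bar>b r x\<bar>" using gaugeD(4)[OF g, of ?y] by (simp only: abs_mult abs_of_nonneg)
    have "?y\<^sup>2 = \<bar>?y\<bar>\<^sup>2" by (rule power2_abs[symmetric])
    also have "\<dots> \<le> (1 / k0 * H x)\<^sup>2" using y by (rule power_mono) simp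
    finally have "K / \<epsilon> * ?y\<^sup>2 \<le> K / \<epsilon> * (1 / k0 * H x)\<^sup>2" using Ke by (rule mult_left_mono)
    then have "\<bar>j ?y - ?y * P ?y\<bar> \<le> K / \<epsilon> * (1 / k0 * H x)\<^sup>2"
      using gauge_j(1,3,5)[OF g, of ?y] by argo
    then have "\<bar>j ?y - ?y * P ?y\<bar> * \<kappa> r \<le> K / \<epsilon> * (1 / k0 * H x)\<^sup>2 * \<kappa> r" using \<kappa>0 by (rule mult_right_mono)
    then have 2: "\<bar>(j ?y - ?y * P ?y) * \<kappa> r\<bar> \<le> K / \<epsilon> * (1 / k0 * H x)\<^sup>2 * \<kappa> r" using \<kappa>0[of r] by (simp only: abs_mult abs_of_nonneg)
    have "\<bar>Q r x\<bar> \<le> K / \<epsilon> * (1 / k0 * H x) * \<bar>b r x\<bar> + K / \<epsilon> * (1 / k0 * H x)\<^sup>2 * \<kappa> r"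
      unfolding Q_def using order_trans[OF abs_triangle_ineq add_mono[OF 1 2]] .
    then show ?thesis unfolding power_mult_distrib fst_conv snd_conv by (simp only: mult_ac)
  qed
  have Qi: "integrable (spt s t) (case_prod Q)"
  proof (rule Bochner_Integration.integrable_bound[OF Di])
    show "case_prod Q \<in> borel_measurable (spt s t)" using Qm by (simp add: measurable_spt split_beta)
    have "AE z in spt s t. \<bar>Q (fst z) (snd z)\<bar> \<le> ?D z"
    proof (rule PS.AE_pair_measure)
      show "{z \<in> space (spt s t). \<bar>Q (fst z) (snd z)\<bar> \<le> ?D z} \<in> sets (spt s t)"
        by (rule borel_measurable_le[OF _ borel_measurable_integrable[OF Di]])
           (use Qm in \<open>simp add: measurable_spt\<close>)
      show "AE r in time_measure s t. AE x in \<nu>1. \<bar>Q (fst (r, x)) (snd (r, x))\<bar> \<le> ?D (r, x)"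
      proof (rule AE_time_measure_I)
        fix r assume "s \<le> r" "r \<le> t"
        show "AE x in \<nu>1. \<bar>Q (fst (r, x)) (snd (r, x))\<bar> \<le> ?D (r, x)"
          using bi
        proof eventually_elim
          case (elim x)
          show ?case using Qle[OF elim, of r] \<open>s \<le> r\<close> \<open>r \<le> t\<close> by simp
        qed
      qed
    qed
    then show "AE z in spt s t. norm (case z of (r, x) \<Rightarrow> Q r x) \<le> norm (?D z)"
    proof eventually_elim
      case (elim z)
      then show ?case unfolding real_norm_def split_beta by linarith
    qed
  qed
  have Qx: "(\<lambda>r. Q r x) \<in> borel_measurable borel" if "x \<in> space \<nu>1" for x
    using measurable_compose[OF measurable_Pair2'[OF that] Qm] by simp
  \<comment> \<open>Perspective function and its gradient on the half-plane of positive scales, to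
    which the curve is confined because its scale never drops below \<open>k0\<close>.\<close>
  let ?\<Theta> = "\<lambda>p::real \<times> real. snd p * j (fst p / snd p)"
  let ?G = "\<lambda>p::real \<times> real. (P (fst p / snd p), j (fst p / snd p) - fst p / snd p * P (fst p / snd p))"
  have ch: "k t * j (W t x / k t) - k0 * j (w0 x / k0) \<le> (\<integral>r. Q r x \<partial>time_measure s t)"
    if bx: "set_integrable lborel {s..t} (\<lambda>r. b r x)" and x: "x \<in> space \<nu>1" for x
  proof -
    have s0: "W s x = w0 x" "k s = k0" unfolding W k by (simp_all only: set_lebesgue_integral_singleton add_0_right)
    have sub: "set_integrable lborel {s..r} (\<lambda>r. b r x)" "set_integrable lborel {s..r} \<kappa>" if "r \<in> {s..t}" for r
      using that by (auto intro: set_integrable_subset[OF bx] set_integrable_subset[OF \<kappa>i])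
    have "?\<Theta> (W t x, k t) - ?\<Theta> (W s x, k s) \<le> (LINT r:{s..t}|lborel. ?G (W r x, k r) \<bullet> (b r x, \<kappa> r))"
    proof (rule convex_chain_rule(2)[OF st set_integrable_Pair(1)[OF bx \<kappa>i], where D="{p. 0 < snd p}"])
      fix r assume r: "r \<in> {s..t}"
      show "(W r x, k r) = (W s x, k s) + (LINT \<rho>:{s..r}|lborel. (b \<rho> x, \<kappa> \<rho>))"
        unfolding set_integrable_Pair(2)[OF sub[OF r]] s0 by (simp add: W k)
      show "(W r x, k r) \<in> {p. 0 < snd p}" using kge[of r] k0 by simp
    next
      have "continuous_on A (\<lambda>p. F (h p))" if "continuous_on UNIV F" "continuous_on A h" for F h :: "_ \<Rightarrow> real" and A :: "(real \<times> real) set"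
        using continuous_on_compose2[OF that] by simp
      note c = this[OF gaugeD(3)[OF g]] this[OF gauge_j(8)[OF g]]
      show "continuous_on {p. 0 < snd p} ?G"
        by (intro continuous_intros c) auto
    next
      fix a b' :: "real \<times> real" assume ab: "a \<in> {p. 0 < snd p}" "b' \<in> {p. 0 < snd p}"
      show "?\<Theta> b' - ?\<Theta> a \<le> ?G b' \<bullet> (b' - a)"
        using gauge_perspective[OF g, of "snd a" "snd b'" "fst b'" "fst a"] ab by (simp add: inner_prod_def)
    qed
    also have "(LINT r:{s..t}|lborel. ?G (W r x, k r) \<bullet> (b r x, \<kappa> r)) = (LINT r:{s..t}|lborel. Q r x)"
      by (simp add: inner_prod_def Q_def)
    also have "\<dots> = (\<integral>r. Q r x \<partial>time_measure s t)" using Qx[OF x] by (simp add: integral_time_measure)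
    finally show ?thesis by (simp add: s0)
  qed
  have Wt: "inH (W t)" unfolding W[abs_def] by (intro memL2_add w0 L2n_time_integral(2)[OF st bm b])
  note gi = gauge_integrable(1)[OF g Wt, of "k t"] gauge_integrable(1)[OF g w0, of k0]
  have "k t * (\<integral>x. j (W t x / k t) \<partial>\<nu>1) - k0 * (\<integral>x. j (w0 x / k0) \<partial>\<nu>1) = (\<integral>x. k t * j (W t x / k t) - k0 * j (w0 x / k0) \<partial>\<nu>1)"
    using gi by simp
  also have "\<dots> \<le> (\<integral>x. \<integral>r. Q r x \<partial>time_measure s t \<partial>\<nu>1)"
  proof (rule integral_mono_AE)
    show "integrable \<nu>1 (\<lambda>x. k t * j (W t x / k t) - k0 * j (w0 x / k0))" using gi by simp
    show "integrable \<nu>1 (\<lambda>x. \<integral>r. Q r x \<partial>time_measure s t)" by (rule PS.integrable_snd[OF Qi])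
    show "AE x in \<nu>1. k t * j (W t x / k t) - k0 * j (w0 x / k0) \<le> (\<integral>r. Q r x \<partial>time_measure s t)"
      using bi AE_space by eventually_elim (rule ch)
  qed
  also have "\<dots> = (\<integral>r. \<integral>x. Q r x \<partial>\<nu>1 \<partial>time_measure s t)" by (rule PS.Fubini_integral[OF Qi])
  also have "\<dots> \<le> (\<integral>r. \<beta> * \<kappa> r \<partial>time_measure s t)"
  proof (rule integral_mono_AE)
    show "integrable (time_measure s t) (\<lambda>r. \<integral>x. Q r x \<partial>\<nu>1)" using PS.integrable_fst[OF Qi] .
    show "integrable (time_measure s t) (\<lambda>r. \<beta> * \<kappa> r)" using \<kappa>i by (simp add: integrable_time_measure)
    show "AE r in time_measure s t. (\<integral>x. Q r x \<partial>\<nu>1) \<le> \<beta> * \<kappa> r" using inst by (simp add: Q_def)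
  qed
  also have "\<dots> = \<beta> * (LINT \<rho>:{s..t}|lborel. \<kappa> \<rho>)" by (simp add: integral_time_measure)
  finally show ?thesis .
qed

lemma strong_solution_tendsto:
  assumes sol: "solution T u0 f u" and t: "t \<in> {0..T}"
    and X: "\<And>n. X n \<in> {0..T}" "\<And>n. X n \<noteq> t" "X \<longlonglongrightarrow> t"
  shows "(\<lambda>n::nat. nH (\<lambda>x. u (X n) x - u t x)) \<longlonglongrightarrow> 0"
proof -
  have "filterlim X (at t within {0..T}) sequentially" unfolding filterlim_at using X by auto
  moreover have "((\<lambda>s. L2dist \<nu>1 (u s) (u t)) \<longlongrightarrow> 0) (at t within {0..T})"
    using sol t unfolding strong_solution_def by blast
  ultimately have "(\<lambda>n. L2dist \<nu>1 (u (X n)) (u t)) \<longlonglongrightarrow> 0" by (rule filterlim_compose[rotated])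
  then show ?thesis by (simp add: L2dist_eq_L2n)
qed

text \<open>A solution agrees with the primitive of its derivative only a.e. in x, with an
  exceptional set depending on the time. The evolution estimate is therefore run for the primitive W
  and translated back at the fixed times where integrals over x are taken.\<close>

lemma gauge_strong_solution:
  assumes g: "gauge P j K \<epsilon>"
    and sol: "solution T u0 f u" and sol': "solution T u0' f' u'"
    and f: "memL2T \<nu>1 T f" "memL2T \<nu>1 T f'"
    and \<kappa>m[measurable]: "\<kappa> \<in> borel_measurable borel" and \<kappa>0: "\<And>r. 0 < \<kappa> r" and k0: "0 < k0"
    and st: "0 < s" "s \<le> t" "t < T" and \<kappa>i: "set_integrable lborel {s..t} \<kappa>"
    and force: "AE r in lborel. r \<in> {s..t} \<longrightarrow> (\<integral>x. j ((f r x - f' r x) / \<kappa> r) \<partial>\<nu>1) \<le> \<beta>"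
    and kt: "kt = k0 + (LINT \<rho>:{s..t}|lborel. \<kappa> \<rho>)"
  shows "kt * (\<integral>x. j ((u t x - u' t x) / kt) \<partial>\<nu>1) - k0 * (\<integral>x. j ((u s x - u' s x) / k0) \<partial>\<nu>1) \<le> \<beta> * (LINT \<rho>:{s..t}|lborel. \<kappa> \<rho>)"
proof -
  note [measurable] = gauge_j(6)[OF g] borel_measurable_mono[OF gaugeD(2)[OF g]]
  have *: "\<exists>v. case_prod v \<in> jmeas \<and> memL2 (spt s t) (unc v)
      \<and> (\<forall>r\<in>{s..t}. AE x in \<nu>1. u r x - u s x = (LINT \<tau>:{s..r}|lborel. v \<tau> x))
      \<and> (AE r in lborel. r \<in> {s..t} \<longrightarrow> A (u r) (\<lambda>x. f r x - v r x))"
    if sol: "solution T u0 f u" for u0 f u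
  proof -
    obtain v where vm: "case_prod v \<in> borel_measurable (lborel \<Otimes>\<^sub>M \<nu>1)"
      and fin: "(\<integral>\<^sup>+ r\<in>{s..t}. (\<integral>\<^sup>+ x. ennreal ((v r x)\<^sup>2) \<partial>\<nu>1) \<partial>lborel) < \<infinity>"
      and int: "\<forall>s t. 0 < s \<longrightarrow> s \<le> t \<longrightarrow> t < T \<longrightarrow> (AE x in \<nu>1. u t x - u s x = (LINT \<tau>:{s..t}|lborel. v \<tau> x))"
      and A: "AE t in lborel. t \<in> {0<..<T} \<longrightarrow> A (u t) (\<lambda>x. f t x - v t x)"
      using sol st unfolding strong_solution_def by blast
    have vb: "case_prod v \<in> jmeas"
      using vm measurable_cong_sets[OF sets_pair_measure_cong[OF sets_lborel refl] refl] by blast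
    then have [measurable]: "(unc v) \<in> jmeas" by (simp add: split_beta)
    have "(\<integral>\<^sup>+z. ennreal ((v (fst z) (snd z))\<^sup>2) \<partial>spt s t) = (\<integral>\<^sup>+r. \<integral>\<^sup>+x. ennreal ((v r x)\<^sup>2) \<partial>\<nu>1 \<partial>time_measure s t)"
      by (subst nn_integral_spt) (auto, measurable)
    also have "\<dots> = (\<integral>\<^sup>+ r\<in>{s..t}. (\<integral>\<^sup>+ x. ennreal ((v r x)\<^sup>2) \<partial>\<nu>1) \<partial>lborel)"
    proof (rule nn_integral_time_measure)
      have "(\<lambda>r. \<integral>\<^sup>+x. ennreal ((v (fst (r, x)) (snd (r, x)))\<^sup>2) \<partial>\<nu>1) \<in> borel_measurable borel" by measurable
      then show "(\<lambda>r. \<integral>\<^sup>+x. ennreal ((v r x)\<^sup>2) \<partial>\<nu>1) \<in> borel_measurable borel" by simp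
    qed
    finally have "memL2 (spt s t) (unc v)" using fin by (subst memL2_iff_nn_integral) (auto simp: measurable_spt)
    moreover have "AE r in lborel. r \<in> {s..t} \<longrightarrow> A (u r) (\<lambda>x. f r x - v r x)"
      using A by eventually_elim (use st in auto)
    ultimately show ?thesis using vb int st by (intro exI[of _ v]) auto
  qed
  obtain v where vm: "case_prod v \<in> jmeas" and v2: "memL2 (spt s t) (unc v)"
    and vi: "\<forall>r\<in>{s..t}. AE x in \<nu>1. u r x - u s x = (LINT \<tau>:{s..r}|lborel. v \<tau> x)"
    and vA: "AE r in lborel. r \<in> {s..t} \<longrightarrow> A (u r) (\<lambda>x. f r x - v r x)" using *[OF sol] by blast
  obtain v' where vm': "case_prod v' \<in> jmeas" and v2': "memL2 (spt s t) (unc v')"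
    and vi': "\<forall>r\<in>{s..t}. AE x in \<nu>1. u' r x - u' s x = (LINT \<tau>:{s..r}|lborel. v' \<tau> x)"
    and vA': "AE r in lborel. r \<in> {s..t} \<longrightarrow> A (u' r) (\<lambda>x. f' r x - v' r x)" using *[OF sol'] by blast
  have mem: "inH (\<lambda>x. u r x - u' r x)" if "r \<in> {s..t}" for r
  proof -
    have "r \<in> {0..T}" using that st by auto
    then have "inH (u r)" "inH (u' r)" using sol sol' unfolding strong_solution_def by blast+
    then show ?thesis by (rule memL2_diff)
  qed
  define b where "b r x = v r x - v' r x" for r x
  define W where "W r x = u s x - u' s x + (LINT \<rho>:{s..r}|lborel. b \<rho> x)" for r x
  define k where "k r = k0 + (LINT \<rho>:{s..r}|lborel. \<kappa> \<rho>)" for r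
  have kpos: "0 < k r" for r
    unfolding k_def set_lebesgue_integral_def using k0 \<kappa>0 by (auto intro!: add_pos_nonneg integral_nonneg_AE simp: less_imp_le)
  have bm: "case_prod b \<in> jmeas"
    using borel_measurable_diff[OF vm vm'] by (simp add: b_def[abs_def] split_beta)
  have b2: "memL2 (spt s t) (unc b)" unfolding b_def by (rule memL2_diff[OF v2 v2'])
  have WAE: "AE x in \<nu>1. W r x = u r x - u' r x" if r: "r \<in> {s..t}" for r
    using L2n_time_integral(1)[OF st(2) vm v2] L2n_time_integral(1)[OF st(2) vm' v2'] bspec[OF vi r] bspec[OF vi' r]
  proof eventually_elim
    case (elim x)
    have "set_integrable lborel {s..r} (\<lambda>r. v r x)" "set_integrable lborel {s..r} (\<lambda>r. v' r x)"
      using r by (auto intro: set_integrable_subset[OF elim(1)] set_integrable_subset[OF elim(2)])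
    then have "(LINT \<rho>:{s..r}|lborel. b \<rho> x) = (LINT \<rho>:{s..r}|lborel. v \<rho> x) - (LINT \<rho>:{s..r}|lborel. v' \<rho> x)"
      unfolding b_def by (rule set_integral_diff(2))
    then show ?case using elim(3,4) unfolding W_def by linarith
  qed
  have Wm[measurable]: "W r \<in> borel_measurable \<nu>1" if r: "r \<in> {s..t}" for r
    unfolding W_def[abs_def]
  proof (rule memL2_measurable, intro memL2_add mem L2n_time_integral(2)[OF _ bm])
    show "memL2 (spt s r) (unc b)" by (rule memL2_spt_mono(1)[OF b2]) (use r in auto)
  qed (use st r in auto)
  have main: "k t * (\<integral>x. j (W t x / k t) \<partial>\<nu>1) - k0 * (\<integral>x. j ((u s x - u' s x) / k0) \<partial>\<nu>1) \<le> \<beta> * (LINT \<rho>:{s..t}|lborel. \<kappa> \<rho>)"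
  proof (rule gauge_evolution[OF g st(2) bm b2 mem \<kappa>m _ \<kappa>i k0 W_def k_def])
    show "0 \<le> \<kappa> r" for r using \<kappa>0[of r] by simp
    have fs: "AE r in time_measure 0 T. inH (f r)" "AE r in time_measure 0 T. inH (f' r)"
      using AE_memL2_slice[OF memL2T_spt(2)[OF f(1)]] AE_memL2_slice[OF memL2T_spt(2)[OF f(2)]] by simp_all
    show "AE r in time_measure s t. (\<integral>x. P (W r x / k r) * b r x + (j (W r x / k r) - W r x / k r * P (W r x / k r)) * \<kappa> r \<partial>\<nu>1) \<le> \<beta> * \<kappa> r"
      unfolding AE_time_measure using vA vA' force fs[unfolded AE_time_measure]
    proof eventually_elim
      case (elim r)
      show ?case
      proof
        assume r: "r \<in> {s..t}"
        then have A: "A (u r) (\<lambda>x. f r x - v r x)" "A (u' r) (\<lambda>x. f' r x - v' r x)" and m: "inH (f r)" "inH (f' r)"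
          using elim st by auto
        have [measurable]: "v r \<in> borel_measurable \<nu>1" "v' r \<in> borel_measurable \<nu>1"
          using A m memL2_diff[of \<nu>1 "f r" "\<lambda>x. f r x - v r x"] memL2_diff[of \<nu>1 "f' r" "\<lambda>x. f' r x - v' r x"]
          by (auto simp: A_rel_def intro: memL2_measurable)
        note [measurable] = memL2_measurable[OF mem[OF r]] Wm[OF r]
        have "(\<integral>x. P (W r x / k r) * b r x + (j (W r x / k r) - W r x / k r * P (W r x / k r)) * \<kappa> r \<partial>\<nu>1)
          = (\<integral>x. P ((u r x - u' r x) / k r) * (v r x - v' r x) + (j ((u r x - u' r x) / k r) - (u r x - u' r x) / k r * P ((u r x - u' r x) / k r)) * \<kappa> r \<partial>\<nu>1)"
          unfolding b_def
        proof (rule integral_cong_AE)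
          show "AE x in \<nu>1. P (W r x / k r) * (v r x - v' r x) + (j (W r x / k r) - W r x / k r * P (W r x / k r)) * \<kappa> r
            = P ((u r x - u' r x) / k r) * (v r x - v' r x) + (j ((u r x - u' r x) / k r) - (u r x - u' r x) / k r * P ((u r x - u' r x) / k r)) * \<kappa> r"
            using WAE[OF r] by eventually_elim simp
        qed measurable
        also have "\<dots> \<le> \<beta> * \<kappa> r" by (rule gauge_instant[OF g kpos \<kappa>0 A m]) (use elim r in auto)
        finally show "(\<integral>x. P (W r x / k r) * b r x + (j (W r x / k r) - W r x / k r * P (W r x / k r)) * \<kappa> r \<partial>\<nu>1) \<le> \<beta> * \<kappa> r" .
      qed
    qed
  qed (use st in auto)
  have tt: "t \<in> {s..t}" using st by simp
  note [measurable] = memL2_measurable[OF mem[OF tt]] Wm[OF tt]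
  have "(\<integral>x. j (W t x / k t) \<partial>\<nu>1) = (\<integral>x. j ((u t x - u' t x) / k t) \<partial>\<nu>1)"
  proof (rule integral_cong_AE)
    show "AE x in \<nu>1. j (W t x / k t) = j ((u t x - u' t x) / k t)" using WAE[OF tt] by eventually_elim simp
  qed measurable
  with main show ?thesis unfolding kt k_def by simp
qed

text \<open>Solutions are differentiable only locally in (0, T), so the estimate is established
  between interior times and carried to 0 and T by continuity in L^2. The bound \<beta> is preserved
  because value and scale grow by the same integral of \<kappa>.\<close>

lemma gauge_contraction:
  assumes g: "gauge P j K \<epsilon>"
    and sol: "solution T u0 f u" and sol': "solution T u0' f' u'"
    and f: "memL2T \<nu>1 T f" "memL2T \<nu>1 T f'" and u0: "inH u0" "inH u0'"
    and \<kappa>m[measurable]: "\<kappa> \<in> borel_measurable borel" and \<kappa>0: "\<And>r. 0 < \<kappa> r" and k0: "0 < k0"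
    and t: "t \<in> {0..T}" and \<kappa>i: "set_integrable lborel {0..t} \<kappa>" and \<beta>: "0 \<le> \<beta>"
    and init: "(\<integral>x. j ((u0 x - u0' x) / k0) \<partial>\<nu>1) \<le> \<beta>"
    and force: "AE r in lborel. r \<in> {0..t} \<longrightarrow> (\<integral>x. j ((f r x - f' r x) / \<kappa> r) \<partial>\<nu>1) \<le> \<beta>"
    and k: "k = k0 + (LINT \<rho>:{0..t}|lborel. \<kappa> \<rho>)"
  shows "(\<integral>x. j ((u t x - u' t x) / k) \<partial>\<nu>1) \<le> \<beta>"
proof -
  define w where "w r x = u r x - u' r x" for r x
  define kk where "kk r = k0 + (LINT \<rho>:{0..r}|lborel. \<kappa> \<rho>)" for r
  define I where "I r h = (\<integral>x. j (w r x / h) \<partial>\<nu>1)" for r h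
  have mem: "inH (u r)" "inH (u' r)" "inH (w r)" if "r \<in> {0..T}" for r
    using sol sol' that memL2_diff[of \<nu>1 "u r" "u' r"] unfolding strong_solution_def w_def by auto
  have \<kappa>s: "set_integrable lborel {a..b} \<kappa>" if "0 \<le> a" "b \<le> t" for a b
    using that by (intro set_integrable_subset[OF \<kappa>i]) auto
  have int0: "0 \<le> (LINT \<rho>:{a..b}|lborel. \<kappa> \<rho>)" for a b
    unfolding set_lebesgue_integral_def using \<kappa>0 by (auto intro!: integral_nonneg_AE simp: less_imp_le)
  have kk0: "k0 \<le> kk r" for r unfolding kk_def using int0 by simp
  have split: "kk b = kk a + (LINT \<rho>:{a..b}|lborel. \<kappa> \<rho>)" if "0 \<le> a" "a \<le> b" "b \<le> t" for a b
    unfolding kk_def using set_integral_Icc_combine[of 0 a b \<kappa>] \<kappa>s[of 0 b] that by simp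
  have anti: "h' * I r h' \<le> h * I r h" if "0 < h" "h \<le> h'" "r \<in> {0..T}" for h h' r
  proof -
    have "h' * I r h' = (\<integral>x. h' * j (w r x / h') \<partial>\<nu>1)" by (simp add: I_def)
    also have "\<dots> \<le> (\<integral>x. h * j (w r x / h) \<partial>\<nu>1)"
      using gauge_perspective_antimono[OF g that(1,2)] by (intro integral_mono integrable_mult_right gauge_integrable(1)[OF g mem(3)[OF that(3)]])
    finally show ?thesis by (simp add: I_def)
  qed
  have lim: "(\<lambda>n. I (X n) h) \<longlonglongrightarrow> I r h" if "0 < h" "r \<in> {0..T}" and X: "\<And>n. X n \<in> {0..T}" "\<And>n. X n \<noteq> r" "X \<longlonglongrightarrow> r" for X :: "nat \<Rightarrow> real" and r h
    unfolding I_def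
  proof (rule gauge_tendsto[OF g mem(3)[OF X(1)] mem(3)[OF that(2)] _ that(1)])
    have s: "(\<lambda>n. nH (\<lambda>x. u (X n) x - u r x) + nH (\<lambda>x. u' (X n) x - u' r x)) \<longlonglongrightarrow> 0"
      using tendsto_add[OF strong_solution_tendsto[OF sol that(2) X] strong_solution_tendsto[OF sol' that(2) X]] by simp
    show "(\<lambda>n. nH (\<lambda>x. w (X n) x - w r x)) \<longlonglongrightarrow> 0"
    proof (rule Lim_null_comparison[OF always_eventually s], rule allI)
      fix n
      have "nH (\<lambda>x. (u (X n) x - u r x) - (u' (X n) x - u' r x)) \<le> nH (\<lambda>x. u (X n) x - u r x) + nH (\<lambda>x. u' (X n) x - u' r x)"
        by (intro L2n_diff_le memL2_diff mem X that)
      moreover have "(\<lambda>x. (u (X n) x - u r x) - (u' (X n) x - u' r x)) = (\<lambda>x. w (X n) x - w r x)" by (auto simp: w_def)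
      ultimately show "norm (nH (\<lambda>x. w (X n) x - w r x)) \<le> nH (\<lambda>x. u (X n) x - u r x) + nH (\<lambda>x. u' (X n) x - u' r x)" by simp
    qed
  qed
  have I0: "I 0 k0 \<le> \<beta>"
  proof -
    have T0: "0 \<in> {0..T}" using t by simp
    note [measurable] = memL2_measurable[OF mem(3)[OF T0]] memL2_measurable[OF u0(1)] memL2_measurable[OF u0(2)] gauge_j(6)[OF g]
    have e: "AE x in \<nu>1. u 0 x = u0 x" "AE x in \<nu>1. u' 0 x = u0' x" using sol sol' unfolding strong_solution_def by blast+
    have "I 0 k0 = (\<integral>x. j ((u0 x - u0' x) / k0) \<partial>\<nu>1)"
      unfolding I_def
    proof (rule integral_cong_AE)
      show "AE x in \<nu>1. j (w 0 x / k0) = j ((u0 x - u0' x) / k0)" using e by eventually_elim (simp add: w_def)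
    qed measurable
    then show ?thesis using init by simp
  qed
  have step: "kk \<tau> * I \<tau> (kk \<tau>) \<le> \<beta> * kk \<tau>" if \<tau>: "0 < \<tau>" "\<tau> \<le> t" "\<tau> < T" for \<tau>
  proof -
    \<comment> \<open>By antimonotonicity the scale at time s is lowered to \<open>k0\<close>; the
      limit as s tends to 0 then concerns one fixed scale.\<close>
    have le: "kk \<tau> * I \<tau> (kk \<tau>) - \<beta> * (kk \<tau> - k0) \<le> k0 * I s k0" if s: "0 < s" "s \<le> \<tau>" for s
    proof -
      have "kk \<tau> * I \<tau> (kk \<tau>) - kk s * I s (kk s) \<le> \<beta> * (LINT \<rho>:{s..\<tau>}|lborel. \<kappa> \<rho>)"
        unfolding I_def w_def
      proof (rule gauge_strong_solution[OF g sol sol' f \<kappa>m \<kappa>0])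
        show "0 < kk s" using kk0[of s] k0 by linarith
        show "AE r in lborel. r \<in> {s..\<tau>} \<longrightarrow> (\<integral>x. j ((f r x - f' r x) / \<kappa> r) \<partial>\<nu>1) \<le> \<beta>"
          using force by eventually_elim (use s \<tau> in auto)
        show "kk \<tau> = kk s + (LINT \<rho>:{s..\<tau>}|lborel. \<kappa> \<rho>)" using split[of s \<tau>] s \<tau> by simp
      qed (use s \<tau> \<kappa>s[of s \<tau>] in auto)
      also have "\<beta> * (LINT \<rho>:{s..\<tau>}|lborel. \<kappa> \<rho>) = \<beta> * (kk \<tau> - kk s)" using split[of s \<tau>] s \<tau> by simp
      also have "\<dots> \<le> \<beta> * (kk \<tau> - k0)" using \<beta> kk0[of s] by (intro mult_left_mono) auto
      finally have "kk \<tau> * I \<tau> (kk \<tau>) - \<beta> * (kk \<tau> - k0) \<le> kk s * I s (kk s)" by linarith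
      also have "\<dots> \<le> k0 * I s k0" using anti[OF k0 kk0] s \<tau> by simp
      finally show ?thesis .
    qed
    define X where "X n = \<tau> / real (Suc n)" for n
    have X: "X n \<in> {0..T}" "X n \<noteq> 0" "0 < X n" "X n \<le> \<tau>" for n
    proof -
      show "X n \<le> \<tau>" unfolding X_def using \<tau> by (simp add: divide_le_eq mult_left_mono[of 1 _ \<tau>, simplified])
      then show "X n \<in> {0..T}" using \<tau> by (simp add: X_def)
    qed (use \<tau> in \<open>auto simp: X_def\<close>)
    have "X \<longlonglongrightarrow> 0" unfolding X_def using lim_const_over_n[of \<tau>, THEN LIMSEQ_Suc] by simp
    then have "(\<lambda>n. I (X n) k0) \<longlonglongrightarrow> I 0 k0" using lim[of k0 0 X] X k0 \<tau> by auto
    then have "(\<lambda>n. k0 * I (X n) k0) \<longlonglongrightarrow> k0 * I 0 k0" by (rule tendsto_mult_left)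
    then have "kk \<tau> * I \<tau> (kk \<tau>) - \<beta> * (kk \<tau> - k0) \<le> k0 * I 0 k0"
      by (rule Lim_bounded2[where N=0]) (use le X in auto)
    also have "\<dots> \<le> k0 * \<beta>" using I0 k0 by simp
    finally show ?thesis by (simp add: algebra_simps)
  qed
  have kpos: "0 < kk r" for r using kk0[of r] k0 by linarith
  have "I t (kk t) \<le> \<beta>"
  proof (cases "t = 0")
    case True
    then show ?thesis using I0 by (simp add: kk_def set_lebesgue_integral_singleton[of 0, simplified])
  next
    case False
    then have t0: "0 < t" using t by simp
    show ?thesis
    proof (cases "t < T")
      case True
      then show ?thesis using step[OF t0 order_refl True] kpos[of t] by (simp add: mult.commute)
    next
      case False
      then have tT: "t = T" using t by simp
      \<comment> \<open>Approach of the endpoint T from inside; the denominators start at 2 so that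
        all these times are positive.\<close>
      define X where "X n = t - t / real (n + 2)" for n
      have X: "X n \<in> {0..T}" "X n \<noteq> t" "0 < X n" "X n < t" for n
      proof -
        have "t / real (n + 2) < t / 1" using t0 by (intro divide_strict_left_mono) auto
        then show "0 < X n" by (simp add: X_def)
        show "X n < t" using t0 by (simp add: X_def)
        then show "X n \<in> {0..T}" "X n \<noteq> t" using \<open>0 < X n\<close> tT by auto
      qed
      have "X \<longlonglongrightarrow> t - 0"
        unfolding X_def by (intro tendsto_diff tendsto_const) (use LIMSEQ_ignore_initial_segment[OF lim_const_over_n[of t], of 2] in simp)
      then have l: "(\<lambda>n. I (X n) (kk t)) \<longlonglongrightarrow> I t (kk t)" using lim[of "kk t" t X] X kpos t by auto
      \<comment> \<open>The scale is frozen at its final value \<open>kk t\<close>, at which the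
        integrals converge as the times tend to T.\<close>
      have "I (X n) (kk t) \<le> \<beta>" for n
      proof -
        have kle: "kk (X n) \<le> kk t" using split[of "X n" t] X[of n] int0[of "X n" t] by simp
        have "kk t * I (X n) (kk t) \<le> kk (X n) * I (X n) (kk (X n))" by (rule anti[OF kpos kle X(1)])
        also have "\<dots> \<le> \<beta> * kk (X n)" using step[of "X n"] X[of n] tT by simp
        also have "\<dots> \<le> \<beta> * kk t" using kle \<beta> by (rule mult_left_mono)
        finally show ?thesis using kpos[of t] by (simp add: mult.commute)
      qed
      then show ?thesis by (intro Lim_bounded[OF l, of 0]) auto
    qed
  qed
  then show ?thesis unfolding I_def w_def kk_def k .
qed

end

section \<open>Gauges that characterize the L^r norms\<close>

lemma gauge_integral:
  assumes \<epsilon>: "0 < \<epsilon>" and mono: "mono P" and cont: "continuous_on UNIV P"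
    and P: "\<And>r. 0 \<le> P r" "\<And>r. P r \<le> K" "\<And>r. r \<le> \<epsilon> \<Longrightarrow> P r = 0"
  shows "gauge P (\<lambda>s. integral {0..s} P) K \<epsilon>"
proof -
  let ?j = "\<lambda>s. integral {0..s} P"
  have int: "P integrable_on {a..b}" for a b
    by (rule integrable_continuous_real[OF continuous_on_subset[OF cont]]) simp
  have nn: "0 \<le> ?j s" for s by (rule integral_nonneg[OF int]) (rule P)
  \<comment> \<open>For negative s the interval is empty and the integral is 0, which is the value a
    gauge must have there.\<close>
  have zero: "?j s = 0" if "s \<le> 0" for s
  proof (cases "s = 0")
    case False
    then have "{0..s} = {}" using that by simp
    then show ?thesis by simp
  qed simp
  have ub: "integral {a..b} P \<le> P b * (b - a)" if "a \<le> b" for a b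
  proof -
    have "integral {a..b} P \<le> integral {a..b} (\<lambda>_. P b)" using monoD[OF mono] by (intro integral_le int) auto
    then show ?thesis using that by (simp add: mult.commute)
  qed
  have lb: "P a * (b - a) \<le> integral {a..b} P" if "a \<le> b" for a b
  proof -
    have "integral {a..b} (\<lambda>_. P a) \<le> integral {a..b} P" using monoD[OF mono] by (intro integral_le int) auto
    then show ?thesis using that by (simp add: mult.commute)
  qed
  have comb: "?j b = ?j a + integral {a..b} P" if "0 \<le> a" "a \<le> b" for a b
    using Henstock_Kurzweil_Integration.integral_combine[OF that int] by simp
  have "?j b - ?j a \<le> P b * (b - a)" for a b
  proof -
    consider "b \<le> 0" | "0 \<le> a" "a \<le> b" | "0 < b" "b \<le> a" | "0 < b" "a < 0" by linarith
    then show ?thesis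
    proof cases
      case 1
      then show ?thesis using zero[of b] nn[of a] P(3)[of b] \<epsilon> by simp
    next
      case 2
      then show ?thesis using comb[OF 2] ub[OF 2(2)] by simp
    next
      case 3
      then show ?thesis using comb[of b a] lb[OF 3(2)] by (simp add: algebra_simps)
    next
      case 4
      then have "P b * (b - 0) \<le> P b * (b - a)" using P(1)[of b] by (intro mult_left_mono) auto
      then show ?thesis using ub[of 0 b] zero[of a] 4 by simp
    qed
  qed
  then show ?thesis unfolding gauge_def using assms zero[of 0] by auto
qed

text \<open>The inner \<open>max\<close> keeps \<open>powP\<close> continuous for \<open>\<rho> = 1\<close>, where \<open>0 powr 0 = 0\<close>.\<close>

definition powP :: "real \<Rightarrow> nat \<Rightarrow> real \<Rightarrow> real" where
  "powP \<rho> n s = min (real (Suc n)) ((max s (1 / real (Suc n))) powr (\<rho> - 1)) * min 1 (max 0 (real (Suc n) * s - 1))"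

definition powj :: "real \<Rightarrow> nat \<Rightarrow> real \<Rightarrow> real" where
  "powj \<rho> n s = integral {0..s} (powP \<rho> n)"

lemma continuous_on_powP: "continuous_on S (powP \<rho> n)"
proof -
  have "0 < max s (1 / real (Suc n))" for s :: real using less_max_iff_disj[of 0 s] by simp
  then have "continuous_on S (\<lambda>s. min (real (Suc n)) ((max s (1 / real (Suc n))) powr (\<rho> - 1)) * min 1 (max 0 (real (Suc n) * s - 1)))"
    by (intro continuous_intros) (auto simp: less_imp_neq[symmetric])
  then show ?thesis unfolding powP_def[abs_def] .
qed

lemma powP_eq_0: "s \<le> 1 / real (Suc n) \<Longrightarrow> powP \<rho> n s = 0"
proof -
  assume "s \<le> 1 / real (Suc n)"
  then have "real (Suc n) * s \<le> real (Suc n) * (1 / real (Suc n))" by (rule mult_left_mono) simp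
  then have "max 0 (real (Suc n) * s - 1) = 0" by simp
  then show "powP \<rho> n s = 0" unfolding powP_def by simp
qed

lemma powP_nonneg: "0 \<le> powP \<rho> n s"
  unfolding powP_def by (intro mult_nonneg_nonneg) auto

lemma gauge_pow:
  assumes \<rho>: "1 \<le> \<rho>" shows "gauge (powP \<rho> n) (powj \<rho> n) (real (Suc n)) (1 / real (Suc n))"
  unfolding powj_def[abs_def]
proof (rule gauge_integral)
  show "mono (powP \<rho> n)"
  proof (rule monoI)
    fix x y :: real assume xy: "x \<le> y"
    have "max x (1 / real (Suc n)) powr (\<rho> - 1) \<le> max y (1 / real (Suc n)) powr (\<rho> - 1)"
      using xy \<rho> by (intro powr_mono2) (auto simp: le_max_iff_disj)
    note a = min.mono[OF order_refl[of "real (Suc n)"] this]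
    have "real (Suc n) * x \<le> real (Suc n) * y" using xy by (rule mult_left_mono) simp
    then have b: "min 1 (max 0 (real (Suc n) * x - 1)) \<le> min 1 (max 0 (real (Suc n) * y - 1))"
      by (intro min.mono max.mono diff_mono order_refl)
    show "powP \<rho> n x \<le> powP \<rho> n y" unfolding powP_def by (rule mult_mono[OF a b]) auto
  qed
  show "powP \<rho> n r \<le> real (Suc n)" for r
  proof -
    have "powP \<rho> n r \<le> real (Suc n) * 1" unfolding powP_def by (intro mult_mono) auto
    then show ?thesis by simp
  qed
qed (use continuous_on_powP powP_eq_0 powP_nonneg in auto)

lemma powP_le:
  assumes "0 \<le> s" shows "powP \<rho> n s \<le> s powr (\<rho> - 1)"
proof (cases "s \<le> 1 / real (Suc n)")
  case False
  then have "powP \<rho> n s \<le> s powr (\<rho> - 1) * 1" unfolding powP_def by (intro mult_mono) auto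
  then show ?thesis by simp
qed (simp add: powP_eq_0)

lemma powj_le:
  assumes \<rho>: "1 \<le> \<rho>" shows "powj \<rho> n s \<le> (max 0 s) powr \<rho> / \<rho>"
proof (cases "s \<le> 0")
  case True
  then show ?thesis using gauge_j(2)[OF gauge_pow[OF \<rho>], of s] order_trans[OF True, of "1 / real (Suc n)"] \<rho> by simp
next
  case False
  have h: "((\<lambda>x. x powr (\<rho> - 1)) has_integral (s powr \<rho> / \<rho>)) {0..s}"
    using has_integral_powr_from_0[of "\<rho> - 1" s] \<rho> False by simp
  have "(powP \<rho> n has_integral powj \<rho> n s) {0..s}"
    unfolding powj_def by (intro integrable_integral integrable_continuous_real continuous_on_powP)
  then have "powj \<rho> n s \<le> s powr \<rho> / \<rho>" using h by (rule has_integral_le) (use powP_le in auto)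
  then show ?thesis using False by (simp add: max_def)
qed

lemma powj_tendsto:
  assumes \<rho>: "1 \<le> \<rho>" shows "(\<lambda>n. powj \<rho> n s) \<longlonglongrightarrow> (max 0 s) powr \<rho> / \<rho>"
proof (cases "s \<le> 0")
  case True
  then have "powj \<rho> n s = 0" for n using gauge_j(2)[OF gauge_pow[OF \<rho>], of s] order_trans[OF True, of "1 / real (Suc n)"] by simp
  then show ?thesis using True by simp
next
  case False
  have h: "((\<lambda>x. x powr (\<rho> - 1)) has_integral (s powr \<rho> / \<rho>)) {0..s}"
    using has_integral_powr_from_0[of "\<rho> - 1" s] \<rho> False by simp
  have "(\<lambda>n. integral {0..s} (powP \<rho> n)) \<longlonglongrightarrow> integral {0..s} (\<lambda>x. x powr (\<rho> - 1))"
  proof (rule dominated_convergence(2)[where h="\<lambda>x. x powr (\<rho> - 1)"])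
    show "powP \<rho> n integrable_on {0..s}" for n by (intro integrable_continuous_real continuous_on_powP)
    show "(\<lambda>x. x powr (\<rho> - 1)) integrable_on {0..s}" using h by blast
    show "norm (powP \<rho> n x) \<le> x powr (\<rho> - 1)" if "x \<in> {0..s}" for n x
      using powP_le[of x \<rho> n] powP_nonneg[of \<rho> n x] that by simp
    show "(\<lambda>n. powP \<rho> n x) \<longlonglongrightarrow> x powr (\<rho> - 1)" if "x \<in> {0..s}" for x
    proof (cases "x = 0")
      case True
      then show ?thesis by (simp add: powP_eq_0)
    next
      case False
      then have x: "0 < x" using that by simp
      \<comment> \<open>From N on, both cut-offs of \<open>powP\<close> are inactive at x: n + 1
        exceeds x^(\<rho>-1), and (n + 1) x exceeds 2.\<close>
      obtain N where N: "max (x powr (\<rho> - 1)) (2 / x) < real N" using reals_Archimedean2 by blast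
      have "powP \<rho> n x = x powr (\<rho> - 1)" if "n \<ge> N" for n
      proof -
        have n: "x powr (\<rho> - 1) < real (Suc n)" "2 / x < real (Suc n)" using N that by auto
        then have "2 < real (Suc n) * x" using x by (simp add: pos_divide_less_eq)
        moreover have "1 / real (Suc n) < x" using calculation x by (simp add: divide_less_eq mult.commute)
        ultimately show ?thesis using n unfolding powP_def by (simp add: max_def min_def)
      qed
      then show ?thesis by (intro tendsto_eventually) (auto simp: eventually_sequentially)
    qed
  qed
  then show ?thesis using False integral_unique[OF h] by (simp add: powj_def max_def)
qed

lemma Lr_norm_le_iff:
  assumes r: "r \<noteq> \<top>" "1 \<le> r" and k: "0 < k"
  shows "Lr_norm \<nu> r g \<le> ennreal k \<longleftrightarrow> (\<integral>\<^sup>+x. ennreal (\<bar>g x\<bar> powr enn2real r) \<partial>\<nu>) \<le> ennreal (k powr enn2real r)"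
proof (cases "(\<integral>\<^sup>+x. ennreal (\<bar>g x\<bar> powr enn2real r) \<partial>\<nu>)")
  case (real i)
  have \<rho>: "1 \<le> enn2real r" using r by (cases r) auto
  have "i powr (1 / enn2real r) \<le> k \<longleftrightarrow> i \<le> k powr enn2real r"
  proof
    assume "i powr (1 / enn2real r) \<le> k"
    then have "(i powr (1 / enn2real r)) powr enn2real r \<le> k powr enn2real r" using \<rho> by (intro powr_mono2) auto
    then show "i \<le> k powr enn2real r" using \<rho> real by (simp add: powr_powr)
  next
    assume "i \<le> k powr enn2real r"
    then have "i powr (1 / enn2real r) \<le> (k powr enn2real r) powr (1 / enn2real r)" using \<rho> real by (intro powr_mono2) auto
    then show "i powr (1 / enn2real r) \<le> k" using \<rho> k by (simp add: powr_powr)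
  qed
  then show ?thesis using r real k by (simp add: Lr_norm_def Let_def)
qed (use r in \<open>simp add: Lr_norm_def Let_def top_unique\<close>)

context plap_space
begin

text \<open>Norm at most k means that the integral of ((w/k)^+)^\<rho> / \<rho> is at most 1/\<rho>.
  The functions \<open>powj \<rho> n\<close> lie below this integrand, giving one direction, and
  converge to it, so Fatou gives the other.\<close>

lemma Lr_norm_gauge_finite:
  assumes r: "r \<noteq> \<top>" "1 \<le> r" and w: "inH w" and k: "0 < k"
  shows "Lr_norm \<nu>1 r (\<lambda>x. max 0 (w x)) \<le> ennreal k \<longleftrightarrow> (\<forall>n. (\<integral>x. powj (enn2real r) n (w x / k) \<partial>\<nu>1) \<le> 1 / enn2real r)"
proof -
  define \<rho> where "\<rho> = enn2real r"
  have \<rho>: "1 \<le> \<rho>" using r unfolding \<rho>_def by (cases r) auto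
  note g = gauge_pow[OF \<rho>] note [measurable] = memL2_measurable[OF w] gauge_j(6)[OF g]
  let ?J = "\<lambda>x. ennreal ((max 0 (w x / k)) powr \<rho> / \<rho>)"
  have "(\<integral>\<^sup>+x. ennreal (\<bar>max 0 (w x)\<bar> powr \<rho>) \<partial>\<nu>1) = (\<integral>\<^sup>+x. ennreal (k powr \<rho> * \<rho>) * ?J x \<partial>\<nu>1)"
  proof (rule nn_integral_cong)
    fix x
    have "max 0 (w x / k) = max 0 (w x) / k" using k by (simp add: max_def zero_le_divide_iff)
    then show "ennreal (\<bar>max 0 (w x)\<bar> powr \<rho>) = ennreal (k powr \<rho> * \<rho>) * ?J x"
      using k \<rho> by (simp add: powr_divide flip: ennreal_mult)
  qed
  also have "\<dots> = ennreal (k powr \<rho> * \<rho>) * (\<integral>\<^sup>+x. ?J x \<partial>\<nu>1)" by (rule nn_integral_cmult) measurable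
  finally have "Lr_norm \<nu>1 r (\<lambda>x. max 0 (w x)) \<le> ennreal k \<longleftrightarrow> ennreal (k powr \<rho> * \<rho>) * (\<integral>\<^sup>+x. ?J x \<partial>\<nu>1) \<le> ennreal (k powr \<rho>)"
    using Lr_norm_le_iff[OF r k, of \<nu>1 "\<lambda>x. max 0 (w x)"] by (simp add: \<rho>_def)
  also have "ennreal (k powr \<rho>) = ennreal (k powr \<rho> * \<rho>) * ennreal (1 / \<rho>)" using \<rho> by (simp flip: ennreal_mult)
  also have "ennreal (k powr \<rho> * \<rho>) * (\<integral>\<^sup>+x. ?J x \<partial>\<nu>1) \<le> ennreal (k powr \<rho> * \<rho>) * ennreal (1 / \<rho>) \<longleftrightarrow> (\<integral>\<^sup>+x. ?J x \<partial>\<nu>1) \<le> ennreal (1 / \<rho>)"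
    using k \<rho> by (intro ennreal_mult_le_mult_iff) auto
  also have "\<dots> \<longleftrightarrow> (\<forall>n. (\<integral>x. powj \<rho> n (w x / k) \<partial>\<nu>1) \<le> 1 / \<rho>)"
  proof -
    have eq: "(\<integral>\<^sup>+x. ennreal (powj \<rho> n (w x / k)) \<partial>\<nu>1) = ennreal (\<integral>x. powj \<rho> n (w x / k) \<partial>\<nu>1)" for n
      using gauge_integrable(1)[OF g w] gauge_j(1)[OF g] by (intro nn_integral_eq_integral) auto
    show ?thesis
    proof
      assume *: "(\<integral>\<^sup>+x. ?J x \<partial>\<nu>1) \<le> ennreal (1 / \<rho>)"
      show "\<forall>n. (\<integral>x. powj \<rho> n (w x / k) \<partial>\<nu>1) \<le> 1 / \<rho>"
      proof
        fix n
        have "(\<integral>\<^sup>+x. ennreal (powj \<rho> n (w x / k)) \<partial>\<nu>1) \<le> (\<integral>\<^sup>+x. ?J x \<partial>\<nu>1)"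
          by (intro nn_integral_mono ennreal_leI powj_le[OF \<rho>])
        then have "ennreal (\<integral>x. powj \<rho> n (w x / k) \<partial>\<nu>1) \<le> ennreal (1 / \<rho>)" using * eq[of n] by simp
        then show "(\<integral>x. powj \<rho> n (w x / k) \<partial>\<nu>1) \<le> 1 / \<rho>" using \<rho> by (subst (asm) ennreal_le_iff) auto
      qed
    next
      assume *: "\<forall>n. (\<integral>x. powj \<rho> n (w x / k) \<partial>\<nu>1) \<le> 1 / \<rho>"
      have "(\<integral>\<^sup>+x. ?J x \<partial>\<nu>1) = (\<integral>\<^sup>+x. liminf (\<lambda>n. ennreal (powj \<rho> n (w x / k))) \<partial>\<nu>1)"
      proof (rule nn_integral_cong)
        fix x
        have "(\<lambda>n. ennreal (powj \<rho> n (w x / k))) \<longlonglongrightarrow> ?J x" by (intro tendsto_ennrealI powj_tendsto[OF \<rho>])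
        then show "?J x = liminf (\<lambda>n. ennreal (powj \<rho> n (w x / k)))" by (simp add: lim_imp_Liminf)
      qed
      also have "\<dots> \<le> liminf (\<lambda>n. \<integral>\<^sup>+x. ennreal (powj \<rho> n (w x / k)) \<partial>\<nu>1)" by (rule nn_integral_liminf) measurable
      also have "\<dots> \<le> limsup (\<lambda>n. \<integral>\<^sup>+x. ennreal (powj \<rho> n (w x / k)) \<partial>\<nu>1)" by (rule Liminf_le_Limsup) simp
      also have "\<dots> \<le> ennreal (1 / \<rho>)"
        by (rule Limsup_bounded) (use * in \<open>auto simp: eq intro!: always_eventually ennreal_leI\<close>)
      finally show "(\<integral>\<^sup>+x. ?J x \<partial>\<nu>1) \<le> ennreal (1 / \<rho>)" .
    qed
  qed
  finally show ?thesis unfolding \<rho>_def .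
qed

text \<open>Here j vanishes precisely on r \<le> 1, so a vanishing integral of j(w/k) says w \<le> k
  almost everywhere. The constant \<beta> is 0 in this case.\<close>

lemma Lr_norm_gauge_top:
  assumes g: "gauge P j K 1" and P: "\<And>s. 1 < s \<Longrightarrow> 0 < P s" and w: "inH w" and k: "0 < k"
  shows "Lr_norm \<nu>1 \<top> (\<lambda>x. max 0 (w x)) \<le> ennreal k \<longleftrightarrow> (\<integral>x. j (w x / k) \<partial>\<nu>1) \<le> 0"
proof -
  note [measurable] = memL2_measurable[OF w]
  have j0: "j s = 0 \<longleftrightarrow> s \<le> 1" for s
  proof
    show "s \<le> 1" if "j s = 0"
    proof (rule ccontr)
      assume "\<not> s \<le> 1"
      \<comment> \<open>The gradient inequality is used at the midpoint of 1 and s, where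
        \<open>P\<close> is already positive.\<close>
      then have s: "1 < (1 + s) / 2" "(1 + s) / 2 < s" by auto
      have "P ((1 + s) / 2) * ((1 + s) / 2 - s) < 0" using P[OF s(1)] s(2) by (intro mult_pos_neg) auto
      then show False using gaugeD(8)[OF g, of "(1 + s) / 2" s] gauge_j(1)[OF g, of "(1 + s) / 2"] that by linarith
    qed
  qed (rule gauge_j(2)[OF g])
  have "(\<integral>x. j (w x / k) \<partial>\<nu>1) \<le> 0 \<longleftrightarrow> (\<integral>x. j (w x / k) \<partial>\<nu>1) = 0"
    using integral_nonneg_AE[of "\<lambda>x. j (w x / k)" \<nu>1] gauge_j(1)[OF g] by (auto simp: order_antisym)
  also have "\<dots> \<longleftrightarrow> (AE x in \<nu>1. j (w x / k) = 0)"
    using gauge_integrable(1)[OF g w] gauge_j(1)[OF g] by (intro integral_nonneg_eq_0_iff_AE) auto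
  also have "\<dots> \<longleftrightarrow> (AE x in \<nu>1. ennreal \<bar>max 0 (w x)\<bar> \<le> ennreal k)"
    using k by (simp add: j0 pos_divide_le_eq ennreal_le_iff)
  also have "\<dots> \<longleftrightarrow> esssup \<nu>1 (\<lambda>x. ennreal \<bar>max 0 (w x)\<bar>) \<le> ennreal k"
  proof
    assume le: "esssup \<nu>1 (\<lambda>x. ennreal \<bar>max 0 (w x)\<bar>) \<le> ennreal k"
    show "AE x in \<nu>1. ennreal \<bar>max 0 (w x)\<bar> \<le> ennreal k"
      using esssup_AE[of "\<lambda>x. ennreal \<bar>max 0 (w x)\<bar>" \<nu>1] by eventually_elim (rule order_trans[OF _ le])
  qed (intro esssup_I, measurable)
  finally show ?thesis by (simp add: Lr_norm_def)
qed

text \<open>One interface for finite r and r = \<infinity>: a countable family of gauges and a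
  common \<beta>. Countability also serves to prove measurability in time.\<close>

lemma Lr_norm_gauge:
  assumes r: "1 \<le> r"
  obtains P j :: "nat \<Rightarrow> real \<Rightarrow> real" and K \<epsilon> :: "nat \<Rightarrow> real" and \<beta> :: real where "0 \<le> \<beta>" "\<And>n. gauge (P n) (j n) (K n) (\<epsilon> n)"
    "\<And>w k. inH w \<Longrightarrow> 0 < k \<Longrightarrow> Lr_norm \<nu>1 r (\<lambda>x. max 0 (w x)) \<le> ennreal k \<longleftrightarrow> (\<forall>n. (\<integral>x. j n (w x / k) \<partial>\<nu>1) \<le> \<beta>)"
proof (cases "r = \<top>")
  case False
  then have \<rho>: "1 \<le> enn2real r" using r by (cases r) auto
  show ?thesis
    by (rule that[of "1 / enn2real r" "powP (enn2real r)" "powj (enn2real r)", OF _ gauge_pow[OF \<rho>] Lr_norm_gauge_finite[OF False r]]) simp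
next
  case True
  let ?P = "\<lambda>s::real. min 1 (max 0 (s - 1))"
  have g: "gauge ?P (\<lambda>s. integral {0..s} ?P) 1 1"
    by (rule gauge_integral) (auto intro!: continuous_intros monoI)
  show ?thesis
    by (rule that[of 0 "\<lambda>_. ?P" "\<lambda>_ s. integral {0..s} ?P" "\<lambda>_. 1" "\<lambda>_. 1"]) (use g Lr_norm_gauge_top[OF g] True in auto)
qed

text \<open>Sublevel sets at positive k are countable intersections of sets defined by integrals
  measurable in s. Levels including 0 are approached from above, because the characterization by
  gauges needs k > 0.\<close>

lemma Lr_norm_slice_measurable:
  assumes r: "1 \<le> r" and Fm[measurable]: "(unc F) \<in> jmeas"
    and F: "\<And>s. inH (F s)"
  shows "(\<lambda>s::real. Lr_norm \<nu>1 r (\<lambda>x. max 0 (F s x))) \<in> borel_measurable borel"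
proof -
  obtain P j :: "nat \<Rightarrow> real \<Rightarrow> real" and K \<epsilon> :: "nat \<Rightarrow> real" and \<beta> :: real where g: "\<And>n. gauge (P n) (j n) (K n) (\<epsilon> n)"
    and N: "\<And>w k. inH w \<Longrightarrow> 0 < k \<Longrightarrow> Lr_norm \<nu>1 r (\<lambda>x. max 0 (w x)) \<le> ennreal k \<longleftrightarrow> (\<forall>n. (\<integral>x. j n (w x / k) \<partial>\<nu>1) \<le> \<beta>)"
    by (rule Lr_norm_gauge[OF r]) blast
  note [measurable] = gauge_j(6)[OF g]
  have le: "{s. Lr_norm \<nu>1 r (\<lambda>x. max 0 (F s x)) \<le> ennreal k} \<in> sets borel" if "0 < k" for k
  proof -
    have "(\<lambda>s. \<integral>x. j n (F (fst (s, x)) (snd (s, x)) / k) \<partial>\<nu>1) \<in> borel_measurable borel" for n by measurable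
    then have [measurable]: "(\<lambda>s. \<integral>x. j n (F s x / k) \<partial>\<nu>1) \<in> borel_measurable borel" for n by simp
    have "{s. Lr_norm \<nu>1 r (\<lambda>x. max 0 (F s x)) \<le> ennreal k} = {s \<in> space borel. \<forall>n. (\<integral>x. j n (F s x / k) \<partial>\<nu>1) \<le> \<beta>}"
      by (simp add: N[OF F that])
    also have "\<dots> \<in> sets borel" by measurable
    finally show ?thesis .
  qed
  show ?thesis
  proof (rule borel_measurableI_le)
    fix y :: ennreal
    show "{s \<in> space borel. Lr_norm \<nu>1 r (\<lambda>x. max 0 (F s x)) \<le> y} \<in> sets borel"
    proof (cases y)
      case (real k)
      have "{s \<in> space borel. Lr_norm \<nu>1 r (\<lambda>x. max 0 (F s x)) \<le> y} = (\<Inter>n. {s. Lr_norm \<nu>1 r (\<lambda>x. max 0 (F s x)) \<le> ennreal (k + 1 / real (Suc n))})"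
      proof (intro equalityI subsetI INT_I CollectI)
        fix s n assume "s \<in> {s \<in> space borel. Lr_norm \<nu>1 r (\<lambda>x. max 0 (F s x)) \<le> y}"
        then have "Lr_norm \<nu>1 r (\<lambda>x. max 0 (F s x)) \<le> ennreal k" using real by simp
        also have "\<dots> \<le> ennreal (k + 1 / real (Suc n))" by (intro ennreal_leI) simp
        finally show "Lr_norm \<nu>1 r (\<lambda>x. max 0 (F s x)) \<le> ennreal (k + 1 / real (Suc n))" .
      next
        fix s assume s: "s \<in> (\<Inter>n. {s. Lr_norm \<nu>1 r (\<lambda>x. max 0 (F s x)) \<le> ennreal (k + 1 / real (Suc n))})"
        have "Lr_norm \<nu>1 r (\<lambda>x. max 0 (F s x)) \<le> y"
        proof (rule ennreal_le_epsilon)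
          fix e :: real assume "0 < e"
          then obtain n where n: "1 / real (Suc n) < e" using nat_approx_posE by blast
          have "Lr_norm \<nu>1 r (\<lambda>x. max 0 (F s x)) \<le> ennreal (k + 1 / real (Suc n))" using s by blast
          also have "\<dots> \<le> ennreal (k + e)" using n by (intro ennreal_leI) simp
          also have "\<dots> = y + ennreal e" using real \<open>0 < e\<close> by simp
          finally show "Lr_norm \<nu>1 r (\<lambda>x. max 0 (F s x)) \<le> y + ennreal e" .
        qed
        then show "s \<in> space borel \<and> Lr_norm \<nu>1 r (\<lambda>x. max 0 (F s x)) \<le> y" by simp
      qed
      also have "\<dots> \<in> sets borel"
      proof (rule sets.countable_INT)
        have "0 < k + 1 / real (Suc n)" for n using real by (simp add: add_nonneg_pos)
        then show "range (\<lambda>n. {s. Lr_norm \<nu>1 r (\<lambda>x. max 0 (F s x)) \<le> ennreal (k + 1 / real (Suc n))}) \<subseteq> sets borel" using le by blast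
      qed simp
      finally show ?thesis .
    qed (simp add: top_unique)
  qed
qed

section \<open>Contraction and uniqueness\<close>

lemma strong_solution_contraction:
  assumes sol: "solution T u0 f u" and sol': "solution T u0' f' u'"
    and f: "memL2T \<nu>1 T f" "memL2T \<nu>1 T f'" and u0: "inH u0" "inH u0'"
    and t: "t \<in> {0..T}" and r: "1 \<le> r"
  shows "Lr_norm \<nu>1 r (\<lambda>x. max 0 (u t x - u' t x)) \<le> Lr_norm \<nu>1 r (\<lambda>x. max 0 (u0 x - u0' x))
    + (\<integral>\<^sup>+ s\<in>{0..t}. Lr_norm \<nu>1 r (\<lambda>x. max 0 (f s x - f' s x)) \<partial>lborel)"
proof -
  obtain P j :: "nat \<Rightarrow> real \<Rightarrow> real" and K \<epsilon> :: "nat \<Rightarrow> real" and \<beta> :: real where \<beta>: "0 \<le> \<beta>" and g: "\<And>n. gauge (P n) (j n) (K n) (\<epsilon> n)"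
    and Nle: "\<And>w k. inH w \<Longrightarrow> 0 < k \<Longrightarrow> Lr_norm \<nu>1 r (\<lambda>x. max 0 (w x)) \<le> ennreal k \<longleftrightarrow> (\<forall>n. (\<integral>x. j n (w x / k) \<partial>\<nu>1) \<le> \<beta>)"
    by (rule Lr_norm_gauge[OF r]) blast
  note f1 = memL2T_spt[OF f(1)] note f2 = memL2T_spt[OF f(2)]
  have [measurable]: "(unc f) \<in> jmeas" "(unc f') \<in> jmeas"
    using f1(1) f2(1) by (simp_all add: split_beta)
  \<comment> \<open>Times at which f - f' is square integrable in space. Off this set, which misses
    almost no time in [0, t], the force is replaced by 0, so that the norm \<open>N\<close> is
    measurable at all times.\<close>
  define S where "S = {s. (\<integral>\<^sup>+x. ennreal ((f s x - f' s x)\<^sup>2) \<partial>\<nu>1) < \<infinity>}"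
  define F where "F s x = (if s \<in> S then f s x - f' s x else 0)" for s x
  define N where "N s = Lr_norm \<nu>1 r (\<lambda>x. max 0 (F s x))" for s
  have Sm[measurable]: "S \<in> sets borel"
  proof -
    have "(\<lambda>s. \<integral>\<^sup>+x. ennreal ((f (fst (s, x)) (snd (s, x)) - f' (fst (s, x)) (snd (s, x)))\<^sup>2) \<partial>\<nu>1) \<in> borel_measurable borel" by measurable
    then have [measurable]: "(\<lambda>s. \<integral>\<^sup>+x. ennreal ((f s x - f' s x)\<^sup>2) \<partial>\<nu>1) \<in> borel_measurable borel" by simp
    have "{s \<in> space borel. (\<integral>\<^sup>+x. ennreal ((f s x - f' s x)\<^sup>2) \<partial>\<nu>1) < \<infinity>} \<in> sets borel" by measurable
    then show ?thesis by (simp add: S_def)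
  qed
  have sl: "(\<lambda>x. f s x - f' s x) \<in> borel_measurable \<nu>1" for s
    using measurable_compose[OF measurable_Pair1'[of s borel \<nu>1] borel_measurable_diff[OF f1(1) f2(1)]] by simp
  have F2: "inH (F s)" for s
    using memL2_iff_nn_integral[OF sl[of s]] by (auto simp: F_def[abs_def] S_def)
  have Nm[measurable]: "N \<in> borel_measurable borel"
    unfolding N_def[abs_def]
  proof (rule Lr_norm_slice_measurable[OF r _ F2])
    show "(unc F) \<in> jmeas" unfolding F_def by measurable
  qed
  have FS: "AE s in lborel. s \<in> {0..t} \<longrightarrow> s \<in> S"
  proof -
    have "AE s in time_measure 0 T. inH (\<lambda>x. f s x - f' s x)"
      using AE_memL2_slice[OF memL2_diff[OF f1(2) f2(2)]] by simp
    then show ?thesis unfolding AE_time_measure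
      by eventually_elim (use t memL2_iff_nn_integral[OF sl] in \<open>auto simp: S_def\<close>)
  qed
  have Neq: "(\<integral>\<^sup>+ s\<in>{0..t}. Lr_norm \<nu>1 r (\<lambda>x. max 0 (f s x - f' s x)) \<partial>lborel) = (\<integral>\<^sup>+ s\<in>{0..t}. N s \<partial>lborel)"
    by (rule nn_integral_cong_AE) (use FS in \<open>eventually_elim, auto simp: N_def F_def indicator_def\<close>)
  have mw: "inH (\<lambda>x. u t x - u' t x)"
    using sol sol' t memL2_diff[of \<nu>1 "u t" "u' t"] unfolding strong_solution_def by blast
  show ?thesis
    unfolding Neq
  proof (rule ennreal_le_epsilon)
    fix e :: real assume fin: "Lr_norm \<nu>1 r (\<lambda>x. max 0 (u0 x - u0' x)) + (\<integral>\<^sup>+ s\<in>{0..t}. N s \<partial>lborel) < \<top>" and e: "0 < e"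
    have t0: "0 \<le> t" using t by simp
    \<comment> \<open>A small \<delta> is added to the initial norm and to the norm of the force at
      each time to make all scales positive; the total surcharge is \<delta>(1 + t) = e.\<close>
    define \<delta> where "\<delta> = e / (1 + t)"
    have "\<delta> * (1 + t) = e" using t0 by (simp add: \<delta>_def)
    then have \<delta>: "0 < \<delta>" "\<delta> + \<delta> * t = e" using e t0 by (auto simp: \<delta>_def distrib_left)
    define \<kappa> where "\<kappa> s = enn2real (N s) + \<delta>" for s
    define k0 where "k0 = enn2real (Lr_norm \<nu>1 r (\<lambda>x. max 0 (u0 x - u0' x))) + \<delta>"
    have \<kappa>m[measurable]: "\<kappa> \<in> borel_measurable borel" unfolding \<kappa>_def by measurable
    have \<kappa>0: "0 < \<kappa> s" for s unfolding \<kappa>_def using \<delta> by (simp add: add_nonneg_pos)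
    have k0: "0 < k0" unfolding k0_def using \<delta> by (simp add: add_nonneg_pos)
    have L0: "Lr_norm \<nu>1 r (\<lambda>x. max 0 (u0 x - u0' x)) < \<top>" and iN: "(\<integral>\<^sup>+ s\<in>{0..t}. N s \<partial>lborel) < \<top>" using fin by auto
    have k0e: "ennreal k0 = Lr_norm \<nu>1 r (\<lambda>x. max 0 (u0 x - u0' x)) + ennreal \<delta>"
      unfolding k0_def using L0 \<delta> by (simp add: ennreal_plus)
    have Nfin: "AE s in lborel. s \<in> {0..t} \<longrightarrow> N s < \<top>"
    proof -
      have "AE s in lborel. N s * indicator {0..t} s \<noteq> \<infinity>" by (rule nn_integral_PInf_AE) (use iN in auto)
      then show ?thesis by eventually_elim (auto simp: indicator_def less_top)
    qed
    have nn: "(\<integral>\<^sup>+ s\<in>{0..t}. ennreal (\<kappa> s) \<partial>lborel) = (\<integral>\<^sup>+ s\<in>{0..t}. N s \<partial>lborel) + ennreal (\<delta> * t)"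
    proof -
      have "(\<integral>\<^sup>+ s\<in>{0..t}. ennreal (\<kappa> s) \<partial>lborel) = (\<integral>\<^sup>+ s. N s * indicator {0..t} s + ennreal \<delta> * indicator {0..t} s \<partial>lborel)"
      proof (rule nn_integral_cong_AE)
        show "AE s in lborel. ennreal (\<kappa> s) * indicator {0..t} s = N s * indicator {0..t} s + ennreal \<delta> * indicator {0..t} s"
          using Nfin by eventually_elim (use \<delta> in \<open>auto simp: \<kappa>_def indicator_def\<close>)
      qed
      also have "\<dots> = (\<integral>\<^sup>+ s\<in>{0..t}. N s \<partial>lborel) + (\<integral>\<^sup>+ s. ennreal \<delta> * indicator {0..t} s \<partial>lborel)"
        by (rule nn_integral_add) measurable
      also have "(\<integral>\<^sup>+ s. ennreal \<delta> * indicator {0..t} s \<partial>lborel) = ennreal (\<delta> * t)"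
        using t0 \<delta> by (simp add: nn_integral_cmult_indicator ennreal_mult)
      finally show ?thesis .
    qed
    have nn': "(\<integral>\<^sup>+ s. ennreal (indicator {0..t} s *\<^sub>R \<kappa> s) \<partial>lborel) = (\<integral>\<^sup>+ s\<in>{0..t}. ennreal (\<kappa> s) \<partial>lborel)"
      by (rule nn_integral_cong) (auto simp: indicator_def)
    have \<kappa>i: "set_integrable lborel {0..t} \<kappa>"
      unfolding set_integrable_def
    proof (rule integrableI_nonneg)
      show "AE s in lborel. 0 \<le> indicator {0..t} s *\<^sub>R \<kappa> s" using \<kappa>0 by (simp add: less_imp_le)
      show "(\<integral>\<^sup>+ s. ennreal (indicator {0..t} s *\<^sub>R \<kappa> s) \<partial>lborel) < \<infinity>" unfolding nn' nn using iN by simp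
    qed measurable
    have kint: "ennreal (LINT \<rho>:{0..t}|lborel. \<kappa> \<rho>) = (\<integral>\<^sup>+ s\<in>{0..t}. N s \<partial>lborel) + ennreal (\<delta> * t)"
      unfolding nn[symmetric] nn'[symmetric] set_lebesgue_integral_def
      using \<kappa>i \<kappa>0 by (intro nn_integral_eq_integral[symmetric]) (auto simp: set_integrable_def less_imp_le)
    have int0: "0 \<le> (LINT \<rho>:{0..t}|lborel. \<kappa> \<rho>)"
      unfolding set_lebesgue_integral_def using \<kappa>0 by (auto intro!: integral_nonneg_AE simp: less_imp_le)
    let ?k = "k0 + (LINT \<rho>:{0..t}|lborel. \<kappa> \<rho>)"
    have "\<forall>n. (\<integral>x. j n ((u t x - u' t x) / ?k) \<partial>\<nu>1) \<le> \<beta>"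
    proof
      fix n
      show "(\<integral>x. j n ((u t x - u' t x) / ?k) \<partial>\<nu>1) \<le> \<beta>"
      proof (rule gauge_contraction[OF g sol sol' f u0 \<kappa>m \<kappa>0 k0 t \<kappa>i \<beta>])
        have "Lr_norm \<nu>1 r (\<lambda>x. max 0 (u0 x - u0' x)) \<le> ennreal k0" unfolding k0e by simp
        then show "(\<integral>x. j n ((u0 x - u0' x) / k0) \<partial>\<nu>1) \<le> \<beta>" using Nle[OF memL2_diff[OF u0] k0] by blast
        show "AE s in lborel. s \<in> {0..t} \<longrightarrow> (\<integral>x. j n ((f s x - f' s x) / \<kappa> s) \<partial>\<nu>1) \<le> \<beta>"
          using FS Nfin
        proof eventually_elim
          case (elim s)
          show ?case
          proof
            assume s: "s \<in> {0..t}"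
            have "N s = ennreal (enn2real (N s))" using elim s by simp
            also have "\<dots> \<le> ennreal (\<kappa> s)" unfolding \<kappa>_def using \<delta> by (intro ennreal_leI) simp
            finally have "\<forall>n. (\<integral>x. j n (F s x / \<kappa> s) \<partial>\<nu>1) \<le> \<beta>" using Nle[OF F2 \<kappa>0] unfolding N_def by blast
            then show "(\<integral>x. j n ((f s x - f' s x) / \<kappa> s) \<partial>\<nu>1) \<le> \<beta>" using elim s by (simp add: F_def)
          qed
        qed
      qed simp
    qed
    then have "Lr_norm \<nu>1 r (\<lambda>x. max 0 (u t x - u' t x)) \<le> ennreal ?k"
      using Nle[OF mw, of ?k] k0 int0 by auto
    also have "\<dots> = ennreal k0 + ennreal (LINT \<rho>:{0..t}|lborel. \<kappa> \<rho>)" using k0 int0 by simp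
    also have "\<dots> = Lr_norm \<nu>1 r (\<lambda>x. max 0 (u0 x - u0' x)) + (\<integral>\<^sup>+ s\<in>{0..t}. N s \<partial>lborel) + (ennreal \<delta> + ennreal (\<delta> * t))"
      unfolding k0e kint by (simp add: ac_simps)
    also have "ennreal \<delta> + ennreal (\<delta> * t) = ennreal e" using \<delta> t0 by (simp flip: ennreal_plus)
    finally show "Lr_norm \<nu>1 r (\<lambda>x. max 0 (u t x - u' t x))
      \<le> Lr_norm \<nu>1 r (\<lambda>x. max 0 (u0 x - u0' x)) + (\<integral>\<^sup>+ s\<in>{0..t}. N s \<partial>lborel) + ennreal e" .
  qed
qed

text \<open>Contraction with r = \<infinity> and equal data makes the positive part of the
  difference vanish; both orders together give equality.\<close>

lemma strong_solution_unique:
  assumes sol: "solution T u0 f u" and sol': "solution T u0 f u'"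
    and f: "memL2T \<nu>1 T f" and u0: "inH u0" and t: "t \<in> {0..T}"
  shows "AE x in \<nu>1. u' t x = u t x"
proof -
  have *: "AE x in \<nu>1. u t x \<le> u' t x"
    if sol: "solution T u0 f u" and sol': "solution T u0 f u'" for u u'
  proof -
    have z: "Lr_norm \<nu>1 \<top> (\<lambda>x. 0) = 0"
      by (simp add: Lr_norm_def) (intro antisym esssup_I; simp)
    have "Lr_norm \<nu>1 \<top> (\<lambda>x. max 0 (u t x - u' t x)) \<le> 0"
      using strong_solution_contraction[OF sol sol' f f u0 u0 t, of \<top>] by (simp add: z)
    then have "esssup \<nu>1 (\<lambda>x. ennreal \<bar>max 0 (u t x - u' t x)\<bar>) \<le> 0" by (simp add: Lr_norm_def)
    with esssup_AE[of "\<lambda>x. ennreal \<bar>max 0 (u t x - u' t x)\<bar>" \<nu>1] show ?thesis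
      by (auto simp: ennreal_eq_0_iff elim!: eventually_mono)
  qed
  show ?thesis using *[OF sol sol'] *[OF sol' sol] by eventually_elim simp
qed

end

text \<open>Measurability over \<open>M\<close> becomes measurability over \<open>\<nu>\<close>,
  which has the same \<sigma>-algebra, so that one measure can serve as carrier of both.\<close>

lemma random_walk_space_reversible_kernel:
  assumes rw: "random_walk_space M m \<nu>" and rev: "reversible M m \<nu>"
  shows "reversible_kernel m \<nu>"
proof (rule reversible_kernel.intro)
  have s: "sets \<nu> = sets M" using rw by (simp add: random_walk_space_def)
  have "measurable \<nu> (subprob_algebra \<nu>) = measurable M (subprob_algebra M)"
    by (rule measurable_cong_sets[OF s]) (simp only: subprob_algebra_cong[OF s])
  then show "m \<in> measurable \<nu> (subprob_algebra \<nu>)" using rw by (simp add: random_walk_space_def)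
  show "prob_space (m x)" if "x \<in> space \<nu>" for x
    using rw that sets_eq_imp_space_eq[OF s] by (simp add: random_walk_space_def)
  show "reversible \<nu> m \<nu>" using rev sets_pair_measure_cong[OF s s] by (simp add: reversible_def)
qed

theorem theorem3p10:
  fixes M :: "'a measure" and m1 m2 :: "'a \<Rightarrow> 'a measure" and \<nu>1 \<nu>2 :: "'a measure"
    and \<mu> :: "'a \<Rightarrow> real" and c p q T :: real
  assumes q: "1 < q" "q \<le> 2" and p: "1 < p"
    and rw1: "random_walk_space M m1 \<nu>1" and rev1: "reversible M m1 \<nu>1"
    and rw2: "random_walk_space M m2 \<nu>2" and rev2: "reversible M m2 \<nu>2"
    and ac: "absolutely_continuous \<nu>1 \<nu>2"
    and mu_meas: "\<mu> \<in> borel_measurable M"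
    and mu_dens: "\<nu>2 = density \<nu>1 (\<lambda>x. ennreal (\<mu> x))"
    and mu_Linf: "\<exists>C. AE x in \<nu>1. \<bar>\<mu> x\<bar> \<le> C"
    and c: "c > 0" "AE x in \<nu>1. \<mu> x \<ge> c"
    and fin: "emeasure \<nu>1 (space M) < \<infinity> \<or>
              (emeasure \<nu>1 (space M) = \<infinity> \<and> q \<le> p / (p - 1) \<and> p / (p - 1) \<le> 2 \<and> 2 \<le> p)"
    and T: "T > 0"
  shows
    "(\<forall>u0 f. memL2 \<nu>1 u0 \<and> memL2T \<nu>1 T f \<longrightarrow>
        (\<exists>u. strong_solution m1 \<nu>1 m2 \<nu>2 \<mu> p q T u0 f u \<and>
             (\<forall>u'. strong_solution m1 \<nu>1 m2 \<nu>2 \<mu> p q T u0 f u' \<longrightarrow>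
                 (\<forall>t\<in>{0..T}. AE x in \<nu>1. u' t x = u t x)))) \<and>
     (\<forall>u0 f u0' f' u u'.
        memL2 \<nu>1 u0 \<and> memL2T \<nu>1 T f \<and> memL2 \<nu>1 u0' \<and> memL2T \<nu>1 T f' \<and>
        strong_solution m1 \<nu>1 m2 \<nu>2 \<mu> p q T u0 f u \<and>
        strong_solution m1 \<nu>1 m2 \<nu>2 \<mu> p q T u0' f' u' \<longrightarrow>
        (\<forall>t\<in>{0..T}. \<forall>r::ennreal. 1 \<le> r \<longrightarrow>
           Lr_norm \<nu>1 r (\<lambda>x. max 0 (u t x - u' t x))
           \<le> Lr_norm \<nu>1 r (\<lambda>x. max 0 (u0 x - u0' x))
              + (\<integral>\<^sup>+ s\<in>{0..t}. Lr_norm \<nu>1 r (\<lambda>x. max 0 (f s x - f' s x)) \<partial>lborel)))"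
proof -
  obtain C where C: "AE x in \<nu>1. \<bar>\<mu> x\<bar> \<le> C" using mu_Linf by blast
  have s: "sets \<nu>1 = sets M" using rw1 by (simp add: random_walk_space_def)
  interpret plap_space m1 \<nu>1 m2 \<nu>2 \<mu> c C p q
  proof (intro plap_space.intro plap_space_axioms.intro q p c(1) mu_dens
      random_walk_space_reversible_kernel[OF rw1 rev1] random_walk_space_reversible_kernel[OF rw2 rev2])
    show "sigma_finite_measure \<nu>1" using rw1 by (simp add: random_walk_space_def)
    show "\<mu> \<in> borel_measurable \<nu>1" using mu_meas by (simp add: measurable_cong_sets[OF s refl])
    show "AE x in \<nu>1. c \<le> \<mu> x \<and> \<mu> x \<le> C" using C c(2) by eventually_elim auto
    show "emeasure \<nu>1 (space \<nu>1) < \<infinity> \<or> 2 \<le> p" using fin sets_eq_imp_space_eq[OF s] by auto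
  qed
  show ?thesis
  proof (intro conjI allI impI ballI)
    fix u0 f assume "memL2 \<nu>1 u0 \<and> memL2T \<nu>1 T f"
    then have uf: "memL2 \<nu>1 u0" "memL2T \<nu>1 T f" by auto
    obtain u where u: "strong_solution m1 \<nu>1 m2 \<nu>2 \<mu> p q T u0 f u" using strong_solution_exists[OF T uf] by blast
    then show "\<exists>u. strong_solution m1 \<nu>1 m2 \<nu>2 \<mu> p q T u0 f u \<and>
        (\<forall>u'. strong_solution m1 \<nu>1 m2 \<nu>2 \<mu> p q T u0 f u' \<longrightarrow> (\<forall>t\<in>{0..T}. AE x in \<nu>1. u' t x = u t x))"
      using strong_solution_unique[OF u _ uf(2,1)] by blast
  qed (use strong_solution_contraction in blast)
qed

end
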